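(* Affine Nash manifolds form a full subcategory of the category of affine QN varieties. Affine (real) algebraic varieties form a subcategory of the category of affine QN varieties, which is not a full subcategory.
   Context: Restricted topology and $\mathbb{R}$-spaces. A restricted topological space is a set with a family of subsets, called open, containing the whole set and $\emptyset$ and closed under finite unions and finite intersections; only finite open covers are considered (also in the sheaf axioms); continuous means that preimages of open sets are open. A semi-algebraic subset of $\mathbb{R}^n$ carries the restricted topology of its relatively open semi-algebraic subsets. An $\mathbb{R}$-space is a pair $(M,\mathcal{O}_M)$ with $M$ a restricted topological space and $\mathcal{O}_M$ a sheaf of $\mathbb{R}$-algebras which is a subsheaf of the sheaf of continuous real-valued functions on $M$. A morphism $(M,\mathcal{O}_M)\to(N,\mathcal{O}_N)$ is a continuous map $\varphi$ such that $f\circ\varphi\in\mathcal{O}_M(\varphi^{-1}(U))$ for every open $U\subset N$ and $f\in\mathcal{O}_N(U)$. Affine QN varieties. A Nash function on an open semi-algebraic subset of $\mathbb{R}^n$ is a $C^\infty$ semi-algebraic function. For a locally closed semi-algebraic $Y\subset\mathbb{R}^n$ and $U\subset Y$ open, $QN_Y(U)$ is the set of $f:U\to\mathbb{R}$ for which there are finitely many open semi-algebraic $V_i\subset\mathbb{R}^n$ and Nash functions $f_i$ on $V_i$ such that the sets $V_i\cap Y$ form an open cover of $U$ and $f|_{V_i\cap Y}=f_i|_{V_i\cap Y}$. An affine QN variety is an $\mathbb{R}$-space isomorphic to $(Y,QN_Y)$ for some closed semi-algebraic $Y\subset\mathbb{R}^n$; morphisms are morphisms of $\mathbb{R}$-spaces.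 Affine Nash manifolds. A Nash submanifold $M\subset\mathbb{R}^n$ is a semi-algebraic subset which is a smooth submanifold; a Nash function on it is a smooth semi-algebraic function. An affine Nash manifold is an $\mathbb{R}$-space isomorphic to $(M,\mathcal{N}_M)$, where $M\subset\mathbb{R}^n$ is a closed Nash submanifold and $\mathcal{N}_M$ its sheaf of Nash functions; morphisms are morphisms of $\mathbb{R}$-spaces. Affine algebraic varieties. An affine algebraic variety is (isomorphic to) an algebraic subset $X\subset\mathbb{R}^n$, with morphisms the regular maps, i.e. maps given by rational functions with nowhere vanishing denominators on $X$. Such an $X$ is regarded as an affine QN variety via $(X,QN_X)$. *)

theory Defs
  imports "HOL-Analysis.Analysis"
begin

section \<open>Categories and (full) subcategories\<close>

record ('o, 'm) cat_data =
  Obj :: "'o set"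
  Hom :: "'o \<Rightarrow> 'o \<Rightarrow> 'm set"
  Id :: "'o \<Rightarrow> 'm"
  Comp :: "'o \<Rightarrow> 'o \<Rightarrow> 'o \<Rightarrow> 'm \<Rightarrow> 'm \<Rightarrow> 'm"

locale category =
  fixes C :: "('o, 'm) cat_data"
  assumes Id_in_Hom: "A \<in> Obj C \<Longrightarrow> Id C A \<in> Hom C A A"
    and Comp_in_Hom: "\<lbrakk>A \<in> Obj C; B \<in> Obj C; D \<in> Obj C; f \<in> Hom C A B; g \<in> Hom C B D\<rbrakk>
          \<Longrightarrow> Comp C A B D g f \<in> Hom C A D"
    and Comp_Id_right: "\<lbrakk>A \<in> Obj C; B \<in> Obj C; f \<in> Hom C A B\<rbrakk> \<Longrightarrow> Comp C A A B f (Id C A) = f"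
    and Comp_Id_left: "\<lbrakk>A \<in> Obj C; B \<in> Obj C; f \<in> Hom C A B\<rbrakk> \<Longrightarrow> Comp C A B B (Id C B) f = f"
    and Comp_assoc: "\<lbrakk>A \<in> Obj C; B \<in> Obj C; D \<in> Obj C; E \<in> Obj C;
            f \<in> Hom C A B; g \<in> Hom C B D; h \<in> Hom C D E\<rbrakk>
          \<Longrightarrow> Comp C A D E h (Comp C A B D g f) = Comp C A B E (Comp C B D E h g) f"

locale subcategory = S: category S + C: category C
  for S C :: "('o, 'm) cat_data" +
  assumes Obj_subset: "Obj S \<subseteq> Obj C"
    and Hom_subset: "\<lbrakk>A \<in> Obj S; B \<in> Obj S\<rbrakk> \<Longrightarrow> Hom S A B \<subseteq> Hom C A B"
    and Id_eq: "A \<in> Obj S \<Longrightarrow> Id S A = Id C A"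
    and Comp_eq: "\<lbrakk>A \<in> Obj S; B \<in> Obj S; D \<in> Obj S; f \<in> Hom S A B; g \<in> Hom S B D\<rbrakk>
          \<Longrightarrow> Comp S A B D g f = Comp C A B D g f"

locale full_subcategory = subcategory S C
  for S C :: "('o, 'm) cat_data" +
  assumes full: "\<lbrakk>A \<in> Obj S; B \<in> Obj S\<rbrakk> \<Longrightarrow> Hom S A B = Hom C A B"


section \<open>Semi-algebraic geometry\<close>

text \<open>
  The space \<open>\<real>\<^sup>n\<close> is the library's \<^const>\<open>Euclidean_space\<close>: its points are the
  \<open>x :: nat \<Rightarrow> real\<close> with \<open>x i = 0\<close> for all \<open>i \<ge> n\<close>. Hence all \<open>\<real>\<^sup>n\<close> live in one type,
  and \<open>\<real>\<^sup>d\<close> is literally a subset of \<open>\<real>\<^sup>n\<close> for \<open>d \<le> n\<close>.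
\<close>

abbreviation Rn :: "nat \<Rightarrow> (nat \<Rightarrow> real) set"
  where "Rn n \<equiv> topspace (Euclidean_space n)"

inductive polynomial_fun :: "nat \<Rightarrow> ((nat \<Rightarrow> real) \<Rightarrow> real) \<Rightarrow> bool" for n where
  const: "polynomial_fun n (\<lambda>x. c)"
| coord: "i < n \<Longrightarrow> polynomial_fun n (\<lambda>x. x i)"
| add: "\<lbrakk>polynomial_fun n p; polynomial_fun n q\<rbrakk> \<Longrightarrow> polynomial_fun n (\<lambda>x. p x + q x)"
| mult: "\<lbrakk>polynomial_fun n p; polynomial_fun n q\<rbrakk> \<Longrightarrow> polynomial_fun n (\<lambda>x. p x * q x)"

inductive semialgebraic :: "nat \<Rightarrow> (nat \<Rightarrow> real) set \<Rightarrow> bool" for n where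
  positive: "polynomial_fun n p \<Longrightarrow> semialgebraic n {x \<in> Rn n. p x > 0}"
| zero: "polynomial_fun n p \<Longrightarrow> semialgebraic n {x \<in> Rn n. p x = 0}"
| union: "\<lbrakk>semialgebraic n S; semialgebraic n T\<rbrakk> \<Longrightarrow> semialgebraic n (S \<union> T)"
| inter: "\<lbrakk>semialgebraic n S; semialgebraic n T\<rbrakk> \<Longrightarrow> semialgebraic n (S \<inter> T)"
| compl: "semialgebraic n S \<Longrightarrow> semialgebraic n (Rn n - S)"

definition open_semialgebraic :: "nat \<Rightarrow> (nat \<Rightarrow> real) set \<Rightarrow> bool"
  where "open_semialgebraic n V \<longleftrightarrow> semialgebraic n V \<and> openin (Euclidean_space n) V"

text \<open>The restricted topology of a semi-algebraic \<open>Y \<subseteq> \<real>\<^sup>n\<close>.\<close>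

definition semialgebraic_opens :: "nat \<Rightarrow> (nat \<Rightarrow> real) set \<Rightarrow> (nat \<Rightarrow> real) set set"
  where "semialgebraic_opens n Y =
    {U. semialgebraic n U \<and> openin (subtopology (Euclidean_space n) Y) U}"

text \<open>The restricted topology of the real line, identified with \<open>\<real>\<^sup>1\<close> by \<open>t \<mapsto> (t, 0, 0, \<dots>)\<close>.\<close>

definition real_opens :: "real set set"
  where "real_opens = {T. (\<lambda>t. (\<lambda>i. 0)(0 := t)) ` T \<in> semialgebraic_opens 1 (Rn 1)}"

text \<open>A function on \<open>U \<subseteq> \<real>\<^sup>n\<close> is semi-algebraic if its graph in \<open>\<real>\<^bsup>n + 1\<^esup>\<close> is; the value is
  stored in the coordinate with index \<open>n\<close>.\<close>

definition semialgebraic_fun :: "nat \<Rightarrow> (nat \<Rightarrow> real) set \<Rightarrow> ((nat \<Rightarrow> real) \<Rightarrow> real) \<Rightarrow> bool"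
  where "semialgebraic_fun n U f \<longleftrightarrow> semialgebraic (Suc n) ((\<lambda>x. x(n := f x)) ` U)"


section \<open>Smooth and Nash functions on open subsets of Euclidean space\<close>

definition partial_deriv :: "nat \<Rightarrow> ((nat \<Rightarrow> real) \<Rightarrow> real) \<Rightarrow> (nat \<Rightarrow> real) \<Rightarrow> real"
  where "partial_deriv i f x = deriv (\<lambda>t. f (x(i := t))) (x i)"

text \<open>
  The functions of class \<open>C\<^sup>k\<close> on an open \<open>V \<subseteq> \<real>\<^sup>n\<close>: all iterated partial derivatives of order
  at most \<open>k\<close> exist and are continuous on \<open>V\<close>. As \<open>V\<close> is open, values of \<open>f\<close> outside \<open>V\<close>
  do not matter.
\<close>

primrec Ck_on :: "nat \<Rightarrow> nat \<Rightarrow> (nat \<Rightarrow> real) set \<Rightarrow> ((nat \<Rightarrow> real) \<Rightarrow> real) \<Rightarrow> bool" where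
  "Ck_on n 0 V f \<longleftrightarrow> continuous_on V f"
| "Ck_on n (Suc k) V f \<longleftrightarrow> continuous_on V f \<and>
     (\<forall>i<n. (\<forall>x\<in>V. (\<lambda>t. f (x(i := t))) differentiable (at (x i))) \<and>
            Ck_on n k V (partial_deriv i f))"

definition smooth_on :: "nat \<Rightarrow> (nat \<Rightarrow> real) set \<Rightarrow> ((nat \<Rightarrow> real) \<Rightarrow> real) \<Rightarrow> bool"
  where "smooth_on n V f \<longleftrightarrow> (\<forall>k. Ck_on n k V f)"

definition Nash_fun :: "nat \<Rightarrow> (nat \<Rightarrow> real) set \<Rightarrow> ((nat \<Rightarrow> real) \<Rightarrow> real) \<Rightarrow> bool"
  where "Nash_fun n V f \<longleftrightarrow> smooth_on n V f \<and> semialgebraic_fun n V f"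


section \<open>Smooth submanifolds of Euclidean space\<close>

text \<open>A diffeomorphism \<open>\<phi>\<close>, with inverse \<open>\<psi>\<close>, of an open set \<open>W\<close> onto an open set that
  carries \<open>M \<inter> W\<close> onto the part of \<open>\<phi> ` W\<close> lying in \<open>\<real>\<^sup>d\<close>.\<close>

definition slice_chart :: "nat \<Rightarrow> (nat \<Rightarrow> real) set \<Rightarrow> nat \<Rightarrow> (nat \<Rightarrow> real) set \<Rightarrow>
    ((nat \<Rightarrow> real) \<Rightarrow> (nat \<Rightarrow> real)) \<Rightarrow> ((nat \<Rightarrow> real) \<Rightarrow> (nat \<Rightarrow> real)) \<Rightarrow> bool"
  where "slice_chart n M d W \<phi> \<psi> \<longleftrightarrow> d \<le> n \<and>
    openin (Euclidean_space n) W \<and> openin (Euclidean_space n) (\<phi> ` W) \<and>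
    (\<forall>j<n. smooth_on n W (\<lambda>x. \<phi> x j)) \<and> (\<forall>j<n. smooth_on n (\<phi> ` W) (\<lambda>y. \<psi> y j)) \<and>
    (\<forall>x\<in>W. \<psi> (\<phi> x) = x) \<and>
    \<phi> ` (M \<inter> W) = \<phi> ` W \<inter> Rn d"

definition smooth_submanifold :: "nat \<Rightarrow> (nat \<Rightarrow> real) set \<Rightarrow> bool"
  where "smooth_submanifold n M \<longleftrightarrow> M \<subseteq> Rn n \<and>
    (\<forall>p\<in>M. \<exists>d W \<phi> \<psi>. slice_chart n M d W \<phi> \<psi> \<and> p \<in> W)"

text \<open>Smoothness of a function on an open subset \<open>U\<close> of the submanifold \<open>M\<close>, tested in charts.\<close>

definition smooth_on_submanifold ::
    "nat \<Rightarrow> (nat \<Rightarrow> real) set \<Rightarrow> (nat \<Rightarrow> real) set \<Rightarrow> ((nat \<Rightarrow> real) \<Rightarrow> real) \<Rightarrow> bool"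
  where "smooth_on_submanifold n M U f \<longleftrightarrow>
    (\<forall>p\<in>U. \<exists>d W \<phi> \<psi>. slice_chart n M d W \<phi> \<psi> \<and> p \<in> W \<and> smooth_on d (\<phi> ` (U \<inter> W)) (f \<circ> \<psi>))"

definition Nash_submanifold :: "nat \<Rightarrow> (nat \<Rightarrow> real) set \<Rightarrow> bool"
  where "Nash_submanifold n M \<longleftrightarrow> semialgebraic n M \<and> smooth_submanifold n M"


section \<open>\<open>\<real>\<close>-spaces\<close>

text \<open>Sections over \<open>U\<close>, and morphisms, are represented by functions that are \<^const>\<open>undefined\<close>
  outside their domain, so that equality is equality of functions on that domain.\<close>

record 'a rspace =
  points :: "'a set"
  opens :: "'a set set"
  sections :: "'a set \<Rightarrow> ('a \<Rightarrow> real) set"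

definition restricted_topology :: "'a set \<Rightarrow> 'a set set \<Rightarrow> bool"
  where "restricted_topology M T \<longleftrightarrow> T \<subseteq> Pow M \<and> M \<in> T \<and> {} \<in> T \<and>
    (\<forall>U\<in>T. \<forall>V\<in>T. U \<union> V \<in> T \<and> U \<inter> V \<in> T)"

text \<open>The second assumption is a normalization: \<open>sections\<close> is a total function, but only its
  values on open sets are meaningful.\<close>

locale R_space =
  fixes A :: "'a rspace"
  assumes topology: "restricted_topology (points A) (opens A)"
    and sections_not_open: "U \<notin> opens A \<Longrightarrow> sections A U = {}"
    and sections_extensional: "U \<in> opens A \<Longrightarrow> sections A U \<subseteq> extensional U"
    and sections_continuous: "\<lbrakk>U \<in> opens A; f \<in> sections A U; T \<in> real_opens\<rbrakk>
          \<Longrightarrow> {x \<in> U. f x \<in> T} \<in> opens A"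
    and sections_const: "U \<in> opens A \<Longrightarrow> (\<lambda>x\<in>U. c) \<in> sections A U"
    and sections_add: "\<lbrakk>U \<in> opens A; f \<in> sections A U; g \<in> sections A U\<rbrakk>
          \<Longrightarrow> (\<lambda>x\<in>U. f x + g x) \<in> sections A U"
    and sections_mult: "\<lbrakk>U \<in> opens A; f \<in> sections A U; g \<in> sections A U\<rbrakk>
          \<Longrightarrow> (\<lambda>x\<in>U. f x * g x) \<in> sections A U"
    and sections_restrict: "\<lbrakk>U \<in> opens A; V \<in> opens A; V \<subseteq> U; f \<in> sections A U\<rbrakk>
          \<Longrightarrow> restrict f V \<in> sections A V"
    and sections_glue: "\<lbrakk>finite \<U>; \<U> \<subseteq> opens A; f \<in> extensional (\<Union>\<U>);
            \<And>V. V \<in> \<U> \<Longrightarrow> restrict f V \<in> sections A V\<rbrakk>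
          \<Longrightarrow> f \<in> sections A (\<Union>\<U>)"

definition rspace_mor :: "'a rspace \<Rightarrow> 'b rspace \<Rightarrow> ('a \<Rightarrow> 'b) set"
  where "rspace_mor A B = {\<phi> \<in> points A \<rightarrow>\<^sub>E points B.
    \<forall>U\<in>opens B. (\<phi> -` U \<inter> points A) \<in> opens A \<and>
      (\<forall>f\<in>sections B U. compose (\<phi> -` U \<inter> points A) f \<phi> \<in> sections A (\<phi> -` U \<inter> points A))}"

definition rspace_iso :: "'a rspace \<Rightarrow> 'b rspace \<Rightarrow> bool"
  where "rspace_iso A B \<longleftrightarrow> (\<exists>\<phi>\<in>rspace_mor A B. \<exists>\<psi>\<in>rspace_mor B A.
    (\<forall>x\<in>points A. \<psi> (\<phi> x) = x) \<and> (\<forall>y\<in>points B. \<phi> (\<psi> y) = y))"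

definition rspace_category ::
    "'a rspace set \<Rightarrow> ('a rspace \<Rightarrow> 'a rspace \<Rightarrow> ('a \<Rightarrow> 'a) set) \<Rightarrow> ('a rspace, 'a \<Rightarrow> 'a) cat_data"
  where "rspace_category obs homs = \<lparr>Obj = obs, Hom = homs,
    Id = (\<lambda>A. \<lambda>x\<in>points A. x), Comp = (\<lambda>A B D g f. compose (points A) g f)\<rparr>"


section \<open>Affine QN varieties, affine Nash manifolds, affine algebraic varieties\<close>

definition QN_sections :: "nat \<Rightarrow> (nat \<Rightarrow> real) set \<Rightarrow> (nat \<Rightarrow> real) set \<Rightarrow> ((nat \<Rightarrow> real) \<Rightarrow> real) set"
  where "QN_sections n Y U = {f \<in> extensional U.
    \<exists>(N::nat) V g. (\<forall>i<N. open_semialgebraic n (V i) \<and> Nash_fun n (V i) (g i)) \<and>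
      U = (\<Union>i<N. V i \<inter> Y) \<and> (\<forall>i<N. \<forall>x\<in>V i \<inter> Y. f x = g i x)}"

definition QN_space :: "nat \<Rightarrow> (nat \<Rightarrow> real) set \<Rightarrow> (nat \<Rightarrow> real) rspace"
  where "QN_space n Y =
    \<lparr>points = Y, opens = semialgebraic_opens n Y, sections = QN_sections n Y\<rparr>"

definition affine_QN_variety :: "'a rspace \<Rightarrow> bool"
  where "affine_QN_variety A \<longleftrightarrow> R_space A \<and>
    (\<exists>n Y. closedin (Euclidean_space n) Y \<and> semialgebraic n Y \<and> rspace_iso A (QN_space n Y))"

definition Nash_sections :: "nat \<Rightarrow> (nat \<Rightarrow> real) set \<Rightarrow> (nat \<Rightarrow> real) set \<Rightarrow> ((nat \<Rightarrow> real) \<Rightarrow> real) set"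
  where "Nash_sections n M U = {f \<in> extensional U. U \<in> semialgebraic_opens n M \<and>
    smooth_on_submanifold n M U f \<and> semialgebraic_fun n U f}"

definition Nash_space :: "nat \<Rightarrow> (nat \<Rightarrow> real) set \<Rightarrow> (nat \<Rightarrow> real) rspace"
  where "Nash_space n M =
    \<lparr>points = M, opens = semialgebraic_opens n M, sections = Nash_sections n M\<rparr>"

definition affine_Nash_manifold :: "'a rspace \<Rightarrow> bool"
  where "affine_Nash_manifold A \<longleftrightarrow> R_space A \<and>
    (\<exists>n M. closedin (Euclidean_space n) M \<and> Nash_submanifold n M \<and> rspace_iso A (Nash_space n M))"

definition algebraic_subset :: "nat \<Rightarrow> (nat \<Rightarrow> real) set \<Rightarrow> bool"
  where "algebraic_subset n X \<longleftrightarrow>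
    (\<exists>P. (\<forall>p\<in>P. polynomial_fun n p) \<and> X = {x \<in> Rn n. \<forall>p\<in>P. p x = 0})"

definition regular_map :: "nat \<Rightarrow> (nat \<Rightarrow> real) set \<Rightarrow> nat \<Rightarrow> (nat \<Rightarrow> real) set \<Rightarrow>
    ((nat \<Rightarrow> real) \<Rightarrow> (nat \<Rightarrow> real)) \<Rightarrow> bool"
  where "regular_map n X m Y f \<longleftrightarrow> f \<in> X \<rightarrow>\<^sub>E Y \<and>
    (\<forall>j<m. \<exists>p q. polynomial_fun n p \<and> polynomial_fun n q \<and>
      (\<forall>x\<in>X. q x \<noteq> 0 \<and> f x j = p x / q x))"

definition QN_category :: "('a rspace, 'a \<Rightarrow> 'a) cat_data"
  where "QN_category = rspace_category {A. affine_QN_variety A} rspace_mor"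

definition Nash_category :: "('a rspace, 'a \<Rightarrow> 'a) cat_data"
  where "Nash_category = rspace_category {A. affine_Nash_manifold A} rspace_mor"

text \<open>An algebraic set \<open>X \<subseteq> \<real>\<^sup>n\<close> enters as the \<open>\<real>\<close>-space \<open>(X, QN\<^sub>X)\<close>, but the morphisms are the
  regular maps.\<close>

definition algebraic_category :: "((nat \<Rightarrow> real) rspace, (nat \<Rightarrow> real) \<Rightarrow> (nat \<Rightarrow> real)) cat_data"
  where "algebraic_category = rspace_category
    {QN_space n X | n X. algebraic_subset n X}
    (\<lambda>A B. {f. \<exists>n X m Y. algebraic_subset n X \<and> A = QN_space n X \<and>
      algebraic_subset m Y \<and> B = QN_space m Y \<and> regular_map n X m Y f})"

end

theory Submission
  imports Defs "HOL-Library.Multiset"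
begin

text \<open>
  A Nash manifold \<open>M \<subseteq> \<real>\<^sup>n\<close> is a QN variety because \<open>\<N>\<^sub>M = QN\<^sub>M\<close>, and the point is to extend a Nash
  function on an open \<open>U \<subseteq> M\<close>, locally for a finite cover, to open semi-algebraic subsets of \<open>\<real>\<^sup>n\<close>.
  Near each of its points, \<open>M\<close> is a smooth graph over the coordinates in some \<open>J \<subseteq> {0, \<dots>, n - 1}\<close>.
  That this holds for a given \<open>J\<close> is a first-order condition: \<open>M\<close> is Lipschitz and open over the
  coordinates in \<open>J\<close>. Indeed, any graph can be transformed into a graph over \<open>J\<close> by exchanging one
  coordinate at a time with the implicit function theorem in one variable, the Lipschitz condition
  providing a nonzero partial derivative. The same exchange, applied to the graph of a chart, yields
  the existence of \<open>J\<close>. For fixed \<open>J\<close>, the points \<open>x \<in> \<real>\<^sup>n\<close> close to a graph point \<open>y \<in> U\<close> with the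
  same coordinates in \<open>J\<close> form an open set, semi-algebraic by Tarski--Seidenberg, on which \<open>x \<mapsto> y\<close> is
  a Nash retraction; composing it with the given function yields the extension.

  The Tarski--Seidenberg theorem is proved in the style of Cohen and Hoermander: the sign pattern of
  \<open>p, q\<^sub>1, \<dots>, q\<^sub>k\<close> with \<open>p\<close> of maximal degree is determined by that of \<open>p'\<close>, the \<open>q\<^sub>i\<close> and the remainders
  of \<open>p\<close> modulo these.

  Regular maps are Nash on the open set where the denominators do not vanish, hence morphisms of QN
  varieties; an algebraic set given by infinitely many equations is semi-algebraic by Hilbert's basis
  theorem. The morphism \<open>x \<mapsto> sqrt (1 + x\<^sup>2)\<close> of the line is not regular, since \<open>p\<^sup>2 = (1 + x\<^sup>2) q\<^sup>2\<close> has no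
  solution in polynomials with \<open>q \<noteq> 0\<close>.
\<close>

text \<open>The charts of a submanifold are merely smooth and may be infinitely many, while a QN
  section needs a finite cover by semi-algebraic sets with Nash functions. So nothing may be built
  from a chart: domain and extension are given by first-order formulas in \<open>M\<close>,
  \<open>U\<close>, \<open>J\<close> and \<open>f\<close>, one pair for each of the finitely many
  \<open>J\<close>, and charts serve only to check smoothness near a single point. Of the two
  conditions on \<open>J\<close>, the Lipschitz one says that the coordinates in \<open>J\<close>
  separate nearby points of \<open>M\<close> at a linear rate, and openness says that they vary
  independently on \<open>M\<close>. Injectivity would not do for the first: the curve x = y^3
  projects homeomorphically to the x-axis, but y = x^(1/3) is not smooth at 0. In the elimination of
  quantifiers, the degrees of remainders depend on the parameters. Division is possible only after
  the parameter space has been cut into cells of constant degree; termination is by the multiset of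
  degrees.\<close>

section \<open>Signs of univariate polynomials\<close>

text \<open>Two families of polynomials have the same pattern of signs along the line if some finite
  order-preserving matching \<open>H\<close> of points has this property: the signs agree at any two points \<open>t\<close>
  and \<open>t'\<close> that lie in the same position relative to \<open>H\<close>. Roots need not be matched explicitly.\<close>

definition order_matching :: "(real \<times> real) set \<Rightarrow> bool"
  where "order_matching H \<longleftrightarrow> finite H \<and>
    (\<forall>(a, a') \<in> H. \<forall>(b, b') \<in> H. sgn (a - b) = sgn (a' - b'))"

definition similar :: "(real \<times> real) set \<Rightarrow> real \<Rightarrow> real \<Rightarrow> bool"
  where "similar H t t' \<longleftrightarrow> (\<forall>(e, e') \<in> H. sgn (t - e) = sgn (t' - e'))"

definition sign_matching :: "(real \<times> real) set \<Rightarrow> (real poly \<times> real poly) set \<Rightarrow> bool"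
  where "sign_matching H S \<longleftrightarrow>
    (\<forall>(p, p') \<in> S. \<forall>t t'. similar H t t' \<longrightarrow> sgn (poly p t) = sgn (poly p' t'))"

lemma sgn_diff_swap: "sgn (a - b) = sgn (c - d) \<Longrightarrow> sgn (b - a) = sgn (d - (c::real))"
  by (metis minus_diff_eq sgn_minus)

lemma similar_memD: "similar H t t' \<Longrightarrow> (e, e') \<in> H \<Longrightarrow> sgn (t - e) = sgn (t' - e')"
  by (auto simp: similar_def)

lemma similar_mem: "order_matching H \<Longrightarrow> (e, e') \<in> H \<Longrightarrow> similar H e e'"
  by (force simp: similar_def order_matching_def)

lemma similar_converse: "similar (H\<inverse>) t' t \<longleftrightarrow> similar H t t'"
  by (force simp: similar_def)

lemma order_matching_converse: "order_matching H \<Longrightarrow> order_matching (H\<inverse>)"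
  by (force simp: order_matching_def)

lemma sign_matching_converse: "sign_matching H S \<Longrightarrow> sign_matching (H\<inverse>) (S\<inverse>)"
  by (force simp: sign_matching_def similar_converse)

section \<open>Classes of similar points\<close>

lemma similar_mono: "H \<subseteq> K \<Longrightarrow> similar K t t' \<Longrightarrow> similar H t t'"
  by (auto simp: similar_def)

text \<open>Being similar to \<open>t'\<close> means lying at, or on prescribed sides of, the points
  of \<open>H\<close>, so the class is an interval; mean and intermediate values taken between two
  of its members remain in it.\<close>

lemma similar_convex:
  assumes "similar H a t'" "similar H b t'" "a \<le> s" "s \<le> b"
  shows "similar H s t'"
proof -
  have "sgn (s - e) = sgn (t' - e')" if "(e, e') \<in> H" for e e'
  proof -
    have "sgn (a - e) = sgn (t' - e')" "sgn (b - e) = sgn (t' - e')"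
      using assms that by (auto simp: similar_def)
    then show ?thesis
      using assms(3,4) by (auto simp: sgn_if split: if_splits)
  qed
  then show ?thesis by (auto simp: similar_def)
qed

lemma finite_between_ex:
  fixes A B :: "real set"
  assumes "finite A" "finite B" "\<And>a b. a \<in> A \<Longrightarrow> b \<in> B \<Longrightarrow> a < b"
  shows "\<exists>t. (\<forall>a\<in>A. a < t) \<and> (\<forall>b\<in>B. t < b)"
proof (cases "A = {}")
  case True
  show ?thesis
  proof (cases "B = {}")
    case False
    have "\<forall>b\<in>B. Min B - 1 < b" using Min_le[OF assms(2)] by fastforce
    then show ?thesis using True by blast
  qed (use True in auto)
next
  case A: False
  show ?thesis
  proof (cases "B = {}")
    case True
    have "\<forall>a\<in>A. a < Max A + 1" using Max_ge[OF assms(1)] by fastforce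
    then show ?thesis using True by blast
  next
    case False
    have "Max A < Min B" using A False assms by simp
    then obtain t where t: "Max A < t" "t < Min B" using dense by blast
    then show ?thesis using A False assms by (intro exI[of _ t]) auto
  qed
qed

text \<open>A matched point goes to its partner. An unmatched \<open>t\<close> splits
  \<open>H\<close> into the points below and above it; their partners are separated too, and any
  number in between will do. This is how witnesses are carried from one line to the other.\<close>

lemma similar_ex:
  assumes "order_matching H"
  shows "\<exists>t'. similar H t t'"
proof (cases "t \<in> fst ` H")
  case True
  then obtain t' where "(t, t') \<in> H" by auto
  then show ?thesis using similar_mem[OF assms] by blast
next
  case False
  let ?A = "snd ` {h \<in> H. fst h < t}" and ?B = "snd ` {h \<in> H. fst h > t}"
  have "finite H" using assms by (simp add: order_matching_def)
  then have fin: "finite ?A" "finite ?B" by auto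
  have lt: "a' < b'" if "a' \<in> ?A" "b' \<in> ?B" for a' b'
  proof -
    from that obtain a b where "(a, a') \<in> H" "(b, b') \<in> H" "a < b" by force
    then have "sgn (a - b) = sgn (a' - b')" using assms by (force simp: order_matching_def)
    then show ?thesis using \<open>a < b\<close> by (auto simp: sgn_if split: if_splits)
  qed
  obtain t' where t': "\<forall>a\<in>?A. a < t'" "\<forall>b\<in>?B. t' < b"
  proof -
    have "\<exists>t'. (\<forall>a\<in>?A. a < t') \<and> (\<forall>b\<in>?B. t' < b)"
      by (rule finite_between_ex[OF fin]) (rule lt)
    then show ?thesis using that by iprover
  qed
  have "sgn (t - e) = sgn (t' - e')" if "(e, e') \<in> H" for e e'
  proof -
    have "e \<noteq> t" using that False by force
    then consider "e < t" | "t < e" by linarith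
    then show ?thesis using t' that by cases force+
  qed
  then show ?thesis by (auto simp: similar_def)
qed

lemma similar_ex':
  assumes "order_matching H"
  shows "\<exists>t. similar H t t'"
  using similar_ex[OF order_matching_converse[OF assms], of t'] by (simp add: similar_converse)

lemma similar_nbhd:
  assumes "finite H" "t \<notin> fst ` H" "similar H t t'"
  shows "\<exists>\<delta>>0. \<forall>s. \<bar>s - t\<bar> < \<delta> \<longrightarrow> similar H s t'"
proof -
  have fin: "finite (fst ` H)" using assms(1) by simp
  have "\<exists>lo. (\<forall>a\<in>{e \<in> fst ` H. e < t}. a < lo) \<and> (\<forall>b\<in>{t}. lo < b)"
    by (rule finite_between_ex) (use fin in simp_all)
  then obtain lo where lo: "\<forall>a\<in>{e \<in> fst ` H. e < t}. a < lo" "lo < t" by (elim exE conjE) simp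
  have "\<exists>hi. (\<forall>a\<in>{t}. a < hi) \<and> (\<forall>b\<in>{e \<in> fst ` H. e > t}. hi < b)"
    by (rule finite_between_ex) (use fin in simp_all)
  then obtain hi where hi: "t < hi" "\<forall>b\<in>{e \<in> fst ` H. e > t}. hi < b" by (elim exE conjE) simp
  have "similar H s t'" if s: "\<bar>s - t\<bar> < min (t - lo) (hi - t)" for s
  proof -
    have "sgn (s - e) = sgn (t' - e')" if e: "(e, e') \<in> H" for e e'
    proof -
      have "sgn (t - e) = sgn (t' - e')" using assms(3) e by (auto simp: similar_def)
      moreover have "e \<noteq> t" using assms(2) e by force
      moreover have "e < t \<Longrightarrow> e < s" "t < e \<Longrightarrow> s < e" using lo hi s e by force+
      ultimately show ?thesis by (auto simp: sgn_if split: if_splits)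
    qed
    then show ?thesis by (auto simp: similar_def)
  qed
  then show ?thesis using lo hi by (intro exI[of _ "min (t - lo) (hi - t)"]) auto
qed

section \<open>Roots and sign changes of matched polynomials\<close>

lemma poly_zero_interval:
  fixes p :: "real poly"
  assumes "a < b" "\<And>s. a < s \<Longrightarrow> s < b \<Longrightarrow> poly p s = 0"
  shows "p = 0"
proof (rule ccontr)
  assume "p \<noteq> 0"
  then have "finite {x. poly p x = 0}" by (rule poly_roots_finite)
  then have "finite {a<..<b}" using assms(2) by (rule_tac finite_subset) auto
  then show False using infinite_Ioo[OF assms(1)] by simp
qed

text \<open>Every point of the second line is reached by \<open>similar_ex'\<close>, so all values
  of \<open>q\<close> have the sign of a value of the zero polynomial.\<close>

lemma sign_matching_zero:
  assumes "order_matching H" "sign_matching H S" "(0, q) \<in> S"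
  shows "q = 0"
proof -
  have "poly q t' = 0" for t'
  proof -
    obtain t where "similar H t t'" using similar_ex'[OF assms(1)] by blast
    then have "sgn (poly 0 t) = sgn (poly q t')" using assms by (force simp: sign_matching_def)
    then show ?thesis by (simp add: sgn_zero_iff)
  qed
  then show ?thesis using poly_zero_interval[of 0 1 q] by simp
qed

text \<open>Off \<open>H\<close> a whole neighbourhood of \<open>t\<close> is similar to one point,
  so \<open>p\<close> has constant sign there; with a root at \<open>t\<close> it would vanish on an
  interval.\<close>

lemma sign_matching_root:
  assumes "order_matching H" "sign_matching H S" "(p, p') \<in> S" "p \<noteq> 0" "poly p t = 0"
  shows "t \<in> fst ` H"
proof (rule ccontr)
  assume "t \<notin> fst ` H"
  moreover obtain t' where t': "similar H t t'" using similar_ex[OF assms(1)] by blast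
  moreover have "finite H" using assms(1) by (simp add: order_matching_def)
  ultimately obtain \<delta> where \<delta>: "\<delta> > 0" "\<And>s. \<bar>s - t\<bar> < \<delta> \<Longrightarrow> similar H s t'"
    using similar_nbhd by meson
  have eq: "similar H s t' \<Longrightarrow> sgn (poly p s) = sgn (poly p' t')" for s
    using assms(2,3) by (auto simp: sign_matching_def)
  have "poly p s = 0" if "t - \<delta> < s" "s < t + \<delta>" for s
  proof -
    have "sgn (poly p s) = sgn (poly p t)" using eq[OF t'] eq[OF \<delta>(2)[of s]] that by auto
    then show ?thesis using assms(5) by (simp add: sgn_zero_iff)
  qed
  then have "p = 0" using \<delta>(1) by (intro poly_zero_interval[of "t - \<delta>" "t + \<delta>"]) auto
  then show False using assms(4) by simp
qed

lemma poly_sgn_change: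
  fixes p :: "real poly"
  assumes "a < b" "sgn (poly p a) \<noteq> sgn (poly p b)"
  shows "\<exists>x. a \<le> x \<and> x \<le> b \<and> poly p x = 0"
proof (cases "poly p a = 0 \<or> poly p b = 0")
  case True
  then show ?thesis using assms(1) by (metis less_eq_real_def)
next
  case False
  then have "poly p a * poly p b < 0"
    using assms(2) by (auto simp: sgn_if mult_less_0_iff split: if_splits)
    then show ?thesis using poly_IVT[OF assms(1), of p] by (meson less_imp_le)
qed

text \<open>A sign changes only at a root, and all roots of nonzero members are matched, so the
  other points of \<open>H\<close> carry no information. Dropping them matters later: at a root, the
  sign of a further polynomial can be read off from a remainder.\<close>

lemma sign_matching_restrict:
  assumes om: "order_matching H" and sm: "sign_matching H S"
    and H0: "H0 = {(e, e') \<in> H. \<exists>(q, q') \<in> S. q \<noteq> 0 \<and> poly q e = 0}"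
  shows "order_matching H0" "sign_matching H0 S"
proof -
  have sub: "H0 \<subseteq> H" using H0 by auto
  show "order_matching H0" using om sub finite_subset[OF sub] unfolding order_matching_def by blast
  have "sgn (poly q t) = sgn (poly q' t')" if q: "(q, q') \<in> S" and sim: "similar H0 t t'" for q q' t t'
  proof -
    \<comment> \<open>\<open>s'\<close> has the same position as \<open>t\<close> relative to all of
      \<open>H\<close>, whereas \<open>t'\<close> has it only relative to \<open>H0\<close>; it
      remains to see that \<open>q'\<close> does not change sign between the two.\<close>
    obtain s' where s': "similar H t s'" using similar_ex[OF om] by blast
    then have "sgn (poly q t) = sgn (poly q' s')" using sm q by (auto simp: sign_matching_def)
    moreover have "sgn (poly q' s') = sgn (poly q' t')"
    proof (rule ccontr)
      assume ne: "sgn (poly q' s') \<noteq> sgn (poly q' t')"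
      then have "s' \<noteq> t'" by auto
      have "\<exists>u'. min s' t' \<le> u' \<and> u' \<le> max s' t' \<and> poly q' u' = 0"
      proof (cases "s' < t'")
        case True
        then show ?thesis using poly_sgn_change[OF True ne] by simp
      next
        case False
        then have "t' < s'" using \<open>s' \<noteq> t'\<close> by simp
        then show ?thesis using poly_sgn_change[OF \<open>t' < s'\<close> ne[symmetric]] by simp
      qed
      then obtain u' where u': "min s' t' \<le> u'" "u' \<le> max s' t'" "poly q' u' = 0" by blast
      have q0: "q' \<noteq> 0" using ne by auto
      then have qn: "q \<noteq> 0" using sign_matching_zero[OF om sm] q by blast
      have "u' \<in> fst ` (H\<inverse>)"
        using sign_matching_root[OF order_matching_converse[OF om] sign_matching_converse[OF sm], of q' q u']
          q q0 u' by auto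
      then obtain u where u: "(u, u') \<in> H" by auto
      then have "sgn (poly q u) = sgn (poly q' u')"
        using sm q similar_mem[OF om u] by (auto simp: sign_matching_def)
      then have "poly q u = 0" using u' by (simp add: sgn_zero_iff)
      then have "(u, u') \<in> H0" using u q qn H0 by auto
      then have "sgn (t - u) = sgn (t' - u')" "sgn (t - u) = sgn (s' - u')"
        using sim s' u by (auto simp: similar_def)
      then show False using u' \<open>s' \<noteq> t'\<close> by (auto simp: sgn_if min_def max_def split: if_splits)
    qed
    ultimately show ?thesis by simp
  qed
  then show "sign_matching H0 S" by (auto simp: sign_matching_def)
qed

text \<open>The mean value theorem within the class of \<open>t'\<close>, where the derivative of
  \<open>p\<close> has the sign that the derivative of \<open>p'\<close> has at \<open>t'\<close>.
  If this sign were zero, the derivative of \<open>p\<close> would vanish on an interval and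
  \<open>p\<close> would be constant.\<close>

lemma similar_class_monotone:
  assumes der: "\<And>t t'. similar H t t' \<Longrightarrow> sgn (poly (pderiv p) t) = sgn (poly (pderiv p') t')"
    and deg: "degree p \<ge> 1"
    and sim: "similar H a t'" "similar H b t'" and ab: "a < b"
  shows "sgn (poly p b - poly p a) = sgn (poly (pderiv p') t')" "poly (pderiv p') t' \<noteq> 0"
proof -
  obtain s where s: "a < s" "s < b" "poly p b - poly p a = (b - a) * poly (pderiv p) s"
    using poly_MVT[OF ab] by blast
  have "similar H s t'" using similar_convex[OF sim] s by simp
  then show "sgn (poly p b - poly p a) = sgn (poly (pderiv p') t')"
    using der s ab by (simp add: sgn_mult)
  show "poly (pderiv p') t' \<noteq> 0"
  proof
    assume 0: "poly (pderiv p') t' = 0"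
    have "poly (pderiv p) s = 0" if "a < s" "s < b" for s
    proof -
      have "similar H s t'" using similar_convex[OF sim] that by simp
      then show ?thesis using der[of s t'] 0 by (simp add: sgn_zero_iff)
    qed
    then have "pderiv p = 0" using poly_zero_interval[OF ab] by blast
    then show False using deg by (simp add: pderiv_eq_0_iff)
  qed
qed

text \<open>An increasing polynomial is positive somewhere on its class iff it is positive near the
  upper end. That end is either the next matched point, where the signs of \<open>p\<close> and
  \<open>p'\<close> agree, or infinity, where a positive derivative forces a positive leading
  coefficient.\<close>

lemma similar_class_positive_aux:
  assumes om: "order_matching H"
    and der: "\<And>t t'. similar H t t' \<Longrightarrow> sgn (poly (pderiv p) t) = sgn (poly (pderiv p') t')"
    and pts: "\<And>e e'. (e, e') \<in> H \<Longrightarrow> sgn (poly p e) = sgn (poly p' e')"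
    and deg: "degree p \<ge> 1" "degree p' \<ge> 1"
    and sim: "similar H t t'" and nt: "t \<notin> fst ` H"
    and pos: "poly (pderiv p) t > 0"
    and s: "similar H s t'" "poly p s > 0"
  shows "\<exists>s'. similar H t s' \<and> poly p' s' > 0"
proof -
  define B where "B = {h \<in> H. t < fst h}"
  have fin: "finite H" using om by (simp add: order_matching_def)
  have pos': "poly (pderiv p') t' > 0" using der[OF sim] pos by (auto simp: sgn_if split: if_splits)
  have above: "similar H t x" if "t' \<le> x" "\<And>e e'. (e, e') \<in> B \<Longrightarrow> x < e'" for x
  proof -
    have "sgn (t - e) = sgn (x - e')" if e: "(e, e') \<in> H" for e e'
    proof (cases "t < e")
      case True
      then have "x < e'" using that \<open>\<And>e e'. (e, e') \<in> B \<Longrightarrow> x < e'\<close> by (auto simp: B_def)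
      then show ?thesis using True by simp
    next
      case False
      then have "e < t" using nt e by force
      moreover have "sgn (t - e) = sgn (t' - e')" using sim e by (auto simp: similar_def)
      ultimately show ?thesis using \<open>t' \<le> x\<close> by (auto simp: sgn_if split: if_splits)
    qed
    then show ?thesis by (auto simp: similar_def)
  qed
  show ?thesis
  proof (cases "B = {}")
    case True
    then have cls: "similar H t x" if "t' \<le> x" for x using above that by auto
    have dp: "poly (pderiv p') x > 0" if "t' \<le> x" for x
      using der[OF cls[OF that]] pos by (auto simp: sgn_if split: if_splits)
    have nz: "p' \<noteq> 0" "pderiv p' \<noteq> 0" using deg by (auto simp: pderiv_eq_0_iff)
    have "lead_coeff p' > 0"
    proof (rule ccontr)
      assume "\<not> lead_coeff p' > 0"
      then have "lead_coeff p' < 0" using nz by (meson leading_coeff_0_iff linorder_neqE_linordered_idom)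
      then have "lead_coeff (- pderiv p') > 0"
        using deg by (simp add: degree_pderiv coeff_pderiv mult_less_0_iff)
      then obtain n where n: "\<forall>x\<ge>n. poly (- pderiv p') x \<ge> lead_coeff (- pderiv p')"
        using poly_pinfty_gt_lc by blast
      then have "poly (- pderiv p') (max n t') > 0"
        using \<open>lead_coeff (- pderiv p') > 0\<close> by (meson less_le_trans max.cobounded1)
      then show False using dp[of "max n t'"] by simp
    qed
    then obtain n where "\<forall>x\<ge>n. poly p' x \<ge> lead_coeff p'" using poly_pinfty_gt_lc by blast
    then have "poly p' (max n t') > 0"
      using \<open>lead_coeff p' > 0\<close> by (meson less_le_trans max.cobounded1)
    then show ?thesis using cls[of "max n t'"] by auto
  next
    case False
    have finB: "finite B" using fin by (simp add: B_def)
    define b where "b = Min (fst ` B)"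
    have "b \<in> fst ` B" unfolding b_def using finB False by (intro Min_in) auto
    then obtain b' where b': "(b, b') \<in> B" by auto
    then have bH: "(b, b') \<in> H" "t < b" by (auto simp: B_def)
    have bmin: "b \<le> e" if "(e, e') \<in> B" for e e'
      unfolding b_def using that finB by (intro Min_le) force+
    have bmin': "b' \<le> e'" if "(e, e') \<in> B" for e e'
    proof -
      have "sgn (b - e) = sgn (b' - e')" using om bH that by (force simp: order_matching_def B_def)
      then show ?thesis using bmin[OF that] by (auto simp: sgn_if split: if_splits)
    qed
    have tb': "t' < b'" using similar_memD[OF sim bH(1)] bH by (auto simp: sgn_if split: if_splits)
    have sb: "s < b" using similar_memD[OF s(1) bH(1)] tb' by (auto simp: sgn_if split: if_splits)
    obtain \<xi> where \<xi>: "s < \<xi>" "\<xi> < b" "poly p b - poly p s = (b - s) * poly (pderiv p) \<xi>"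
      using poly_MVT[OF sb] by blast
    have "similar H \<xi> t'"
    proof -
      have "sgn (\<xi> - e) = sgn (t' - e')" if e: "(e, e') \<in> H" for e e'
      proof (cases "t < e")
        case True
        then have "\<xi> < e" using bmin[of e e'] e \<xi> by (auto simp: B_def)
        moreover have "sgn (t - e) = sgn (t' - e')" using sim e by (auto simp: similar_def)
        ultimately show ?thesis using True by (auto simp: sgn_if split: if_splits)
      next
        case False
        then have "e < t" using nt e by force
        moreover have "sgn (t - e) = sgn (t' - e')" "sgn (s - e) = sgn (t' - e')"
          using sim s(1) e by (auto simp: similar_def)
        ultimately show ?thesis using \<xi> by (auto simp: sgn_if split: if_splits)
      qed
      then show ?thesis by (auto simp: similar_def)
    qed
    then have "sgn (poly (pderiv p) \<xi>) = 1" using der[of \<xi> t'] pos' by simp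
    then have "poly (pderiv p) \<xi> > 0" by (simp add: sgn_1_pos)
    then have "poly p b > 0" using \<xi> s(2) sb by (smt (verit) mult_pos_pos)
    then have "poly p' b' > 0" using pts[OF bH(1)] by (auto simp: sgn_if split: if_splits)
    moreover have "isCont (poly p') b'" by simp
    ultimately have "\<forall>\<^sub>F x in at b'. poly p' x > 0"
      by (simp add: isCont_def order_tendstoD(1))
    then obtain d where d: "d > 0" "\<And>x. x \<noteq> b' \<Longrightarrow> dist x b' < d \<Longrightarrow> poly p' x > 0"
      unfolding eventually_at by auto
    \<comment> \<open>Close enough to \<open>b'\<close> for \<open>p'\<close> to be positive, and
      not below \<open>t'\<close>, so still in the class.\<close>
    define x where "x = max t' (b' - d / 2)"
    have "x < b'" "dist x b' < d" "t' \<le> x" using d tb' by (auto simp: x_def dist_real_def)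
    then have "poly p' x > 0" "similar H t x"
      using d above[of x] bmin' by (force+)
    then show ?thesis by blast
  qed
qed

lemma similar_class_positive:
  assumes om: "order_matching H"
    and der: "\<And>t t'. similar H t t' \<Longrightarrow> sgn (poly (pderiv p) t) = sgn (poly (pderiv p') t')"
    and pts: "\<And>e e'. (e, e') \<in> H \<Longrightarrow> sgn (poly p e) = sgn (poly p' e')"
    and deg: "degree p \<ge> 1" "degree p' \<ge> 1"
    and sim: "similar H t t'" and nt: "t \<notin> fst ` H"
    and s: "similar H s t'" "poly p s > 0"
  shows "\<exists>s'. similar H t s' \<and> poly p' s' > 0"
proof -
  have fin: "finite H" using om by (simp add: order_matching_def)
  obtain \<delta> where \<delta>: "\<delta> > 0" "\<And>s. \<bar>s - t\<bar> < \<delta> \<Longrightarrow> similar H s t'"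
    using similar_nbhd[OF fin nt sim] by meson
  have "poly (pderiv p') t' \<noteq> 0"
    using similar_class_monotone(2)[OF der deg(1) sim, of "t + \<delta>/2"] \<delta> by auto
  then have "poly (pderiv p) t \<noteq> 0" using der[OF sim] by (metis sgn_zero_iff)
  then consider "poly (pderiv p) t > 0" | "poly (pderiv p) t < 0" by linarith
  then show ?thesis
  proof cases
    case 1
    then show ?thesis using similar_class_positive_aux[OF om der pts deg sim nt _ s] by blast
  next
    case 2
    \<comment> \<open>The reflection t -> -t turns a decreasing polynomial into an increasing one;
      the matching is reflected along with it.\<close>
    let ?m = "\<lambda>(a::real, b::real). (- a, - b)"
    let ?r = "\<lambda>q::real poly. pcompose q [:0, -1:]"
    have simm: "similar (?m ` H) a b \<longleftrightarrow> similar H (- a) (- b)" for a b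
    proof -
      have "sgn (- a - e) = sgn (- b - e') \<longleftrightarrow> sgn (a + e) = sgn (b + e')" for e e'
        by (auto simp: sgn_if)
      then show ?thesis by (simp add: similar_def case_prod_unfold)
    qed
    have "\<exists>s'. similar (?m ` H) (- t) s' \<and> poly (?r p') s' > 0"
    proof (rule similar_class_positive_aux[where p = "?r p" and t' = "- t'" and s = "- s"])
      show "order_matching (?m ` H)"
      proof -
        have "sgn (- a - - b) = sgn (- a' - - b')" if "(a, a') \<in> H" "(b, b') \<in> H" for a a' b b'
          using om that sgn_diff_swap[of a b a' b'] by (auto simp: order_matching_def)
        then show ?thesis using fin by (auto simp: order_matching_def)
      qed
      show "sgn (poly (pderiv (?r p)) x) = sgn (poly (pderiv (?r p')) x')"
        if "similar (?m ` H) x x'" for x x'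
        using der[of "- x" "- x'"] that by (simp add: simm pderiv_pcompose poly_pcompose pderiv_pCons)
      show "sgn (poly (?r p) e) = sgn (poly (?r p') e')" if "(e, e') \<in> ?m ` H" for e e'
        using that pts by (auto simp: poly_pcompose)
      show "- t \<notin> fst ` ?m ` H" using nt by force
    qed (use deg sim s 2 in \<open>simp_all add: simm poly_pcompose pderiv_pcompose pderiv_pCons degree_pcompose\<close>)
    then obtain s' where "similar (?m ` H) (- t) s'" "poly (?r p') s' > 0" by blast
    then show ?thesis by (intro exI[of _ "- s'"]) (simp add: simm poly_pcompose)
  qed
qed

lemma similar_class_negative:
  assumes om: "order_matching H"
    and der: "\<And>t t'. similar H t t' \<Longrightarrow> sgn (poly (pderiv p) t) = sgn (poly (pderiv p') t')"
    and pts: "\<And>e e'. (e, e') \<in> H \<Longrightarrow> sgn (poly p e) = sgn (poly p' e')"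
    and deg: "degree p \<ge> 1" "degree p' \<ge> 1"
    and sim: "similar H t t'" and nt: "t \<notin> fst ` H"
    and s: "similar H s t'" "poly p s < 0"
  shows "\<exists>s'. similar H t s' \<and> poly p' s' < 0"
proof -
  have "\<exists>s'. similar H t s' \<and> poly (- p') s' > 0"
  proof (rule similar_class_positive[where p = "- p"])
    show "sgn (poly (pderiv (- p)) u) = sgn (poly (pderiv (- p')) u')" if "similar H u u'" for u u'
      using der[OF that] by (simp add: pderiv_minus)
    show "sgn (poly (- p) e) = sgn (poly (- p') e')" if "(e, e') \<in> H" for e e'
      using pts[OF that] by simp
  qed (use om deg sim nt s in simp_all)
  then show ?thesis by simp
qed

text \<open>An unmatched root has a neighbourhood in its class, where \<open>p\<close> is strictly
  monotone, so \<open>p\<close> is negative on one side of it and positive on the other.\<close>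

lemma similar_class_zero:
  assumes om: "order_matching H"
    and der: "\<And>t t'. similar H t t' \<Longrightarrow> sgn (poly (pderiv p) t) = sgn (poly (pderiv p') t')"
    and deg: "degree p \<ge> 1"
    and sim: "similar H t t'" and nt: "t \<notin> fst ` H" and 0: "poly p t = 0"
  shows "\<exists>s. similar H s t' \<and> poly p s > 0" "\<exists>s. similar H s t' \<and> poly p s < 0"
proof -
  have fin: "finite H" using om by (simp add: order_matching_def)
  obtain \<delta> where \<delta>: "\<delta> > 0" "\<And>s. \<bar>s - t\<bar> < \<delta> \<Longrightarrow> similar H s t'"
    using similar_nbhd[OF fin nt sim] by meson
  let ?\<sigma> = "sgn (poly (pderiv p') t')"
  have l: "similar H (t - \<delta>/2) t'" and r: "similar H (t + \<delta>/2) t'" using \<delta> by simp_all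
  have "sgn (0 - poly p (t - \<delta>/2)) = ?\<sigma>"
    using similar_class_monotone(1)[OF der deg l sim] \<delta>(1) 0 by simp
  moreover have "sgn (poly p (t + \<delta>/2) - 0) = ?\<sigma>"
    using similar_class_monotone(1)[OF der deg sim r] \<delta>(1) 0 by simp
  moreover have "?\<sigma> \<noteq> 0"
    using similar_class_monotone(2)[OF der deg sim r] \<delta>(1) by (simp add: sgn_zero_iff)
  ultimately have "poly p (t - \<delta>/2) < 0 \<and> poly p (t + \<delta>/2) > 0
    \<or> poly p (t - \<delta>/2) > 0 \<and> poly p (t + \<delta>/2) < 0"
    by (auto simp: sgn_if split: if_splits)
  then show "\<exists>s. similar H s t' \<and> poly p s > 0" "\<exists>s. similar H s t' \<and> poly p s < 0"
    using l r by blast+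
qed

lemma similar_class_root:
  assumes "similar H a t'" "poly p a > 0" "similar H b t'" "poly p b < 0"
  shows "\<exists>c. similar H c t' \<and> poly p c = 0"
proof -
  have "a \<noteq> b" using assms by auto
  then consider "a < b" | "b < a" by linarith
  then show ?thesis
  proof cases
    case 1
    then obtain c where "a < c" "c < b" "poly p c = 0" using poly_IVT_neg assms by blast
    then show ?thesis using similar_convex[OF assms(1,3)] by (meson less_imp_le)
  next
    case 2
    then obtain c where "b < c" "c < a" "poly p c = 0" using poly_IVT_pos assms by blast
    then show ?thesis using similar_convex[OF assms(3,1)] by (meson less_imp_le)
  qed
qed

lemma similar_sym3:
  "similar H a b \<Longrightarrow> similar H c b \<Longrightarrow> similar H c d \<Longrightarrow> similar H a d"
  by (force simp: similar_def)

text \<open>On an unmatched class \<open>p\<close> is strictly monotone and has at most one root,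
  which exists iff \<open>p\<close> takes both signs there. By the preceding lemmas
  \<open>p'\<close> takes the same signs on the matched class, so the roots come in pairs, and these
  pairs are added to \<open>H\<close>.\<close>

lemma sign_matching_extend:
  assumes om: "order_matching H" and sm: "sign_matching H Q"
    and pQ: "(pderiv p, pderiv p') \<in> Q"
    and pts: "\<And>e e'. (e, e') \<in> H \<Longrightarrow> sgn (poly p e) = sgn (poly p' e')"
    and deg: "degree p \<ge> 1" "degree p' \<ge> 1"
  shows "\<exists>H'. order_matching H' \<and> sign_matching H' (insert (p, p') Q)"
proof -
  define R where "R = {(c, c'). poly p c = 0 \<and> poly p' c' = 0 \<and> similar H c c'}"
  have fin: "finite H" using om by (simp add: order_matching_def)
  have der: "sgn (poly (pderiv p) t) = sgn (poly (pderiv p') t')" if "similar H t t'" for t t'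
    using sm pQ that by (auto simp: sign_matching_def)
  have der': "sgn (poly (pderiv p') t) = sgn (poly (pderiv p) t')" if "similar (H\<inverse>) t t'" for t t'
    using der[of t' t] that by (simp add: similar_converse)
  have omc: "order_matching (H\<inverse>)" by (rule order_matching_converse[OF om])
  have ptsc: "\<And>e e'. (e, e') \<in> H\<inverse> \<Longrightarrow> sgn (poly p' e) = sgn (poly p e')" using pts by simp
  have "p \<noteq> 0" "p' \<noteq> 0" using deg by auto
  then have finR: "finite R"
    by (intro finite_subset[of R "{c. poly p c = 0} \<times> {c. poly p' c = 0}"])
      (auto simp: R_def poly_roots_finite)
  have HR: "similar H c c'" if "(c, c') \<in> H \<union> R" for c c'
    using that similar_mem[OF om] by (auto simp: R_def)
  have uniq: "c = b" if "similar H c t'" "similar H b t'" "poly p c = 0" "poly p b = 0" for b c t'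
    using similar_class_monotone[OF der deg(1) that(1,2)] similar_class_monotone[OF der deg(1) that(2,1)] that
    by (cases c b rule: linorder_cases) (auto simp: sgn_zero_iff)
  have uniq': "c = b" if "similar H t c" "similar H t b" "poly p' c = 0" "poly p' b = 0" for b c t
  proof -
    have c: "similar (H\<inverse>) c t" and b: "similar (H\<inverse>) b t" using that by (simp_all add: similar_converse)
    show ?thesis
      using similar_class_monotone[OF der' deg(2) c b] similar_class_monotone[OF der' deg(2) b c] that
      by (cases c b rule: linorder_cases) (auto simp: sgn_zero_iff)
  qed
  have ord: "sgn (a - b) = sgn (a' - b')" if a: "(a, a') \<in> H \<union> R" and b: "(b, b') \<in> H \<union> R" for a a' b b'
  proof (cases "(a, a') \<in> H \<or> (b, b') \<in> H")
    case True
    then show ?thesis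
      using similar_memD[OF HR[OF b], of a a'] similar_memD[OF HR[OF a], of b b'] sgn_diff_swap by blast
  next
    case False
    then have ab: "(a, a') \<in> R" "(b, b') \<in> R" using a b by auto
    have sa: "similar H a a'" and sb: "similar H b b'" using HR a b by auto
    show ?thesis
    \<comment> \<open>Two new roots in one class coincide, on both lines; otherwise a point of
      \<open>H\<close> separates them, on both lines alike.\<close>
    proof (cases "\<forall>(e, e') \<in> H. sgn (a - e) = sgn (b - e)")
      case True
      then have "similar H a b'" "similar H b a'"
        using sa sb unfolding similar_def by fastforce+
      then have "a = b" "a' = b'"
        using uniq[of a b' b] uniq'[of a a' b'] sa sb ab by (auto simp: R_def)
      then show ?thesis by simp
    next
      case False
      then obtain e e' where e: "(e, e') \<in> H" "sgn (a - e) \<noteq> sgn (b - e)" by auto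
      then have "sgn (a - e) = sgn (a' - e')" "sgn (b - e) = sgn (b' - e')"
        using similar_memD sa sb by auto
      with e(2) show ?thesis
        by (auto simp: sgn_if split: if_splits)
    qed
  qed
  have om': "order_matching (H \<union> R)"
    using fin finR ord unfolding order_matching_def by blast
  have main: "sgn (poly p t) = sgn (poly p' t')" if sim': "similar (H \<union> R) t t'" for t t'
  proof (cases "t \<in> fst ` H")
    case True
    then obtain e' where e: "(t, e') \<in> H" by auto
    then have "t' = e'" using similar_memD[OF sim', of t e'] by (simp add: sgn_zero_iff)
    then show ?thesis using pts e by simp
  next
    case nt: False
    have sim: "similar H t t'" using similar_mono[OF _ sim'] by blast
    have nt': "t' \<notin> fst ` (H\<inverse>)"
    proof
      assume "t' \<in> fst ` (H\<inverse>)"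
      then obtain e where "(e, t') \<in> H" by auto
      then show False using similar_memD[OF sim, of e t'] nt by (force simp: sgn_zero_iff)
    qed
    have simc: "similar (H\<inverse>) t' t" using sim by (simp add: similar_converse)
    let ?P = "\<exists>s. similar H s t' \<and> poly p s > 0" and ?N = "\<exists>s. similar H s t' \<and> poly p s < 0"
    let ?P' = "\<exists>s. similar H t s \<and> poly p' s > 0" and ?N' = "\<exists>s. similar H t s \<and> poly p' s < 0"
    have P: "?P \<longleftrightarrow> ?P'"
      using similar_class_positive[OF om der pts deg sim nt]
        similar_class_positive[OF omc der' ptsc deg(2,1) simc nt'] by (auto simp: similar_converse)
    have N: "?N \<longleftrightarrow> ?N'"
      using similar_class_negative[OF om der pts deg sim nt]
        similar_class_negative[OF omc der' ptsc deg(2,1) simc nt'] by (auto simp: similar_converse)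
    have Z: "poly p t = 0 \<Longrightarrow> ?P \<and> ?N"
      using similar_class_zero[OF om der deg(1) sim nt] by simp
    have Z': "poly p' t' = 0 \<Longrightarrow> ?P' \<and> ?N'"
      using similar_class_zero[OF omc der' deg(2) simc nt'] by (simp add: similar_converse)
    show ?thesis
    \<comment> \<open>If the class misses one strict sign, a root is excluded by \<open>Z\<close>
      and \<open>Z'\<close>, and the other sign prevails on both sides. Otherwise both classes
      contain a root, and the sign at a point is the side of the root times the sign of the
      derivative.\<close>
    proof (cases "?P \<and> ?N")
      case False
      have "poly p t > 0 \<Longrightarrow> ?P" "poly p t < 0 \<Longrightarrow> ?N"
        "poly p' t' > 0 \<Longrightarrow> ?P'" "poly p' t' < 0 \<Longrightarrow> ?N'" using sim by blast+
      then show ?thesis using False P N Z Z'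
        by (cases "poly p t" "0::real" rule: linorder_cases; cases "poly p' t'" "0::real" rule: linorder_cases)
          simp_all
    next
      case True
      then obtain c where c: "similar H c t'" "poly p c = 0" using similar_class_root by blast
      from True P N obtain a b where "similar (H\<inverse>) a t" "poly p' a > 0" "similar (H\<inverse>) b t" "poly p' b < 0"
        by (auto simp: similar_converse)
      then obtain c' where c': "similar H t c'" "poly p' c' = 0"
        using similar_class_root[of "H\<inverse>" a t p' b] unfolding similar_converse by blast
      have cc: "similar H c c'" using similar_sym3[OF c(1) sim c'(1)] .
      then have "(c, c') \<in> R" using c c' by (simp add: R_def)
      then have tc: "sgn (t - c) = sgn (t' - c')" using similar_memD[OF sim'] by blast
      let ?\<sigma> = "sgn (poly (pderiv p') t')"
      have "sgn (poly (pderiv p) t) = ?\<sigma>" using der[OF sim] .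
      moreover have "sgn (poly p t) = sgn (t - c) * ?\<sigma>"
      proof (cases t c rule: linorder_cases)
        case less
        then show ?thesis using similar_class_monotone(1)[OF der deg(1) sim c(1)] c(2)
          by (simp add: sgn_minus)
      next
        case greater
        then show ?thesis using similar_class_monotone(1)[OF der deg(1) c(1) sim] c(2) by simp
      qed (use c in simp)
      moreover have "sgn (poly p' t') = sgn (t' - c') * sgn (poly (pderiv p) t)"
      proof (cases t' c' rule: linorder_cases)
        case less
        have c'': "similar (H\<inverse>) c' t" using c'(1) by (simp add: similar_converse)
        show ?thesis using similar_class_monotone(1)[OF der' deg(2) simc c'' less] c'(2) less
          by (simp add: sgn_minus)
      next
        case greater
        have c'': "similar (H\<inverse>) c' t" using c'(1) by (simp add: similar_converse)
        show ?thesis using similar_class_monotone(1)[OF der' deg(2) c'' simc greater] c'(2) greater by simp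
      qed (use c' in simp)
      ultimately show ?thesis using tc by simp
    qed
  qed
  have "sign_matching (H \<union> R) (insert (p, p') Q)"
    using main sm similar_mono[of H "H \<union> R"] by (fastforce simp: sign_matching_def)
  then show ?thesis using om' by blast
qed

text \<open>The roots of the polynomials in \<open>Q\<close> are the only points at which the sign of \<open>p\<close> has to be
  known, and at a root of \<open>q\<close> it is the sign of \<open>p mod q\<close>.\<close>

lemma sign_matching_mod:
  assumes om: "order_matching H" and sm: "sign_matching H Q"
    and pQ: "(pderiv p, pderiv p') \<in> Q"
    and rem: "\<And>q q'. (q, q') \<in> Q \<Longrightarrow> degree q \<ge> 1 \<Longrightarrow> sign_matching H {(p mod q, p' mod q')}"
    and deg: "degree p \<ge> 1" "degree p' \<ge> 1"
  shows "\<exists>H'. order_matching H' \<and> sign_matching H' (insert (p, p') Q)"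
proof -
  define H0 where "H0 = {(e, e') \<in> H. \<exists>(q, q') \<in> Q. q \<noteq> 0 \<and> poly q e = 0}"
  have "sgn (poly p e) = sgn (poly p' e')" if e: "(e, e') \<in> H0" for e e'
  proof -
    from e obtain q q' where q: "(q, q') \<in> Q" "q \<noteq> 0" "poly q e = 0" and eH: "(e, e') \<in> H"
      by (auto simp: H0_def)
    have sim: "similar H e e'" using similar_mem[OF om eH] .
    then have "sgn (poly q e) = sgn (poly q' e')" using sm q(1) by (auto simp: sign_matching_def)
    then have q': "poly q' e' = 0" using q by (simp add: sgn_zero_iff)
    have "degree q \<ge> 1"
    proof (rule ccontr)
      assume "\<not> degree q \<ge> 1"
      then obtain c where "q = [:c:]" using degree_eq_zeroE[of q] by (metis less_one linorder_not_le)
      then show False using q by simp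
    qed
    then have "sgn (poly (p mod q) e) = sgn (poly (p' mod q') e')"
      using rem[OF q(1)] sim by (auto simp: sign_matching_def)
    moreover have "poly (p mod q) e = poly p e"
    proof -
      have "poly p e = poly (p div q * q + p mod q) e" by simp
      then show ?thesis using q  unfolding poly_add poly_mult by simp
    qed
    moreover have "poly (p' mod q') e' = poly p' e'"
    proof -
      have "poly p' e' = poly (p' div q' * q' + p' mod q') e'" by simp
      then show ?thesis using q q' unfolding poly_add poly_mult by simp
    qed
    ultimately show ?thesis by simp
  qed
  then show ?thesis
    using sign_matching_extend[OF sign_matching_restrict[OF om sm H0_def] pQ _ deg] by blast
qed

section \<open>The Tarski--Seidenberg theorem\<close>

text \<open>The type of variables is arbitrary, so that a bound variable can be adjoined by
  \<open>option\<close> or \<open>+\<close>; in contrast to \<open>polynomial_fun\<close>, no number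
  of variables is fixed.\<close>

inductive polynomial_term :: "(('v \<Rightarrow> real) \<Rightarrow> real) \<Rightarrow> bool" where
  pt_const: "polynomial_term (\<lambda>z. c)"
| pt_coord: "polynomial_term (\<lambda>z. z i)"
| pt_add: "\<lbrakk>polynomial_term p; polynomial_term q\<rbrakk> \<Longrightarrow> polynomial_term (\<lambda>z. p z + q z)"
| pt_mult: "\<lbrakk>polynomial_term p; polynomial_term q\<rbrakk> \<Longrightarrow> polynomial_term (\<lambda>z. p z * q z)"

text \<open>A shallow form of quantifier-free formulas. Closure under quantifiers is the theorem
  \<open>tarski_seidenberg\<close>; once it is available, a first-order condition is shown to be
  definable by introduction rules alone.\<close>

inductive definable :: "(('v \<Rightarrow> real) \<Rightarrow> bool) \<Rightarrow> bool" where
  definable_pos: "polynomial_term p \<Longrightarrow> definable (\<lambda>z. p z > 0)"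
| definable_zero: "polynomial_term p \<Longrightarrow> definable (\<lambda>z. p z = 0)"
| definable_conj: "\<lbrakk>definable P; definable Q\<rbrakk> \<Longrightarrow> definable (\<lambda>z. P z \<and> Q z)"
| definable_not: "definable P \<Longrightarrow> definable (\<lambda>z. \<not> P z)"

lemma pt_uminus: "polynomial_term p \<Longrightarrow> polynomial_term (\<lambda>z. - p z)"
  using pt_mult[OF pt_const[of "-1"]] by simp

lemma pt_diff: "polynomial_term p \<Longrightarrow> polynomial_term q \<Longrightarrow> polynomial_term (\<lambda>z. p z - q z)"
  using pt_add[OF _ pt_uminus] by fastforce

lemma pt_sum:
  "(\<And>i. i \<in> I \<Longrightarrow> polynomial_term (p i)) \<Longrightarrow> polynomial_term (\<lambda>z. \<Sum>i\<in>I. p i z)"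
  by (induction I rule: infinite_finite_induct) (auto intro: pt_const pt_add)

lemma definable_const: "definable (\<lambda>z. c)"
proof -
  have "definable (\<lambda>z. (1::real) > 0)" "definable (\<lambda>z. (1::real) = 0)"
    using definable_pos[OF pt_const] definable_zero[OF pt_const] .
  then show ?thesis by (cases c) simp_all
qed

lemma definable_disj: "definable P \<Longrightarrow> definable Q \<Longrightarrow> definable (\<lambda>z. P z \<or> Q z)"
  using definable_not[OF definable_conj[OF definable_not definable_not, of P Q]] by simp

lemma definable_finite_disj:
  "finite I \<Longrightarrow> (\<And>i. i \<in> I \<Longrightarrow> definable (P i)) \<Longrightarrow> definable (\<lambda>z. \<exists>i\<in>I. P i z)"
  by (induction I rule: finite_induct) (auto intro: definable_const definable_disj)

lemma definable_signs:
  assumes "definable P"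
  shows "\<exists>ps. (\<forall>p\<in>set ps. polynomial_term p) \<and>
    (\<forall>z z'. (\<forall>p\<in>set ps. sgn (p z) = sgn (p z')) \<longrightarrow> P z = P z')"
  using assms
proof induction
  case (definable_pos p)
  then show ?case by (intro exI[of _ "[p]"]) (auto simp: sgn_if split: if_splits)
next
  case (definable_zero p)
  then show ?case by (intro exI[of _ "[p]"]) (auto simp: sgn_if split: if_splits)
next
  case (definable_conj P Q)
  from definable_conj.IH obtain ps qs where
    ps: "\<forall>p\<in>set ps. polynomial_term p"
      "\<forall>z z'. (\<forall>p\<in>set ps. sgn (p z) = sgn (p z')) \<longrightarrow> P z = P z'" and
    qs: "\<forall>p\<in>set qs. polynomial_term p"
      "\<forall>z z'. (\<forall>p\<in>set qs. sgn (p z) = sgn (p z')) \<longrightarrow> Q z = Q z'"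
    by (elim exE conjE)
  show ?case
  proof (intro exI[of _ "ps @ qs"] conjI allI impI)
    show "\<forall>p\<in>set (ps @ qs). polynomial_term p" using ps(1) qs(1) by auto
    fix z z' assume "\<forall>p\<in>set (ps @ qs). sgn (p z) = sgn (p z')"
    then have "\<forall>p\<in>set ps. sgn (p z) = sgn (p z')" "\<forall>p\<in>set qs. sgn (p z) = sgn (p z')" by simp_all
    then have "P z = P z'" "Q z = Q z'" using ps(2) qs(2) by blast+
    then show "(P z \<and> Q z) = (P z' \<and> Q z')" by simp
  qed
next
  case (definable_not P)
  then show ?case by auto
qed

section \<open>Rational functions on a set of parameters\<close>

definition rational_on :: "(('v \<Rightarrow> real) \<Rightarrow> bool) \<Rightarrow> (('v \<Rightarrow> real) \<Rightarrow> real) \<Rightarrow> bool"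
  where "rational_on A a \<longleftrightarrow> (\<exists>p q. polynomial_term p \<and> polynomial_term q \<and>
    (\<forall>z. A z \<longrightarrow> q z \<noteq> 0 \<and> a z = p z / q z))"

lemma rational_on_cong: "rational_on A a \<Longrightarrow> (\<And>z. A z \<Longrightarrow> b z = a z) \<Longrightarrow> rational_on A b"
  unfolding rational_on_def by metis

lemma rational_on_subset: "rational_on A a \<Longrightarrow> (\<And>z. B z \<Longrightarrow> A z) \<Longrightarrow> rational_on B a"
  unfolding rational_on_def by metis

lemma rational_on_polynomial: "polynomial_term a \<Longrightarrow> rational_on A a"
  unfolding rational_on_def by (intro exI[of _ a] exI[of _ "\<lambda>_. 1"]) (auto intro: pt_const)

lemma rational_on_add: "rational_on A a \<Longrightarrow> rational_on A b \<Longrightarrow> rational_on A (\<lambda>z. a z + b z)"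
proof -
  assume "rational_on A a" "rational_on A b"
  then obtain p q r s where "polynomial_term p" "polynomial_term q" "polynomial_term r" "polynomial_term s"
    "\<And>z. A z \<Longrightarrow> q z \<noteq> 0 \<and> a z = p z / q z" "\<And>z. A z \<Longrightarrow> s z \<noteq> 0 \<and> b z = r z / s z"
    unfolding rational_on_def by auto
  then show ?thesis unfolding rational_on_def
    by (intro exI[of _ "\<lambda>z. p z * s z + r z * q z"] exI[of _ "\<lambda>z. q z * s z"])
      (auto intro!: pt_add pt_mult simp: add_frac_eq)
qed

lemma rational_on_mult: "rational_on A a \<Longrightarrow> rational_on A b \<Longrightarrow> rational_on A (\<lambda>z. a z * b z)"
proof -
  assume "rational_on A a" "rational_on A b"
  then obtain p q r s where "polynomial_term p" "polynomial_term q" "polynomial_term r" "polynomial_term s"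
    "\<And>z. A z \<Longrightarrow> q z \<noteq> 0 \<and> a z = p z / q z" "\<And>z. A z \<Longrightarrow> s z \<noteq> 0 \<and> b z = r z / s z"
    unfolding rational_on_def by auto
  then show ?thesis unfolding rational_on_def
    by (intro exI[of _ "\<lambda>z. p z * r z"] exI[of _ "\<lambda>z. q z * s z"]) (auto intro!: pt_mult)
qed

lemma rational_on_divide:
  assumes "rational_on A a" "rational_on A b" "\<And>z. A z \<Longrightarrow> b z \<noteq> 0"
  shows "rational_on A (\<lambda>z. a z / b z)"
proof -
  obtain r s where rs: "polynomial_term r" "polynomial_term s" "\<And>z. A z \<Longrightarrow> s z \<noteq> 0 \<and> b z = r z / s z"
    using assms(2) unfolding rational_on_def by auto
  then have "rational_on A (\<lambda>z. s z / r z)"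
    unfolding rational_on_def using assms(3) by (intro exI[of _ s] exI[of _ r]) auto
  then have "rational_on A (\<lambda>z. a z * (s z / r z))" by (rule rational_on_mult[OF assms(1)])
  then show ?thesis by (rule rational_on_cong) (simp add: rs(3))
qed

lemma rational_on_diff:
  "rational_on A a \<Longrightarrow> rational_on A b \<Longrightarrow> rational_on A (\<lambda>z. a z - b z)"
  using rational_on_add[OF _ rational_on_mult[OF rational_on_polynomial[OF pt_const[of "-1"]]], of A a b]
  by simp

text \<open>To be read as uniformity: \<open>R z z'\<close> says that z and z' look alike, and
  within a cell this holds for all pairs from \<open>A\<close>. Cells may overlap and leave
  \<open>A\<close>. Their finite number is what turns an existential quantifier into a finite
  disjunction.\<close>

definition cellwise :: "(('v \<Rightarrow> real) \<Rightarrow> bool) \<Rightarrow> (('v \<Rightarrow> real) \<Rightarrow> ('v \<Rightarrow> real) \<Rightarrow> bool) \<Rightarrow> bool"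
  where "cellwise A R \<longleftrightarrow> (\<exists>\<P>. finite \<P> \<and> (\<forall>B\<in>\<P>. definable B) \<and> (\<forall>z. A z \<longrightarrow> (\<exists>B\<in>\<P>. B z)) \<and>
    (\<forall>B\<in>\<P>. \<forall>z z'. A z \<longrightarrow> A z' \<longrightarrow> B z \<longrightarrow> B z' \<longrightarrow> R z z'))"

lemma cellwiseI:
  assumes "finite \<P>" "\<And>B. B \<in> \<P> \<Longrightarrow> definable B" "\<And>z. A z \<Longrightarrow> \<exists>B\<in>\<P>. B z"
    "\<And>B z z'. \<lbrakk>B \<in> \<P>; A z; A z'; B z; B z'\<rbrakk> \<Longrightarrow> R z z'"
  shows "cellwise A R"
  unfolding cellwise_def using assms by (intro exI[of _ \<P>]) simp

lemma cellwiseE: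
  assumes "cellwise A R"
  obtains \<P> where "finite \<P>" "\<And>B. B \<in> \<P> \<Longrightarrow> definable B" "\<And>z. A z \<Longrightarrow> \<exists>B\<in>\<P>. B z"
    "\<And>B z z'. \<lbrakk>B \<in> \<P>; A z; A z'; B z; B z'\<rbrakk> \<Longrightarrow> R z z'"
  using assms unfolding cellwise_def by (elim exE conjE) simp

lemma cellwise_mono:
  assumes "cellwise A R" "\<And>z z'. \<lbrakk>A z; A z'; R z z'\<rbrakk> \<Longrightarrow> R' z z'"
  shows "cellwise A R'"
  using assms(1)
proof (rule cellwiseE)
  fix \<P> assume \<P>: "finite \<P>" "\<And>B. B \<in> \<P> \<Longrightarrow> definable B" "\<And>z. A z \<Longrightarrow> \<exists>B\<in>\<P>. B z"
    "\<And>B z z'. \<lbrakk>B \<in> \<P>; A z; A z'; B z; B z'\<rbrakk> \<Longrightarrow> R z z'"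
  show ?thesis by (rule cellwiseI[OF \<P>(1-3)]) (auto intro: assms(2) \<P>(4))
qed

lemma cellwise_subset:
  assumes "cellwise A R" "\<And>z. B z \<Longrightarrow> A z"
  shows "cellwise B R"
  using assms(1)
proof (rule cellwiseE)
  fix \<P> assume \<P>: "finite \<P>" "\<And>B. B \<in> \<P> \<Longrightarrow> definable B" "\<And>z. A z \<Longrightarrow> \<exists>B\<in>\<P>. B z"
    "\<And>B z z'. \<lbrakk>B \<in> \<P>; A z; A z'; B z; B z'\<rbrakk> \<Longrightarrow> R z z'"
  show ?thesis by (rule cellwiseI[OF \<P>(1,2)]) (auto intro: assms(2) \<P>(3,4))
qed

lemma cellwise_trivial: "(\<And>z z'. \<lbrakk>A z; A z'\<rbrakk> \<Longrightarrow> R z z') \<Longrightarrow> cellwise A R"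
  by (rule cellwiseI[of "{\<lambda>_. True}"]) (auto intro: definable_const)

text \<open>Cell-by-cell refinement: \<open>R\<close> may be proved under the assumption that
  \<open>E\<close> holds throughout. In the main uses \<open>E\<close> is equality of degrees, which
  keeps leading coefficients of nonconstant members nonzero on each cell.\<close>

lemma cellwise_split:
  assumes "cellwise A E"
    and split: "\<And>B. definable B \<Longrightarrow> (\<And>z z'. A z \<and> B z \<Longrightarrow> A z' \<and> B z' \<Longrightarrow> E z z') \<Longrightarrow>
      cellwise (\<lambda>z. A z \<and> B z) R"
  shows "cellwise A R"
proof -
  obtain \<P> where \<P>: "finite \<P>" "\<And>B. B \<in> \<P> \<Longrightarrow> definable B" "\<And>z. A z \<Longrightarrow> \<exists>B\<in>\<P>. B z"
    "\<And>B z z'. B \<in> \<P> \<Longrightarrow> A z \<Longrightarrow> A z' \<Longrightarrow> B z \<Longrightarrow> B z' \<Longrightarrow> E z z'"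
    using assms(1) by (rule cellwiseE) (rule that)
  define ok where "ok B \<Q> \<longleftrightarrow> finite \<Q> \<and> (\<forall>C\<in>\<Q>. definable C) \<and> (\<forall>z. A z \<and> B z \<longrightarrow> (\<exists>C\<in>\<Q>. C z)) \<and>
      (\<forall>C\<in>\<Q>. \<forall>z z'. A z \<and> B z \<longrightarrow> A z' \<and> B z' \<longrightarrow> C z \<longrightarrow> C z' \<longrightarrow> R z z')" for B \<Q>
  have "\<exists>\<Q>. ok B \<Q>" if "B \<in> \<P>" for B
    using split[of B, OF \<P>(2)[OF that]] \<P>(4)[OF that] unfolding cellwise_def ok_def by simp
  then obtain \<Q> where "\<And>B. B \<in> \<P> \<Longrightarrow> ok B (\<Q> B)" by metis
  note \<Q> = this[unfolded ok_def]
  let ?\<R> = "\<Union>B\<in>\<P>. (\<lambda>C z. B z \<and> C z) ` \<Q> B"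
  show ?thesis unfolding cellwise_def
  proof (intro exI[of _ ?\<R>] conjI ballI allI impI)
    show "finite ?\<R>" using \<P>(1) \<Q> by blast
    show "definable D" if "D \<in> ?\<R>" for D
      using that \<P>(2) \<Q> by (auto intro!: definable_conj)
    show "\<exists>D\<in>?\<R>. D z" if z: "A z" for z
    proof -
      obtain B where B: "B \<in> \<P>" "B z" using \<P>(3)[OF z] by blast
      then obtain C where "C \<in> \<Q> B" "C z" using \<Q> z by blast
      then have "(\<lambda>z. B z \<and> C z) \<in> ?\<R>" "B z \<and> C z" using B by auto
      then show ?thesis by (intro bexI[of _ "\<lambda>z. B z \<and> C z"])
    qed
    show "R z z'" if "D \<in> ?\<R>" "A z" "A z'" "D z" "D z'" for D z z'
    proof -
      from that obtain B C where "B \<in> \<P>" "C \<in> \<Q> B" "D = (\<lambda>z. B z \<and> C z)" by auto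
      then show ?thesis using that \<Q>[of B] by auto
    qed
  qed
qed

lemma cellwise_conj:
  assumes "cellwise A R1" "cellwise A R2"
  shows "cellwise A (\<lambda>z z'. R1 z z' \<and> R2 z z')"
proof (rule cellwise_split[OF assms(1)])
  fix B assume B: "\<And>z z'. A z \<and> B z \<Longrightarrow> A z' \<and> B z' \<Longrightarrow> R1 z z'"
  have "cellwise (\<lambda>z. A z \<and> B z) R2" using assms(2) by (rule cellwise_subset) simp
  then show "cellwise (\<lambda>z. A z \<and> B z) (\<lambda>z z'. R1 z z' \<and> R2 z z')"
    by (rule cellwise_mono) (simp add: B)
qed

lemma cellwise_list:
  "(\<And>x. x \<in> set xs \<Longrightarrow> cellwise A (R x)) \<Longrightarrow> cellwise A (\<lambda>z z'. \<forall>x\<in>set xs. R x z z')"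
proof (induction xs)
  case Nil
  then show ?case by (intro cellwise_trivial) simp
next
  case (Cons x xs)
  then have "cellwise A (\<lambda>z z'. R x z z' \<and> (\<forall>x\<in>set xs. R x z z'))" by (intro cellwise_conj) simp_all
  then show ?case by simp
qed

lemma cellwise_sgn:
  assumes "rational_on A a"
  shows "cellwise A (\<lambda>z z'. sgn (a z) = sgn (a z'))"
proof -
  obtain p q where pq: "polynomial_term p" "polynomial_term q"
    "\<And>z. A z \<Longrightarrow> q z \<noteq> 0 \<and> a z = p z / q z"
    using assms unfolding rational_on_def by auto
  \<comment> \<open>A quotient has the sign of the corresponding product, so no division is
    left.\<close>
  define r where "r z = p z * q z" for z
  have r: "polynomial_term r" unfolding r_def using pq by (intro pt_mult)
  have s: "sgn (a z) = sgn (r z)" if "A z" for z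
    using pq(3)[OF that] by (cases "q z > 0") (simp_all add: r_def sgn_divide sgn_mult)
  show ?thesis
  proof (rule cellwiseI[of "{\<lambda>z. r z > 0, \<lambda>z. r z = 0, \<lambda>z. - r z > 0}"])
    show "definable B" if "B \<in> {\<lambda>z. r z > 0, \<lambda>z. r z = 0, \<lambda>z. - r z > 0}" for B
      using that definable_pos[OF r] definable_zero[OF r] definable_pos[OF pt_uminus[OF r]] by auto
    show "\<exists>B\<in>{\<lambda>z. r z > 0, \<lambda>z. r z = 0, \<lambda>z. - r z > 0}. B z" for z
      by auto
    fix B z z' assume "B \<in> {\<lambda>z. r z > 0, \<lambda>z. r z = 0, \<lambda>z. - r z > 0}" "A z" "A z'" "B z" "B z'"
    then have "sgn (r z) = sgn (r z')" by auto
    then show "sgn (a z) = sgn (a z')" using s \<open>A z\<close> \<open>A z'\<close> by simp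
  qed simp
qed

section \<open>Families of polynomials with rational coefficients\<close>

definition coeffs_rational :: "(('v \<Rightarrow> real) \<Rightarrow> bool) \<Rightarrow> (('v \<Rightarrow> real) \<Rightarrow> real poly) \<Rightarrow> bool"
  where "coeffs_rational A F \<longleftrightarrow> (\<forall>k. rational_on A (\<lambda>z. coeff (F z) k))"

lemma coeffs_rational_subset:
  "coeffs_rational A F \<Longrightarrow> (\<And>z. B z \<Longrightarrow> A z) \<Longrightarrow> coeffs_rational B F"
  unfolding coeffs_rational_def by (meson rational_on_subset)

lemma coeffs_rational_pderiv:
  assumes "coeffs_rational A F"
  shows "coeffs_rational A (\<lambda>z. pderiv (F z))"
  unfolding coeffs_rational_def
proof
  fix k
  have "rational_on A (\<lambda>z. of_nat (Suc k) * coeff (F z) (Suc k))"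
    using assms
    by (intro rational_on_mult[OF rational_on_polynomial[OF pt_const]]) (simp add: coeffs_rational_def)
  then show "rational_on A (\<lambda>z. coeff (pderiv (F z)) k)" by (simp add: coeff_pderiv)
qed

text \<open>Long division inverts only the leading coefficient of \<open>G z\<close>, which does not
  vanish on \<open>A\<close> because the degree is constantly \<open>e\<close> there. The degree of
  \<open>F z\<close> may vary, so the induction is on a bound \<open>n\<close>, and the coefficient
  divided out may be zero.\<close>

lemma coeffs_rational_mod:
  assumes G: "coeffs_rational A G" "\<And>z. A z \<Longrightarrow> degree (G z) = e" "e \<ge> 1"
    and F: "coeffs_rational A F" "\<And>z. A z \<Longrightarrow> degree (F z) \<le> n"
  shows "coeffs_rational A (\<lambda>z. F z mod G z)"
  using F
proof (induction n arbitrary: F)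
  case (0 F)
  have "F z mod G z = F z" if "A z" for z
    using G(2,3) 0(2) that by (intro mod_poly_less) fastforce
  then show ?case using 0(1) unfolding coeffs_rational_def
    by (auto intro: rational_on_cong)
next
  case (Suc n F)
  show ?case
  proof (cases "Suc n < e")
    case True
    have "F z mod G z = F z" if "A z" for z
      using G(2,3) Suc(3) that True by (intro mod_poly_less) fastforce
    then show ?thesis using Suc(2) unfolding coeffs_rational_def
      by (auto intro: rational_on_cong)
  next
    case False
    define c where "c z = coeff (F z) (Suc n) / coeff (G z) e" for z
    define F1 where "F1 z = F z - monom (c z) (Suc n - e) * G z" for z
    have lc: "coeff (G z) e \<noteq> 0" if "A z" for z
      using G(2)[OF that] G(3) by (metis degree_0 leading_coeff_0_iff not_one_le_zero)
    have "rational_on A c" unfolding c_def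
      using G Suc(2) lc by (intro rational_on_divide) (auto simp: coeffs_rational_def)
    then have "coeffs_rational A F1"
      unfolding coeffs_rational_def F1_def coeff_diff coeff_monom_mult
    proof (intro allI rational_on_diff)
      fix k
      show "rational_on A (\<lambda>z. coeff (F z) k)" using Suc(2) by (simp add: coeffs_rational_def)
      show "rational_on A (\<lambda>z. if k < Suc n - e then 0 else c z * coeff (G z) (k - (Suc n - e)))"
        using G(1) \<open>rational_on A c\<close>
        by (cases "k < Suc n - e")
          (simp_all add: rational_on_polynomial[OF pt_const] rational_on_mult coeffs_rational_def)
    qed
    moreover have "degree (F1 z) \<le> n" if z: "A z" for z
    proof (rule degree_le, intro allI impI)
      fix i assume i: "n < i"
      show "coeff (F1 z) i = 0"
      proof (cases "i = Suc n")
        case True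
        then show ?thesis using False lc[OF z] by (simp add: F1_def coeff_monom_mult c_def)
      next
        case ne: False
        then have "coeff (F z) i = 0" using Suc(3)[OF z] i by (intro coeff_eq_0) simp
        moreover have "coeff (G z) (i - (Suc n - e)) = 0"
          using G(2)[OF z] i ne False by (intro coeff_eq_0) linarith
        ultimately show ?thesis by (simp add: F1_def coeff_monom_mult)
      qed
    qed
    ultimately have "coeffs_rational A (\<lambda>z. F1 z mod G z)" by (rule Suc.IH)
    moreover have "F1 z mod G z = F z mod G z" for z
      using mod_mult_self1[of "F z" "- monom (c z) (Suc n - e)" "G z"] by (simp add: F1_def)
    ultimately show ?thesis by simp
  qed
qed

text \<open>A degree is determined by which of finitely many coefficients vanish, and this is part
  of their signs.\<close>

lemma cellwise_degree:
  assumes "coeffs_rational A F" "\<And>z. A z \<Longrightarrow> degree (F z) \<le> n"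
  shows "cellwise A (\<lambda>z z'. degree (F z) = degree (F z'))"
proof -
  have "cellwise A (\<lambda>z z'. \<forall>k\<in>set [0..<Suc n]. sgn (coeff (F z) k) = sgn (coeff (F z') k))"
    using assms(1) by (intro cellwise_list cellwise_sgn) (simp add: coeffs_rational_def)
  then show ?thesis
  proof (rule cellwise_mono)
    fix z z' assume z: "A z" "A z'"
      and eq: "\<forall>k\<in>set [0..<Suc n]. sgn (coeff (F z) k) = sgn (coeff (F z') k)"
    have "coeff (F z) k = 0 \<longleftrightarrow> coeff (F z') k = 0" for k
    proof (cases "k \<le> n")
      case True
      then have "k \<in> set [0..<Suc n]" by auto
      then have "sgn (coeff (F z) k) = sgn (coeff (F z') k)" using eq by blast
      then show ?thesis by (metis sgn_zero_iff)
    next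
      case False
      then show ?thesis using assms(2)[OF z(1)] assms(2)[OF z(2)]
        by (simp add: coeff_eq_0)
    qed
    then show "degree (F z) = degree (F z')" by (simp add: degree_def)
  qed
qed

definition same_sign_type ::
    "(('v \<Rightarrow> real) \<Rightarrow> real poly) list \<Rightarrow> ('v \<Rightarrow> real) \<Rightarrow> ('v \<Rightarrow> real) \<Rightarrow> bool"
  where "same_sign_type Fs z z' \<longleftrightarrow>
    (\<exists>H. order_matching H \<and> sign_matching H ((\<lambda>F. (F z, F z')) ` set Fs))"

lemma sign_matching_subset: "sign_matching H S \<Longrightarrow> T \<subseteq> S \<Longrightarrow> sign_matching H T"
  unfolding sign_matching_def by blast

text \<open>A member of maximal degree m is replaced by its derivative and its remainders modulo the
  derivative and the other members. All new degrees are below m, so the multiset of degrees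
  decreases. The degrees of the remainders depend on z; hence \<open>A\<close> is split again before
  each recursive call, and the induction generalizes \<open>A\<close> and \<open>z0\<close>.\<close>

lemma cellwise_sign_type_const_degree:
  assumes "A z0"
    "\<And>F. F \<in> set Fs \<Longrightarrow> coeffs_rational A F"
    "\<And>F z. F \<in> set Fs \<Longrightarrow> A z \<Longrightarrow> degree (F z) = degree (F z0)"
  shows "cellwise A (same_sign_type Fs)"
proof -
  have "wf (mult less_than)" by (intro wf_mult wf_less_than)
  then have "\<And>A z0 Fs. A z0 \<Longrightarrow> (\<And>F. F \<in> set Fs \<Longrightarrow> coeffs_rational A F) \<Longrightarrow>
    (\<And>F z. F \<in> set Fs \<Longrightarrow> A z \<Longrightarrow> degree (F z) = degree (F z0)) \<Longrightarrow>
    image_mset (\<lambda>F. degree (F z0)) (mset Fs) = M \<Longrightarrow> cellwise A (same_sign_type Fs)"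
    for M :: "nat multiset"
  proof (induction M rule: wf_induct_rule)
    case (less M A z0 Fs)
    note IH = less(1) and z0 = less(2) and cr = less(3) and deg = less(4) and M = less(5)
    show ?case
    proof (cases "\<forall>F\<in>set Fs. degree (F z0) = 0")
      case True
      have "cellwise A (\<lambda>z z'. \<forall>F\<in>set Fs. sgn (coeff (F z) 0) = sgn (coeff (F z') 0))"
        using cr by (intro cellwise_list cellwise_sgn) (simp add: coeffs_rational_def)
      then show ?thesis
      proof (rule cellwise_mono)
        fix z z' assume z: "A z" "A z'"
          and eq: "\<forall>F\<in>set Fs. sgn (coeff (F z) 0) = sgn (coeff (F z') 0)"
        have p0: "poly (F z) t = coeff (F z) 0" if "F \<in> set Fs" "A z" for F z t
        proof -
          have "degree (F z) = 0" using deg[OF that] True that by simp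
          then obtain c where "F z = [:c:]" by (rule degree_eq_zeroE)
          then show ?thesis by simp
        qed
        have "order_matching {}" by (simp add: order_matching_def)
        moreover have "sign_matching {} ((\<lambda>F. (F z, F z')) ` set Fs)"
          using eq z by (auto simp: sign_matching_def p0)
        ultimately show "same_sign_type Fs z z'" by (auto simp: same_sign_type_def)
      qed
    next
      case False
      define m where "m = Max ((\<lambda>F. degree (F z0)) ` set Fs)"
      have ne: "set Fs \<noteq> {}" using False by auto
      have "m \<in> (\<lambda>F. degree (F z0)) ` set Fs" unfolding m_def using ne by (intro Max_in) auto
      then obtain F where F: "F \<in> set Fs" "degree (F z0) = m" by auto
      have m_ge: "degree (G z0) \<le> m" if "G \<in> set Fs" for G
        unfolding m_def using that by (intro Max_ge) auto
      have m1: "m \<ge> 1" using False m_ge by fastforce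
      have degF: "degree (F z) = m" if "A z" for z using deg[OF F(1) that] F(2) by simp
      define Gs where "Gs = remove1 F Fs"
      have mFs: "mset Fs = add_mset F (mset Gs)" using F(1) by (simp add: Gs_def)
      have GsFs: "set Gs \<subseteq> set Fs" unfolding Gs_def by (rule set_remove1_subset)
      have FsGs: "set Fs = insert F (set Gs)" using mFs by (metis set_mset_add_mset_insert set_mset_mset)
      define Ns where "Ns = (\<lambda>z. pderiv (F z)) # Gs"
      \<comment> \<open>Constant members are left out: a nonzero one has no roots at which the sign
        of \<open>F\<close> must be known, and division by zero is avoided.\<close>
      define Ls where "Ls = filter (\<lambda>G. degree (G z0) \<ge> 1) Ns"
      define Rs where "Rs = map (\<lambda>G z. F z mod G z) Ls"
      have crN: "coeffs_rational A G" if "G \<in> set Ns" for G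
        using that cr F(1) GsFs by (auto simp: Ns_def intro: coeffs_rational_pderiv)
      have degN: "degree (G z) = degree (G z0)" if "G \<in> set Ns" "A z" for G z
        using that deg GsFs degF z0 by (auto simp: Ns_def degree_pderiv)
      have leN: "degree (G z0) \<le> m" if "G \<in> set Ns" for G
        using that m_ge GsFs F(2) by (auto simp: Ns_def degree_pderiv)
      have crR: "coeffs_rational A G" if GR: "G \<in> set Rs" for G
      proof -
        obtain G' where G': "G' \<in> set Ns" "degree (G' z0) \<ge> 1" "G = (\<lambda>z. F z mod G' z)"
          using GR by (auto simp: Rs_def Ls_def)
        show ?thesis unfolding G'(3)
          using coeffs_rational_mod[OF crN[OF G'(1)] degN[OF G'(1)] G'(2) cr[OF F(1)], of m] degF by simp
      qed
      have ltR: "degree (G z) < m" if GR: "G \<in> set Rs" "A z" for G z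
      proof -
        obtain G' where G': "G' \<in> set Ns" "degree (G' z0) \<ge> 1" "G = (\<lambda>z. F z mod G' z)"
          using GR by (auto simp: Rs_def Ls_def)
        have "degree (F z mod G' z) < degree (G' z)"
          using degN[OF G'(1) GR(2)] G'(2) degree_mod_less[of "G' z" "F z"] by fastforce
        then show ?thesis using G'(3) degN[OF G'(1) GR(2)] leN[OF G'(1)] by simp
      qed
      have "cellwise A (\<lambda>z z'. \<forall>G\<in>set (Ns @ Rs). degree (G z) = degree (G z'))"
      proof (intro cellwise_list)
        fix G assume G: "G \<in> set (Ns @ Rs)"
        have "degree (G z) \<le> m" if "A z" for z
          using G degN leN ltR that by (fastforce simp: less_imp_le)
        then show "cellwise A (\<lambda>z z'. degree (G z) = degree (G z'))"
          using G crN crR by (intro cellwise_degree) auto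
      qed
      then show ?thesis
      proof (rule cellwise_split)
        fix B assume B: "\<And>z z'. A z \<and> B z \<Longrightarrow> A z' \<and> B z' \<Longrightarrow>
          \<forall>G\<in>set (Ns @ Rs). degree (G z) = degree (G z')"
        show "cellwise (\<lambda>z. A z \<and> B z) (same_sign_type Fs)"
        proof (cases "\<exists>z1. A z1 \<and> B z1")
          case False
          then show ?thesis by (intro cellwise_trivial) auto
        next
          case True
          then obtain z1 where z1: "A z1" "B z1" by auto
          let ?dg = "\<lambda>F. degree (F z1)"
          have "cellwise (\<lambda>z. A z \<and> B z) (same_sign_type (Ns @ Rs))"
          proof (rule IH[OF _ _ _ _ refl])
            show "A z1 \<and> B z1" using z1 by simp
            show "coeffs_rational (\<lambda>z. A z \<and> B z) G" if "G \<in> set (Ns @ Rs)" for G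
            proof -
              have "coeffs_rational A G" using that crN crR by auto
              then show ?thesis by (rule coeffs_rational_subset) simp
            qed
            show "degree (G z) = degree (G z1)" if "G \<in> set (Ns @ Rs)" "A z \<and> B z" for G z
              using B[OF that(2)] z1 that(1) by blast
            have eqG: "image_mset (\<lambda>F. degree (F z0)) (mset Gs) = image_mset ?dg (mset Gs)"
              using deg GsFs z1 by (intro image_mset_cong) auto
            \<comment> \<open>The single degree m gives way to these smaller ones: m - 1 for the
              derivative, and the degrees of the remainders.\<close>
            let ?K = "add_mset (m - 1) (image_mset ?dg (mset Rs))"
            have "image_mset ?dg (mset (Ns @ Rs)) = image_mset ?dg (mset Gs) + ?K"
              using degF[OF z1(1)] by (simp add: Ns_def degree_pderiv)
            moreover have "M = image_mset ?dg (mset Gs) + {#m#}"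
              using M mFs F(2) eqG by simp
            moreover have "(image_mset ?dg (mset Gs) + ?K, image_mset ?dg (mset Gs) + {#m#}) \<in> mult less_than"
              using ltR z1(1) m1 by (intro one_step_implies_mult) auto
            ultimately show "(image_mset ?dg (mset (Ns @ Rs)), M) \<in> mult less_than" by simp
          qed
          then show ?thesis
          proof (rule cellwise_mono)
            fix z z' assume z: "A z \<and> B z" "A z' \<and> B z'" and same: "same_sign_type (Ns @ Rs) z z'"
            let ?pr = "\<lambda>F. (F z, F z')"
            obtain H where H: "order_matching H" "sign_matching H (?pr ` set (Ns @ Rs))"
              using same by (auto simp: same_sign_type_def)
            have "\<exists>H'. order_matching H' \<and> sign_matching H' (insert (F z, F z') (?pr ` set Ns))"
            proof (rule sign_matching_mod[OF H(1)])
              show "sign_matching H (?pr ` set Ns)" by (rule sign_matching_subset[OF H(2)]) auto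
              show "(pderiv (F z), pderiv (F z')) \<in> ?pr ` set Ns"
                by (auto simp: Ns_def)
              show "degree (F z) \<ge> 1" "degree (F z') \<ge> 1" using degF z m1 by auto
              fix q q' assume q: "(q, q') \<in> ?pr ` set Ns" "degree q \<ge> 1"
              then obtain G where G: "G \<in> set Ns" "q = G z" "q' = G z'" by auto
              then have "G \<in> set Ls" using q degN z by (auto simp: Ls_def)
              then have "(\<lambda>z. F z mod G z) \<in> set Rs" by (auto simp: Rs_def)
              then have "(F z mod G z, F z' mod G z') \<in> ?pr ` set (Ns @ Rs)" by force
              then show "sign_matching H {(F z mod q, F z' mod q')}"
                using G by (intro sign_matching_subset[OF H(2)]) auto
            qed
            then obtain H' where "order_matching H'" "sign_matching H' (insert (F z, F z') (?pr ` set Ns))"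
              by blast
            moreover have "?pr ` set Fs \<subseteq> insert (F z, F z') (?pr ` set Ns)"
              by (auto simp: FsGs Ns_def)
            ultimately show "same_sign_type Fs z z'"
              unfolding same_sign_type_def using sign_matching_subset by blast
          qed
        qed
      qed
    qed
  qed
  then show ?thesis using assms by blast
qed

lemma cellwise_sign_type:
  assumes "\<And>F. F \<in> set Fs \<Longrightarrow> coeffs_rational A F"
    "\<And>F. F \<in> set Fs \<Longrightarrow> \<exists>n. \<forall>z. degree (F z) \<le> n"
  shows "cellwise A (same_sign_type Fs)"
proof (rule cellwise_split)
  show "cellwise A (\<lambda>z z'. \<forall>F\<in>set Fs. degree (F z) = degree (F z'))"
    using assms by (intro cellwise_list) (metis cellwise_degree)
  fix B assume B: "\<And>z z'. A z \<and> B z \<Longrightarrow> A z' \<and> B z' \<Longrightarrow> \<forall>F\<in>set Fs. degree (F z) = degree (F z')"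
  show "cellwise (\<lambda>z. A z \<and> B z) (same_sign_type Fs)"
  proof (cases "\<exists>z1. A z1 \<and> B z1")
    case False
    then show ?thesis by (intro cellwise_trivial) auto
  next
    case True
    then obtain z1 where z1: "A z1 \<and> B z1" by auto
    show ?thesis
    proof (rule cellwise_sign_type_const_degree[where A = "\<lambda>z. A z \<and> B z" and ?z0.0 = z1])
      show "A z1 \<and> B z1" by (rule z1)
      show "coeffs_rational (\<lambda>z. A z \<and> B z) F" if "F \<in> set Fs" for F
        using assms(1)[OF that] by (rule coeffs_rational_subset) simp
      show "degree (F z) = degree (F z1)" if "F \<in> set Fs" "A z \<and> B z" for F z
        using B[OF that(2) z1] that(1) by blast
    qed
  qed
qed

section \<open>Elimination of one quantifier\<close>

lemma polynomial_term_update: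
  assumes "polynomial_term p"
  shows "\<exists>F n. (\<forall>k. polynomial_term (\<lambda>z. coeff (F z) k)) \<and> (\<forall>z. degree (F z) \<le> n) \<and>
    (\<forall>z t. p (z(i := t)) = poly (F z) t)"
  using assms
proof induction
  case (pt_const c)
  show ?case
    by (intro exI[of _ "\<lambda>_. [:c:]"] exI[of _ 0]) (auto intro: polynomial_term.pt_const)
next
  case (pt_coord j)
  show ?case
  proof (cases "j = i")
    case True
    then show ?thesis
      by (intro exI[of _ "\<lambda>_. [:0, 1:]"] exI[of _ 1]) (auto intro: polynomial_term.pt_const)
  next
    case False
    have "polynomial_term (\<lambda>z. coeff [:z j:] k)" for k
      by (cases k) (auto intro: polynomial_term.intros)
    then show ?thesis using False
      by (intro exI[of _ "\<lambda>z. [:z j:]"] exI[of _ 0]) auto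
  qed
next
  case (pt_add p q)
  then obtain F m G n where "\<And>k. polynomial_term (\<lambda>z. coeff (F z) k)" "\<And>z. degree (F z) \<le> m"
    "\<And>z t. p (z(i := t)) = poly (F z) t" "\<And>k. polynomial_term (\<lambda>z. coeff (G z) k)"
    "\<And>z. degree (G z) \<le> n" "\<And>z t. q (z(i := t)) = poly (G z) t" by metis
  then show ?case
    by (intro exI[of _ "\<lambda>z. F z + G z"] exI[of _ "max m n"])
      (auto intro!: polynomial_term.pt_add degree_add_le intro: le_max_iff_disj[THEN iffD2]
        simp del: fun_upd_apply)
next
  case (pt_mult p q)
  then obtain F m G n where FG: "\<And>k. polynomial_term (\<lambda>z. coeff (F z) k)" "\<And>z. degree (F z) \<le> m"
    "\<And>z t. p (z(i := t)) = poly (F z) t" "\<And>k. polynomial_term (\<lambda>z. coeff (G z) k)"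
    "\<And>z. degree (G z) \<le> n" "\<And>z t. q (z(i := t)) = poly (G z) t" by metis
  have "degree (F z * G z) \<le> m + n" for z
    using degree_mult_le[of "F z" "G z"] FG(2,5) by (meson add_mono order_trans)
  then show ?case using FG
    by (intro exI[of _ "\<lambda>z. F z * G z"] exI[of _ "m + n"])
      (auto intro!: polynomial_term.pt_mult pt_sum simp: coeff_mult simp del: fun_upd_apply)
qed

text \<open>On a cell the polynomials that decide \<open>P\<close>, seen as polynomials in t, have
  one sign type, so a witness over one parameter is carried to every other by
  \<open>similar_ex\<close>. The projection is therefore a union of cells.\<close>

theorem tarski_seidenberg:
  assumes "definable P"
  shows "definable (\<lambda>z. \<exists>t. P (z(i := t)))"
proof -
  obtain ps where ps: "\<And>p. p \<in> set ps \<Longrightarrow> polynomial_term p"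
    "\<And>z z'. (\<forall>p\<in>set ps. sgn (p z) = sgn (p z')) \<Longrightarrow> P z = P z'"
    using definable_signs[OF assms] by blast
  define ok where "ok p F n \<longleftrightarrow> (\<forall>k. polynomial_term (\<lambda>z. coeff (F z) k)) \<and> (\<forall>z. degree (F z) \<le> n) \<and>
    (\<forall>z t. p (z(i := t)) = poly (F z) t)" for p F and n :: nat
  have "\<exists>F n. ok p F n" if "p \<in> set ps" for p
    unfolding ok_def by (rule polynomial_term_update[OF ps(1)[OF that]])
  then obtain F n where "\<And>p. p \<in> set ps \<Longrightarrow> ok p (F p) (n p)" by metis
  then have F: "\<And>p k. p \<in> set ps \<Longrightarrow> polynomial_term (\<lambda>z. coeff (F p z) k)"
    "\<And>p z. p \<in> set ps \<Longrightarrow> degree (F p z) \<le> n p"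
    "\<And>p z t. p \<in> set ps \<Longrightarrow> p (z(i := t)) = poly (F p z) t"
    unfolding ok_def by simp_all
  have "cellwise (\<lambda>_. True) (same_sign_type (map F ps))"
  proof (rule cellwise_sign_type)
    show "coeffs_rational (\<lambda>_. True) G" if "G \<in> set (map F ps)" for G
      using that F(1) by (auto simp: coeffs_rational_def intro: rational_on_polynomial)
    show "\<exists>n. \<forall>z. degree (G z) \<le> n" if "G \<in> set (map F ps)" for G
      using that F(2) by auto
  qed
  then obtain \<P> where \<P>: "finite \<P>" "\<And>B. B \<in> \<P> \<Longrightarrow> definable B" "\<And>z. \<exists>B\<in>\<P>. B z"
    "\<And>B z z'. B \<in> \<P> \<Longrightarrow> B z \<Longrightarrow> B z' \<Longrightarrow> same_sign_type (map F ps) z z'"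
    by (rule cellwiseE) simp
  have step: "\<exists>t'. P (z'(i := t'))" if B: "B \<in> \<P>" "B z" "B z'" "P (z(i := t))" for B z z' t
  proof -
    obtain H where H: "order_matching H" "sign_matching H ((\<lambda>F. (F z, F z')) ` set (map F ps))"
      using \<P>(4)[OF B(1-3)] by (auto simp: same_sign_type_def)
    obtain t' where t': "similar H t t'" using similar_ex[OF H(1)] by blast
    have "sgn (p (z(i := t))) = sgn (p (z'(i := t')))" if p: "p \<in> set ps" for p
      using H(2) t' p F(3)[OF p] by (auto simp: sign_matching_def)
    then have "P (z(i := t)) = P (z'(i := t'))" using ps(2) by blast
    then show ?thesis using B(4) by blast
  qed
  have eq: "(\<exists>t. P (z(i := t))) \<longleftrightarrow> (\<exists>B\<in>{B \<in> \<P>. \<exists>z t. B z \<and> P (z(i := t))}. B z)" for z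
  proof
    assume "\<exists>t. P (z(i := t))"
    moreover obtain B where "B \<in> \<P>" "B z" using \<P>(3) by blast
    ultimately show "\<exists>B\<in>{B \<in> \<P>. \<exists>z t. B z \<and> P (z(i := t))}. B z" by (intro bexI[of _ B]) auto
  next
    assume "\<exists>B\<in>{B \<in> \<P>. \<exists>z t. B z \<and> P (z(i := t))}. B z"
    then obtain B z' t where "B \<in> \<P>" "B z'" "B z" "P (z'(i := t))" by auto
    then show "\<exists>t. P (z(i := t))" by (rule step)
  qed
  have "definable (\<lambda>z. \<exists>B\<in>{B \<in> \<P>. \<exists>z t. B z \<and> P (z(i := t))}. B z)"
    by (rule definable_finite_disj[where P = "\<lambda>B. B"]) (use \<P>(1,2) in simp_all)
  then show ?thesis unfolding eq .
qed

section \<open>Definable functions and semi-algebraic sets\<close>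

lemma polynomial_term_subst:
  assumes "polynomial_term p" "\<And>i. polynomial_term (\<lambda>z. h z i)"
  shows "polynomial_term (\<lambda>z. p (h z))"
  using assms(1) by induction (auto intro: polynomial_term.intros assms(2))

lemma definable_subst:
  assumes "definable P" "\<And>i. polynomial_term (\<lambda>z. h z i)"
  shows "definable (\<lambda>z. P (h z))"
  using assms(1)
proof induction
  case (definable_pos p)
  show ?case by (rule definable.definable_pos[OF polynomial_term_subst[OF definable_pos assms(2)]])
next
  case (definable_zero p)
  show ?case by (rule definable.definable_zero[OF polynomial_term_subst[OF definable_zero assms(2)]])
qed (auto intro: definable.intros)

section \<open>Closure of definable predicates under connectives and quantifiers\<close>

lemma definable_imp: "definable P \<Longrightarrow> definable Q \<Longrightarrow> definable (\<lambda>z. P z \<longrightarrow> Q z)"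
  unfolding imp_conv_disj by (intro definable_disj definable_not)

lemma definable_finite_all:
  "finite I \<Longrightarrow> (\<And>i. i \<in> I \<Longrightarrow> definable (P i)) \<Longrightarrow> definable (\<lambda>z. \<forall>i\<in>I. P i z)"
  by (induction I rule: finite_induct) (auto intro: definable_const definable_conj)

lemma definable_all_less:
  "(\<And>i. i < n \<Longrightarrow> definable (P i)) \<Longrightarrow> definable (\<lambda>z. \<forall>i<(n::nat). P i z)"
  using definable_finite_all[of "{..<n}" P] by (simp add: Ball_def)

text \<open>The bound variable becomes \<open>None\<close>. With \<open>Q\<close> applied separately
  to parameters and value, the rule can be applied by unification to nested quantifiers.\<close>

lemma definable_ex:
  fixes Q :: "('v \<Rightarrow> real) \<Rightarrow> real \<Rightarrow> bool"
  assumes "definable (\<lambda>w :: 'v option \<Rightarrow> real. Q (\<lambda>v. w (Some v)) (w None))"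
  shows "definable (\<lambda>z. \<exists>t. Q z t)"
proof -
  \<comment> \<open>The value 0 at \<open>None\<close> is a dummy, overwritten by the quantified
    t.\<close>
  have "polynomial_term (\<lambda>z :: 'v \<Rightarrow> real. case i of None \<Rightarrow> 0 | Some v \<Rightarrow> z v)" for i
    by (cases i) (auto intro: polynomial_term.intros)
  then show ?thesis
    using definable_subst[OF tarski_seidenberg[OF assms, of None], of "\<lambda>z i. case i of None \<Rightarrow> 0 | Some v \<Rightarrow> z v"]
    by simp
qed

lemma definable_all:
  fixes Q :: "('v \<Rightarrow> real) \<Rightarrow> real \<Rightarrow> bool"
  assumes "definable (\<lambda>w :: 'v option \<Rightarrow> real. Q (\<lambda>v. w (Some v)) (w None))"
  shows "definable (\<lambda>z. \<forall>t. Q z t)"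
  using definable_not[OF definable_ex[where Q = "\<lambda>z t. \<not> Q z t", OF definable_not[OF assms]]] by simp

text \<open>Maps every assignment into \<open>Rn n\<close>, so that conditions on points of R^n
  become conditions on arbitrary assignments, and formulas need not express that the higher
  coordinates vanish.\<close>

definition trunc :: "nat \<Rightarrow> (nat \<Rightarrow> real) \<Rightarrow> nat \<Rightarrow> real"
  where "trunc n x = (\<lambda>i. if i < n then x i else 0)"

lemma Rn_iff: "x \<in> Rn n \<longleftrightarrow> (\<forall>i\<ge>n. x i = 0)"
  by (simp add: topspace_Euclidean_space)

lemma trunc_in_Rn [simp]: "trunc n x \<in> Rn n"
  by (simp add: trunc_def Rn_iff)

lemma trunc_Rn: "x \<in> Rn n \<Longrightarrow> trunc n x = x"
  by (rule ext) (simp add: trunc_def Rn_iff)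

lemma trunc_apply [simp]: "i < n \<Longrightarrow> trunc n x i = x i"
  by (simp add: trunc_def)

lemma Rn_eqI: "x \<in> Rn n \<Longrightarrow> y \<in> Rn n \<Longrightarrow> (\<And>i. i < n \<Longrightarrow> x i = y i) \<Longrightarrow> x = y"
  by (rule ext) (metis Rn_iff not_less)

lemma definable_ex_Rn:
  fixes Q :: "('v \<Rightarrow> real) \<Rightarrow> (nat \<Rightarrow> real) \<Rightarrow> bool"
  assumes "definable (\<lambda>w :: 'v + nat \<Rightarrow> real. Q (\<lambda>v. w (Inl v)) (trunc n (\<lambda>i. w (Inr i))))"
  shows "definable (\<lambda>z. \<exists>y\<in>Rn n. Q z y)"
proof -
  define P where "P w \<longleftrightarrow> Q (\<lambda>v. w (Inl v)) (trunc n (\<lambda>i. w (Inr i)))" for w :: "'v + nat \<Rightarrow> real"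
  \<comment> \<open>Overwrites the bound coordinates below m. The induction on m eliminates these
    one by one, while the other bound coordinates remain free.\<close>
  define ins where "ins m y w = (\<lambda>x. case x of Inl v \<Rightarrow> w x | Inr i \<Rightarrow> if i < m then y i else w x)"
    for m :: nat and y :: "nat \<Rightarrow> real" and w :: "'v + nat \<Rightarrow> real"
  have "definable (\<lambda>w. \<exists>y\<in>Rn m. P (ins m y w))" for m
  proof (induction m)
    case 0
    have "ins 0 y w = w" for y w by (auto simp: ins_def split: sum.splits)
    moreover have "(\<lambda>_. 0) \<in> Rn 0" by (simp add: Rn_iff)
    ultimately have "(\<exists>y\<in>Rn 0. P (ins 0 y w)) \<longleftrightarrow> P w" for w by auto
    then show ?case using assms by (simp add: P_def)
  next
    case (Suc m)
    have "(\<exists>y\<in>Rn (Suc m). P (ins (Suc m) y w)) \<longleftrightarrow> (\<exists>t. \<exists>y\<in>Rn m. P (ins m y (w(Inr m := t))))" for w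
    proof
      assume "\<exists>y\<in>Rn (Suc m). P (ins (Suc m) y w)"
      then obtain y where y: "y \<in> Rn (Suc m)" "P (ins (Suc m) y w)" by blast
      have "ins m (trunc m y) (w(Inr m := y m)) = ins (Suc m) y w"
        by (auto simp: ins_def fun_eq_iff less_Suc_eq split: sum.splits)
      then show "\<exists>t. \<exists>y\<in>Rn m. P (ins m y (w(Inr m := t)))"
        using y by (intro exI[of _ "y m"] bexI[of _ "trunc m y"]) auto
    next
      assume "\<exists>t. \<exists>y\<in>Rn m. P (ins m y (w(Inr m := t)))"
      then obtain t y where y: "y \<in> Rn m" "P (ins m y (w(Inr m := t)))" by blast
      have "ins (Suc m) (y(m := t)) w = ins m y (w(Inr m := t))"
        by (auto simp: ins_def fun_eq_iff less_Suc_eq split: sum.splits)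
      then show "\<exists>y\<in>Rn (Suc m). P (ins (Suc m) y w)"
        using y by (intro bexI[of _ "y(m := t)"]) (auto simp: Rn_iff)
    qed
    then show ?case using tarski_seidenberg[OF Suc.IH, of "Inr m"] by (simp del: fun_upd_apply)
  qed
  from this[of n] have 1: "definable (\<lambda>w. \<exists>y\<in>Rn n. P (ins n y w))" .
  have "definable (\<lambda>z :: 'v \<Rightarrow> real. \<exists>y\<in>Rn n. P (ins n y (case_sum z (\<lambda>_. 0))))"
  proof (rule definable_subst[OF 1])
    show "polynomial_term (\<lambda>z :: 'v \<Rightarrow> real. case_sum z (\<lambda>_. 0) i)" for i
      by (cases i) (auto intro: polynomial_term.intros)
  qed
  moreover have "P (ins n y (case_sum z (\<lambda>_. 0))) = Q z y" if "y \<in> Rn n" for y z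
  proof -
    have "trunc n (\<lambda>i. ins n y (case_sum z (\<lambda>_. 0)) (Inr i)) = y"
      using that by (intro Rn_eqI[of _ n]) (auto simp: ins_def)
    then show ?thesis by (simp add: P_def) (simp add: ins_def)
  qed
  ultimately show ?thesis by (simp cong: bex_cong)
qed

lemma definable_all_Rn:
  fixes Q :: "('v \<Rightarrow> real) \<Rightarrow> (nat \<Rightarrow> real) \<Rightarrow> bool"
  assumes "definable (\<lambda>w :: 'v + nat \<Rightarrow> real. Q (\<lambda>v. w (Inl v)) (trunc n (\<lambda>i. w (Inr i))))"
  shows "definable (\<lambda>z. \<forall>y\<in>Rn n. Q z y)"
  using definable_not[OF definable_ex_Rn[where Q = "\<lambda>z y. \<not> Q z y", OF definable_not[OF assms]]] by simp

text \<open>Formulas may thus contain terms beyond polynomials, such as absolute values, truncations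
  and case distinctions.\<close>

definition definable_fun :: "(('v \<Rightarrow> real) \<Rightarrow> real) \<Rightarrow> bool"
  where "definable_fun a \<longleftrightarrow> definable (\<lambda>w :: 'v option \<Rightarrow> real. w None = a (\<lambda>v. w (Some v)))"

lemma definable_eq_pt: "polynomial_term p \<Longrightarrow> polynomial_term q \<Longrightarrow> definable (\<lambda>z. p z = q z)"
  using definable_zero[OF pt_diff, of p q] by simp

lemma definable_fun_pt:
  assumes "polynomial_term p"
  shows "definable_fun p"
  unfolding definable_fun_def
proof (rule definable_eq_pt[OF pt_coord])
  show "polynomial_term (\<lambda>w. p (\<lambda>v. w (Some v)))"
    by (rule polynomial_term_subst[OF assms]) (rule pt_coord)
qed

lemma definable_fun_subst_pt:
  assumes "definable_fun a" "\<And>i. polynomial_term (\<lambda>z. h z i)"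
  shows "definable_fun (\<lambda>z. a (h z))"
  unfolding definable_fun_def
proof -
  have "polynomial_term (\<lambda>w. case i of None \<Rightarrow> w None | Some v \<Rightarrow> h (\<lambda>v. w (Some v)) v)" for i
    by (cases i) (auto intro: polynomial_term.intros polynomial_term_subst[OF assms(2)])
  from definable_subst[OF assms(1)[unfolded definable_fun_def],
      where h = "\<lambda>w i. case i of None \<Rightarrow> w None | Some v \<Rightarrow> h (\<lambda>v. w (Some v)) v", OF this]
  show "definable (\<lambda>w. w None = a (h (\<lambda>v. w (Some v))))" by simp
qed

text \<open>A definable function is substituted by quantifying over its value.\<close>

lemma definable_subst_fun:
  assumes "definable_fun a" "definable (\<lambda>w. R (\<lambda>v. w (Some v)) (w None))"
  shows "definable (\<lambda>z. R z (a z))"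
proof -
  have "definable (\<lambda>z. \<exists>t. t = a z \<and> R z t)"
    using assms unfolding definable_fun_def by (intro definable_ex definable_conj)
  then show ?thesis by simp
qed

text \<open>Each substitution adds a variable \<open>None\<close> and shifts the others by
  \<open>Some\<close>: in the hypothesis on \<open>g\<close> the result sits at
  \<open>Some (Some None)\<close>, the first operand at \<open>Some None\<close> and the second at
  \<open>None\<close>.\<close>

lemma definable_fun_binop:
  fixes a b :: "('v \<Rightarrow> real) \<Rightarrow> real"
  assumes a: "definable_fun a" and b: "definable_fun b"
    and g: "definable (\<lambda>x :: 'v option option option \<Rightarrow> real. x (Some (Some None)) = g (x (Some None)) (x None))"
  shows "definable_fun (\<lambda>z. g (a z) (b z))"
  unfolding definable_fun_def
proof (rule definable_subst_fun[where a = "\<lambda>w :: 'v option \<Rightarrow> real. a (\<lambda>v. w (Some v))"])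
  show "definable_fun (\<lambda>w :: 'v option \<Rightarrow> real. a (\<lambda>v. w (Some v)))"
    by (rule definable_fun_subst_pt[OF a]) (rule pt_coord)
  show "definable (\<lambda>u :: 'v option option \<Rightarrow> real. u (Some None) = g (u None) (b (\<lambda>v. u (Some (Some v)))))"
  proof (rule definable_subst_fun[where a = "\<lambda>u :: 'v option option \<Rightarrow> real. b (\<lambda>v. u (Some (Some v)))"])
    show "definable_fun (\<lambda>u :: 'v option option \<Rightarrow> real. b (\<lambda>v. u (Some (Some v))))"
      by (rule definable_fun_subst_pt[OF b]) (rule pt_coord)
  qed (rule g)
qed

lemma definable_fun_add: "definable_fun a \<Longrightarrow> definable_fun b \<Longrightarrow> definable_fun (\<lambda>z. a z + b z)"
  by (rule definable_fun_binop) (auto intro!: definable_eq_pt polynomial_term.intros)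

lemma definable_fun_mult: "definable_fun a \<Longrightarrow> definable_fun b \<Longrightarrow> definable_fun (\<lambda>z. a z * b z)"
  by (rule definable_fun_binop) (auto intro!: definable_eq_pt polynomial_term.intros)

lemma definable_subst_funs:
  assumes "definable P" "\<And>i. definable_fun (\<lambda>z. h z i)"
  shows "definable (\<lambda>z. P (h z))"
proof -
  have pf: "definable_fun (\<lambda>z. p (h z))" if "polynomial_term p" for p
    using that
    by induction (auto intro: assms(2) definable_fun_pt pt_const definable_fun_add definable_fun_mult)
  show ?thesis
    using assms(1)
  proof induction
    case (definable_pos p)
    show ?case by (rule definable_subst_fun[OF pf[OF definable_pos], where R = "\<lambda>_ t. t > 0"])
      (intro definable.intros polynomial_term.intros)
  next
    case (definable_zero p)
    show ?case by (rule definable_subst_fun[OF pf[OF definable_zero], where R = "\<lambda>_ t. t = 0"])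
      (intro definable.intros polynomial_term.intros)
  qed (auto intro: definable.intros)
qed

lemma definable_subst2:
  assumes "definable_fun a" "definable_fun b" "definable (\<lambda>u :: bool \<Rightarrow> real. R (u True) (u False))"
  shows "definable (\<lambda>z. R (a z) (b z))"
proof -
  have "definable_fun (\<lambda>z. if i then a z else b z)" for i
    by (cases i) (simp_all add: assms)
  from definable_subst_funs[OF assms(3), where h = "\<lambda>z i. if i then a z else b z", OF this]
  show ?thesis by simp
qed

lemma definable_less:
  assumes "definable_fun a" "definable_fun b"
  shows "definable (\<lambda>z. a z < b z)"
proof (rule definable_subst2[where R = "(<)", OF assms])
  have "definable (\<lambda>u :: bool \<Rightarrow> real. u False - u True > 0)"
    by (rule definable_pos[OF pt_diff[OF pt_coord pt_coord]])
  then show "definable (\<lambda>u :: bool \<Rightarrow> real. u True < u False)" by simp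
qed

lemma definable_eq:
  assumes "definable_fun a" "definable_fun b"
  shows "definable (\<lambda>z. a z = b z)"
  by (rule definable_subst2[where R = "(=)", OF assms]) (rule definable_eq_pt[OF pt_coord pt_coord])

lemma definable_le: "definable_fun a \<Longrightarrow> definable_fun b \<Longrightarrow> definable (\<lambda>z. a z \<le> b z)"
  unfolding not_less[symmetric] by (intro definable_not definable_less)

lemma definable_fun_const: "definable_fun (\<lambda>z. c)"
  by (rule definable_fun_pt[OF pt_const])

lemma definable_fun_coord: "definable_fun (\<lambda>z. z i)"
  by (rule definable_fun_pt[OF pt_coord])

lemma definable_fun_if:
  assumes "definable P" "definable_fun a" "definable_fun b"
  shows "definable_fun (\<lambda>z. if P z then a z else b z)"
proof -
  have 1: "definable (\<lambda>w. P (\<lambda>v. w (Some v)))"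
    by (rule definable_subst[OF assms(1)]) (rule pt_coord)
  have "definable (\<lambda>w. P (\<lambda>v. w (Some v)) \<and> w None = a (\<lambda>v. w (Some v))
      \<or> \<not> P (\<lambda>v. w (Some v)) \<and> w None = b (\<lambda>v. w (Some v)))"
    by (intro definable_disj definable_conj definable_not 1 assms(2,3)[unfolded definable_fun_def])
  then show ?thesis unfolding definable_fun_def by (rule back_subst[of definable]) (auto simp: fun_eq_iff)
qed

lemma definable_fun_diff: "definable_fun a \<Longrightarrow> definable_fun b \<Longrightarrow> definable_fun (\<lambda>z. a z - b z)"
  using definable_fun_add[of a "\<lambda>z. - 1 * b z"] definable_fun_mult[OF definable_fun_const[of "- 1"], of b]
  by simp

lemma definable_fun_abs:
  assumes "definable_fun a"
  shows "definable_fun (\<lambda>z. \<bar>a z\<bar>)"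
proof -
  have "(\<lambda>z. \<bar>a z\<bar>) = (\<lambda>z. if a z < 0 then 0 - a z else a z)" by (auto simp: fun_eq_iff)
  moreover have "definable (\<lambda>z. a z < 0)" by (rule definable_less[OF assms definable_fun_const])
  moreover have "definable_fun (\<lambda>z. 0 - a z)" by (rule definable_fun_diff[OF definable_fun_const assms])
  ultimately show ?thesis using definable_fun_if[of "\<lambda>z. a z < 0" "\<lambda>z. 0 - a z" a] assms by simp
qed

lemma definable_fun_sum:
  "(\<And>i. i \<in> I \<Longrightarrow> definable_fun (a i)) \<Longrightarrow> definable_fun (\<lambda>z. \<Sum>i\<in>I. a i z)"
  by (induction I rule: infinite_finite_induct) (auto intro: definable_fun_const definable_fun_add)

lemma definable_fun_trunc:
  "(\<And>i. definable_fun (\<lambda>z. h z i)) \<Longrightarrow> definable_fun (\<lambda>z. trunc n (h z) i)"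
  by (cases "i < n") (simp_all add: trunc_def definable_fun_const)

section \<open>Semi-algebraic sets and functions as definable ones\<close>

lemma polynomial_fun_trunc: "polynomial_fun n p \<Longrightarrow> polynomial_term (\<lambda>z. p (trunc n z))"
  by (induction rule: polynomial_fun.induct) (auto intro: polynomial_term.intros)

lemma semialgebraic_subset: "semialgebraic n S \<Longrightarrow> S \<subseteq> Rn n"
  by (induction rule: semialgebraic.induct) auto

lemma semialgebraic_definable:
  assumes "semialgebraic n S"
  shows "definable (\<lambda>z. trunc n z \<in> S)"
  using assms
proof induction
  case (positive p)
  show ?case using definable_pos[OF polynomial_fun_trunc[OF positive]] by simp
next
  case (zero p)
  show ?case using definable_zero[OF polynomial_fun_trunc[OF zero]] by simp
qed (auto intro: definable.intros definable_disj)

lemma definable_mem: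
  assumes "semialgebraic n S" "\<And>i. definable_fun (\<lambda>z. h z i)"
  shows "definable (\<lambda>z. trunc n (h z) \<in> S)"
  by (rule definable_subst_funs[OF semialgebraic_definable[OF assms(1)] assms(2)])

lemma polynomial_term_Rn:
  "polynomial_term p \<Longrightarrow> \<exists>q. polynomial_fun n q \<and> (\<forall>x\<in>Rn n. p x = q x)"
proof (induction rule: polynomial_term.induct)
  case (pt_const c)
  then show ?case by (intro exI[of _ "\<lambda>_. c"]) (auto intro: polynomial_fun.intros)
next
  case (pt_coord i)
  show ?case
  proof (cases "i < n")
    case True
    then show ?thesis by (intro exI[of _ "\<lambda>x. x i"]) (auto intro: polynomial_fun.intros)
  next
    case False
    then show ?thesis by (intro exI[of _ "\<lambda>_. 0"]) (auto intro: polynomial_fun.intros simp: Rn_iff)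
  qed
next
  case (pt_add p q)
  then obtain p' q' where "polynomial_fun n p'" "\<forall>x\<in>Rn n. p x = p' x"
    "polynomial_fun n q'" "\<forall>x\<in>Rn n. q x = q' x" by blast
  then show ?case by (intro exI[of _ "\<lambda>x. p' x + q' x"]) (auto intro: polynomial_fun.intros)
next
  case (pt_mult p q)
  then obtain p' q' where "polynomial_fun n p'" "\<forall>x\<in>Rn n. p x = p' x"
    "polynomial_fun n q'" "\<forall>x\<in>Rn n. q x = q' x" by blast
  then show ?case by (intro exI[of _ "\<lambda>x. p' x * q' x"]) (auto intro: polynomial_fun.intros)
qed

lemma definable_imp_semialgebraic:
  assumes "definable P"
  shows "semialgebraic n {x \<in> Rn n. P x}"
  using assms
proof induction
  case (definable_pos p)
  then obtain q where "polynomial_fun n q" "\<forall>x\<in>Rn n. p x = q x" using polynomial_term_Rn by blast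
  then show ?case using semialgebraic.positive[of n q] by (simp cong: conj_cong)
next
  case (definable_zero p)
  then obtain q where "polynomial_fun n q" "\<forall>x\<in>Rn n. p x = q x" using polynomial_term_Rn by blast
  then show ?case using semialgebraic.zero[of n q] by (simp cong: conj_cong)
next
  case (definable_conj P Q)
  then have "semialgebraic n ({x \<in> Rn n. P x} \<inter> {x \<in> Rn n. Q x})" by (intro semialgebraic.inter)
  then show ?case by (rule back_subst[of "semialgebraic n"]) auto
next
  case (definable_not P)
  then have "semialgebraic n (Rn n - {x \<in> Rn n. P x})" by (intro semialgebraic.compl)
  then show ?case by (rule back_subst[of "semialgebraic n"]) auto
qed

lemma semialgebraic_Collect:
  assumes "definable (\<lambda>z. Q (trunc n z))"
  shows "semialgebraic n {x \<in> Rn n. Q x}"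
proof -
  have "{x \<in> Rn n. Q x} = {x \<in> Rn n. Q (trunc n x)}" by (auto simp: trunc_Rn)
  then show ?thesis using definable_imp_semialgebraic[OF assms] by simp
qed

lemma semialgebraic_fun_definable_eq:
  assumes "semialgebraic_fun n U f" "U \<subseteq> Rn n"
    and h: "\<And>i. definable_fun (\<lambda>z. h z i)" and a: "definable_fun a"
  shows "definable (\<lambda>z. trunc n (h z) \<in> U \<and> f (trunc n (h z)) = a z)"
proof -
  let ?G = "(\<lambda>x. x(n := f x)) ` U"
  have "definable (\<lambda>z. trunc (Suc n) (\<lambda>i. if i = n then a z else h z i) \<in> ?G)"
  proof (rule definable_mem[where h = "\<lambda>z i. if i = n then a z else h z i",
      OF assms(1)[unfolded semialgebraic_fun_def]])
    show "definable_fun (\<lambda>z. if i = n then a z else h z i)" for i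
      by (cases "i = n") (simp_all add: h a)
  qed
  moreover have "trunc (Suc n) (\<lambda>i. if i = n then a z else h z i) \<in> ?G \<longleftrightarrow>
      trunc n (h z) \<in> U \<and> f (trunc n (h z)) = a z" for z
  proof -
    let ?t = "trunc (Suc n) (\<lambda>i. if i = n then a z else h z i)"
    have t: "?t = (trunc n (h z))(n := a z)" by (auto simp: trunc_def fun_eq_iff)
    have "?t = x(n := f x) \<longleftrightarrow> trunc n (h z) = x \<and> f x = a z" if "x \<in> U" for x
    proof -
      have "x \<in> Rn n" using that assms(2) by blast
      \<comment> \<open>Coordinate n vanishes for both points, so overwriting it with the value
        loses nothing.\<close>
      then have "x n = 0" "trunc n (h z) n = 0" by (simp_all add: Rn_iff trunc_def)
      show ?thesis unfolding t
      proof
        assume eq: "(trunc n (h z))(n := a z) = x(n := f x)"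
        have "trunc n (h z) i = x i" for i
          using fun_cong[OF eq, of i] \<open>x n = 0\<close> \<open>trunc n (h z) n = 0\<close> by (cases "i = n") auto
        then show "trunc n (h z) = x \<and> f x = a z" using fun_cong[OF eq, of n] by auto
      qed auto
    qed
    then show ?thesis by auto
  qed
  ultimately show ?thesis by simp
qed

lemma semialgebraic_funI:
  assumes "U \<subseteq> Rn n" "definable (\<lambda>z. trunc n z \<in> U \<and> f (trunc n z) = z n)"
  shows "semialgebraic_fun n U f"
proof -
  have sub: "(\<lambda>x. x(n := f x)) ` U \<subseteq> Rn (Suc n)" using assms(1) by (auto simp: Rn_iff)
  have "x \<in> (\<lambda>x. x(n := f x)) ` U \<longleftrightarrow> trunc n x \<in> U \<and> f (trunc n x) = x n" if "x \<in> Rn (Suc n)" for x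
  proof
    assume "x \<in> (\<lambda>x. x(n := f x)) ` U"
    then obtain u where u: "u \<in> U" "x = u(n := f u)" by auto
    then have "trunc n x = u" using assms(1) by (intro Rn_eqI[of _ n]) auto
    then show "trunc n x \<in> U \<and> f (trunc n x) = x n" using u by simp
  next
    assume x: "trunc n x \<in> U \<and> f (trunc n x) = x n"
    have "x = (trunc n x)(n := f (trunc n x))"
      using x that by (intro Rn_eqI[of _ "Suc n"]) (auto simp: Rn_iff less_Suc_eq trunc_def)
    then show "x \<in> (\<lambda>x. x(n := f x)) ` U" using x by blast
  qed
  then have "(\<lambda>x. x(n := f x)) ` U = {x \<in> Rn (Suc n). trunc n x \<in> U \<and> f (trunc n x) = x n}"
    using sub by blast
  then show ?thesis unfolding semialgebraic_fun_def
    using definable_imp_semialgebraic[OF assms(2)] by simp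
qed

section \<open>Calculus of \<open>C\<^sup>k\<close> functions\<close>

text \<open>A neighbourhood basis adapted to coordinates: membership is tested coordinate by
  coordinate, hence definable, and mixing the coordinates of two members stays inside.\<close>

definition cube :: "nat \<Rightarrow> (nat \<Rightarrow> real) \<Rightarrow> real \<Rightarrow> (nat \<Rightarrow> real) set"
  where "cube n p e = {y \<in> Rn n. \<forall>i<n. \<bar>y i - p i\<bar> < e}"

lemma cubeD: "y \<in> cube n p e \<Longrightarrow> i < n \<Longrightarrow> \<bar>y i - p i\<bar> < e"
  and cube_Rn: "y \<in> cube n p e \<Longrightarrow> y \<in> Rn n"
  by (auto simp: cube_def)

lemma centre_in_cube: "p \<in> Rn n \<Longrightarrow> e > 0 \<Longrightarrow> p \<in> cube n p e"
  by (simp add: cube_def)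

lemma cube_mono: "d \<le> e \<Longrightarrow> cube n p d \<subseteq> cube n p e"
  by (auto simp: cube_def)

section \<open>The topology of R^n in terms of cubes\<close>

lemma subtopology_Rn:
  assumes "Y \<subseteq> Rn n"
  shows "subtopology (Euclidean_space n) Y = top_of_set Y"
proof -
  have "Y \<subseteq> {x. \<forall>i\<ge>n. x i = 0}" using assms by (simp add: topspace_Euclidean_space)
  then show ?thesis
    by (simp add: Euclidean_space_def euclidean_product_topology subtopology_subtopology inf.absorb2)
qed

lemma openin_Euclidean: "openin (Euclidean_space n) V \<longleftrightarrow> openin (top_of_set (Rn n)) V"
  using subtopology_Rn[OF subset_refl, of n] by (metis subtopology_topspace)

text \<open>A basic neighbourhood in the product topology restricts each coordinate separately. From
  index \<open>n\<close> on all points concerned have coordinate 0, so a minimum of finitely many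
  radii suffices.\<close>

lemma open_contains_cube:
  assumes "open T" "p \<in> T" "p \<in> Rn n"
  shows "\<exists>e>0. cube n p e \<subseteq> T"
proof -
  have "openin (product_topology (\<lambda>i. euclidean) UNIV) T"
    unfolding euclidean_product_topology using assms(1) by (simp only: open_openin)
  from product_topology_open_contains_basis[OF this assms(2)]
  obtain X where X: "p \<in> (\<Pi>\<^sub>E i\<in>UNIV. X i)" "\<forall>i. openin euclidean (X i)" "(\<Pi>\<^sub>E i\<in>UNIV. X i) \<subseteq> T"
    by (elim exE conjE)
  have "\<exists>e>0. \<forall>s. \<bar>s - p i\<bar> < e \<longrightarrow> s \<in> X i" for i
  proof -
    have "open (X i)" using X(2) by (simp only: open_openin)
    moreover have "p i \<in> X i" using X(1) by (simp add: PiE_iff)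
    ultimately show ?thesis unfolding open_dist dist_real_def by blast
  qed
  then obtain e where e: "\<And>i. e i > 0" "\<And>i s. \<bar>s - p i\<bar> < e i \<Longrightarrow> s \<in> X i" by metis
  define d where "d = Min (insert 1 (e ` {..<n}))"
  have d: "d > 0" "\<And>i. i < n \<Longrightarrow> d \<le> e i"
    unfolding d_def using e(1) by (auto simp: Min_gr_iff Min_le_iff)
  have "y \<in> T" if y: "y \<in> cube n p d" for y
  proof -
    have "y i \<in> X i" for i
    proof (cases "i < n")
      case True
      then show ?thesis using cubeD[OF y True] d(2)[OF True] e(2) by fastforce
    next
      case False
      then have "y i = p i" using cube_Rn[OF y] assms(3) by (auto simp: Rn_iff)
      then show ?thesis using e by simp
    qed
    then show ?thesis using X(3) by (auto simp: PiE_iff)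
  qed
  then show ?thesis using d(1) by blast
qed

lemma openin_cube: "openin (Euclidean_space n) (cube n p e)"
proof -
  have "open {y. \<bar>y i - p i\<bar> < e}" for i
    by (intro open_Collect_less continuous_intros continuous_on_product_coordinates)
  then have "open (\<Inter>i\<in>{..<n}. {y. \<bar>y i - p i\<bar> < e})" by (intro open_INT) auto
  moreover have "cube n p e = Rn n \<inter> (\<Inter>i\<in>{..<n}. {y. \<bar>y i - p i\<bar> < e})" by (auto simp: cube_def)
  ultimately show ?thesis unfolding openin_Euclidean by (auto simp: openin_open)
qed

lemma openin_top_of_set_cube_iff:
  assumes "Y \<subseteq> Rn n"
  shows "openin (top_of_set Y) U \<longleftrightarrow> U \<subseteq> Y \<and> (\<forall>p\<in>U. \<exists>e>0. cube n p e \<inter> Y \<subseteq> U)"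
proof
  assume "openin (top_of_set Y) U"
  then obtain T where T: "open T" "U = Y \<inter> T" by (auto simp: openin_open)
  have "\<exists>e>0. cube n p e \<inter> Y \<subseteq> U" if "p \<in> U" for p
    using open_contains_cube[of T p n] T that assms by blast
  then show "U \<subseteq> Y \<and> (\<forall>p\<in>U. \<exists>e>0. cube n p e \<inter> Y \<subseteq> U)" using T by blast
next
  assume U: "U \<subseteq> Y \<and> (\<forall>p\<in>U. \<exists>e>0. cube n p e \<inter> Y \<subseteq> U)"
  then obtain e where e: "\<And>p. p \<in> U \<Longrightarrow> e p > 0" "\<And>p. p \<in> U \<Longrightarrow> cube n p (e p) \<inter> Y \<subseteq> U" by metis
  have "openin (top_of_set (Rn n)) (\<Union>p\<in>U. cube n p (e p))"
    using openin_cube[of n] unfolding openin_Euclidean by (intro openin_Union) auto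
  then have "openin (top_of_set Y) (Y \<inter> (\<Union>p\<in>U. cube n p (e p)))"
    using assms by (metis openin_subtopology_Int2 subtopology_subtopology inf.absorb2)
  moreover have "Y \<inter> (\<Union>p\<in>U. cube n p (e p)) = U"
  proof
    show "Y \<inter> (\<Union>p\<in>U. cube n p (e p)) \<subseteq> U" using e(2) by auto
    show "U \<subseteq> Y \<inter> (\<Union>p\<in>U. cube n p (e p))"
    proof
      fix p assume p: "p \<in> U"
      then have "p \<in> cube n p (e p)" using U assms e(1) by (intro centre_in_cube) auto
      then show "p \<in> Y \<inter> (\<Union>p\<in>U. cube n p (e p))" using p U by blast
    qed
  qed
  ultimately show "openin (top_of_set Y) U" by simp
qed

lemma openin_Rn_iff:
  "openin (Euclidean_space n) V \<longleftrightarrow> V \<subseteq> Rn n \<and> (\<forall>p\<in>V. \<exists>e>0. cube n p e \<subseteq> V)"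
proof -
  have "cube n p e \<inter> Rn n = cube n p e" for p e by (auto simp: cube_def)
  then show ?thesis using openin_top_of_set_cube_iff[of "Rn n" n V] by (simp add: openin_Euclidean)
qed

lemma openin_Rn_subset: "openin (Euclidean_space n) V \<Longrightarrow> V \<subseteq> Rn n"
  by (simp add: openin_Rn_iff)

lemma openin_cubeE:
  assumes "openin (Euclidean_space n) V" "p \<in> V"
  obtains e where "e > 0" "cube n p e \<subseteq> V"
  using assms by (auto simp: openin_Rn_iff)

lemma continuous_on_cube_iff:
  fixes f :: "(nat \<Rightarrow> real) \<Rightarrow> real"
  assumes "V \<subseteq> Rn n"
  shows "continuous_on V f \<longleftrightarrow> (\<forall>p\<in>V. \<forall>e>0. \<exists>d>0. \<forall>y\<in>V \<inter> cube n p d. \<bar>f y - f p\<bar> < e)"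
proof
  assume f: "continuous_on V f"
  show "\<forall>p\<in>V. \<forall>e>0. \<exists>d>0. \<forall>y\<in>V \<inter> cube n p d. \<bar>f y - f p\<bar> < e"
  proof (intro ballI allI impI)
    fix p e assume p: "p \<in> V" and e: "e > (0::real)"
    have "openin (top_of_set V) (V \<inter> f -` ball (f p) e)"
      using f by (intro continuous_openin_preimage_gen) auto
    then obtain d where "d > 0" "cube n p d \<inter> V \<subseteq> V \<inter> f -` ball (f p) e"
      using p e unfolding openin_top_of_set_cube_iff[OF assms]
      by (metis IntI centre_in_ball vimageI)
    then show "\<exists>d>0. \<forall>y\<in>V \<inter> cube n p d. \<bar>f y - f p\<bar> < e"
      by (intro exI[of _ d]) (auto simp: dist_real_def abs_minus_commute)
  qed
next
  assume R: "\<forall>p\<in>V. \<forall>e>0. \<exists>d>0. \<forall>y\<in>V \<inter> cube n p d. \<bar>f y - f p\<bar> < e"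
  have "openin (top_of_set V) (V \<inter> f -` B)" if "open B" for B
    unfolding openin_top_of_set_cube_iff[OF assms]
  proof (intro conjI ballI)
    fix p assume p: "p \<in> V \<inter> f -` B"
    then obtain e where e: "e > 0" "ball (f p) e \<subseteq> B" using \<open>open B\<close> by (auto simp: open_contains_ball)
    obtain d where "d > 0" "\<forall>y\<in>V \<inter> cube n p d. \<bar>f y - f p\<bar> < e"
      using R p e(1) by (metis IntD1)
    then show "\<exists>d>0. cube n p d \<inter> V \<subseteq> V \<inter> f -` B"
      using e(2) by (intro exI[of _ d]) (auto simp: dist_real_def abs_minus_commute subset_iff)
  qed auto
  then show "continuous_on V f" by (simp add: continuous_on_open_gen[of _ _ UNIV] continuous_openin_preimage_eq)
qed

lemma openin_Collect_pos:
  assumes "openin (Euclidean_space n) V" "continuous_on V f"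
  shows "openin (Euclidean_space n) {x \<in> V. f x > (0::real)}"
proof -
  have "openin (top_of_set V) (V \<inter> f -` {0<..})"
    using assms(2) by (intro continuous_openin_preimage_gen) auto
  moreover have "V \<inter> f -` {0<..} = {x \<in> V. f x > 0}" by auto
  ultimately have "openin (top_of_set V) {x \<in> V. f x > 0}" by simp
  then show ?thesis using assms(1) unfolding openin_Euclidean by (rule openin_trans)
qed

lemma continuous_on_vec:
  assumes "\<And>x. x \<in> V \<Longrightarrow> G x \<in> Rn m" "\<And>j. j < m \<Longrightarrow> continuous_on V (\<lambda>x. G x j)"
  shows "continuous_on V G"
proof (rule continuous_on_coordinatewise_then_product)
  fix j
  show "continuous_on V (\<lambda>x. G x j)"
  proof (cases "j < m")
    case False
    then have "G x j = 0" if "x \<in> V" for x using assms(1)[OF that] by (auto simp: Rn_iff)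
    then show ?thesis by (simp cong: continuous_on_cong)
  qed (rule assms(2))
qed

lemma openin_preimage_vec:
  assumes "openin (Euclidean_space n) V" "continuous_on V G" "openin (Euclidean_space m) W" "G ` V \<subseteq> Rn m"
  shows "openin (Euclidean_space n) {x \<in> V. G x \<in> W}"
proof -
  have "openin (top_of_set V) (V \<inter> G -` W)"
    using assms(2-4) unfolding openin_Euclidean
    by (intro continuous_openin_preimage[of V G "Rn m"]) auto
  moreover have "V \<inter> G -` W = {x \<in> V. G x \<in> W}" by auto
  ultimately have "openin (top_of_set V) {x \<in> V. G x \<in> W}" by simp
  then show ?thesis using assms(1) unfolding openin_Euclidean by (rule openin_trans)
qed

section \<open>Closure properties of functions of class C^k\<close>

lemma eventually_line_in_open:
  assumes "openin (Euclidean_space n) V" "x \<in> V" "i < n"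
  shows "\<forall>\<^sub>F t in nhds (x i). x(i := t) \<in> V"
proof -
  obtain e where e: "e > 0" "cube n x e \<subseteq> V" using openin_cubeE[OF assms(1,2)] .
  have "x(i := t) \<in> V" if "dist t (x i) < e" for t
    using that e assms(3) openin_Rn_subset[OF assms(1)] assms(2)
    by (intro subsetD[OF e(2)]) (auto simp: cube_def dist_real_def Rn_iff)
  then show ?thesis using e(1) by (auto simp: eventually_nhds_metric)
qed

lemma partial_deriv_cong:
  assumes "openin (Euclidean_space n) V" "x \<in> V" "i < n" "\<And>y. y \<in> V \<Longrightarrow> f y = g y"
  shows "partial_deriv i f x = partial_deriv i g x"
  unfolding partial_deriv_def
  using eventually_line_in_open[OF assms(1-3)]
  by (intro deriv_cong_ev) (auto elim!: eventually_mono simp: assms(4))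

lemma line_has_derivative_cong:
  assumes "openin (Euclidean_space n) V" "x \<in> V" "i < n" "\<And>y. y \<in> V \<Longrightarrow> f y = g y"
  shows "((\<lambda>t. f (x(i := t))) has_real_derivative D) (at (x i)) \<longleftrightarrow>
    ((\<lambda>t. g (x(i := t))) has_real_derivative D) (at (x i))"
  using eventually_line_in_open[OF assms(1-3)]
  by (intro DERIV_cong_ev) (auto elim!: eventually_mono simp: assms(4))

lemma Ck_on_continuous: "Ck_on n k V f \<Longrightarrow> continuous_on V f"
  by (cases k) auto

lemma Ck_on_subset: "Ck_on n k V f \<Longrightarrow> W \<subseteq> V \<Longrightarrow> Ck_on n k W f"
  by (induction k arbitrary: f) (auto intro: continuous_on_subset)

lemma Ck_on_SucD: "Ck_on n (Suc k) V f \<Longrightarrow> Ck_on n k V f"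
  by (induction k arbitrary: f) auto

lemma Ck_on_SucE:
  assumes "Ck_on n (Suc k) V f" "i < n"
  shows "Ck_on n k V (partial_deriv i f)"
    and "x \<in> V \<Longrightarrow> ((\<lambda>t. f (x(i := t))) has_real_derivative partial_deriv i f x) (at (x i))"
  using assms by (auto simp: partial_deriv_def DERIV_deriv_iff_real_differentiable)

lemma Ck_on_cong_imp:
  "Ck_on n k V f \<Longrightarrow> openin (Euclidean_space n) V \<Longrightarrow> (\<And>x. x \<in> V \<Longrightarrow> g x = f x) \<Longrightarrow> Ck_on n k V g"
proof (induction k arbitrary: f g)
  case 0
  then show ?case by (simp cong: continuous_on_cong)
next
  case (Suc k)
  have "(\<lambda>t. g (x(i := t))) differentiable (at (x i))" if "x \<in> V" "i < n" for x i
  proof -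
    have "((\<lambda>t. g (x(i := t))) has_real_derivative partial_deriv i f x) (at (x i))"
      using Ck_on_SucE(2)[OF Suc.prems(1) that(2,1)]
        line_has_derivative_cong[where f = g and g = f, OF Suc.prems(2) that Suc.prems(3)]
      by (simp del: fun_upd_apply)
    then show ?thesis unfolding real_differentiable_def by blast
  qed
  moreover have "Ck_on n k V (partial_deriv i g)" if "i < n" for i
    by (rule Suc.IH[OF Ck_on_SucE(1)[OF Suc.prems(1) that] Suc.prems(2)])
      (rule partial_deriv_cong[OF Suc.prems(2) _ that Suc.prems(3)])
  moreover have "continuous_on V g"
    using Ck_on_continuous[OF Suc.prems(1)] Suc.prems(3) by (simp cong: continuous_on_cong)
  ultimately show ?case by simp
qed

lemma Ck_on_SucI:
  assumes "openin (Euclidean_space n) V" "continuous_on V f"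
    and D: "\<And>i x. i < n \<Longrightarrow> x \<in> V \<Longrightarrow> ((\<lambda>t. f (x(i := t))) has_real_derivative D i x) (at (x i))"
    and "\<And>i. i < n \<Longrightarrow> Ck_on n k V (D i)"
  shows "Ck_on n (Suc k) V f"
proof -
  have "partial_deriv i f x = D i x" if "i < n" "x \<in> V" for i x
    unfolding partial_deriv_def by (rule DERIV_imp_deriv[OF D[OF that]])
  then have "Ck_on n k V (partial_deriv i f)" if "i < n" for i
    using Ck_on_cong_imp[OF assms(4)[OF that] assms(1)] that by blast
  then show ?thesis using assms(2) D by (auto simp: real_differentiable_def)
qed

lemma Ck_on_local:
  assumes "V \<subseteq> Rn n" "\<And>p. p \<in> V \<Longrightarrow> \<exists>W. openin (Euclidean_space n) W \<and> p \<in> W \<and> Ck_on n k (W \<inter> V) f"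
  shows "Ck_on n k V f"
proof -
  have cont: "continuous_on V f"
    if loc: "\<And>p. p \<in> V \<Longrightarrow> \<exists>W. openin (Euclidean_space n) W \<and> p \<in> W \<and> continuous_on (W \<inter> V) f"
    for f :: "(nat \<Rightarrow> real) \<Rightarrow> real"
    unfolding continuous_on_cube_iff[OF assms(1)]
  proof (intro ballI allI impI)
    fix p e assume p: "p \<in> V" and e: "e > (0::real)"
    obtain W where W: "openin (Euclidean_space n) W" "p \<in> W" "continuous_on (W \<inter> V) f"
      using loc[OF p] by blast
    obtain d where d: "d > 0" "cube n p d \<subseteq> W" using openin_cubeE[OF W(1,2)] .
    have WV: "W \<inter> V \<subseteq> Rn n" using assms(1) by blast
    obtain d' where d': "d' > 0" "\<And>y. y \<in> W \<inter> V \<inter> cube n p d' \<Longrightarrow> \<bar>f y - f p\<bar> < e"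
      using W(3) p W(2) e unfolding continuous_on_cube_iff[OF WV] by blast
    then show "\<exists>d>0. \<forall>y\<in>V \<inter> cube n p d. \<bar>f y - f p\<bar> < e"
      using d cube_mono[of "min d d'" d n p] cube_mono[of "min d d'" d' n p]
      by (intro exI[of _ "min d d'"]) auto
  qed
  show ?thesis using assms(2)
  proof (induction k arbitrary: f)
    case 0
    then show ?case using cont by simp
  next
    case (Suc k)
    have "continuous_on V f"
      using Suc.prems by (intro cont) (meson Ck_on_continuous)
    moreover have "(\<lambda>t. f (x(i := t))) differentiable (at (x i))" if "x \<in> V" "i < n" for x i
      using Suc.prems[OF that(1)] that by auto
    moreover have "Ck_on n k V (partial_deriv i f)" if "i < n" for i
      using Suc.prems that by (intro Suc.IH) fastforce
    ultimately show ?case by simp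
  qed
qed

lemma Ck_on_const: "openin (Euclidean_space n) V \<Longrightarrow> Ck_on n k V (\<lambda>x. c)"
proof (induction k arbitrary: c)
  case (Suc k)
  show ?case
  proof (rule Ck_on_SucI[OF Suc.prems, of _ "\<lambda>_ _. 0"])
    show "((\<lambda>t. c) has_real_derivative 0) (at (x i))" for i and x :: "nat \<Rightarrow> real" by simp
  qed (use Suc in auto)
qed auto

lemma Ck_on_coord: "openin (Euclidean_space n) V \<Longrightarrow> Ck_on n k V (\<lambda>x. x i)"
proof (cases k)
  case (Suc l)
  assume V: "openin (Euclidean_space n) V"
  show ?thesis unfolding Suc
  proof (rule Ck_on_SucI[OF V, of _ "\<lambda>j _. if j = i then 1 else 0"])
    show "continuous_on V (\<lambda>x. x i)" by (rule continuous_on_subset[OF continuous_on_product_coordinates]) simp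
    show "((\<lambda>t. (x(j := t)) i) has_real_derivative (if j = i then 1 else 0)) (at (x j))" for j and x :: "nat \<Rightarrow> real"
      by (cases "j = i") auto
  qed (use Ck_on_const[OF V] in auto)
qed (simp add: continuous_on_subset[OF continuous_on_product_coordinates])

lemma Ck_on_add:
  "openin (Euclidean_space n) V \<Longrightarrow> Ck_on n k V f \<Longrightarrow> Ck_on n k V g \<Longrightarrow> Ck_on n k V (\<lambda>x. f x + g x)"
proof (induction k arbitrary: f g)
  case (Suc k)
  show ?case
  proof (rule Ck_on_SucI[OF Suc.prems(1), of _ "\<lambda>i x. partial_deriv i f x + partial_deriv i g x"])
    show "continuous_on V (\<lambda>x. f x + g x)"
      using Suc.prems(2,3) by (intro continuous_on_add) (auto intro: Ck_on_continuous)
    show "((\<lambda>t. f (x(i := t)) + g (x(i := t))) has_real_derivative partial_deriv i f x + partial_deriv i g x) (at (x i))"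
      if "i < n" "x \<in> V" for i x
      using Ck_on_SucE(2)[OF Suc.prems(2) that] Ck_on_SucE(2)[OF Suc.prems(3) that] by (rule DERIV_add)
    show "Ck_on n k V (\<lambda>x. partial_deriv i f x + partial_deriv i g x)" if "i < n" for i
      using Ck_on_SucE(1)[OF Suc.prems(2) that] Ck_on_SucE(1)[OF Suc.prems(3) that]
      by (rule Suc.IH[OF Suc.prems(1)])
  qed
qed (auto intro: continuous_on_add)

lemma Ck_on_mult:
  "openin (Euclidean_space n) V \<Longrightarrow> Ck_on n k V f \<Longrightarrow> Ck_on n k V g \<Longrightarrow> Ck_on n k V (\<lambda>x. f x * g x)"
proof (induction k arbitrary: f g)
  case (Suc k)
  show ?case
  proof (rule Ck_on_SucI[OF Suc.prems(1), of _ "\<lambda>i x. partial_deriv i f x * g x + partial_deriv i g x * f x"])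
    show "continuous_on V (\<lambda>x. f x * g x)"
      using Suc.prems(2,3) by (intro continuous_on_mult) (auto intro: Ck_on_continuous)
    show "((\<lambda>t. f (x(i := t)) * g (x(i := t))) has_real_derivative
        partial_deriv i f x * g x + partial_deriv i g x * f x) (at (x i))"
      if "i < n" "x \<in> V" for i x
      using DERIV_mult[OF Ck_on_SucE(2)[OF Suc.prems(2) that] Ck_on_SucE(2)[OF Suc.prems(3) that]]
      by (simp del: fun_upd_apply)
    show "Ck_on n k V (\<lambda>x. partial_deriv i f x * g x + partial_deriv i g x * f x)" if "i < n" for i
      using Ck_on_SucE(1)[OF Suc.prems(2) that] Ck_on_SucE(1)[OF Suc.prems(3) that]
        Ck_on_SucD[OF Suc.prems(2)] Ck_on_SucD[OF Suc.prems(3)] Suc.prems(1)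
      by (intro Ck_on_add Suc.IH)
  qed
qed (auto intro: continuous_on_mult)

lemma Ck_on_sum:
  "openin (Euclidean_space n) V \<Longrightarrow> (\<And>i. i \<in> I \<Longrightarrow> Ck_on n k V (f i)) \<Longrightarrow> Ck_on n k V (\<lambda>x. \<Sum>i\<in>I. f i x)"
  by (induction I rule: infinite_finite_induct) (auto intro: Ck_on_const Ck_on_add)

lemma Ck_on_uminus: "openin (Euclidean_space n) V \<Longrightarrow> Ck_on n k V f \<Longrightarrow> Ck_on n k V (\<lambda>x. - f x)"
  using Ck_on_mult[OF _ Ck_on_const[of n V k "-1"], of f] by simp

lemma Ck_on_diff:
  "openin (Euclidean_space n) V \<Longrightarrow> Ck_on n k V f \<Longrightarrow> Ck_on n k V g \<Longrightarrow> Ck_on n k V (\<lambda>x. f x - g x)"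
  using Ck_on_add[of n V k f "\<lambda>x. - g x"] Ck_on_uminus[of n V k g] by simp

lemma Ck_on_inverse:
  assumes V: "openin (Euclidean_space n) V" and nz: "\<And>x. x \<in> V \<Longrightarrow> f x \<noteq> 0"
  shows "Ck_on n k V f \<Longrightarrow> Ck_on n k V (\<lambda>x. inverse (f x))"
proof (induction k)
  case 0
  then show ?case using nz by (auto intro: continuous_on_inverse)
next
  case (Suc k)
  let ?D = "\<lambda>i x. - (inverse (f x) * partial_deriv i f x * inverse (f x))"
  show ?case
  proof (rule Ck_on_SucI[OF V, of _ ?D])
    show "continuous_on V (\<lambda>x. inverse (f x))"
      using Ck_on_continuous[OF Suc.prems] nz by (auto intro: continuous_on_inverse)
    show "((\<lambda>t. inverse (f (x(i := t)))) has_real_derivative ?D i x) (at (x i))" if "i < n" "x \<in> V" for i x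
      using DERIV_inverse'[OF Ck_on_SucE(2)[OF Suc.prems that]] nz[OF that(2)] by (simp del: fun_upd_apply)
    show "Ck_on n k V (?D i)" if "i < n" for i
      using Ck_on_SucE(1)[OF Suc.prems that] Suc.IH[OF Ck_on_SucD[OF Suc.prems]]
      by (intro Ck_on_uminus Ck_on_mult V)
  qed
qed

lemma Ck_on_divide:
  assumes "openin (Euclidean_space n) V" "\<And>x. x \<in> V \<Longrightarrow> g x \<noteq> 0" "Ck_on n k V f" "Ck_on n k V g"
  shows "Ck_on n k V (\<lambda>x. f x / g x)"
  unfolding divide_inverse by (intro Ck_on_mult Ck_on_inverse assms)

lemma Ck_on_sqrt:
  assumes V: "openin (Euclidean_space n) V" and pos: "\<And>x. x \<in> V \<Longrightarrow> f x > 0"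
  shows "Ck_on n k V f \<Longrightarrow> Ck_on n k V (\<lambda>x. sqrt (f x))"
proof (induction k)
  case 0
  then show ?case by (auto intro: continuous_on_real_sqrt)
next
  case (Suc k)
  let ?D = "\<lambda>i x. inverse (sqrt (f x)) * (1 / 2) * partial_deriv i f x"
  show ?case
  proof (rule Ck_on_SucI[OF V, of _ ?D])
    show "continuous_on V (\<lambda>x. sqrt (f x))"
      using Ck_on_continuous[OF Suc.prems] by (auto intro: continuous_on_real_sqrt)
    show "((\<lambda>t. sqrt (f (x(i := t)))) has_real_derivative ?D i x) (at (x i))" if "i < n" "x \<in> V" for i x
    proof -
      have "(sqrt has_real_derivative inverse (sqrt (f x)) / 2) (at (f (x(i := x i))))"
        using DERIV_real_sqrt[OF pos[OF that(2)]] by simp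
      from DERIV_chain2[OF this Ck_on_SucE(2)[OF Suc.prems that]] show ?thesis
        by (simp del: fun_upd_apply)
    qed
    show "Ck_on n k V (?D i)" if "i < n" for i
      using Ck_on_SucE(1)[OF Suc.prems that] Suc.IH[OF Ck_on_SucD[OF Suc.prems]] pos
      by (intro Ck_on_mult Ck_on_const Ck_on_inverse V) (auto dest: pos)
  qed
qed

text \<open>A chain rule for increments of the form c times the increment of \<open>g\<close>, where
  c, typically a derivative at an unspecified intermediate point, tends to \<open>D\<close>. It
  gives both the chain rule and the derivative of an implicit function.\<close>

lemma DERIV_of_quotient_bound:
  fixes u g :: "real \<Rightarrow> real"
  assumes g: "(g has_real_derivative g') (at t0)"
    and c: "\<And>e. e > 0 \<Longrightarrow> \<forall>\<^sub>F t in at t0. \<exists>c. \<bar>c - D\<bar> < e \<and> u t - u t0 = c * (g t - g t0)"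
  shows "(u has_real_derivative D * g') (at t0)"
proof -
  \<comment> \<open>Where \<open>g\<close> returns to its value at \<open>t0\<close>, so does
    \<open>u\<close>, and the quotient is set to its limit \<open>D\<close>.\<close>
  define q where "q t = (if g t = g t0 then D else (u t - u t0) / (g t - g t0))" for t
  have q: "\<forall>\<^sub>F t in at t0. \<bar>q t - D\<bar> < e" if "e > 0" for e
    using c[OF that] by eventually_elim (use that in \<open>auto simp: q_def\<close>)
  have "(q \<longlongrightarrow> D) (at t0)"
    unfolding tendsto_iff using q by (simp add: dist_real_def)
  moreover have "((\<lambda>t. (g t - g t0) / (t - t0)) \<longlongrightarrow> g') (at t0)"
    using g by (simp add: has_field_derivative_iff)
  ultimately have "((\<lambda>t. q t * ((g t - g t0) / (t - t0))) \<longlongrightarrow> D * g') (at t0)" by (rule tendsto_mult)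
  moreover have "\<forall>\<^sub>F t in at t0. q t * ((g t - g t0) / (t - t0)) = (u t - u t0) / (t - t0)"
    using c[OF zero_less_one] by eventually_elim (auto simp: q_def)
  ultimately have "((\<lambda>t. (u t - u t0) / (t - t0)) \<longlongrightarrow> D * g') (at t0)"
    by (rule Lim_transform_eventually)
  then show ?thesis by (simp add: has_field_derivative_iff)
qed

text \<open>The mean value theorem in one coordinate, for end points in either order; a cube
  contains the segment between them.\<close>

lemma coordinate_MVT:
  assumes f: "Ck_on n (Suc k) V f" and i: "i < n" and B: "cube n p e \<subseteq> V"
    and y: "y \<in> cube n p e" "y(i := s) \<in> cube n p e"
  shows "\<exists>c. min (y i) s \<le> c \<and> c \<le> max (y i) s \<and> y(i := c) \<in> cube n p e \<and>
    f (y(i := s)) - f y = (s - y i) * partial_deriv i f (y(i := c))"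
proof -
  have in_cube: "y(i := c) \<in> cube n p e" if "min (y i) s \<le> c" "c \<le> max (y i) s" for c
    using y that i by (fastforce simp: cube_def Rn_iff)
  have der: "((\<lambda>t. f (y(i := t))) has_real_derivative partial_deriv i f (y(i := c))) (at c)"
    if "min (y i) s \<le> c" "c \<le> max (y i) s" for c
    using Ck_on_SucE(2)[OF f i subsetD[OF B in_cube[OF that]]] by simp
  consider "y i = s" | "y i < s" | "s < y i" by linarith
  then show ?thesis
  proof cases
    case 1
    then show ?thesis using y by (intro exI[of _ s]) auto
  next
    case 2
    then obtain c where "y i < c" "c < s"
      "f (y(i := s)) - f (y(i := y i)) = (s - y i) * partial_deriv i f (y(i := c))"
      using MVT2[of "y i" s "\<lambda>t. f (y(i := t))" "\<lambda>c. partial_deriv i f (y(i := c))"] der by auto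
    then show ?thesis using in_cube by (intro exI[of _ c]) auto
  next
    case 3
    then obtain c where "s < c" "c < y i"
      "f (y(i := y i)) - f (y(i := s)) = (y i - s) * partial_deriv i f (y(i := c))"
      using MVT2[of s "y i" "\<lambda>t. f (y(i := t))" "\<lambda>c. partial_deriv i f (y(i := c))"] der by auto
    then show ?thesis using in_cube by (intro exI[of _ c]) (auto simp: algebra_simps)
  qed
qed

text \<open>Leads from z to y in n steps, each changing a single coordinate, so that
  \<open>coordinate_MVT\<close> applies to every step.\<close>

definition hybrid :: "nat \<Rightarrow> (nat \<Rightarrow> real) \<Rightarrow> (nat \<Rightarrow> real) \<Rightarrow> nat \<Rightarrow> real"
  where "hybrid j y z = (\<lambda>i. if i < j then y i else z i)"

lemma hybrid_Suc: "hybrid (Suc j) y z = (hybrid j y z)(j := y j)"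
  by (auto simp: hybrid_def fun_eq_iff less_Suc_eq)

lemma hybrid_cube: "y \<in> cube n p e \<Longrightarrow> z \<in> cube n p e \<Longrightarrow> hybrid j y z \<in> cube n p e"
  by (auto simp: cube_def hybrid_def Rn_iff)

lemma telescope_hybrid:
  assumes "y \<in> Rn n" "z \<in> Rn n"
  shows "f y - f z = (\<Sum>j<n. f (hybrid (Suc j) y z) - f (hybrid j y z) :: real)"
proof -
  have "hybrid n y z = y" "hybrid 0 y z = z"
    using assms by (auto simp: hybrid_def fun_eq_iff Rn_iff)
  then show ?thesis using sum_lessThan_telescope[of "\<lambda>j. f (hybrid j y z)" n] by simp
qed

text \<open>The increment of f is telescoped over \<open>hybrid\<close>. Every step is a partial
  derivative at a nearby point times the increment of one coordinate of the curve, and the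
  continuity of the partial derivatives gives the limit.\<close>

lemma chain_rule_curve:
  assumes V: "openin (Euclidean_space n) V" and f: "Ck_on n (Suc k) V f"
    and \<gamma>: "\<And>j. j < n \<Longrightarrow> ((\<lambda>t. \<gamma> t j) has_real_derivative \<gamma>' j) (at t0)"
    and in_V: "\<forall>\<^sub>F t in nhds t0. \<gamma> t \<in> V"
  shows "((\<lambda>t. f (\<gamma> t)) has_real_derivative (\<Sum>j<n. partial_deriv j f (\<gamma> t0) * \<gamma>' j)) (at t0)"
proof -
  let ?p = "\<gamma> t0"
  have p: "?p \<in> V" using in_V by (rule eventually_nhds_x_imp_x)
  then have pR: "?p \<in> Rn n" using openin_Rn_subset[OF V] by blast
  obtain r where r: "r > 0" "cube n ?p r \<subseteq> V" using openin_cubeE[OF V p] .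
  define u where "u j t = f (hybrid (Suc j) (\<gamma> t) ?p) - f (hybrid j (\<gamma> t) ?p)" for j t
  have u0: "u j t0 = 0" for j
    by (simp add: u_def hybrid_def cong: if_cong)
  have "\<forall>\<^sub>F t in at t0. \<bar>\<gamma> t j - ?p j\<bar> < d" if "d > 0" "j < n" for d j
    using DERIV_isCont[OF \<gamma>[OF that(2)]] that(1) by (auto simp: isCont_def tendsto_iff dist_real_def)
  then have "\<forall>\<^sub>F t in at t0. \<forall>j<n. \<bar>\<gamma> t j - ?p j\<bar> < d" if "d > 0" for d
    using that eventually_ball_finite[of "{..<n}" "\<lambda>t j. \<bar>\<gamma> t j - ?p j\<bar> < d" "at t0"] by (simp add: Ball_def)
  moreover have inV': "\<forall>\<^sub>F t in at t0. \<gamma> t \<in> V" using in_V by (simp add: eventually_nhds_conv_at)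
  ultimately have near: "\<forall>\<^sub>F t in at t0. \<gamma> t \<in> cube n ?p d" if "d > 0" for d
  proof -
    have "\<forall>\<^sub>F t in at t0. (\<forall>j<n. \<bar>\<gamma> t j - ?p j\<bar> < d) \<and> \<gamma> t \<in> V"
      using \<open>\<And>d. d > 0 \<Longrightarrow> \<forall>\<^sub>F t in at t0. \<forall>j<n. \<bar>\<gamma> t j - ?p j\<bar> < d\<close>[OF that] inV'
      by (rule eventually_conj)
    then show ?thesis using openin_Rn_subset[OF V] by (auto elim!: eventually_mono simp: cube_def)
  qed
  have du: "(u j has_real_derivative partial_deriv j f ?p * \<gamma>' j) (at t0)" if j: "j < n" for j
  proof (rule DERIV_of_quotient_bound[OF \<gamma>[OF j]])
    fix e :: real assume "e > 0"
    have "continuous_on V (partial_deriv j f)" using Ck_on_SucE(1)[OF f j] by (rule Ck_on_continuous)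
    then obtain d where d: "d > 0" "\<And>y. y \<in> V \<inter> cube n ?p d \<Longrightarrow> \<bar>partial_deriv j f y - partial_deriv j f ?p\<bar> < e"
      using p \<open>e > 0\<close> unfolding continuous_on_cube_iff[OF openin_Rn_subset[OF V]] by blast
    define m where "m = min r d"
    have m: "m > 0" "cube n ?p m \<subseteq> V" "cube n ?p m \<subseteq> cube n ?p d"
      using r d cube_mono[of m r n ?p] cube_mono[of m d n ?p] by (auto simp: m_def)
    show "\<forall>\<^sub>F t in at t0. \<exists>c. \<bar>c - partial_deriv j f ?p\<bar> < e \<and> u j t - u j t0 = c * (\<gamma> t j - \<gamma> t0 j)"
      using near[OF m(1)]
    proof eventually_elim
      case (elim t)
      have h: "hybrid j (\<gamma> t) ?p \<in> cube n ?p m" "(hybrid j (\<gamma> t) ?p)(j := \<gamma> t j) \<in> cube n ?p m"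
        using hybrid_cube[OF elim centre_in_cube[OF pR m(1)]] hybrid_Suc by metis+
      have hj: "hybrid j (\<gamma> t) ?p j = ?p j" by (simp add: hybrid_def)
      obtain c where c: "(hybrid j (\<gamma> t) ?p)(j := c) \<in> cube n ?p m"
        "u j t = (\<gamma> t j - ?p j) * partial_deriv j f ((hybrid j (\<gamma> t) ?p)(j := c))"
        using coordinate_MVT[OF f j m(2) h] by (auto simp: u_def hybrid_Suc hj)
      have "\<bar>partial_deriv j f ((hybrid j (\<gamma> t) ?p)(j := c)) - partial_deriv j f ?p\<bar> < e"
        using c(1) m by (intro d(2)) auto
      then show ?case using c(2) u0
        by (intro exI[of _ "partial_deriv j f ((hybrid j (\<gamma> t) ?p)(j := c))"]) auto
    qed
  qed
  have "((\<lambda>t. f ?p + (\<Sum>j<n. u j t)) has_real_derivative 0 + (\<Sum>j<n. partial_deriv j f ?p * \<gamma>' j)) (at t0)"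
    using du by (intro DERIV_add DERIV_const DERIV_sum) auto
  moreover have "\<forall>\<^sub>F t in nhds t0. f ?p + (\<Sum>j<n. u j t) = f (\<gamma> t)"
    using in_V
  proof eventually_elim
    case (elim t)
    then have "\<gamma> t \<in> Rn n" using openin_Rn_subset[OF V] by blast
    then show ?case using telescope_hybrid[of "\<gamma> t" n ?p f] pR by (simp add: u_def)
  qed
  ultimately show ?thesis by (subst (asm) DERIV_cong_ev[OF refl _ refl]) auto
qed

text \<open>The partial derivatives of the composite are sums of products involving composites of
  class one lower, whence the induction on k for arbitrary f.\<close>

lemma Ck_on_compose:
  assumes V: "openin (Euclidean_space n) V" and W: "openin (Euclidean_space m) W"
    and GW: "\<And>x. x \<in> V \<Longrightarrow> G x \<in> W"
  shows "Ck_on m k W f \<Longrightarrow> (\<And>j. j < m \<Longrightarrow> Ck_on n k V (\<lambda>x. G x j)) \<Longrightarrow> Ck_on n k V (\<lambda>x. f (G x))"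
proof (induction k arbitrary: f)
  case 0
  have "continuous_on V G"
    using 0(2) GW openin_Rn_subset[OF W] by (intro continuous_on_vec[of _ _ m]) auto
  then show ?case using 0(1) GW
    by (auto intro!: continuous_on_compose2[of W f])
next
  case (Suc k)
  have cG: "continuous_on V G"
    using Suc.prems(2) GW openin_Rn_subset[OF W] Ck_on_continuous by (intro continuous_on_vec[of _ _ m]) blast+
  let ?D = "\<lambda>i x. \<Sum>j<m. partial_deriv j f (G x) * partial_deriv i (\<lambda>x. G x j) x"
  show ?case
  proof (rule Ck_on_SucI[OF V, of _ ?D])
    show "continuous_on V (\<lambda>x. f (G x))"
      using Ck_on_continuous[OF Suc.prems(1)] cG GW by (auto intro!: continuous_on_compose2[of W f])
    show "((\<lambda>t. f (G (x(i := t)))) has_real_derivative ?D i x) (at (x i))" if "i < n" "x \<in> V" for i x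
    proof -
      have "\<forall>\<^sub>F t in nhds (x i). G (x(i := t)) \<in> W"
        using eventually_line_in_open[OF V that(2,1)] by (rule eventually_mono) (rule GW)
      then show ?thesis
        using chain_rule_curve[OF W Suc.prems(1), of "\<lambda>t. G (x(i := t))" "\<lambda>j. partial_deriv i (\<lambda>x. G x j) x" "x i"]
          Ck_on_SucE(2)[OF Suc.prems(2) that] by simp
    qed
    show "Ck_on n k V (?D i)" if "i < n" for i
    proof (intro Ck_on_sum Ck_on_mult V)
      fix j assume "j \<in> {..<m}"
      then have j: "j < m" by simp
      show "Ck_on n k V (\<lambda>x. partial_deriv j f (G x))"
        by (rule Suc.IH[OF Ck_on_SucE(1)[OF Suc.prems(1) j]]) (rule Ck_on_SucD[OF Suc.prems(2)])
      show "Ck_on n k V (partial_deriv i (\<lambda>x. G x j))"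
        by (rule Ck_on_SucE(1)[OF Suc.prems(2)[OF j] that])
    qed
  qed
qed

lemma smooth_on_lipschitz:
  assumes V: "openin (Euclidean_space n) V" and f: "smooth_on n V f" and p: "p \<in> V"
  shows "\<exists>e>0. \<exists>C\<ge>0. cube n p e \<subseteq> V \<and>
    (\<forall>y\<in>cube n p e. \<forall>z\<in>cube n p e. \<bar>f y - f z\<bar> \<le> C * (\<Sum>j<n. \<bar>y j - z j\<bar>))"
proof -
  have f1: "Ck_on n (Suc 0) V f" using f unfolding smooth_on_def by blast
  have "\<exists>d>0. \<forall>y\<in>V \<inter> cube n p d. \<bar>partial_deriv j f y - partial_deriv j f p\<bar> < 1" if "j < n" for j
    using Ck_on_continuous[OF Ck_on_SucE(1)[OF f1 that]] p
    unfolding continuous_on_cube_iff[OF openin_Rn_subset[OF V]] by (metis zero_less_one)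
  then obtain d where d: "\<And>j. j < n \<Longrightarrow> d j > 0"
    "\<And>j y. j < n \<Longrightarrow> y \<in> V \<inter> cube n p (d j) \<Longrightarrow> \<bar>partial_deriv j f y - partial_deriv j f p\<bar> < 1" by metis
  obtain r where r: "r > 0" "cube n p r \<subseteq> V" using openin_cubeE[OF V p] .
  define e where "e = Min (insert r (d ` {..<n}))"
  have e: "e > 0" "e \<le> r" "\<And>j. j < n \<Longrightarrow> e \<le> d j"
    unfolding e_def using d(1) r(1) by (auto simp: Min_gr_iff Min_le_iff)
  have eV: "cube n p e \<subseteq> V" using cube_mono[OF e(2)] r(2) by blast
  \<comment> \<open>The sum bounds every partial derivative on the cube, and unlike a maximum it
    makes sense for n = 0.\<close>
  define C where "C = (\<Sum>j<n. \<bar>partial_deriv j f p\<bar> + 1)"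
  have C0: "C \<ge> 0" unfolding C_def by (intro sum_nonneg) auto
  have Cj: "\<bar>partial_deriv j f p\<bar> + 1 \<le> C" if "j < n" for j
    unfolding C_def using that by (intro member_le_sum) auto
  have "\<bar>f y - f z\<bar> \<le> C * (\<Sum>j<n. \<bar>y j - z j\<bar>)" if y: "y \<in> cube n p e" and z: "z \<in> cube n p e" for y z
  proof -
    have step: "\<bar>f (hybrid (Suc j) y z) - f (hybrid j y z)\<bar> \<le> C * \<bar>y j - z j\<bar>" if j: "j < n" for j
    proof -
      have h: "hybrid j y z \<in> cube n p e" "(hybrid j y z)(j := y j) \<in> cube n p e"
        using hybrid_cube[OF y z] hybrid_Suc by metis+
      obtain c where c: "(hybrid j y z)(j := c) \<in> cube n p e"
        "f (hybrid (Suc j) y z) - f (hybrid j y z) = (y j - z j) * partial_deriv j f ((hybrid j y z)(j := c))"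
        using coordinate_MVT[OF f1 j eV h] by (auto simp: hybrid_Suc) (auto simp: hybrid_def)
      have "\<bar>partial_deriv j f ((hybrid j y z)(j := c)) - partial_deriv j f p\<bar> < 1"
        using c(1) eV cube_mono[OF e(3)[OF j]] by (intro d(2)[OF j]) auto
      then have "\<bar>partial_deriv j f ((hybrid j y z)(j := c))\<bar> \<le> C" using Cj[OF j] by linarith
      then have "\<bar>y j - z j\<bar> * \<bar>partial_deriv j f ((hybrid j y z)(j := c))\<bar> \<le> \<bar>y j - z j\<bar> * C"
        by (intro mult_left_mono) auto
      then show ?thesis unfolding c(2) abs_mult by (simp add: mult.commute)
    qed
    have "\<bar>f y - f z\<bar> \<le> (\<Sum>j<n. \<bar>f (hybrid (Suc j) y z) - f (hybrid j y z)\<bar>)"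
      using telescope_hybrid[of y n z f] cube_Rn[OF y] cube_Rn[OF z] by (simp add: sum_abs)
    also have "\<dots> \<le> (\<Sum>j<n. C * \<bar>y j - z j\<bar>)" using step by (intro sum_mono) auto
    finally show ?thesis by (simp add: sum_distrib_left)
  qed
  then show ?thesis using e(1) C0 eV by blast
qed

section \<open>Coordinate retractions\<close>

lemma smooth_on_continuous: "smooth_on n V f \<Longrightarrow> continuous_on V f"
  unfolding smooth_on_def by (meson Ck_on_continuous)

lemma smooth_on_subset: "smooth_on n V f \<Longrightarrow> W \<subseteq> V \<Longrightarrow> smooth_on n W f"
  unfolding smooth_on_def by (meson Ck_on_subset)

lemma smooth_on_cong:
  "smooth_on n V f \<Longrightarrow> openin (Euclidean_space n) V \<Longrightarrow> (\<And>x. x \<in> V \<Longrightarrow> g x = f x) \<Longrightarrow> smooth_on n V g"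
  unfolding smooth_on_def using Ck_on_cong_imp by blast

lemma smooth_on_local:
  assumes "V \<subseteq> Rn n" "\<And>p. p \<in> V \<Longrightarrow> \<exists>W. openin (Euclidean_space n) W \<and> p \<in> W \<and> smooth_on n (W \<inter> V) f"
  shows "smooth_on n V f"
  unfolding smooth_on_def
proof
  fix k
  show "Ck_on n k V f"
    by (rule Ck_on_local[OF assms(1)]) (use assms(2) in \<open>unfold smooth_on_def, blast\<close>)
qed

lemma smooth_on_const: "openin (Euclidean_space n) V \<Longrightarrow> smooth_on n V (\<lambda>x. c)"
  by (simp add: smooth_on_def Ck_on_const)

lemma smooth_on_coord: "openin (Euclidean_space n) V \<Longrightarrow> smooth_on n V (\<lambda>x. x i)"
  by (simp add: smooth_on_def Ck_on_coord)

lemma smooth_on_add: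
  "openin (Euclidean_space n) V \<Longrightarrow> smooth_on n V f \<Longrightarrow> smooth_on n V g \<Longrightarrow> smooth_on n V (\<lambda>x. f x + g x)"
  by (simp add: smooth_on_def Ck_on_add)

lemma smooth_on_mult:
  "openin (Euclidean_space n) V \<Longrightarrow> smooth_on n V f \<Longrightarrow> smooth_on n V g \<Longrightarrow> smooth_on n V (\<lambda>x. f x * g x)"
  by (simp add: smooth_on_def Ck_on_mult)

lemma smooth_on_divide:
  "openin (Euclidean_space n) V \<Longrightarrow> (\<And>x. x \<in> V \<Longrightarrow> g x \<noteq> 0) \<Longrightarrow> smooth_on n V f \<Longrightarrow> smooth_on n V g \<Longrightarrow>
    smooth_on n V (\<lambda>x. f x / g x)"
  by (simp add: smooth_on_def Ck_on_divide)

lemma smooth_on_sqrt: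
  "openin (Euclidean_space n) V \<Longrightarrow> (\<And>x. x \<in> V \<Longrightarrow> f x > 0) \<Longrightarrow> smooth_on n V f \<Longrightarrow>
    smooth_on n V (\<lambda>x. sqrt (f x))"
  by (simp add: smooth_on_def Ck_on_sqrt)

lemma smooth_on_compose:
  assumes "openin (Euclidean_space n) V" "openin (Euclidean_space m) W" "\<And>x. x \<in> V \<Longrightarrow> G x \<in> W"
    "smooth_on m W f" "\<And>j. j < m \<Longrightarrow> smooth_on n V (\<lambda>x. G x j)"
  shows "smooth_on n V (\<lambda>x. f (G x))"
  unfolding smooth_on_def
proof
  fix k
  show "Ck_on n k V (\<lambda>x. f (G x))"
    by (rule Ck_on_compose[OF assms(1-3)]) (use assms(4,5) in \<open>simp_all add: smooth_on_def\<close>)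
qed

section \<open>The implicit function theorem in one coordinate\<close>

lemma Ck_on_upd:
  assumes "openin (Euclidean_space n) V" "Ck_on n k V \<theta>"
  shows "Ck_on n k V (\<lambda>x. (x(i := \<theta> x)) l)"
  using assms by (cases "l = i") (simp_all add: Ck_on_coord)

lemma smooth_on_partial_deriv: "smooth_on n V f \<Longrightarrow> i < n \<Longrightarrow> smooth_on n V (partial_deriv i f)"
  unfolding smooth_on_def using Ck_on_SucE(1) by blast

lemma smooth_on_has_partial:
  "smooth_on n V f \<Longrightarrow> i < n \<Longrightarrow> x \<in> V \<Longrightarrow>
    ((\<lambda>t. f (x(i := t))) has_real_derivative partial_deriv i f x) (at (x i))"
  unfolding smooth_on_def using Ck_on_SucE(2) by blast

lemma cube_upd: "x \<in> cube n p e \<Longrightarrow> i < n \<Longrightarrow> \<bar>t - p i\<bar> < e \<Longrightarrow> x(i := t) \<in> cube n p e"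
  by (auto simp: cube_def Rn_iff)

text \<open>The equation \<open>g (x(i := t)) = x j\<close> is to be solved for t; its right-hand
  side is x j because g will be component j of a retraction. Uniqueness on one interval for all x in
  \<open>U\<close> will show that the new retraction reads only the exchanged set of
  coordinates.\<close>

lemma implicit_coordinate:
  assumes V: "openin (Euclidean_space n) V" and g: "smooth_on n V g" and p: "p \<in> V"
    and i: "i < n" and j: "j < n" "j \<noteq> i" and gp: "g p = p j" and nz: "partial_deriv i g p \<noteq> 0"
  obtains U \<delta> \<theta> where "openin (Euclidean_space n) U" "p \<in> U" "\<delta> > 0" "smooth_on n U \<theta>"
    "\<And>x. x \<in> U \<Longrightarrow> x(i := \<theta> x) \<in> V" "\<And>x. x \<in> U \<Longrightarrow> \<bar>\<theta> x - p i\<bar> < \<delta>" "\<And>x. x \<in> U \<Longrightarrow> \<bar>x i - p i\<bar> < \<delta>"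
    "\<And>x. x \<in> U \<Longrightarrow> g (x(i := \<theta> x)) = x j"
    "\<And>x t. x \<in> U \<Longrightarrow> \<bar>t - p i\<bar> < \<delta> \<Longrightarrow> x(i := t) \<in> V"
    "\<And>x t. x \<in> U \<Longrightarrow> \<bar>t - p i\<bar> < \<delta> \<Longrightarrow> g (x(i := t)) = x j \<Longrightarrow> t = \<theta> x"
proof -
  \<comment> \<open>Multiplication by \<open>s\<close> makes g increasing in coordinate i, whatever
    the sign of its derivative.\<close>
  define s where "s = sgn (partial_deriv i g p)"
  have s: "s \<noteq> 0" "s * partial_deriv i g p > 0"
    using nz by (auto simp: s_def sgn_if)
  have pR: "p \<in> Rn n" using p openin_Rn_subset[OF V] by blast
  have dg: "smooth_on n V (partial_deriv i g)" by (rule smooth_on_partial_deriv[OF g i])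
  have "openin (Euclidean_space n) {x \<in> V. s * partial_deriv i g x > 0}"
    by (rule openin_Collect_pos[OF V]) (intro continuous_on_mult continuous_on_const smooth_on_continuous[OF dg])
  then obtain e where e: "e > 0" "cube n p e \<subseteq> {x \<in> V. s * partial_deriv i g x > 0}"
    using p s(2) by (auto elim: openin_cubeE)
  define B where "B = cube n p e"
  have BV: "B \<subseteq> V" and Bpos: "\<And>x. x \<in> B \<Longrightarrow> s * partial_deriv i g x > 0" and pB: "p \<in> B"
    using e centre_in_cube[OF pR e(1)] by (auto simp: B_def)
  have oB: "openin (Euclidean_space n) B" unfolding B_def by (rule openin_cube)
  have B_upd: "x(i := t) \<in> B" if "x \<in> B" "\<bar>t - p i\<bar> < e" for x t
    using cube_upd[of x n p e i t] that i by (simp add: B_def)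
  have g1: "Ck_on n (Suc 0) V g" using g unfolding smooth_on_def by blast
  have MVT: "\<exists>c. min t1 t2 \<le> c \<and> c \<le> max t1 t2 \<and> x(i := c) \<in> B \<and>
      g (x(i := t2)) - g (x(i := t1)) = (t2 - t1) * partial_deriv i g (x(i := c))"
    if "x \<in> B" "\<bar>t1 - p i\<bar> < e" "\<bar>t2 - p i\<bar> < e" for x t1 t2
  proof -
    have b: "x(i := t1) \<in> cube n p e" "(x(i := t1))(i := t2) \<in> cube n p e"
      using B_upd that by (simp_all add: B_def)
    show ?thesis
      using coordinate_MVT[OF g1 i BV[unfolded B_def] b] by (simp add: B_def)
  qed
  have mono: "s * g (x(i := t1)) < s * g (x(i := t2))"
    if m: "x \<in> B" "\<bar>t1 - p i\<bar> < e" "\<bar>t2 - p i\<bar> < e" "t1 < t2" for x t1 t2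
  proof -
    obtain c where "x(i := c) \<in> B" "g (x(i := t2)) - g (x(i := t1)) = (t2 - t1) * partial_deriv i g (x(i := c))"
      using MVT[OF m(1-3)] by blast
    then have "s * g (x(i := t2)) - s * g (x(i := t1)) = (t2 - t1) * (s * partial_deriv i g (x(i := c)))"
      by (simp add: right_diff_distrib[symmetric] mult_ac)
    moreover have "(t2 - t1) * (s * partial_deriv i g (x(i := c))) > 0"
      using m(4) Bpos[OF \<open>x(i := c) \<in> B\<close>] by simp
    ultimately show ?thesis by linarith
  qed
  \<comment> \<open>Strictly below e, so that the end points of the interval still lie where g is
    monotone.\<close>
  define \<delta> where "\<delta> = e / 2"
  have \<delta>: "\<delta> > 0" "\<delta> < e" using e(1) by (auto simp: \<delta>_def)
  have cont_upd: "continuous_on B (\<lambda>x. g (x(i := c)))" if "\<bar>c - p i\<bar> < e" for c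
  proof -
    have "Ck_on n 0 B (\<lambda>x. g (x(i := c)))"
    proof (rule Ck_on_compose[where G = "\<lambda>x. x(i := c)", OF oB V])
      show "x(i := c) \<in> V" if "x \<in> B" for x using B_upd[OF that \<open>\<bar>c - p i\<bar> < e\<close>] BV by blast
      show "Ck_on n 0 V g" using g unfolding smooth_on_def by blast
      show "Ck_on n 0 B (\<lambda>x. (x(i := c)) l)" for l by (rule Ck_on_upd[OF oB Ck_on_const[OF oB]])
    qed
    then show ?thesis by simp
  qed
  have cont_coord: "continuous_on B (\<lambda>x. x j)"
    by (rule continuous_on_subset[OF continuous_on_product_coordinates]) simp
  have between_open: "openin (Euclidean_space n)
      {x \<in> {x \<in> B. s * (g (x(i := b)) - x j) > 0}. s * (x j - g (x(i := a))) > 0}"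
    if "\<bar>a - p i\<bar> < e" "\<bar>b - p i\<bar> < e" for a b
  proof (rule openin_Collect_pos)
    show "openin (Euclidean_space n) {x \<in> B. s * (g (x(i := b)) - x j) > 0}"
      by (rule openin_Collect_pos[OF oB])
        (intro continuous_on_mult continuous_on_const continuous_on_diff cont_upd[OF that(2)] cont_coord)
    have "continuous_on B (\<lambda>x. s * (x j - g (x(i := a))))"
      by (intro continuous_on_mult continuous_on_const continuous_on_diff cont_upd[OF that(1)] cont_coord)
    then show "continuous_on {x \<in> B. s * (g (x(i := b)) - x j) > 0} (\<lambda>x. s * (x j - g (x(i := a))))"
      by (rule continuous_on_subset) auto
  qed
  \<comment> \<open>On \<open>U0\<close> the values of g at the two end points enclose x j, which
    gives a solution by the intermediate value theorem.\<close>
  define U0 where "U0 = {x \<in> {x \<in> B. s * (g (x(i := p i + \<delta>)) - x j) > 0}. s * (x j - g (x(i := p i - \<delta>))) > 0}"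
  define U where "U = U0 \<inter> cube n p \<delta>"
  have "openin (Euclidean_space n) U0"
    unfolding U0_def using \<delta> by (intro between_open) auto
  then have oU: "openin (Euclidean_space n) U" unfolding U_def by (intro openin_Int openin_cube)
  have UB: "U \<subseteq> B" by (auto simp: U_def U0_def)
  have pU: "p \<in> U"
  proof -
    have "s * g (p(i := p i)) < s * g (p(i := p i + \<delta>))" "s * g (p(i := p i - \<delta>)) < s * g (p(i := p i))"
      using mono[OF pB, of "p i" "p i + \<delta>"] mono[OF pB, of "p i - \<delta>" "p i"] \<delta> e(1) by auto
    then show ?thesis using pB gp centre_in_cube[OF pR \<delta>(1)] by (simp add: U_def U0_def algebra_simps)
  qed
  have ex: "\<exists>t. \<bar>t - p i\<bar> < \<delta> \<and> g (x(i := t)) = x j" if x: "x \<in> U" for x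
  proof -
    let ?h = "\<lambda>t. s * (g (x(i := t)) - x j)"
    have xB: "x \<in> B" using UB x by blast
    have h: "?h (p i - \<delta>) < 0" "?h (p i + \<delta>) > 0"
      using x by (auto simp: U_def U0_def algebra_simps)
    have "isCont ?h t" if "p i - \<delta> \<le> t \<and> t \<le> p i + \<delta>" for t
    proof -
      have "x(i := t) \<in> V" using B_upd[OF xB, of t] that \<delta> BV by auto
      then have "((\<lambda>u. g ((x(i := t))(i := u))) has_real_derivative partial_deriv i g (x(i := t))) (at ((x(i := t)) i))"
        by (rule smooth_on_has_partial[OF g i])
      then have "isCont (\<lambda>u. g (x(i := u))) t" using DERIV_isCont by fastforce
      then show ?thesis by (intro continuous_intros)
    qed
    then obtain t where t: "p i - \<delta> \<le> t" "t \<le> p i + \<delta>" "?h t = 0"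
      using IVT[of ?h "p i - \<delta>" 0 "p i + \<delta>"] h \<delta>(1) by auto
    then have "t \<noteq> p i - \<delta>" "t \<noteq> p i + \<delta>" using h by auto
    then show ?thesis using t s(1) by (intro exI[of _ t]) auto
  qed
  have uniq: "t = t'" if "x \<in> U" "\<bar>t - p i\<bar> < \<delta>" "\<bar>t' - p i\<bar> < \<delta>" "g (x(i := t)) = x j" "g (x(i := t')) = x j" for x t t'
    using mono[of x t t'] mono[of x t' t] that UB \<delta>(2)
    by (cases t t' rule: linorder_cases) auto
  define \<theta> where "\<theta> x = (SOME t. \<bar>t - p i\<bar> < \<delta> \<and> g (x(i := t)) = x j)" for x
  have \<theta>: "\<bar>\<theta> x - p i\<bar> < \<delta>" "g (x(i := \<theta> x)) = x j" if "x \<in> U" for x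
    using someI_ex[OF ex[OF that]] by (auto simp: \<theta>_def)
  have \<theta>_eq: "t = \<theta> x" if "x \<in> U" "\<bar>t - p i\<bar> < \<delta>" "g (x(i := t)) = x j" for x t
    using uniq[OF that(1,2) \<theta>(1)[OF that(1)] that(3) \<theta>(2)[OF that(1)]] .
  have \<theta>B: "x(i := \<theta> x) \<in> B" if "x \<in> U" for x
    using B_upd[of x "\<theta> x"] \<theta>(1)[OF that] \<delta>(2) UB that by auto
  have cont: "continuous_on U \<theta>"
    unfolding continuous_on_cube_iff[OF openin_Rn_subset[OF oU]]
  proof (intro ballI allI impI)
    fix x0 \<epsilon> assume x0: "x0 \<in> U" and \<epsilon>: "\<epsilon> > (0::real)"
    \<comment> \<open>Small enough that the solution at x0 can move by \<eta> to either side without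
      leaving the interval. That x j lies between the values of g at these two places is an open
      condition on x.\<close>
    define \<eta> where "\<eta> = min \<epsilon> (\<delta> - \<bar>\<theta> x0 - p i\<bar>) / 2"
    have \<eta>: "\<eta> > 0" "\<eta> < \<epsilon>" using \<epsilon> \<theta>(1)[OF x0] by (auto simp: \<eta>_def)
    have ab: "\<bar>\<theta> x0 - \<eta> - p i\<bar> < \<delta>" "\<bar>\<theta> x0 + \<eta> - p i\<bar> < \<delta>"
      using \<epsilon> \<theta>(1)[OF x0] by (auto simp: \<eta>_def min_def field_simps abs_if split: if_splits)
    let ?W = "{x \<in> {x \<in> B. s * (g (x(i := \<theta> x0 + \<eta>)) - x j) > 0}. s * (x j - g (x(i := \<theta> x0 - \<eta>))) > 0}"
    have "openin (Euclidean_space n) ?W" using ab \<delta>(2) by (intro between_open) auto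
    moreover have "x0 \<in> ?W"
    proof -
      have xB: "x0 \<in> B" using UB x0 by blast
      have "s * g (x0(i := \<theta> x0)) < s * g (x0(i := \<theta> x0 + \<eta>))"
        by (rule mono[OF xB]) (use \<theta>(1)[OF x0] ab \<eta>(1) \<delta>(2) in auto)
      moreover have "s * g (x0(i := \<theta> x0 - \<eta>)) < s * g (x0(i := \<theta> x0))"
        by (rule mono[OF xB]) (use \<theta>(1)[OF x0] ab \<eta>(1) \<delta>(2) in auto)
      ultimately show ?thesis using xB \<theta>(2)[OF x0] by (simp add: algebra_simps)
    qed
    ultimately obtain d where d: "d > 0" "cube n x0 d \<subseteq> ?W" by (rule openin_cubeE)
    have "\<bar>\<theta> x - \<theta> x0\<bar> < \<epsilon>" if x: "x \<in> U \<inter> cube n x0 d" for x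
    proof -
      have xU: "x \<in> U" and xW: "x \<in> ?W" using x d(2) by auto
      have xB: "x \<in> B" using UB xU by blast
      have lt: "\<theta> x < \<theta> x0 + \<eta>"
      proof (rule ccontr)
        assume "\<not> \<theta> x < \<theta> x0 + \<eta>"
        then have "s * g (x(i := \<theta> x0 + \<eta>)) \<le> s * g (x(i := \<theta> x))"
          using mono[OF xB, of "\<theta> x0 + \<eta>" "\<theta> x"] ab(2) \<theta>(1)[OF xU] \<delta>(2)
          by (cases "\<theta> x = \<theta> x0 + \<eta>") auto
        then show False using xW \<theta>(2)[OF xU] by (simp add: algebra_simps)
      qed
      have gt: "\<theta> x0 - \<eta> < \<theta> x"
      proof (rule ccontr)
        assume "\<not> \<theta> x0 - \<eta> < \<theta> x"
        then have "s * g (x(i := \<theta> x)) \<le> s * g (x(i := \<theta> x0 - \<eta>))"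
          using mono[OF xB, of "\<theta> x" "\<theta> x0 - \<eta>"] ab(1) \<theta>(1)[OF xU] \<delta>(2)
          by (cases "\<theta> x = \<theta> x0 - \<eta>") auto
        then show False using xW \<theta>(2)[OF xU] by (simp add: algebra_simps)
      qed
      show ?thesis using lt gt \<eta> by linarith
    qed
    then show "\<exists>d>0. \<forall>y\<in>U \<inter> cube n x0 d. \<bar>\<theta> y - \<theta> x0\<bar> < \<epsilon>" using d(1) by blast
  qed
  \<comment> \<open>Obtained by differentiating \<open>g (x(i := \<theta> x)) = x j\<close> in
    coordinate k; since x i is overwritten, \<theta> does not depend on it.\<close>
  define D where "D k x = (if k = i then 0 else
      inverse (partial_deriv i g (x(i := \<theta> x))) * ((if k = j then 1 else 0) - partial_deriv k g (x(i := \<theta> x))))"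
    for k x
  have der: "((\<lambda>t. \<theta> (x(k := t))) has_real_derivative D k x) (at (x k))" if k: "k < n" and x: "x \<in> U" for k x
  proof (cases "k = i")
    case True
    have "\<forall>\<^sub>F t in nhds (x i). \<theta> x = \<theta> (x(i := t))"
      using eventually_line_in_open[OF oU x i]
    proof eventually_elim
      case (elim t)
      show ?case using \<theta>[OF x] j by (intro \<theta>_eq[OF elim]) auto
    qed
    then have "((\<lambda>t. \<theta> (x(i := t))) has_real_derivative 0) (at (x i))"
      using DERIV_cong_ev[OF refl, of "\<lambda>t. \<theta> x" "\<lambda>t. \<theta> (x(i := t))" "x i" 0 0] by simp
    then show ?thesis using True by (simp add: D_def)
  next
    case False
    define y where "y = x(i := \<theta> x)"
    have yB: "y \<in> B" using \<theta>B[OF x] by (simp add: y_def)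
    have yV: "y \<in> V" using yB BV by blast
    \<comment> \<open>The defect of the equation when coordinate k moves while coordinate i stays at
      the old solution. It equals the increment of \<theta> times a partial derivative of g at an
      intermediate point.\<close>
    define h where "h t = (if k = j then t else x j) - g (y(k := t))" for t
    have yk: "y k = x k" using False by (simp add: y_def)
    have h: "(h has_real_derivative (if k = j then 1 else 0) - partial_deriv k g y) (at (x k))"
    proof -
      have "((\<lambda>t. if k = j then t else x j) has_real_derivative (if k = j then 1 else 0)) (at (x k))"
        by (cases "k = j") auto
      moreover have "((\<lambda>t. g (y(k := t))) has_real_derivative partial_deriv k g y) (at (x k))"
        using smooth_on_has_partial[OF g k yV] yk by simp
      ultimately show ?thesis unfolding h_def by (rule DERIV_diff)
    qed
    have "g y = x j" using \<theta>(2)[OF x] by (simp add: y_def)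
    moreover have "y(k := x k) = y" unfolding yk[symmetric] by (rule fun_upd_triv)
    ultimately have h0: "h (x k) = 0" by (simp add: h_def del: fun_upd_apply)
    have "((\<lambda>t. \<theta> (x(k := t))) has_real_derivative
        inverse (partial_deriv i g y) * ((if k = j then 1 else 0) - partial_deriv k g y)) (at (x k))"
    proof (rule DERIV_of_quotient_bound[OF h])
      fix \<epsilon> :: real assume \<epsilon>: "\<epsilon> > 0"
      have nzB: "partial_deriv i g z \<noteq> 0" if "z \<in> B" for z using Bpos[OF that] by auto
      have "continuous_on B (\<lambda>z. inverse (partial_deriv i g z))"
        using continuous_on_subset[OF smooth_on_continuous[OF dg] BV] nzB by (intro continuous_on_inverse) auto
      then obtain d where d: "d > 0"
        "\<And>z. z \<in> B \<inter> cube n y d \<Longrightarrow> \<bar>inverse (partial_deriv i g z) - inverse (partial_deriv i g y)\<bar> < \<epsilon>"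
        using yB \<epsilon> unfolding continuous_on_cube_iff[OF openin_Rn_subset[OF oB]] by blast
      obtain d' where d': "d' > 0" "\<And>z. z \<in> U \<inter> cube n x d' \<Longrightarrow> \<bar>\<theta> z - \<theta> x\<bar> < d"
        using cont x d(1) unfolding continuous_on_cube_iff[OF openin_Rn_subset[OF oU]] by blast
      have xR: "x \<in> Rn n" using x openin_Rn_subset[OF oU] by blast
      have "\<forall>\<^sub>F t in nhds (x k). x(k := t) \<in> U \<inter> cube n x d' \<inter> cube n x d"
        using d(1) d'(1) centre_in_cube[OF xR] x
        by (intro eventually_line_in_open[OF _ _ k] openin_Int openin_cube oU) auto
      then have "\<forall>\<^sub>F t in at (x k). x(k := t) \<in> U \<inter> cube n x d' \<inter> cube n x d"
        by (simp add: eventually_nhds_conv_at)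
      then show "\<forall>\<^sub>F t in at (x k). \<exists>c. \<bar>c - inverse (partial_deriv i g y)\<bar> < \<epsilon> \<and>
          \<theta> (x(k := t)) - \<theta> (x(k := x k)) = c * (h t - h (x k))"
      proof eventually_elim
        case (elim t)
        let ?x = "x(k := t)"
        have xU: "?x \<in> U" and xd: "?x \<in> cube n x d" using elim by auto
        have near: "\<bar>\<theta> ?x - \<theta> x\<bar> < d" using elim d'(2) by auto
        have b: "?x \<in> B" "\<bar>\<theta> x - p i\<bar> < e" "\<bar>\<theta> ?x - p i\<bar> < e"
          using xU UB \<theta>(1)[OF x] \<theta>(1)[OF xU] \<delta>(2) by auto
        obtain c where c: "min (\<theta> x) (\<theta> ?x) \<le> c" "c \<le> max (\<theta> x) (\<theta> ?x)" "?x(i := c) \<in> B"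
          "g (?x(i := \<theta> ?x)) - g (?x(i := \<theta> x)) = (\<theta> ?x - \<theta> x) * partial_deriv i g (?x(i := c))"
          using MVT[OF b] by blast
        have "?x(i := c) \<in> cube n y d"
        proof -
          have "\<bar>c - \<theta> x\<bar> < d" using c(1,2) near by auto
          moreover have "?x(i := c) \<in> Rn n" using c(3) openin_Rn_subset[OF oB] by blast
          moreover have "\<bar>t - x k\<bar> < d" using cubeD[OF xd k] by simp
          ultimately show ?thesis using d(1) False by (auto simp: cube_def y_def)
        qed
        then have 1: "\<bar>inverse (partial_deriv i g (?x(i := c))) - inverse (partial_deriv i g y)\<bar> < \<epsilon>"
          using c(3) by (intro d(2)) auto
        have "?x(i := \<theta> x) = y(k := t)" using False by (auto simp: y_def fun_eq_iff)
        then have "h t = g (?x(i := \<theta> ?x)) - g (?x(i := \<theta> x))"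
          using \<theta>(2)[OF xU] by (auto simp: h_def)
        then have "\<theta> ?x - \<theta> x = inverse (partial_deriv i g (?x(i := c))) * h t"
          using c(4) nzB[OF c(3)] by simp
        then show ?case using 1 h0
          by (intro exI[of _ "inverse (partial_deriv i g (?x(i := c)))"]) simp
      qed
    qed
    then show ?thesis using False by (simp add: D_def y_def)
  qed
  \<comment> \<open>Bootstrapping: the formula for \<open>D\<close> contains \<theta> only through
    composition, so class m of \<theta> gives class m of \<open>D\<close>, and hence class m + 1 of
    \<theta>.\<close>
  have "Ck_on n m U \<theta>" for m
  proof (induction m)
    case 0
    then show ?case using cont by simp
  next
    case (Suc m)
    have comp: "Ck_on n m U (\<lambda>x. f (x(i := \<theta> x)))" if "smooth_on n V f" for f
    proof (rule Ck_on_compose[where G = "\<lambda>x. x(i := \<theta> x)", OF oU oB \<theta>B])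
      show "Ck_on n m B f" using that BV unfolding smooth_on_def by (meson Ck_on_subset)
      show "Ck_on n m U (\<lambda>x. (x(i := \<theta> x)) l)" for l by (rule Ck_on_upd[OF oU Suc])
    qed
    show ?case
    proof (rule Ck_on_SucI[OF oU cont der])
      fix k assume k: "k < n"
      show "Ck_on n m U (D k)"
      proof (cases "k = i")
        case True
        then have "D k = (\<lambda>x. 0)" by (simp add: D_def fun_eq_iff)
        then show ?thesis by (simp add: Ck_on_const[OF oU])
      next
        case False
        have "Ck_on n m U (\<lambda>x. inverse (partial_deriv i g (x(i := \<theta> x))) *
            ((if k = j then 1 else 0) - partial_deriv k g (x(i := \<theta> x))))"
          using Bpos[OF \<theta>B] comp[OF dg] comp[OF smooth_on_partial_deriv[OF g k]]
          by (intro Ck_on_mult Ck_on_diff Ck_on_inverse Ck_on_const oU) fastforce+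
        moreover have "D k = (\<lambda>x. inverse (partial_deriv i g (x(i := \<theta> x))) *
            ((if k = j then 1 else 0) - partial_deriv k g (x(i := \<theta> x))))"
          using False by (simp add: D_def fun_eq_iff)
        ultimately show ?thesis by simp
      qed
    qed
  qed
  then have "smooth_on n U \<theta>" by (simp add: smooth_on_def)
  moreover have "x(i := \<theta> x) \<in> V" if "x \<in> U" for x using \<theta>B[OF that] BV by blast
  moreover have "x(i := t) \<in> V" if "x \<in> U" "\<bar>t - p i\<bar> < \<delta>" for x t
    using B_upd[of x t] that UB BV \<delta>(2) by auto
  moreover have "\<bar>x i - p i\<bar> < \<delta>" if "x \<in> U" for x using that i by (auto simp: U_def cube_def)
  ultimately show ?thesis using that[OF oU pU \<delta>(1)] \<theta> \<theta>_eq by blast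
qed

text \<open>\<open>S\<close> is locally the graph of a smooth function of the coordinates in \<open>I\<close>; the graph map is
  given on an open subset of \<open>\<real>\<^sup>n\<close> as a retraction \<open>r\<close> that only reads the coordinates in \<open>I\<close>.\<close>

definition coord_retraction ::
    "nat \<Rightarrow> (nat \<Rightarrow> real) set \<Rightarrow> nat set \<Rightarrow> (nat \<Rightarrow> real) set \<Rightarrow> ((nat \<Rightarrow> real) \<Rightarrow> (nat \<Rightarrow> real)) \<Rightarrow> bool"
  where "coord_retraction n S I W r \<longleftrightarrow> openin (Euclidean_space n) W \<and>
    (\<forall>j<n. smooth_on n W (\<lambda>x. r x j)) \<and> (\<forall>x\<in>W. r x \<in> S \<and> (\<forall>i\<in>I. r x i = x i)) \<and>
    (\<forall>x\<in>S \<inter> W. r x = x) \<and> (\<forall>x\<in>W. \<forall>y\<in>W. (\<forall>i\<in>I. x i = y i) \<longrightarrow> r x = r y)"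

definition lipschitz_over :: "nat \<Rightarrow> (nat \<Rightarrow> real) set \<Rightarrow> nat set \<Rightarrow> (nat \<Rightarrow> real) \<Rightarrow> bool"
  where "lipschitz_over n S J p \<longleftrightarrow> (\<exists>e>0. \<exists>L. \<forall>y\<in>S \<inter> cube n p e. \<forall>z\<in>S \<inter> cube n p e. \<forall>i<n.
    \<bar>y i - z i\<bar> \<le> L * (\<Sum>j\<in>J. \<bar>y j - z j\<bar>))"

section \<open>Exchange of coordinates\<close>

lemma coord_retractionD:
  assumes "coord_retraction n S I W r"
  shows "openin (Euclidean_space n) W" "j < n \<Longrightarrow> smooth_on n W (\<lambda>x. r x j)"
    "x \<in> W \<Longrightarrow> r x \<in> S" "x \<in> W \<Longrightarrow> i \<in> I \<Longrightarrow> r x i = x i" "x \<in> S \<Longrightarrow> x \<in> W \<Longrightarrow> r x = x"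
    "x \<in> W \<Longrightarrow> y \<in> W \<Longrightarrow> (\<And>i. i \<in> I \<Longrightarrow> x i = y i) \<Longrightarrow> r x = r y"
proof -
  note R = assms[unfolded coord_retraction_def]
  note A = R[THEN conjunct1] R[THEN conjunct2, THEN conjunct1] R[THEN conjunct2, THEN conjunct2, THEN conjunct1]
    R[THEN conjunct2, THEN conjunct2, THEN conjunct2, THEN conjunct1]
    R[THEN conjunct2, THEN conjunct2, THEN conjunct2, THEN conjunct2]
  show "openin (Euclidean_space n) W" by (rule A(1))
  show "smooth_on n W (\<lambda>x. r x j)" if "j < n" using A(2) that by blast
  show "r x \<in> S" if "x \<in> W" using A(3) that by blast
  show "r x i = x i" if "x \<in> W" "i \<in> I" using A(3) that by blast
  show "r x = x" if "x \<in> S" "x \<in> W" using A(4) that by blast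
  show "r x = r y" if "x \<in> W" "y \<in> W" "\<And>i. i \<in> I \<Longrightarrow> x i = y i"
    using A(5) that by blast
qed

lemma eventually_small_of_derivative_zero:
  assumes "(f has_real_derivative 0) (at a)" "\<eta> > 0"
  shows "\<forall>\<^sub>F t in at a. \<bar>f t - f a\<bar> \<le> \<eta> * \<bar>t - a\<bar>"
proof -
  have "((\<lambda>t. (f t - f a) / (t - a)) \<longlongrightarrow> 0) (at a)" using assms(1) by (simp add: has_field_derivative_iff)
  then have "\<forall>\<^sub>F t in at a. \<bar>(f t - f a) / (t - a)\<bar> < \<eta>"
    using assms(2) by (simp add: tendsto_iff dist_real_def)
  moreover have "\<forall>\<^sub>F t in at a. t \<noteq> a" by (simp add: eventually_at_filter)
  ultimately show ?thesis
    by eventually_elim (simp add: field_simps)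
qed

text \<open>Moving the coordinate \<open>x i\<close> moves the point of \<open>S\<close>, hence by the Lipschitz condition to
  first order one of its coordinates in \<open>J\<close>.\<close>

lemma coord_retraction_pivot:
  assumes S: "S \<subseteq> Rn n" and r: "coord_retraction n S I W r" and p: "p \<in> S" "p \<in> W"
    and I: "I \<subseteq> {..<n}" and J: "J \<subseteq> {..<n}" and lip: "lipschitz_over n S J p"
    and i: "i \<in> I" "i \<notin> J"
  shows "\<exists>j\<in>J - I. partial_deriv i (\<lambda>x. r x j) p \<noteq> 0"
proof (rule ccontr)
  assume "\<not> ?thesis"
  then have 0: "partial_deriv i (\<lambda>x. r x j) p = 0" if "j \<in> J" "j \<notin> I" for j using that by auto
  note W = coord_retractionD(1)[OF r]
  have inn: "i < n" using i(1) I by auto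
  have pR: "p \<in> Rn n" using p(2) openin_Rn_subset[OF W] by blast
  have rp: "r p = p" using coord_retractionD(5)[OF r p] .
  define c where "c t = r (p(i := t))" for t
  have cp: "c (p i) = p" using rp by (simp add: c_def)
  have inW: "\<forall>\<^sub>F t in nhds (p i). p(i := t) \<in> W" by (rule eventually_line_in_open[OF W p(2) inn])
  have dc: "((\<lambda>t. c t j) has_real_derivative partial_deriv i (\<lambda>x. r x j) p) (at (p i))" if "j < n" for j
    unfolding c_def by (rule smooth_on_has_partial[OF coord_retractionD(2)[OF r that] inn p(2)])
  have dJ: "((\<lambda>t. c t j) has_real_derivative 0) (at (p i))" if j: "j \<in> J" for j
  proof (cases "j \<in> I")
    case False
    then show ?thesis using dc[of j] 0[OF j] j J by auto
  next
    \<comment> \<open>The retraction keeps the coordinates in \<open>I\<close>, and j differs from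
      the moving coordinate i, so this coordinate is constant.\<close>
    case True
    have "\<forall>\<^sub>F t in nhds (p i). p j = c t j"
      using inW
    proof eventually_elim
      case (elim t)
      then show ?case using coord_retractionD(4)[OF r elim True] i(2) j by (auto simp: c_def)
    qed
    then show ?thesis using DERIV_cong_ev[OF refl, of "\<lambda>t. p j" "\<lambda>t. c t j" "p i" 0 0] by simp
  qed
  obtain e L where e: "e > 0" and L: "\<And>y z l. \<lbrakk>y \<in> S \<inter> cube n p e; z \<in> S \<inter> cube n p e; l < n\<rbrakk> \<Longrightarrow>
      \<bar>y l - z l\<bar> \<le> L * (\<Sum>j\<in>J. \<bar>y j - z j\<bar>)"
    using lip unfolding lipschitz_over_def by blast
  have finJ: "finite J" using J finite_subset by blast
  \<comment> \<open>With \<eta> = 1 / (2 K) the Lipschitz estimate yields |t - p i| <= |t - p i| /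
    2, which is absurd for t near p i; the summands 1 keep \<open>K\<close> positive.\<close>
  define K where "K = (\<bar>L\<bar> + 1) * (real (card J) + 1)"
  have K: "K > 0" unfolding K_def by (intro mult_pos_pos) auto
  define \<eta> where "\<eta> = 1 / (2 * K)"
  have \<eta>: "\<eta> > 0" using K by (simp add: \<eta>_def)
  have "\<forall>j\<in>J. \<forall>\<^sub>F t in at (p i). \<bar>c t j - c (p i) j\<bar> \<le> \<eta> * \<bar>t - p i\<bar>"
    using eventually_small_of_derivative_zero[OF dJ \<eta>] by blast
  then have 1: "\<forall>\<^sub>F t in at (p i). \<forall>j\<in>J. \<bar>c t j - c (p i) j\<bar> \<le> \<eta> * \<bar>t - p i\<bar>"
    by (rule eventually_ball_finite[OF finJ])
  have "\<forall>l\<in>{..<n}. \<forall>\<^sub>F t in at (p i). \<bar>c t l - p l\<bar> < e"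
  proof
    fix l assume "l \<in> {..<n}"
    then have "isCont (\<lambda>t. c t l) (p i)" using DERIV_isCont[OF dc] by auto
    then show "\<forall>\<^sub>F t in at (p i). \<bar>c t l - p l\<bar> < e"
      using e by (simp add: isCont_def tendsto_iff dist_real_def cp)
  qed
  then have 2: "\<forall>\<^sub>F t in at (p i). \<forall>l\<in>{..<n}. \<bar>c t l - p l\<bar> < e"
    by (rule eventually_ball_finite[OF finite_lessThan])
  have 3: "\<forall>\<^sub>F t in at (p i). p(i := t) \<in> W" using inW by (simp add: eventually_nhds_conv_at)
  have 4: "\<forall>\<^sub>F t in at (p i). t \<noteq> p i" by (simp add: eventually_at_filter)
  have "\<forall>\<^sub>F t in at (p i). False"
    using 1 2 3 4
  proof eventually_elim
    case (elim t)
    have cS: "c t \<in> S" using coord_retractionD(3)[OF r elim(3)] by (simp add: c_def)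
    have "c t \<in> Rn n" using cS S by blast
      then have cb: "c t \<in> S \<inter> cube n p e" using cS elim(2) by (simp add: cube_def)
      have pb: "p \<in> S \<inter> cube n p e" using p(1) centre_in_cube[OF pR e] by simp
      have ci: "c t i = t" using coord_retractionD(4)[OF r elim(3) i(1)] by (simp add: c_def)
      have "\<bar>c t i - p i\<bar> \<le> L * (\<Sum>j\<in>J. \<bar>c t j - p j\<bar>)" by (rule L[OF cb pb inn])
      also have "\<dots> \<le> \<bar>L\<bar> * (\<Sum>j\<in>J. \<bar>c t j - p j\<bar>)" by (intro mult_right_mono sum_nonneg) auto
      also have "\<dots> \<le> \<bar>L\<bar> * (\<Sum>j\<in>J. \<eta> * \<bar>t - p i\<bar>)"
        using elim(1) by (intro mult_left_mono sum_mono) (auto simp: cp)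
      also have "\<dots> = (\<bar>L\<bar> * real (card J)) * \<eta> * \<bar>t - p i\<bar>" by simp
      also have "\<dots> \<le> K * \<eta> * \<bar>t - p i\<bar>"
        using \<eta> unfolding K_def by (intro mult_right_mono mult_mono) auto
      also have "\<dots> = \<bar>t - p i\<bar> / 2" using K by (simp add: \<eta>_def)
      finally show False using elim(4) ci by auto
  qed
  then show False by simp
qed

text \<open>The nonzero derivative at the pivot lets \<open>r (x(i := t)) j = x j\<close> be solved
  for t, say by \<open>\<theta> x\<close>. Then r applied to \<open>x(i := \<theta> x)\<close> keeps
  coordinate j instead of i, and it still lands in \<open>S\<close>.\<close>

lemma coord_retraction_exchange:
  assumes S: "S \<subseteq> Rn n" and r: "coord_retraction n S I W r" and p: "p \<in> S" "p \<in> W"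
    and I: "I \<subseteq> {..<n}" and J: "J \<subseteq> {..<n}" and lip: "lipschitz_over n S J p"
    and i: "i \<in> I" "i \<notin> J"
  shows "\<exists>j\<in>J - I. \<exists>W' r'. coord_retraction n S (insert j (I - {i})) W' r' \<and> p \<in> W'"
proof -
  obtain j where j: "j \<in> J" "j \<notin> I" and nz: "partial_deriv i (\<lambda>x. r x j) p \<noteq> 0"
    using coord_retraction_pivot[OF assms] by blast
  have ij: "i < n" "j < n" "j \<noteq> i" using i j I J by auto
  note W = coord_retractionD(1)[OF r]
  have rp: "r p j = p j" using coord_retractionD(5)[OF r p] by simp
  obtain U \<delta> \<theta> where U: "openin (Euclidean_space n) U" "p \<in> U" "\<delta> > 0" "smooth_on n U \<theta>"
    and \<theta>: "\<And>x. x \<in> U \<Longrightarrow> x(i := \<theta> x) \<in> W" "\<And>x. x \<in> U \<Longrightarrow> \<bar>\<theta> x - p i\<bar> < \<delta>"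
      "\<And>x. x \<in> U \<Longrightarrow> \<bar>x i - p i\<bar> < \<delta>" "\<And>x. x \<in> U \<Longrightarrow> r (x(i := \<theta> x)) j = x j"
      "\<And>x t. x \<in> U \<Longrightarrow> \<bar>t - p i\<bar> < \<delta> \<Longrightarrow> x(i := t) \<in> W"
      "\<And>x t. x \<in> U \<Longrightarrow> \<bar>t - p i\<bar> < \<delta> \<Longrightarrow> r (x(i := t)) j = x j \<Longrightarrow> t = \<theta> x"
    using implicit_coordinate[OF W coord_retractionD(2)[OF r ij(2)] p(2) ij rp nz] by blast
  define r' where "r' x = r (x(i := \<theta> x))" for x
  let ?I = "insert j (I - {i})"
  have "coord_retraction n S ?I U r'"
    unfolding coord_retraction_def
  proof (intro conjI ballI allI impI)
    show "smooth_on n U (\<lambda>x. r' x l)" if "l < n" for l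
      unfolding r'_def
    proof (rule smooth_on_compose[where G = "\<lambda>x. x(i := \<theta> x)" and f = "\<lambda>x. r x l", OF U(1) W \<theta>(1)])
      show "smooth_on n W (\<lambda>x. r x l)" by (rule coord_retractionD(2)[OF r that])
      show "smooth_on n U (\<lambda>x. (x(i := \<theta> x)) m)" for m
        using U(4) unfolding smooth_on_def by (blast intro: Ck_on_upd[OF U(1)])
    qed
    show "r' x \<in> S" if "x \<in> U" for x
      unfolding r'_def by (rule coord_retractionD(3)[OF r \<theta>(1)[OF that]])
    show "r' x l = x l" if x: "x \<in> U" and l: "l \<in> ?I" for x l
    proof (cases "l = j")
      case True
      then show ?thesis using \<theta>(4)[OF x] by (simp add: r'_def)
    next
      case False
      then have "l \<in> I" "l \<noteq> i" using l by auto
      then show ?thesis using coord_retractionD(4)[OF r \<theta>(1)[OF x]] by (simp add: r'_def)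
    qed
    show "r' x = x" if x: "x \<in> S \<inter> U" for x
    proof -
      have xU: "x \<in> U" and xS: "x \<in> S" using x by auto
      have xW: "x \<in> W" using \<theta>(5)[OF xU \<theta>(3)[OF xU]] by simp
      have rx: "r x = x" by (rule coord_retractionD(5)[OF r xS xW])
      have "x i = \<theta> x" by (rule \<theta>(6)[OF xU \<theta>(3)[OF xU]]) (simp add: rx)
      then have "x(i := \<theta> x) = x" by (metis fun_upd_triv)
      then show ?thesis using rx by (simp add: r'_def)
    qed
    show "r' x = r' y" if x: "x \<in> U" and y: "y \<in> U" and eq: "\<forall>l\<in>?I. x l = y l" for x y
    proof -
      have eqr: "r (x(i := t)) = r (y(i := t))" if "\<bar>t - p i\<bar> < \<delta>" for t
        by (rule coord_retractionD(6)[OF r \<theta>(5)[OF x that] \<theta>(5)[OF y that]]) (use eq in auto)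
      \<comment> \<open>Both values solve the same equation: r reads only \<open>I\<close>, on which
        x and y agree apart from i, and x j = y j.\<close>
      have "\<theta> y = \<theta> x"
        using \<theta>(6)[OF x \<theta>(2)[OF y]] eqr[OF \<theta>(2)[OF y]] \<theta>(4)[OF y] eq by simp
      then show ?thesis using eqr[OF \<theta>(2)[OF x]] by (simp add: r'_def)
    qed
  qed (rule U(1))
  then show ?thesis using j U(2) by blast
qed

text \<open>Every exchange trades a coordinate outside \<open>J\<close> for one in \<open>J\<close>,
  so the number of coordinates of \<open>I\<close> outside \<open>J\<close> drops by one.\<close>

lemma coord_retraction_exists_within:
  assumes S: "S \<subseteq> Rn n" and p: "p \<in> S" and J: "J \<subseteq> {..<n}" and lip: "lipschitz_over n S J p"
    and r: "coord_retraction n S I W r" "p \<in> W" "I \<subseteq> {..<n}"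
  shows "\<exists>I'\<subseteq>J. \<exists>W' r'. coord_retraction n S I' W' r' \<and> p \<in> W'"
  using r
proof (induction "card (I - J)" arbitrary: I W r)
  case 0
  have "finite (I - J)" using 0(4) finite_subset by blast
  then have "I \<subseteq> J" using 0(1) by auto
  then show ?case using 0 by blast
next
  case (Suc k)
  have fin: "finite (I - J)" using Suc.prems(3) finite_subset by blast
  obtain i where i: "i \<in> I" "i \<notin> J" using Suc.hyps(2) by (metis DiffE card.empty equals0I nat.distinct(1))
  obtain j W' r' where j: "j \<in> J" "coord_retraction n S (insert j (I - {i})) W' r'" "p \<in> W'"
    using coord_retraction_exchange[OF S Suc.prems(1) p Suc.prems(2,3) J lip i] by blast
  have "insert j (I - {i}) - J = (I - J) - {i}" using j(1) by auto
  then have "card (insert j (I - {i}) - J) = k" using Suc.hyps(2) fin i by simp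
  moreover have "insert j (I - {i}) \<subseteq> {..<n}" using j(1) J Suc.prems(3) by auto
  ultimately show ?case using Suc.hyps(1)[of "insert j (I - {i})"] j by blast
qed

section \<open>From charts to graphs\<close>

lemma smooth_family_lipschitz:
  assumes V: "openin (Euclidean_space n) V" and f: "\<And>j. j < m \<Longrightarrow> smooth_on n V (f j)" and p: "p \<in> V"
  obtains e C where "e > 0" "C \<ge> 0" "cube n p e \<subseteq> V"
    "\<And>j y z. j < (m::nat) \<Longrightarrow> y \<in> cube n p e \<Longrightarrow> z \<in> cube n p e \<Longrightarrow> \<bar>f j y - f j z\<bar> \<le> C * (\<Sum>l<n. \<bar>y l - z l\<bar>)"
proof -
  define ok where "ok j e C \<longleftrightarrow> e > 0 \<and> C \<ge> 0 \<and> cube n p e \<subseteq> V \<and>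
    (\<forall>y\<in>cube n p e. \<forall>z\<in>cube n p e. \<bar>f j y - f j z\<bar> \<le> C * (\<Sum>l<n. \<bar>y l - z l\<bar>))" for j e and C :: real
  have "\<exists>e C. ok j e C" if "j < m" for j
    using smooth_on_lipschitz[OF V f[OF that] p] unfolding ok_def by blast
  then obtain e C where eC: "\<And>j. j < m \<Longrightarrow> ok j (e j) (C j)" by metis
  obtain r where r: "r > 0" "cube n p r \<subseteq> V" using openin_cubeE[OF V p] .
  define d where "d = Min (insert r (e ` {..<m}))"
  have d: "d > 0" "d \<le> r" "\<And>j. j < m \<Longrightarrow> d \<le> e j"
    unfolding d_def using eC r(1) by (auto simp: Min_gr_iff Min_le_iff ok_def)
  define K where "K = (\<Sum>j<m. C j)"
  have C0: "C j \<ge> 0" if "j < m" for j using eC[OF that] by (simp add: ok_def)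
  have K: "K \<ge> 0" "C j \<le> K" if "j < m" for j
    unfolding K_def using C0 that by (auto intro: sum_nonneg intro!: member_le_sum)
  have K0: "K \<ge> 0" unfolding K_def using C0 by (auto intro: sum_nonneg)
  show ?thesis
  proof (rule that[OF d(1) K0])
    show "cube n p d \<subseteq> V" using cube_mono[OF d(2)] r(2) by blast
    fix j y z assume j: "j < m" and y: "y \<in> cube n p d" and z: "z \<in> cube n p d"
    have "y \<in> cube n p (e j)" "z \<in> cube n p (e j)" using y z cube_mono[OF d(3)[OF j]] by blast+
    then have "\<bar>f j y - f j z\<bar> \<le> C j * (\<Sum>l<n. \<bar>y l - z l\<bar>)" using eC[OF j] by (simp add: ok_def)
    also have "\<dots> \<le> K * (\<Sum>l<n. \<bar>y l - z l\<bar>)" using K(2)[OF j] by (intro mult_right_mono sum_nonneg) auto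
    finally show "\<bar>f j y - f j z\<bar> \<le> K * (\<Sum>l<n. \<bar>y l - z l\<bar>)" .
  qed
qed

lemma openin_Rn: "openin (Euclidean_space n) (Rn n)"
  by (rule openin_topspace)

lemma Rn_mono: "d \<le> n \<Longrightarrow> Rn d \<subseteq> Rn n"
  by simp

lemma slice_chartD:
  assumes "slice_chart n M d W \<phi> \<psi>"
  shows "d \<le> n" "openin (Euclidean_space n) W" "openin (Euclidean_space n) (\<phi> ` W)"
    "j < n \<Longrightarrow> smooth_on n W (\<lambda>x. \<phi> x j)" "j < n \<Longrightarrow> smooth_on n (\<phi> ` W) (\<lambda>y. \<psi> y j)"
    "x \<in> W \<Longrightarrow> \<psi> (\<phi> x) = x" "\<phi> ` (M \<inter> W) = \<phi> ` W \<inter> Rn d"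
  using assms unfolding slice_chart_def by blast+

text \<open>The graph of \<phi> over \<open>M \<inter> W\<close>, in R^(2n), is a graph over its d
  chart coordinates by means of \<psi>, and near the point over p it is Lipschitz over the first n
  coordinates because \<phi> is smooth. Exchange therefore makes it a graph over some of the first n
  coordinates, and forgetting the chart coordinates gives the retraction onto M. No minor of a
  Jacobian has to be chosen.\<close>

lemma slice_chart_retraction:
  assumes M: "M \<subseteq> Rn n" and sc: "slice_chart n M d W \<phi> \<psi>" and p: "p \<in> M" "p \<in> W"
  shows "\<exists>I\<subseteq>{..<n}. \<exists>W' r. coord_retraction n M I W' r \<and> p \<in> W'"
proof -
  note sc = slice_chartD[OF sc]
  have WR: "W \<subseteq> Rn n" using openin_Rn_subset[OF sc(2)] .
  have \<phi>R: "\<phi> ` W \<subseteq> Rn n" using openin_Rn_subset[OF sc(3)] .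
  define N where "N = n + n"
  \<comment> \<open>\<open>zz x\<close> is the pair of x and \<phi> x, and \<open>uu\<close>
    recovers the chart coordinates, of which only the first d can be nonzero on M.\<close>
  define zz where "zz x = (\<lambda>i. if i < n then x i else if i < N then \<phi> x (i - n) else 0)" for x
  define uu where "uu w = trunc d (\<lambda>i. w (n + i))" for w
  define Z where "Z = zz ` (M \<inter> W)"
  have zzR: "zz x \<in> Rn N" for x by (auto simp: zz_def Rn_iff N_def)
  have ZR: "Z \<subseteq> Rn N" using zzR by (auto simp: Z_def)
  have tzz: "trunc n (zz x) = x" if "x \<in> Rn n" for x
    using that by (intro Rn_eqI[of _ n]) (auto simp: zz_def)
  have uuzz: "uu (zz x) = \<phi> x" if "x \<in> M \<inter> W" for x
  proof -
    have "\<phi> x \<in> Rn d" using sc(7) that by blast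
    then show ?thesis unfolding uu_def
      using sc(1) by (intro Rn_eqI[of _ d]) (auto simp: zz_def N_def)
  qed
  define O1 where "O1 = {w \<in> Rn N. uu w \<in> \<phi> ` W}"
  define r where "r w = zz (\<psi> (uu w))" for w
  have key: "\<exists>y\<in>M \<inter> W. uu w = \<phi> y \<and> \<psi> (uu w) = y \<and> r w = zz y" if "w \<in> O1" for w
  proof -
    have "uu w \<in> \<phi> ` W \<inter> Rn d" using that by (simp add: O1_def uu_def)
    then obtain y where "y \<in> M \<inter> W" "uu w = \<phi> y" using sc(7) by blast
    then show ?thesis using sc(6)[of y] by (intro bexI[of _ y]) (auto simp: r_def)
  qed
  have su: "smooth_on N (Rn N) (\<lambda>w. uu w j)" for j
    by (cases "j < d") (auto simp: uu_def trunc_def intro: smooth_on_coord smooth_on_const openin_Rn)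
  have uuR: "uu w \<in> Rn n" for w
    unfolding uu_def by (rule subsetD[OF Rn_mono[OF sc(1)] trunc_in_Rn])
  have cu: "continuous_on (Rn N) uu"
    by (rule continuous_on_vec[OF uuR smooth_on_continuous[OF su]])
  have oO: "openin (Euclidean_space N) O1" unfolding O1_def
    by (rule openin_preimage_vec[OF openin_Rn cu sc(3)]) (use uuR in blast)
  have O1R: "O1 \<subseteq> Rn N" by (auto simp: O1_def)
  have ret: "coord_retraction N Z {n..<n + d} O1 r"
    unfolding coord_retraction_def
  proof (intro conjI allI impI ballI)
    show "smooth_on N O1 (\<lambda>w. r w j)" if "j < N" for j
    proof (cases "j < n")
      case True
      have "smooth_on N O1 (\<lambda>w. \<psi> (uu w) j)"
        by (rule smooth_on_compose[where f = "\<lambda>y. \<psi> y j" and G = uu, OF oO sc(3) _ sc(5)[OF True]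
              smooth_on_subset[OF su O1R]]) (simp add: O1_def)
      then show ?thesis using True by (simp add: r_def zz_def)
    next
      case False
      have "smooth_on N O1 (\<lambda>w. uu w (j - n))" by (rule smooth_on_subset[OF su O1R])
      then show ?thesis
      proof (rule smooth_on_cong[OF _ oO])
        fix w assume "w \<in> O1"
        then obtain y where "y \<in> M \<inter> W" "uu w = \<phi> y" "r w = zz y" using key by blast
        then show "r w j = uu w (j - n)" using False that by (simp add: zz_def)
      qed
    qed
    show "r w \<in> Z" if "w \<in> O1" for w using key[OF that] by (auto simp: Z_def)
    show "r w i = w i" if w: "w \<in> O1" and i: "i \<in> {n..<n + d}" for w i
    proof -
      obtain y where y: "uu w = \<phi> y" "r w = zz y" using key[OF w] by blast
      have "r w i = uu w (i - n)" using y i sc(1) by (auto simp: zz_def N_def)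
      also have "\<dots> = w i" using i by (auto simp: uu_def trunc_def)
      finally show ?thesis .
    qed
    show "r w = w" if "w \<in> Z \<inter> O1" for w
    proof -
      from that obtain x where x: "x \<in> M \<inter> W" "w = zz x" by (auto simp: Z_def)
      then show ?thesis using uuzz[OF x(1)] sc(6)[of x] by (simp add: r_def)
    qed
    show "r w = r w'" if "\<forall>i\<in>{n..<n + d}. w i = w' i" for w w'
    proof -
      have "uu w = uu w'" using that by (auto simp: uu_def trunc_def fun_eq_iff)
      then show ?thesis by (simp add: r_def)
    qed
  qed (rule oO)
  have pM: "p \<in> M \<inter> W" using p by simp
  have pO: "zz p \<in> O1" using uuzz[OF pM] zzR p by (simp add: O1_def)
  obtain e C where e: "e > 0" "C \<ge> 0" "cube n p e \<subseteq> W" and C: "\<And>j y z. j < n \<Longrightarrow> y \<in> cube n p e \<Longrightarrow>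
      z \<in> cube n p e \<Longrightarrow> \<bar>\<phi> y j - \<phi> z j\<bar> \<le> C * (\<Sum>l<n. \<bar>y l - z l\<bar>)"
    using smooth_family_lipschitz[where f = "\<lambda>j x. \<phi> x j" and m = n, OF sc(2) sc(4) p(2)] by metis
  have lip: "lipschitz_over N Z {..<n} (zz p)"
    unfolding lipschitz_over_def
  proof (rule exI[of _ e], intro conjI e(1), rule exI[of _ "C + 1"], intro ballI allI impI)
    fix y z i assume y: "y \<in> Z \<inter> cube N (zz p) e" and z: "z \<in> Z \<inter> cube N (zz p) e" and i: "i < N"
    have incube: "\<exists>x\<in>cube n p e. w = zz x" if "w \<in> Z \<inter> cube N (zz p) e" for w
    proof -
      from that obtain x where x: "x \<in> M \<inter> W" "w = zz x" by (auto simp: Z_def)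
      have "\<bar>x l - p l\<bar> < e" if "l < n" for l
        using cubeD[of w N "zz p" e l] \<open>w \<in> Z \<inter> cube N (zz p) e\<close> x(2) that by (auto simp: zz_def N_def)
      then show ?thesis using x WR by (auto simp: cube_def)
    qed
    obtain a b where ab: "a \<in> cube n p e" "y = zz a" "b \<in> cube n p e" "z = zz b"
      using incube[OF y] incube[OF z] by blast
    have eq: "(\<Sum>j<n. \<bar>y j - z j\<bar>) = (\<Sum>j<n. \<bar>a j - b j\<bar>)" by (simp add: ab zz_def)
    have nn: "(\<Sum>j<n. \<bar>a j - b j\<bar>) \<ge> 0" by (intro sum_nonneg) auto
    show "\<bar>y i - z i\<bar> \<le> (C + 1) * (\<Sum>j<n. \<bar>y j - z j\<bar>)"
    proof (cases "i < n")
      case True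
      have "\<bar>a i - b i\<bar> \<le> (\<Sum>j<n. \<bar>a j - b j\<bar>)" using True by (intro member_le_sum) auto
      also have "\<dots> \<le> (C + 1) * (\<Sum>j<n. \<bar>a j - b j\<bar>)" using e(2) nn mult_right_mono[of 1 "C + 1"] by simp
      finally show ?thesis unfolding eq using True by (simp add: ab zz_def)
    next
      case False
      then have "i - n < n" using i by (simp add: N_def)
      then have "\<bar>\<phi> a (i - n) - \<phi> b (i - n)\<bar> \<le> C * (\<Sum>j<n. \<bar>a j - b j\<bar>)" using C ab by blast
      also have "\<dots> \<le> (C + 1) * (\<Sum>j<n. \<bar>a j - b j\<bar>)" using nn by (intro mult_right_mono) auto
      finally show ?thesis unfolding eq using False i by (simp add: ab zz_def)
    qed
  qed
  have "zz p \<in> Z" using p by (auto simp: Z_def)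
  moreover have "{..<n} \<subseteq> {..<N}" "{n..<n + d} \<subseteq> {..<N}" using sc(1) by (auto simp: N_def)
  ultimately obtain I O2 r2 where I: "I \<subseteq> {..<n}" and r2: "coord_retraction N Z I O2 r2" and pO2: "zz p \<in> O2"
    using coord_retraction_exists_within[OF ZR _ _ lip ret pO] by blast
  note r2 = coord_retractionD[OF r2]
  have O2R: "O2 \<subseteq> Rn N" using openin_Rn_subset[OF r2(1)] .
  \<comment> \<open>Completes x by the chart coordinates of p. The retraction \<open>r2\<close>
    reads only coordinates below n, so it does not notice that these are not those of x.\<close>
  define w0 where "w0 x = (\<lambda>i. if i < n then x i else zz p i)" for x :: "nat \<Rightarrow> real"
  have w0R: "w0 x \<in> Rn N" for x using zzR[of p] by (auto simp: w0_def Rn_iff N_def)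
  have w0p: "w0 p = zz p" by (auto simp: w0_def zz_def)
  have czz: "continuous_on W zz"
  proof (rule continuous_on_vec[OF zzR])
    show "continuous_on W (\<lambda>x. zz x j)" if "j < N" for j
      using that smooth_on_continuous[OF smooth_on_coord[OF sc(2)]] smooth_on_continuous[OF sc(4)[of "j - n"]]
      by (cases "j < n") (auto simp: zz_def N_def)
  qed
  have sw0: "smooth_on n V (\<lambda>x. w0 x j)" if "openin (Euclidean_space n) V" for V j
    using that by (cases "j < n") (auto simp: w0_def intro: smooth_on_coord smooth_on_const)
  define W1 where "W1 = {x \<in> W. zz x \<in> O2}"
  have oW1: "openin (Euclidean_space n) W1" unfolding W1_def
    using zzR by (intro openin_preimage_vec[OF sc(2) czz r2(1)]) auto
  define W2 where "W2 = {x \<in> W1. w0 x \<in> O2}"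
  have oW2: "openin (Euclidean_space n) W2" unfolding W2_def
    using w0R by (intro openin_preimage_vec[OF oW1 _ r2(1)]
        continuous_on_vec[OF w0R smooth_on_continuous[OF sw0[OF oW1]]]) auto
  have W2: "x \<in> W" "zz x \<in> O2" "w0 x \<in> O2" "x \<in> Rn n" if "x \<in> W2" for x
    using that WR by (auto simp: W2_def W1_def)
  define r3 where "r3 x = trunc n (r2 (w0 x))" for x
  have "coord_retraction n M I W2 r3"
    unfolding coord_retraction_def
  proof (intro conjI allI impI ballI)
    show "smooth_on n W2 (\<lambda>x. r3 x j)" if "j < n" for j
    proof -
      have "j < N" using that by (simp add: N_def)
      have "smooth_on n W2 (\<lambda>x. r2 (w0 x) j)"
        by (rule smooth_on_compose[where f = "\<lambda>y. r2 y j" and G = w0, OF oW2 r2(1) W2(3) r2(2)[OF \<open>j < N\<close>] sw0[OF oW2]])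
      then show ?thesis using that by (simp add: r3_def)
    qed
    show "r3 x \<in> M" if "x \<in> W2" for x
    proof -
      have "r2 (w0 x) \<in> Z" by (rule r2(3)[OF W2(3)[OF that]])
      then obtain y where "y \<in> M \<inter> W" "r2 (w0 x) = zz y" by (auto simp: Z_def)
      then show ?thesis using tzz[of y] M by (auto simp: r3_def)
    qed
    show "r3 x i = x i" if "x \<in> W2" "i \<in> I" for x i
      using r2(4)[OF W2(3)[OF that(1)] that(2)] that(2) I by (auto simp: r3_def w0_def)
    show "r3 x = x" if x: "x \<in> M \<inter> W2" for x
    proof -
      have x2: "x \<in> W2" using x by simp
      have zZ: "zz x \<in> Z" using x W2(1)[OF x2] by (auto simp: Z_def)
      have "r2 (w0 x) = r2 (zz x)"
        by (rule r2(6)[OF W2(3)[OF x2] W2(2)[OF x2]]) (use I in \<open>auto simp: w0_def zz_def\<close>)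
      also have "\<dots> = zz x" by (rule r2(5)[OF zZ W2(2)[OF x2]])
      finally show ?thesis using tzz[OF W2(4)[OF x2]] by (simp add: r3_def)
    qed
    show "r3 x = r3 y" if x: "x \<in> W2" and y: "y \<in> W2" and eq: "\<forall>i\<in>I. x i = y i" for x y
    proof -
      have "r2 (w0 x) = r2 (w0 y)"
        by (rule r2(6)[OF W2(3)[OF x] W2(3)[OF y]]) (use I eq in \<open>auto simp: w0_def\<close>)
      then show ?thesis by (simp add: r3_def)
    qed
  qed (rule oW2)
  moreover have "p \<in> W2" using p pO2 w0p by (simp add: W2_def W1_def)
  ultimately show ?thesis using I by blast
qed

text \<open>The last condition is openness at p of the projection of M to the coordinates in
  \<open>J\<close>; of w only these coordinates matter.\<close>

definition local_graph :: "nat \<Rightarrow> (nat \<Rightarrow> real) set \<Rightarrow> nat set \<Rightarrow> (nat \<Rightarrow> real) \<Rightarrow> bool"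
  where "local_graph n M J p \<longleftrightarrow> p \<in> M \<and> lipschitz_over n M J p \<and>
    (\<forall>e>0. \<exists>d>0. \<forall>w\<in>cube n p d. \<exists>y\<in>M \<inter> cube n p e. \<forall>j\<in>J. y j = w j)"

text \<open>Being a local graph is a first-order condition, although the retraction it provides is smooth.\<close>

lemma local_graph_imp_retraction:
  assumes M: "smooth_submanifold n M" and J: "J \<subseteq> {..<n}" and lg: "local_graph n M J p"
  shows "\<exists>W r. coord_retraction n M J W r \<and> p \<in> W"
proof -
  have MR: "M \<subseteq> Rn n" and pM: "p \<in> M" and lip: "lipschitz_over n M J p"
    using M lg by (auto simp: smooth_submanifold_def local_graph_def)
  obtain d W0 \<phi> \<psi> where sc: "slice_chart n M d W0 \<phi> \<psi>" "p \<in> W0"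
    using M pM by (auto simp: smooth_submanifold_def)
  from slice_chart_retraction[OF MR sc(1) pM sc(2)] obtain I1 W1 r1
    where 1: "I1 \<subseteq> {..<n}" "coord_retraction n M I1 W1 r1" "p \<in> W1" by (elim exE conjE)
  from coord_retraction_exists_within[OF MR pM J lip 1(2,3,1)] obtain I W r
    where I: "I \<subseteq> J" and r: "coord_retraction n M I W r" and pW: "p \<in> W" by (elim exE conjE)
  \<comment> \<open>If some j in \<open>J\<close> were missing from \<open>I\<close>, openness would
    give a nearby point of M that differs from p in coordinate j but agrees with it on
    \<open>I\<close>, whereas r recovers a point of M from its coordinates in
    \<open>I\<close>.\<close>
  have "J \<subseteq> I"
  proof (rule ccontr)
    assume "\<not> J \<subseteq> I"
    then obtain j where j: "j \<in> J" "j \<notin> I" by blast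
    obtain e where e: "e > 0" "cube n p e \<subseteq> W" using openin_cubeE[OF coord_retractionD(1)[OF r] pW] .
    have "\<exists>d>0. \<forall>w\<in>cube n p d. \<exists>y\<in>M \<inter> cube n p e. \<forall>j\<in>J. y j = w j"
      using lg e(1) by (simp add: local_graph_def)
    then obtain d where d: "d > 0" "\<forall>w\<in>cube n p d. \<exists>y\<in>M \<inter> cube n p e. \<forall>j\<in>J. y j = w j"
      by (elim exE conjE)
    have pR: "p \<in> Rn n" using pM MR by blast
    have "j < n" using j(1) J by auto
    then have "p(j := p j + d / 2) \<in> cube n p d"
      using d(1) by (intro cube_upd[OF centre_in_cube[OF pR d(1)]]) auto
    from bspec[OF d(2) this] obtain y where y: "y \<in> M" "y \<in> cube n p e" "\<forall>l\<in>J. y l = (p(j := p j + d / 2)) l"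
      by blast
    then have yW: "y \<in> W" using e(2) by blast
    have "r y = r p"
      by (rule coord_retractionD(6)[OF r yW pW]) (use y(3) I j in auto)
    then have "y = p" using coord_retractionD(5)[OF r y(1) yW] coord_retractionD(5)[OF r pM pW] by simp
    then show False using y(3) j d(1) by auto
  qed
  then have "I = J" using I by blast
  then show ?thesis using r pW by blast
qed

lemma retraction_imp_local_graph:
  assumes MR: "M \<subseteq> Rn n" and J: "J \<subseteq> {..<n}" and r: "coord_retraction n M J W r" and p: "p \<in> M" "p \<in> W"
  shows "local_graph n M J p"
  unfolding local_graph_def
proof (intro conjI p(1) allI impI)
  note r = coord_retractionD[OF r]
  have pR: "p \<in> Rn n" using p MR by blast
  have rp: "r p = p" by (rule r(5)[OF p])
  obtain e C where e: "e > 0" "C \<ge> 0" "cube n p e \<subseteq> W" and C: "\<And>j y z. j < n \<Longrightarrow> y \<in> cube n p e \<Longrightarrow>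
      z \<in> cube n p e \<Longrightarrow> \<bar>r y j - r z j\<bar> \<le> C * (\<Sum>l<n. \<bar>y l - z l\<bar>)"
    using smooth_family_lipschitz[where f = "\<lambda>j x. r x j" and m = n, OF r(1,2) p(2)] by metis
  show "lipschitz_over n M J p"
    unfolding lipschitz_over_def
  proof (rule exI[of _ e], intro conjI e(1), rule exI[of _ C], intro ballI allI impI)
    fix y z i assume y: "y \<in> M \<inter> cube n p e" and z: "z \<in> M \<inter> cube n p e" and i: "i < n"
    \<comment> \<open>r maps \<open>z'\<close> to y, as these agree on \<open>J\<close>, and z to
      itself. But \<open>z'\<close> and z differ only in \<open>J\<close>, so the Lipschitz bound
      for r involves no other coordinates.\<close>
    define z' where "z' = (\<lambda>i. if i \<in> J then y i else z i)"
    have z': "z' \<in> cube n p e" using y z by (auto simp: z'_def cube_def Rn_iff)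
    have yW: "y \<in> W" and zW: "z \<in> W" and z'W: "z' \<in> W" using y z z' e(3) by blast+
    have "r z' = r y" by (rule r(6)[OF z'W yW]) (simp add: z'_def)
    then have "r z' = y" "r z = z" using r(5)[OF _ yW] r(5)[OF _ zW] y z by auto
    then have "\<bar>y i - z i\<bar> \<le> C * (\<Sum>l<n. \<bar>z' l - z l\<bar>)" using C[OF i z', of z] z by auto
    also have "(\<Sum>l<n. \<bar>z' l - z l\<bar>) = (\<Sum>l<n. if l \<in> J then \<bar>y l - z l\<bar> else 0)"
      by (intro sum.cong) (auto simp: z'_def)
    also have "\<dots> = (\<Sum>l\<in>J. \<bar>y l - z l\<bar>)"
      using J by (simp add: sum.If_cases Int_absorb1)
    finally show "\<bar>y i - z i\<bar> \<le> C * (\<Sum>j\<in>J. \<bar>y j - z j\<bar>)" .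
  qed
  fix e :: real assume e: "e > 0"
  have cr: "continuous_on W r"
    using r(3) MR by (intro continuous_on_vec[of _ _ n] smooth_on_continuous[OF r(2)]) auto
  have "openin (Euclidean_space n) {x \<in> W. r x \<in> cube n p e}"
    using r(3) MR by (intro openin_preimage_vec[OF r(1) cr openin_cube]) auto
  moreover have "p \<in> {x \<in> W. r x \<in> cube n p e}" using p rp centre_in_cube[OF pR e] by simp
  ultimately obtain d where d: "d > 0" "cube n p d \<subseteq> {x \<in> W. r x \<in> cube n p e}" by (rule openin_cubeE)
  have "\<exists>y\<in>M \<inter> cube n p e. \<forall>j\<in>J. y j = w j" if "w \<in> cube n p d" for w
    using d(2) that r(3,4) by (intro bexI[of _ "r w"]) auto
  then show "\<exists>d>0. \<forall>w\<in>cube n p d. \<exists>y\<in>M \<inter> cube n p e. \<forall>j\<in>J. y j = w j" using d(1) by blast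
qed

section \<open>Extension of Nash functions to the ambient space\<close>

lemma openin_subtopology_cube_iff:
  assumes "Y \<subseteq> Rn n"
  shows "openin (subtopology (Euclidean_space n) Y) U \<longleftrightarrow> U \<subseteq> Y \<and> (\<forall>p\<in>U. \<exists>e>0. cube n p e \<inter> Y \<subseteq> U)"
  unfolding subtopology_Rn[OF assms] by (rule openin_top_of_set_cube_iff[OF assms])

lemma openin_Rn_Int:
  assumes "d \<le> n" "openin (Euclidean_space n) V"
  shows "openin (Euclidean_space d) (V \<inter> Rn d)"
  unfolding openin_Rn_iff
proof (intro conjI ballI)
  fix p assume p: "p \<in> V \<inter> Rn d"
  then obtain e where e: "e > 0" "cube n p e \<subseteq> V" using openin_cubeE[OF assms(2)] by blast
  have "cube d p e \<subseteq> cube n p e \<inter> Rn d"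
  proof
    fix y assume y: "y \<in> cube d p e"
    have "\<bar>y i - p i\<bar> < e" if "i < n" for i
    proof (cases "i < d")
      case True
      then show ?thesis using cubeD[OF y] by blast
    next
      case False
      then have "y i = 0" "p i = 0" using cube_Rn[OF y] p by (auto simp: Rn_iff)
      then show ?thesis using e(1) by simp
    qed
    then show "y \<in> cube n p e \<inter> Rn d"
      using cube_Rn[OF y] subsetD[OF Rn_mono[OF assms(1)] cube_Rn[OF y]] by (auto simp: cube_def)
  qed
  then show "\<exists>e>0. cube d p e \<subseteq> V \<inter> Rn d" using e by blast
qed simp

lemma slice_chart_image_open:
  assumes M: "M \<subseteq> Rn n" and sc: "slice_chart n M d W \<phi> \<psi>"
    and U: "openin (subtopology (Euclidean_space n) M) U"
  shows "openin (Euclidean_space d) (\<phi> ` (U \<inter> W))"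
  unfolding openin_Rn_iff
proof (intro conjI ballI)
  note sc = slice_chartD[OF sc]
  have UM: "U \<subseteq> M" and Ucube: "\<forall>p\<in>U. \<exists>e>0. cube n p e \<inter> M \<subseteq> U"
    using U unfolding openin_subtopology_cube_iff[OF M] by blast+
  have sub: "\<phi> ` (U \<inter> W) \<subseteq> \<phi> ` W \<inter> Rn d" using sc(7) UM by blast
  then show "\<phi> ` (U \<inter> W) \<subseteq> Rn d" by blast
  fix u assume u: "u \<in> \<phi> ` (U \<inter> W)"
  then obtain x where x: "x \<in> U" "x \<in> W" "u = \<phi> x" by blast
  obtain e where e: "e > 0" "cube n x e \<inter> M \<subseteq> U" using Ucube x(1) by blast
  have WR: "W \<subseteq> Rn n" by (rule openin_Rn_subset[OF sc(2)])
  have \<psi>R: "\<psi> v \<in> Rn n" if "v \<in> \<phi> ` W" for v using that sc(6) WR by auto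
  have c\<psi>: "continuous_on (\<phi> ` W) \<psi>"
    by (rule continuous_on_vec[OF \<psi>R smooth_on_continuous[OF sc(5)]])
  have "openin (Euclidean_space n) {v \<in> \<phi> ` W. \<psi> v \<in> cube n x e}"
    using \<psi>R by (intro openin_preimage_vec[OF sc(3) c\<psi> openin_cube]) auto
  then have "openin (Euclidean_space d) ({v \<in> \<phi> ` W. \<psi> v \<in> cube n x e} \<inter> Rn d)"
    by (rule openin_Rn_Int[OF sc(1)])
  moreover have "u \<in> {v \<in> \<phi> ` W. \<psi> v \<in> cube n x e} \<inter> Rn d"
    using u sub x sc(6) centre_in_cube[of x n e] e(1) WR by auto
  ultimately obtain r where r: "r > 0" "cube d u r \<subseteq> {v \<in> \<phi> ` W. \<psi> v \<in> cube n x e} \<inter> Rn d"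
    by (rule openin_cubeE)
  have "v \<in> \<phi> ` (U \<inter> W)" if "v \<in> cube d u r" for v
  proof -
    have v: "v \<in> \<phi> ` W \<inter> Rn d" "\<psi> v \<in> cube n x e" using r(2) that by auto
    then obtain y where y: "y \<in> M \<inter> W" "v = \<phi> y" using sc(7) by blast
    then have "y \<in> U" using v(2) sc(6)[of y] e(2) by auto
    then show ?thesis using y by blast
  qed
  then show "\<exists>e>0. cube d u e \<subseteq> \<phi> ` (U \<inter> W)" using r(1) by blast
qed

section \<open>The map to graph points\<close>

definition isolated_over :: "nat \<Rightarrow> (nat \<Rightarrow> real) set \<Rightarrow> nat set \<Rightarrow> (nat \<Rightarrow> real) \<Rightarrow> real \<Rightarrow> bool"
  where "isolated_over n M J y e \<longleftrightarrow>
    (\<forall>a\<in>M \<inter> cube n y e. \<forall>b\<in>M \<inter> cube n y e. (\<forall>j\<in>J. a j = b j) \<longrightarrow> a = b)"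

text \<open>The factor \<open>1/2\<close> makes the point \<open>y\<close> associated with \<open>x\<close> unique: the larger of two competing
  cubes contains both candidates.\<close>

definition graph_point ::
    "nat \<Rightarrow> (nat \<Rightarrow> real) set \<Rightarrow> nat set \<Rightarrow> (nat \<Rightarrow> real) set \<Rightarrow> (nat \<Rightarrow> real) \<Rightarrow> (nat \<Rightarrow> real) \<Rightarrow> bool"
  where "graph_point n M J U x y \<longleftrightarrow> y \<in> U \<and> local_graph n M J y \<and> (\<forall>j\<in>J. y j = x j) \<and>
    (\<exists>e>0. isolated_over n M J y e \<and> x \<in> cube n y (e / 2))"

lemma graph_point_unique_aux:
  assumes "y \<in> M" "y' \<in> M" "y \<in> Rn n" "y' \<in> Rn n" "\<forall>j\<in>J. y j = y' j"
    "isolated_over n M J y e" "x \<in> cube n y (e / 2)" "x \<in> cube n y' (e' / 2)" "e > 0" "e' \<le> e"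
  shows "y = y'"
proof -
  have "\<bar>y' i - y i\<bar> < e" if "i < n" for i
    using cubeD[OF assms(7) that] cubeD[OF assms(8) that] assms(10) by linarith
  then have "y' \<in> cube n y e" using assms(4) by (auto simp: cube_def)
  moreover have "y \<in> cube n y e" by (rule centre_in_cube[OF assms(3,9)])
  ultimately show ?thesis using assms(1,2,5,6) unfolding isolated_over_def by blast
qed

lemma graph_point_unique:
  assumes "U \<subseteq> M" "M \<subseteq> Rn n" "graph_point n M J U x y" "graph_point n M J U x y'"
  shows "y = y'"
proof -
  obtain e e' where e: "e > 0" "isolated_over n M J y e" "x \<in> cube n y (e / 2)"
    and e': "e' > 0" "isolated_over n M J y' e'" "x \<in> cube n y' (e' / 2)"
    using assms(3,4) unfolding graph_point_def by blast
  have y: "y \<in> M" "y' \<in> M" "y \<in> Rn n" "y' \<in> Rn n" and eq: "\<forall>j\<in>J. y j = y' j" "\<forall>j\<in>J. y' j = y j"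
    using assms unfolding graph_point_def by auto
  show ?thesis
    using graph_point_unique_aux[OF y eq(1) e(2,3) e'(3) e(1)]
      graph_point_unique_aux[OF y(2,1,4,3) eq(2) e'(2,3) e(3) e'(1)] by fastforce
qed

text \<open>Only finitely many coordinates count, so membership leaves some room; it is spent in
  \<open>graph_point_locally_smooth\<close> on moving both the point and the centre.\<close>

lemma cube_shrink:
  assumes "x \<in> cube n p e" "e > 0"
  shows "\<exists>e'>0. e' < e \<and> x \<in> cube n p e'"
proof -
  define m where "m = Max (insert 0 ((\<lambda>i. \<bar>x i - p i\<bar>) ` {..<n}))"
  have "m < e" unfolding m_def using cubeD[OF assms(1)] assms(2) by (subst Max_less_iff) auto
  moreover have m: "0 \<le> m" "\<bar>x i - p i\<bar> \<le> m" if "i < n" for i unfolding m_def using that by (auto intro: Max_ge)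
  moreover have "0 \<le> m" unfolding m_def by (intro Max_ge) auto
  moreover have "m < (m + e) / 2" using \<open>m < e\<close> by (simp add: field_simps)
  ultimately have "\<bar>x i - p i\<bar> < (m + e) / 2" if "i < n" for i
    using le_less_trans[OF m(2)[OF that]] by blast
  then show ?thesis using cube_Rn[OF assms(1)] \<open>m < e\<close> \<open>0 \<le> m\<close>
    by (intro exI[of _ "(m + e) / 2"]) (auto simp: cube_def)
qed

lemma graph_point_self:
  assumes M: "M \<subseteq> Rn n" and J: "J \<subseteq> {..<n}" and y: "y \<in> U" "local_graph n M J y"
  shows "graph_point n M J U y y"
proof -
  have yM: "y \<in> M" using y(2) by (simp add: local_graph_def)
  obtain e L where e: "e > 0" and L: "\<forall>a\<in>M \<inter> cube n y e. \<forall>b\<in>M \<inter> cube n y e. \<forall>i<n.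
      \<bar>a i - b i\<bar> \<le> L * (\<Sum>j\<in>J. \<bar>a j - b j\<bar>)"
    using y(2) unfolding local_graph_def lipschitz_over_def by blast
  have "a = b" if a: "a \<in> M \<inter> cube n y e" and b: "b \<in> M \<inter> cube n y e" and eq: "\<forall>j\<in>J. a j = b j" for a b
  proof (rule Rn_eqI[of _ n])
    show "a \<in> Rn n" "b \<in> Rn n" using a b M by auto
    fix i assume "i < n"
    then have "\<bar>a i - b i\<bar> \<le> L * (\<Sum>j\<in>J. \<bar>a j - b j\<bar>)" using L a b by blast
    also have "\<dots> = 0" using eq by simp
    finally show "a i = b i" by simp
  qed
  then have "isolated_over n M J y e" unfolding isolated_over_def by blast
  moreover have "y \<in> cube n y (e / 2)" using yM M e by (intro centre_in_cube) auto
  ultimately show ?thesis using y e unfolding graph_point_def by blast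
qed

lemma graph_point_of_mem:
  assumes M: "M \<subseteq> Rn n" and U: "U \<subseteq> M" and x: "x \<in> M" and gp: "graph_point n M J U x y"
  shows "x = y"
proof -
  obtain e where e: "e > 0" "isolated_over n M J y e" "x \<in> cube n y (e / 2)" and y: "y \<in> U" "\<forall>j\<in>J. y j = x j"
    using gp unfolding graph_point_def by blast
  have "x \<in> M \<inter> cube n y e" using x e(1,3) cube_mono[of "e / 2" e n y] by auto
  moreover have "y \<in> M \<inter> cube n y e" using y U M e(1) by (intro IntI centre_in_cube) auto
  moreover have "\<forall>j\<in>J. x j = y j" using y(2) by simp
  ultimately show ?thesis using e(2) unfolding isolated_over_def by blast
qed

text \<open>Serves both the openness of the domain of the extension and the smoothness of the map to
  graph points. The neighbourhood \<open>W'\<close> is used to steer these points into a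
  chart.\<close>

lemma graph_point_locally_smooth:
  assumes M: "smooth_submanifold n M" and J: "J \<subseteq> {..<n}"
    and U: "openin (subtopology (Euclidean_space n) M) U"
    and x0: "x0 \<in> Rn n" and gp: "graph_point n M J U x0 y0"
    and W': "openin (Euclidean_space n) W'" "y0 \<in> W'"
  shows "\<exists>T \<rho>. openin (Euclidean_space n) T \<and> x0 \<in> T \<and> (\<forall>j<n. smooth_on n T (\<lambda>x. \<rho> x j)) \<and>
    (\<forall>x\<in>T. graph_point n M J U x (\<rho> x) \<and> \<rho> x \<in> W')"
proof -
  have MR: "M \<subseteq> Rn n" using M by (simp add: smooth_submanifold_def)
  have UM: "U \<subseteq> M" and Ucube: "\<forall>p\<in>U. \<exists>e>0. cube n p e \<inter> M \<subseteq> U"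
    using U unfolding openin_subtopology_cube_iff[OF MR] by blast+
  obtain e where e: "e > 0" "isolated_over n M J y0 e" "x0 \<in> cube n y0 (e / 2)"
    and y0: "y0 \<in> U" "\<forall>j\<in>J. y0 j = x0 j" "local_graph n M J y0"
    using gp unfolding graph_point_def by blast
  have yM: "y0 \<in> M" and yR: "y0 \<in> Rn n" using y0(1) UM MR by auto
  obtain W r where r: "coord_retraction n M J W r" and yW: "y0 \<in> W"
    using local_graph_imp_retraction[OF M J y0(3)] by (elim exE conjE)
  note rD = coord_retractionD[OF r]
  obtain m where m: "0 < m" "m < e / 2" "x0 \<in> cube n y0 m" using cube_shrink[OF e(3)] e(1) by auto
  obtain eU where eU: "eU > 0" "cube n y0 eU \<inter> M \<subseteq> U" using Ucube y0(1) by blast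
  \<comment> \<open>When x0 and y0 move by less than \<eta>, x must stay within half the reduced
    radius e - \<eta> of its graph point. This asks for 5 \<eta> < e - 2 m, and the divisor 6 leaves
    a margin.\<close>
  define \<eta> where "\<eta> = (e - 2 * m) / 6"
  have "e - \<eta> = (5 * e + 2 * m) / 6" by (simp add: \<eta>_def field_simps)
  then have \<eta>: "\<eta> > 0" "2 * \<eta> + m < (e - \<eta>) / 2" "e - \<eta> > 0"
    using m(1,2) e(1) by (auto simp: \<eta>_def field_simps)
  \<comment> \<open>x0 may be too far from y0 to lie in the domain \<open>W\<close> of r. Since r
    reads only \<open>J\<close>, it is applied to y0 with the coordinates in \<open>J\<close>
    replaced by those of x.\<close>
  define \<sigma> where "\<sigma> x = (\<lambda>i. if i \<in> J then x i else y0 i)" for x :: "nat \<Rightarrow> real"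
  have \<sigma>R: "\<sigma> x \<in> Rn n" if "x \<in> Rn n" for x using that yR by (auto simp: \<sigma>_def Rn_iff)
  have \<sigma>x0: "\<sigma> x0 = y0" using y0(2) by (auto simp: \<sigma>_def)
  have s\<sigma>: "smooth_on n V (\<lambda>x. \<sigma> x j)" if "openin (Euclidean_space n) V" for V j
    using that by (cases "j \<in> J") (auto simp: \<sigma>_def intro: smooth_on_coord smooth_on_const)
  define T1 where "T1 = {x \<in> Rn n. \<sigma> x \<in> W}"
  have oT1: "openin (Euclidean_space n) T1" unfolding T1_def
    using \<sigma>R by (intro openin_preimage_vec[OF openin_Rn _ rD(1)]
        continuous_on_vec[OF \<sigma>R smooth_on_continuous[OF s\<sigma>[OF openin_Rn]]]) auto
  define \<rho> where "\<rho> x = r (\<sigma> x)" for x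
  have \<rho>x0: "\<rho> x0 = y0" using rD(5)[OF yM yW] by (simp add: \<rho>_def \<sigma>x0)
  have \<rho>M: "\<rho> x \<in> M" if "x \<in> T1" for x using that rD(3) by (auto simp: T1_def \<rho>_def)
  have s\<rho>: "smooth_on n T1 (\<lambda>x. \<rho> x j)" if "j < n" for j
    unfolding \<rho>_def
    by (rule smooth_on_compose[where f = "\<lambda>x. r x j" and G = \<sigma>, OF oT1 rD(1) _ rD(2)[OF that] s\<sigma>[OF oT1]])
      (simp add: T1_def)
  have c\<rho>: "continuous_on T1 \<rho>"
    using \<rho>M MR by (intro continuous_on_vec[OF _ smooth_on_continuous[OF s\<rho>]]) auto
  define B where "B = cube n y0 eU \<inter> W \<inter> cube n y0 \<eta> \<inter> W'"
  have oB: "openin (Euclidean_space n) B" unfolding B_def by (intro openin_Int openin_cube rD(1) W'(1))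
  have yB: "y0 \<in> B" using centre_in_cube[OF yR] eU(1) \<eta>(1) yW W'(2) by (simp add: B_def)
  define T where "T = {x \<in> T1. \<rho> x \<in> B} \<inter> cube n x0 \<eta>"
  have oT: "openin (Euclidean_space n) T" unfolding T_def
    using \<rho>M MR by (intro openin_Int openin_cube openin_preimage_vec[OF oT1 c\<rho> oB]) auto
  have "x0 \<in> T" using x0 yW yB \<rho>x0 \<sigma>x0 centre_in_cube[OF x0 \<eta>(1)] by (simp add: T_def T1_def)
  moreover have "smooth_on n T (\<lambda>x. \<rho> x j)" if "j < n" for j
    by (rule smooth_on_subset[OF s\<rho>[OF that]]) (auto simp: T_def)
  moreover have "graph_point n M J U x (\<rho> x) \<and> \<rho> x \<in> W'" if x: "x \<in> T" for x
  proof
    have xT1: "x \<in> T1" and \<rho>B: "\<rho> x \<in> B" and xc: "x \<in> cube n x0 \<eta>" using x by (auto simp: T_def)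
    have \<rho>c: "\<rho> x \<in> cube n y0 \<eta>" using \<rho>B by (simp add: B_def)
    show "\<rho> x \<in> W'" using \<rho>B by (simp add: B_def)
    have "\<rho> x \<in> U" using \<rho>B \<rho>M[OF xT1] eU(2) by (auto simp: B_def)
    moreover have "local_graph n M J (\<rho> x)"
      using \<rho>B by (intro retraction_imp_local_graph[OF MR J r \<rho>M[OF xT1]]) (simp add: B_def)
    moreover have "\<rho> x j = x j" if "j \<in> J" for j
      using rD(4)[of "\<sigma> x" j] xT1 that by (simp add: T1_def \<rho>_def) (simp add: \<sigma>_def)
    moreover have "isolated_over n M J (\<rho> x) (e - \<eta>)"
    proof -
      have "cube n (\<rho> x) (e - \<eta>) \<subseteq> cube n y0 e"
        using cubeD[OF \<rho>c] by (fastforce simp: cube_def)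
      then show ?thesis using e(2) unfolding isolated_over_def by blast
    qed
    moreover have "x \<in> cube n (\<rho> x) ((e - \<eta>) / 2)"
    proof -
      have "\<bar>x i - \<rho> x i\<bar> < (e - \<eta>) / 2" if "i < n" for i
        using cubeD[OF xc that] cubeD[OF \<rho>c that] cubeD[OF m(3) that] \<eta>(2) by linarith
      then show ?thesis using cube_Rn[OF xc] by (simp add: cube_def)
    qed
    ultimately show "graph_point n M J U x (\<rho> x)" using \<eta>(3) unfolding graph_point_def by blast
  qed
  ultimately show ?thesis using oT by blast
qed

section \<open>Definability of local graphs and graph points\<close>

lemma definable_fun_divide_const: "definable_fun a \<Longrightarrow> definable_fun (\<lambda>z. a z / c)"
  using definable_fun_mult[OF definable_fun_const[of "1 / c"], of a] by simp

lemma definable_cube: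
  assumes "\<And>i. definable_fun (\<lambda>z. h z i)" "\<And>i. definable_fun (\<lambda>z. p z i)" "definable_fun e"
  shows "definable (\<lambda>z. trunc n (h z) \<in> cube n (p z) (e z))"
proof -
  have "definable (\<lambda>z. \<forall>i<n. \<bar>trunc n (h z) i - p z i\<bar> < e z)"
    by (intro definable_all_less definable_less definable_fun_abs definable_fun_diff definable_fun_trunc assms)
  then show ?thesis by (simp add: cube_def)
qed

text \<open>Brings bounded quantifiers into the form of \<open>definable_all_Rn\<close> and
  \<open>definable_ex_Rn\<close>.\<close>

lemma Ball_Int_Rn: "M \<subseteq> Rn n \<Longrightarrow> (\<forall>y\<in>M \<inter> A. P y) \<longleftrightarrow> (\<forall>y\<in>Rn n. y \<in> M \<and> y \<in> A \<longrightarrow> P y)"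
  and Bex_Int_Rn: "M \<subseteq> Rn n \<Longrightarrow> (\<exists>y\<in>M \<inter> A. P y) \<longleftrightarrow> (\<exists>y\<in>Rn n. y \<in> M \<and> y \<in> A \<and> P y)"
  and Ball_cube_Rn: "(\<forall>y\<in>cube n p e. P y) \<longleftrightarrow> (\<forall>y\<in>Rn n. y \<in> cube n p e \<longrightarrow> P y)"
  using cube_Rn by blast+

lemma definable_lipschitz_over:
  assumes M: "semialgebraic n M" and J: "finite J"
  shows "definable (\<lambda>z. lipschitz_over n M J (trunc n z))"
  unfolding lipschitz_over_def Ball_Int_Rn[OF semialgebraic_subset[OF M]]
  by (intro definable_ex definable_all_Rn definable_conj definable_imp definable_all_less definable_less definable_le
      definable_cube definable_mem[OF M] definable_fun_const definable_fun_coord definable_fun_mult definable_fun_abs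
      definable_fun_diff definable_fun_sum definable_fun_trunc)

lemma definable_local_graph_aux:
  assumes M: "semialgebraic n M" and J: "finite J"
  shows "definable (\<lambda>z. local_graph n M J (trunc n z))"
  unfolding local_graph_def Ball_cube_Rn Bex_Int_Rn[OF semialgebraic_subset[OF M]]
  by (intro definable_conj definable_mem[OF M] definable_lipschitz_over[OF M J] definable_ex definable_all
      definable_all_Rn definable_ex_Rn definable_imp definable_less
      definable_eq definable_cube definable_finite_all[OF J] definable_fun_const definable_fun_coord definable_fun_trunc)

lemma definable_local_graph:
  assumes "semialgebraic n M" "finite J" "\<And>i. definable_fun (\<lambda>z. h z i)"
  shows "definable (\<lambda>z. local_graph n M J (trunc n (h z)))"
  by (rule definable_subst_funs[OF definable_local_graph_aux[OF assms(1,2)] assms(3)])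

lemma Rn_eq_iff: "x \<in> Rn n \<Longrightarrow> y \<in> Rn n \<Longrightarrow> x = y \<longleftrightarrow> (\<forall>i<n. x i = y i)"
  using Rn_eqI[of x n y] by blast

lemma definable_isolated_over:
  assumes M: "semialgebraic n M" and J: "finite J"
    and h: "\<And>i. definable_fun (\<lambda>z. h z i)" and e: "definable_fun e"
  shows "definable (\<lambda>z. isolated_over n M J (trunc n (h z)) (e z))"
proof -
  have iff: "isolated_over n M J y e \<longleftrightarrow> (\<forall>a\<in>Rn n. a \<in> M \<and> a \<in> cube n y e \<longrightarrow>
      (\<forall>b\<in>Rn n. b \<in> M \<and> b \<in> cube n y e \<longrightarrow> (\<forall>j\<in>J. a j = b j) \<longrightarrow> (\<forall>i<n. a i = b i)))" for y e
    unfolding isolated_over_def Ball_Int_Rn[OF semialgebraic_subset[OF M]] by (simp add: Rn_eq_iff cong: ball_cong)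
  have "definable (\<lambda>w. isolated_over n M J (trunc n (\<lambda>i. w (Some i))) (w None))"
    unfolding iff
    by (intro definable_all_Rn definable_imp definable_conj definable_mem[OF M] definable_cube definable_finite_all[OF J]
        definable_all_less definable_eq definable_fun_coord definable_fun_trunc)
  moreover have "definable_fun (\<lambda>z. case v of None \<Rightarrow> e z | Some i \<Rightarrow> h z i)" for v
    using h e by (cases v) auto
  ultimately show ?thesis
    using definable_subst_funs[where h = "\<lambda>z v. case v of None \<Rightarrow> e z | Some i \<Rightarrow> h z i" and
        P = "\<lambda>w. isolated_over n M J (trunc n (\<lambda>i. w (Some i))) (w None)"] by simp
qed

lemma definable_graph_point:
  assumes M: "semialgebraic n M" and J: "finite J" and U: "semialgebraic n U"
  shows "definable (\<lambda>w. graph_point n M J U (trunc n (\<lambda>v. w (Inl v))) (trunc n (\<lambda>i. w (Inr i))))"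
  unfolding graph_point_def
  by (intro definable_conj definable_mem[OF U] definable_local_graph[OF M J] definable_finite_all[OF J]
      definable_ex definable_isolated_over[OF M J] definable_cube definable_eq definable_less definable_fun_const
      definable_fun_coord definable_fun_trunc definable_fun_divide_const)

text \<open>The domain consists of all points that have a graph point in U, and the extension
  evaluates f there. Uniqueness of graph points makes this a definition by formulas, hence
  semi-algebraic although the charts need not be; smoothness is local and may use them.\<close>

lemma smooth_on_submanifold_extend:
  assumes M: "smooth_submanifold n M" "semialgebraic n M" and J: "J \<subseteq> {..<n}"
    and U: "U \<in> semialgebraic_opens n M"
    and f: "smooth_on_submanifold n M U f" "semialgebraic_fun n U f"
  shows "\<exists>V g. open_semialgebraic n V \<and> Nash_fun n V g \<and> V \<inter> M = {x \<in> U. local_graph n M J x} \<and>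
    (\<forall>x\<in>V \<inter> M. f x = g x)"
proof -
  have MR: "M \<subseteq> Rn n" using M by (simp add: smooth_submanifold_def)
  have Usa: "semialgebraic n U" and Uop: "openin (subtopology (Euclidean_space n) M) U"
    using U by (auto simp: semialgebraic_opens_def)
  have UM: "U \<subseteq> M" using Uop unfolding openin_subtopology_cube_iff[OF MR] by blast
  have UR: "U \<subseteq> Rn n" using UM MR by blast
  have finJ: "finite J" using J finite_subset by blast
  let ?gp = "graph_point n M J U"
  define V where "V = {x \<in> Rn n. \<exists>y\<in>Rn n. ?gp x y}"
  define g where "g x = f (THE y. ?gp x y)" for x
  have geq: "g x = f y" if "?gp x y" for x y
    unfolding g_def using that graph_point_unique[OF UM MR that] by (metis the_equality)
  have gpR: "y \<in> Rn n" if "?gp x y" for x y using that UR by (auto simp: graph_point_def)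
  have "semialgebraic n V"
    unfolding V_def by (intro semialgebraic_Collect definable_ex_Rn definable_graph_point M(2) finJ Usa)
  moreover have oV: "openin (Euclidean_space n) V"
    unfolding openin_Rn_iff
  proof (intro conjI ballI)
    show "V \<subseteq> Rn n" by (auto simp: V_def)
    fix x assume "x \<in> V"
    then obtain y where x: "x \<in> Rn n" and gp: "?gp x y" by (auto simp: V_def)
    from graph_point_locally_smooth[OF M(1) J Uop x gp openin_Rn gpR[OF gp]] obtain T \<rho>
      where T: "openin (Euclidean_space n) T" "x \<in> T" "\<forall>x\<in>T. ?gp x (\<rho> x) \<and> \<rho> x \<in> Rn n"
      by (elim exE conjE)
    obtain e where e: "e > 0" "cube n x e \<subseteq> T" using openin_cubeE[OF T(1,2)] .
    then have "cube n x e \<subseteq> V" using T(3) cube_Rn unfolding V_def by blast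
    then show "\<exists>e>0. cube n x e \<subseteq> V" using e(1) by blast
  qed
  moreover have "smooth_on n V g"
  proof (rule smooth_on_local)
    show "V \<subseteq> Rn n" by (auto simp: V_def)
    fix x assume "x \<in> V"
    then obtain y where x: "x \<in> Rn n" and gp: "?gp x y" by (auto simp: V_def)
    have yU: "y \<in> U" using gp by (simp add: graph_point_def)
    obtain d W \<phi> \<psi> where sc: "slice_chart n M d W \<phi> \<psi>" and yW: "y \<in> W"
      and sf: "smooth_on d (\<phi> ` (U \<inter> W)) (f \<circ> \<psi>)"
      using f(1) yU unfolding smooth_on_submanifold_def by blast
    note scD = slice_chartD[OF sc]
    from graph_point_locally_smooth[OF M(1) J Uop x gp scD(2) yW] obtain T \<rho>
      where T: "openin (Euclidean_space n) T" "x \<in> T" "\<forall>j<n. smooth_on n T (\<lambda>x. \<rho> x j)"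
        "\<forall>x\<in>T. ?gp x (\<rho> x) \<and> \<rho> x \<in> W"
      by (elim exE conjE)
    have \<rho>: "\<rho> z \<in> U \<inter> W" if "z \<in> T" for z using T(4) that by (auto simp: graph_point_def)
    have dj: "j < n" if "j < d" for j using that scD(1) by simp
    have s\<phi>\<rho>: "smooth_on n T (\<lambda>z. \<phi> (\<rho> z) j)" if "j < d" for j
      by (rule smooth_on_compose[where f = "\<lambda>x. \<phi> x j" and G = \<rho>, OF T(1) scD(2) _ scD(4)[OF dj[OF that]]])
        (use \<rho> T(3) in auto)
    \<comment> \<open>f is known to be smooth only after composition with \<psi>, so it is factored
      through the chart, whose image of U is open in R^d.\<close>
    have "smooth_on n T (\<lambda>z. (f \<circ> \<psi>) (\<phi> (\<rho> z)))"
      by (rule smooth_on_compose[where G = "\<lambda>z. \<phi> (\<rho> z)", OF T(1) slice_chart_image_open[OF MR sc Uop] _ sf s\<phi>\<rho>])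
        (use \<rho> in auto)
    then have "smooth_on n T g"
    proof (rule smooth_on_cong[OF _ T(1)])
      fix z assume z: "z \<in> T"
      then have "g z = f (\<rho> z)" using T(4) geq by blast
      then show "g z = (f \<circ> \<psi>) (\<phi> (\<rho> z))" using \<rho>[OF z] scD(6)[of "\<rho> z"] by simp
    qed
    then show "\<exists>W. openin (Euclidean_space n) W \<and> x \<in> W \<and> smooth_on n (W \<inter> V) g"
      using T(1,2) by (meson Int_lower1 smooth_on_subset)
  qed
  moreover have "semialgebraic_fun n V g"
  proof (rule semialgebraic_funI)
    show "V \<subseteq> Rn n" by (auto simp: V_def)
    have "definable (\<lambda>z. \<exists>y\<in>Rn n. ?gp (trunc n z) y \<and> (y \<in> U \<and> f y = z n))"
      by (intro definable_ex_Rn definable_conj definable_graph_point M(2) finJ Usa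
          semialgebraic_fun_definable_eq[OF f(2) UR] definable_fun_coord)
    moreover have "(\<exists>y\<in>Rn n. ?gp (trunc n z) y \<and> (y \<in> U \<and> f y = z n)) \<longleftrightarrow>
        trunc n z \<in> V \<and> g (trunc n z) = z n" for z
    proof
      assume "\<exists>y\<in>Rn n. ?gp (trunc n z) y \<and> (y \<in> U \<and> f y = z n)"
      then show "trunc n z \<in> V \<and> g (trunc n z) = z n" using geq by (auto simp: V_def)
    next
      assume R: "trunc n z \<in> V \<and> g (trunc n z) = z n"
      then obtain y where y: "y \<in> Rn n" "?gp (trunc n z) y" by (auto simp: V_def)
      then have "y \<in> U" by (simp add: graph_point_def)
      then show "\<exists>y\<in>Rn n. ?gp (trunc n z) y \<and> (y \<in> U \<and> f y = z n)" using y geq[OF y(2)] R by auto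
    qed
    ultimately show "definable (\<lambda>z. trunc n z \<in> V \<and> g (trunc n z) = z n)" by simp
  qed
  moreover have VM: "V \<inter> M = {x \<in> U. local_graph n M J x}"
  proof (intro equalityI subsetI)
    fix x assume "x \<in> V \<inter> M"
    then obtain y where y: "?gp x y" "x \<in> M" by (auto simp: V_def)
    then have "x = y" using graph_point_of_mem[OF MR UM] by blast
    then show "x \<in> {x \<in> U. local_graph n M J x}" using y by (simp add: graph_point_def)
  next
    fix x assume x: "x \<in> {x \<in> U. local_graph n M J x}"
    then have "?gp x x" using graph_point_self[OF MR J] by blast
    then show "x \<in> V \<inter> M" using x UM UR by (auto simp: V_def)
  qed
  moreover have "f x = g x" if "x \<in> V \<inter> M" for x
  proof -
    have "x \<in> U" "local_graph n M J x" using that VM by auto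
    then have "?gp x x" using graph_point_self[OF MR J] by blast
    then show ?thesis using geq by simp
  qed
  ultimately show ?thesis unfolding open_semialgebraic_def Nash_fun_def by blast
qed

section \<open>QN varieties as \<open>\<real>\<close>-spaces\<close>

text \<open>Sets of pairs instead of numbered families: unions and refinements of covers then need
  no renumbering.\<close>

definition qn_cover ::
    "nat \<Rightarrow> (nat \<Rightarrow> real) set \<Rightarrow> (nat \<Rightarrow> real) set \<Rightarrow> ((nat \<Rightarrow> real) \<Rightarrow> real) \<Rightarrow>
      ((nat \<Rightarrow> real) set \<times> ((nat \<Rightarrow> real) \<Rightarrow> real)) set \<Rightarrow> bool"
  where "qn_cover n Y U f \<V> \<longleftrightarrow> finite \<V> \<and>
    (\<forall>(V, g)\<in>\<V>. open_semialgebraic n V \<and> Nash_fun n V g \<and> (\<forall>x\<in>V \<inter> Y. f x = g x)) \<and>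
    U = (\<Union>(V, g)\<in>\<V>. V \<inter> Y)"

lemma QN_sections_iff: "f \<in> QN_sections n Y U \<longleftrightarrow> f \<in> extensional U \<and> (\<exists>\<V>. qn_cover n Y U f \<V>)"
proof
  assume "f \<in> QN_sections n Y U"
  then obtain N :: nat and V g where f: "f \<in> extensional U"
    "\<And>i. i < N \<Longrightarrow> open_semialgebraic n (V i) \<and> Nash_fun n (V i) (g i)"
    "U = (\<Union>i<N. V i \<inter> Y)" "\<And>i x. i < N \<Longrightarrow> x \<in> V i \<inter> Y \<Longrightarrow> f x = g i x"
    unfolding QN_sections_def by blast
  have "qn_cover n Y U f ((\<lambda>i. (V i, g i)) ` {..<N})"
    unfolding qn_cover_def using f(2-4) by auto
  then show "f \<in> extensional U \<and> (\<exists>\<V>. qn_cover n Y U f \<V>)" using f(1) by blast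
next
  assume "f \<in> extensional U \<and> (\<exists>\<V>. qn_cover n Y U f \<V>)"
  then obtain \<V> where f: "f \<in> extensional U" and \<V>: "qn_cover n Y U f \<V>" by blast
  then have "finite \<V>" by (simp add: qn_cover_def)
  then obtain N :: nat and h where h: "\<V> = h ` {i. i < N}" using finite_imp_nat_seg_image_inj_on by metis
  have "\<forall>i<N. open_semialgebraic n (fst (h i)) \<and> Nash_fun n (fst (h i)) (snd (h i))"
    "U = (\<Union>i<N. fst (h i) \<inter> Y)" "\<forall>i<N. \<forall>x\<in>fst (h i) \<inter> Y. f x = snd (h i) x"
    using \<V> unfolding qn_cover_def h by (auto simp: case_prod_unfold)
  then show "f \<in> QN_sections n Y U" using f unfolding QN_sections_def
    by (intro CollectI conjI exI[of _ N] exI[of _ "\<lambda>i. fst (h i)"] exI[of _ "\<lambda>i. snd (h i)"]) auto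
qed

section \<open>Open semi-algebraic subsets\<close>

lemma semialgebraic_empty: "semialgebraic n {}"
  using semialgebraic_Collect[OF definable_const[of False], of n] by simp

lemma semialgebraic_finite_UN:
  "finite I \<Longrightarrow> (\<And>i. i \<in> I \<Longrightarrow> semialgebraic n (V i)) \<Longrightarrow> semialgebraic n (\<Union>i\<in>I. V i)"
  by (induction I rule: finite_induct) (auto intro: semialgebraic_empty semialgebraic.union)

lemma semialgebraic_opens_iff:
  assumes "Y \<subseteq> Rn n"
  shows "U \<in> semialgebraic_opens n Y \<longleftrightarrow>
    semialgebraic n U \<and> U \<subseteq> Y \<and> (\<forall>p\<in>U. \<exists>e>0. cube n p e \<inter> Y \<subseteq> U)"
  unfolding semialgebraic_opens_def openin_subtopology_cube_iff[OF assms] by simp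

lemma open_semialgebraic_UN_Int:
  assumes Y: "semialgebraic n Y" and I: "finite I" "\<And>i. i \<in> I \<Longrightarrow> open_semialgebraic n (V i)"
  shows "(\<Union>i\<in>I. V i \<inter> Y) \<in> semialgebraic_opens n Y"
  unfolding semialgebraic_opens_iff[OF semialgebraic_subset[OF Y]]
proof (intro conjI ballI)
  show "semialgebraic n (\<Union>i\<in>I. V i \<inter> Y)"
    using I by (intro semialgebraic_finite_UN semialgebraic.inter Y) (auto simp: open_semialgebraic_def)
  fix p assume "p \<in> (\<Union>i\<in>I. V i \<inter> Y)"
  then obtain i where i: "i \<in> I" "p \<in> V i" by blast
  then obtain e where "e > 0" "cube n p e \<subseteq> V i"
    using I(2) openin_cubeE unfolding open_semialgebraic_def by blast
  then show "\<exists>e>0. cube n p e \<inter> Y \<subseteq> (\<Union>i\<in>I. V i \<inter> Y)" using i by blast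
qed auto

lemma qn_cover_open:
  assumes "semialgebraic n Y" "qn_cover n Y U f \<V>"
  shows "U \<in> semialgebraic_opens n Y"
proof -
  have "U = (\<Union>v\<in>\<V>. fst v \<inter> Y)" using assms(2) by (simp add: qn_cover_def case_prod_unfold)
  moreover have "finite \<V>" "\<And>v. v \<in> \<V> \<Longrightarrow> open_semialgebraic n (fst v)"
    using assms(2) by (auto simp: qn_cover_def case_prod_unfold)
  ultimately show ?thesis using open_semialgebraic_UN_Int[OF assms(1), of \<V> fst] by simp
qed

text \<open>The union of all cubes about points of U whose trace on Y lies in U has trace U.
  Quantifying over the radius instead of choosing one keeps the union definable.\<close>

lemma semialgebraic_open_extension:
  assumes Y: "semialgebraic n Y" and U: "U \<in> semialgebraic_opens n Y"
  shows "\<exists>V. open_semialgebraic n V \<and> V \<inter> Y = U"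
proof -
  have YR: "Y \<subseteq> Rn n" by (rule semialgebraic_subset[OF Y])
  have U: "semialgebraic n U" "U \<subseteq> Y" "\<forall>p\<in>U. \<exists>e>0. cube n p e \<inter> Y \<subseteq> U"
    using U unfolding semialgebraic_opens_iff[OF YR] by auto
  define V where "V = {x \<in> Rn n. \<exists>p\<in>Rn n. p \<in> U \<and>
    (\<exists>e. e > 0 \<and> (\<forall>y\<in>Rn n. y \<in> cube n p e \<and> y \<in> Y \<longrightarrow> y \<in> U) \<and> x \<in> cube n p e)}"
  have "semialgebraic n V"
    unfolding V_def
    by (intro semialgebraic_Collect definable_ex_Rn definable_all_Rn definable_ex definable_conj definable_imp
        definable_mem[OF Y] definable_mem[OF U(1)] definable_cube definable_less definable_fun_const
        definable_fun_coord definable_fun_trunc)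
  moreover have "openin (Euclidean_space n) V"
    unfolding openin_Rn_iff
  proof (intro conjI ballI)
    fix x assume "x \<in> V"
    then obtain p e where p: "p \<in> Rn n" "p \<in> U" "e > 0" "\<forall>y\<in>Rn n. y \<in> cube n p e \<and> y \<in> Y \<longrightarrow> y \<in> U" "x \<in> cube n p e"
      unfolding V_def by blast
    obtain r where r: "r > 0" "cube n x r \<subseteq> cube n p e" using openin_cubeE[OF openin_cube p(5)] .
    have "z \<in> V" if "z \<in> cube n x r" for z
      using that r(2) p cube_Rn[OF that] unfolding V_def by blast
    then show "\<exists>e>0. cube n x e \<subseteq> V" using r(1) by blast
  qed (auto simp: V_def)
  moreover have "V \<inter> Y = U"
  proof (intro equalityI subsetI)
    fix x assume "x \<in> V \<inter> Y"
    then show "x \<in> U" unfolding V_def using YR by blast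
  next
    fix x assume x: "x \<in> U"
    then obtain e where e: "e > 0" "cube n x e \<inter> Y \<subseteq> U" using U(3) by blast
    have xR: "x \<in> Rn n" using x U(2) YR by blast
    have "\<forall>y\<in>Rn n. y \<in> cube n x e \<and> y \<in> Y \<longrightarrow> y \<in> U" using e(2) by blast
    then show "x \<in> V \<inter> Y" unfolding V_def using x U(2) xR e(1) centre_in_cube[OF xR e(1)] by blast
  qed
  ultimately show ?thesis unfolding open_semialgebraic_def by blast
qed

lemma open_semialgebraic_Int:
  "open_semialgebraic n V \<Longrightarrow> open_semialgebraic n W \<Longrightarrow> open_semialgebraic n (V \<inter> W)"
  by (auto simp: open_semialgebraic_def intro: semialgebraic.inter)

lemma open_semialgebraic_Rn: "open_semialgebraic n (Rn n)"
  using semialgebraic_Collect[of "\<lambda>_. True" n] definable_const[of True] openin_Rn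
  by (simp add: open_semialgebraic_def)

section \<open>Algebra of Nash functions and QN sections\<close>

lemma Nash_fun_subset:
  assumes V: "open_semialgebraic n V" and g: "Nash_fun n V g" and W: "open_semialgebraic n W" "W \<subseteq> V"
  shows "Nash_fun n W g"
proof -
  have VR: "V \<subseteq> Rn n" and Wsa: "semialgebraic n W"
    using V W semialgebraic_subset by (auto simp: open_semialgebraic_def)
  have "definable (\<lambda>z. trunc n z \<in> W \<and> (trunc n z \<in> V \<and> g (trunc n z) = z n))"
    using g unfolding Nash_fun_def
    by (intro definable_conj definable_mem[OF Wsa] semialgebraic_fun_definable_eq VR definable_fun_coord) auto
  moreover have "trunc n z \<in> W \<and> (trunc n z \<in> V \<and> g (trunc n z) = z n) \<longleftrightarrow> trunc n z \<in> W \<and> g (trunc n z) = z n" for z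
    using W(2) by blast
  ultimately have "semialgebraic_fun n W g" using W(2) VR by (intro semialgebraic_funI) auto
  then show ?thesis using g W(2) smooth_on_subset unfolding Nash_fun_def by blast
qed

lemma Nash_fun_const:
  assumes V: "open_semialgebraic n V"
  shows "Nash_fun n V (\<lambda>x. c)"
proof -
  have V': "semialgebraic n V" "openin (Euclidean_space n) V" using V by (auto simp: open_semialgebraic_def)
  have "semialgebraic_fun n V (\<lambda>x. c)"
    by (intro semialgebraic_funI semialgebraic_subset[OF V'(1)] definable_conj definable_mem[OF V'(1)] definable_eq
        definable_fun_const definable_fun_coord)
  then show ?thesis unfolding Nash_fun_def using smooth_on_const[OF V'(2)] by blast
qed

text \<open>The graph is described by quantifying over the two values; the variable type in the last
  hypothesis is the one that arises from these two quantifiers. Sum and product share this argument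
  and differ only in smoothness and definability of the operation.\<close>

lemma Nash_fun_binop:
  assumes V: "open_semialgebraic n V" and f: "Nash_fun n V f" and g: "Nash_fun n V g"
    and sm: "smooth_on n V (\<lambda>x. op (f x) (g x))"
    and df: "\<And>a b :: (nat option option \<Rightarrow> real) \<Rightarrow> real. definable_fun a \<Longrightarrow> definable_fun b \<Longrightarrow> definable_fun (\<lambda>z. op (a z) (b z))"
  shows "Nash_fun n V (\<lambda>x. op (f x) (g x))"
proof -
  have VR: "V \<subseteq> Rn n" using V semialgebraic_subset by (auto simp: open_semialgebraic_def)
  have sa: "semialgebraic_fun n V f" "semialgebraic_fun n V g" using f g by (auto simp: Nash_fun_def)
  have "definable (\<lambda>z. \<exists>s. \<exists>t. (trunc n z \<in> V \<and> f (trunc n z) = s) \<and> (trunc n z \<in> V \<and> g (trunc n z) = t) \<and> op s t = z n)"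
    by (intro definable_ex definable_conj semialgebraic_fun_definable_eq[OF sa(1) VR] semialgebraic_fun_definable_eq[OF sa(2) VR]
        definable_eq df definable_fun_coord)
  moreover have "(\<exists>s. \<exists>t. (trunc n z \<in> V \<and> f (trunc n z) = s) \<and> (trunc n z \<in> V \<and> g (trunc n z) = t) \<and> op s t = z n)
      \<longleftrightarrow> trunc n z \<in> V \<and> op (f (trunc n z)) (g (trunc n z)) = z n" for z by blast
  ultimately have "semialgebraic_fun n V (\<lambda>x. op (f x) (g x))" using VR by (intro semialgebraic_funI) auto
  then show ?thesis using sm unfolding Nash_fun_def by blast
qed

lemma Nash_fun_add:
  assumes "open_semialgebraic n V" "Nash_fun n V f" "Nash_fun n V g"
  shows "Nash_fun n V (\<lambda>x. f x + g x)"
proof (rule Nash_fun_binop[where op = "(+)", OF assms])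
  show "smooth_on n V (\<lambda>x. f x + g x)"
    using assms unfolding Nash_fun_def open_semialgebraic_def by (intro smooth_on_add) blast+
qed (rule definable_fun_add)

lemma Nash_fun_mult:
  assumes "open_semialgebraic n V" "Nash_fun n V f" "Nash_fun n V g"
  shows "Nash_fun n V (\<lambda>x. f x * g x)"
proof (rule Nash_fun_binop[where op = times, OF assms])
  show "smooth_on n V (\<lambda>x. f x * g x)"
    using assms unfolding Nash_fun_def open_semialgebraic_def by (intro smooth_on_mult) blast+
qed (rule definable_fun_mult)

lemma qn_cover_cong: "qn_cover n Y U f \<V> \<Longrightarrow> (\<And>x. x \<in> U \<Longrightarrow> f' x = f x) \<Longrightarrow> qn_cover n Y U f' \<V>"
  unfolding qn_cover_def case_prod_unfold by fastforce

lemma qn_cover_binop: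
  assumes f: "qn_cover n Y U f \<V>" and g: "qn_cover n Y U g \<W>"
    and op: "\<And>V f g. open_semialgebraic n V \<Longrightarrow> Nash_fun n V f \<Longrightarrow> Nash_fun n V g \<Longrightarrow> Nash_fun n V (\<lambda>x. op (f x) (g x))"
  shows "qn_cover n Y U (\<lambda>x. op (f x) (g x)) ((\<lambda>((V, f), (W, g)). (V \<inter> W, \<lambda>x. op (f x) (g x))) ` (\<V> \<times> \<W>))"
  unfolding qn_cover_def
proof (intro conjI)
  show "finite ((\<lambda>((V, f), (W, g)). (V \<inter> W, \<lambda>x. op (f x) (g x))) ` (\<V> \<times> \<W>))"
    using f g by (auto simp: qn_cover_def)
  have *: "open_semialgebraic n (V \<inter> W) \<and> Nash_fun n (V \<inter> W) (\<lambda>x. op (f' x) (g' x)) \<and>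
      (\<forall>x\<in>V \<inter> W \<inter> Y. op (f x) (g x) = op (f' x) (g' x))" if "(V, f') \<in> \<V>" "(W, g') \<in> \<W>" for V W f' g'
  proof -
    have V: "open_semialgebraic n V" "Nash_fun n V f'" "\<forall>x\<in>V \<inter> Y. f x = f' x"
      using f that(1) unfolding qn_cover_def by blast+
    have W: "open_semialgebraic n W" "Nash_fun n W g'" "\<forall>x\<in>W \<inter> Y. g x = g' x"
      using g that(2) unfolding qn_cover_def by blast+
    have VW: "open_semialgebraic n (V \<inter> W)" by (rule open_semialgebraic_Int[OF V(1) W(1)])
    have "Nash_fun n (V \<inter> W) (\<lambda>x. op (f' x) (g' x))"
      by (intro op VW Nash_fun_subset[OF V(1,2) VW] Nash_fun_subset[OF W(1,2) VW]) auto
    then show ?thesis using VW V(3) W(3) by simp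
  qed
  then show "\<forall>(V, g')\<in>(\<lambda>((V, f), (W, g)). (V \<inter> W, \<lambda>x. op (f x) (g x))) ` (\<V> \<times> \<W>).
      open_semialgebraic n V \<and> Nash_fun n V g' \<and> (\<forall>x\<in>V \<inter> Y. op (f x) (g x) = g' x)"
    by auto
  have "U = (\<Union>(V, f)\<in>\<V>. V \<inter> Y)" "U = (\<Union>(W, g)\<in>\<W>. W \<inter> Y)" using f g by (auto simp: qn_cover_def)
  then have "U = (\<Union>(V, f)\<in>\<V>. V \<inter> Y) \<inter> (\<Union>(W, g)\<in>\<W>. W \<inter> Y)" by simp
  also have "\<dots> = (\<Union>(V, g)\<in>(\<lambda>((V, f), (W, g)). (V \<inter> W, \<lambda>x. op (f x) (g x))) ` (\<V> \<times> \<W>). V \<inter> Y)"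
    by (auto simp: case_prod_unfold)
  finally show "U = (\<Union>(V, g)\<in>(\<lambda>((V, f), (W, g)). (V \<inter> W, \<lambda>x. op (f x) (g x))) ` (\<V> \<times> \<W>). V \<inter> Y)" .
qed

lemma openin_Collect_open:
  assumes "openin (Euclidean_space n) V" "continuous_on V f" "open (T :: real set)"
  shows "openin (Euclidean_space n) {x \<in> V. f x \<in> T}"
proof -
  have "openin (top_of_set V) (V \<inter> f -` T)" by (rule continuous_openin_preimage_gen[OF assms(2,3)])
  moreover have "V \<inter> f -` T = {x \<in> V. f x \<in> T}" by auto
  ultimately have "openin (top_of_set V) {x \<in> V. f x \<in> T}" by simp
  then show ?thesis using assms(1) unfolding openin_Euclidean by (rule openin_trans)
qed

lemma real_opens_iff_mem: "trunc 1 (\<lambda>i. t) \<in> (\<lambda>t. (\<lambda>i. 0)(0 := t)) ` T \<longleftrightarrow> t \<in> T"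
proof -
  have "trunc 1 (\<lambda>i. t) = (\<lambda>i. 0)(0 := t)" by (auto simp: trunc_def)
  moreover have "t = s" if "(\<lambda>i. 0)(0 := t) = (\<lambda>i. 0 :: real)(0 := s)" for s :: real
    using fun_cong[OF that, of 0] by simp
  ultimately show ?thesis by (metis image_iff)
qed

lemma real_opens_open:
  assumes "T \<in> real_opens"
  shows "open T"
  unfolding open_dist
proof (intro ballI)
  fix t assume "t \<in> T"
  let ?I = "(\<lambda>t. (\<lambda>i. 0)(0 := t)) ` T :: (nat \<Rightarrow> real) set"
  have "?I \<in> semialgebraic_opens 1 (Rn 1)" using assms by (simp add: real_opens_def)
  then have "\<forall>p\<in>?I. \<exists>e>0. cube 1 p e \<inter> Rn 1 \<subseteq> ?I"
    unfolding semialgebraic_opens_iff[OF subset_refl] by blast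
  moreover have t: "trunc 1 (\<lambda>i. t) \<in> ?I" using \<open>t \<in> T\<close> unfolding real_opens_iff_mem .
  ultimately obtain e where e: "e > 0" "cube 1 (trunc 1 (\<lambda>i. t)) e \<inter> Rn 1 \<subseteq> ?I" by blast
  have "s \<in> T" if "dist s t < e" for s
  proof -
    have "trunc 1 (\<lambda>i. s) \<in> cube 1 (trunc 1 (\<lambda>i. t)) e \<inter> Rn 1"
      using that by (simp add: cube_def dist_real_def)
    then show ?thesis using e(2) real_opens_iff_mem by blast
  qed
  then show "\<exists>e>0. \<forall>y. dist y t < e \<longrightarrow> y \<in> T" using e(1) by blast
qed

lemma real_opens_definable:
  assumes "T \<in> real_opens" "definable_fun a"
  shows "definable (\<lambda>z. a z \<in> T)"
proof -
  have "semialgebraic 1 ((\<lambda>t. (\<lambda>i. 0)(0 := t)) ` T)"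
    using assms(1) by (simp add: real_opens_def semialgebraic_opens_def)
  from definable_mem[OF this, where h = "\<lambda>z i. a z", OF assms(2)]
  show ?thesis unfolding real_opens_iff_mem .
qed

lemma open_semialgebraic_Nash_preimage:
  assumes V: "open_semialgebraic n V" and g: "Nash_fun n V g" and T: "T \<in> real_opens"
  shows "open_semialgebraic n {x \<in> V. g x \<in> T}"
proof -
  have V': "semialgebraic n V" "openin (Euclidean_space n) V" and VR: "V \<subseteq> Rn n"
    using V semialgebraic_subset by (auto simp: open_semialgebraic_def)
  have sa: "semialgebraic_fun n V g" and sm: "smooth_on n V g" using g by (auto simp: Nash_fun_def)
  have "definable (\<lambda>z. \<exists>t. (trunc n z \<in> V \<and> g (trunc n z) = t) \<and> t \<in> T)"
    by (intro definable_ex definable_conj semialgebraic_fun_definable_eq[OF sa VR] definable_fun_coord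
        real_opens_definable[OF T])
  then have "semialgebraic n {x \<in> Rn n. \<exists>t. (x \<in> V \<and> g x = t) \<and> t \<in> T}" by (rule semialgebraic_Collect)
  moreover have "{x \<in> Rn n. \<exists>t. (x \<in> V \<and> g x = t) \<and> t \<in> T} = {x \<in> V. g x \<in> T}" using VR by auto
  ultimately show ?thesis
    using openin_Collect_open[OF V'(2) smooth_on_continuous[OF sm] real_opens_open[OF T]]
    unfolding open_semialgebraic_def by simp
qed

lemma qn_cover_restrict:
  assumes f: "qn_cover n Y U f \<V>" and W: "open_semialgebraic n W" "W \<inter> Y \<subseteq> U"
  shows "qn_cover n Y (W \<inter> Y) f ((\<lambda>(V, g). (V \<inter> W, g)) ` \<V>)"
  unfolding qn_cover_def
proof (intro conjI)
  show "finite ((\<lambda>(V, g). (V \<inter> W, g)) ` \<V>)" using f by (simp add: qn_cover_def)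
  have "open_semialgebraic n (V \<inter> W) \<and> Nash_fun n (V \<inter> W) g \<and> (\<forall>x\<in>V \<inter> W \<inter> Y. f x = g x)" if "(V, g) \<in> \<V>" for V g
  proof -
    have V: "open_semialgebraic n V" "Nash_fun n V g" "\<forall>x\<in>V \<inter> Y. f x = g x"
      using f that unfolding qn_cover_def by blast+
    have VW: "open_semialgebraic n (V \<inter> W)" by (rule open_semialgebraic_Int[OF V(1) W(1)])
    then show ?thesis using Nash_fun_subset[OF V(1,2) VW] V(3) by auto
  qed
  then show "\<forall>(V, g)\<in>(\<lambda>(V, g). (V \<inter> W, g)) ` \<V>. open_semialgebraic n V \<and> Nash_fun n V g \<and> (\<forall>x\<in>V \<inter> Y. f x = g x)"
    by auto
  have "U = (\<Union>(V, g)\<in>\<V>. V \<inter> Y)" using f by (simp add: qn_cover_def)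
  then show "W \<inter> Y = (\<Union>(V, g)\<in>(\<lambda>(V, g). (V \<inter> W, g)) ` \<V>. V \<inter> Y)" using W(2) by (auto simp: case_prod_unfold)
qed

section \<open>The R-space of a semi-algebraic set\<close>

lemma restricted_topology_semialgebraic_opens:
  assumes Y: "semialgebraic n Y"
  shows "restricted_topology Y (semialgebraic_opens n Y)"
proof -
  have YR: "Y \<subseteq> Rn n" by (rule semialgebraic_subset[OF Y])
  have top: "topspace (subtopology (Euclidean_space n) Y) = Y" using YR by auto
  show ?thesis
    unfolding restricted_topology_def
  proof (intro conjI ballI subsetI)
    show "U \<in> Pow Y" if "U \<in> semialgebraic_opens n Y" for U
      using that unfolding semialgebraic_opens_iff[OF YR] by blast
    show "Y \<in> semialgebraic_opens n Y" "{} \<in> semialgebraic_opens n Y"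
      unfolding semialgebraic_opens_iff[OF YR] using Y semialgebraic_empty zero_less_one by blast+
    show "U \<union> V \<in> semialgebraic_opens n Y" "U \<inter> V \<in> semialgebraic_opens n Y"
      if "U \<in> semialgebraic_opens n Y" "V \<in> semialgebraic_opens n Y" for U V
      using that unfolding semialgebraic_opens_def
      by (auto intro: semialgebraic.union semialgebraic.inter openin_Un openin_Int)
  qed
qed

lemma QN_space_simps [simp]:
  "points (QN_space n Y) = Y" "opens (QN_space n Y) = semialgebraic_opens n Y"
  "sections (QN_space n Y) = QN_sections n Y"
  by (simp_all add: QN_space_def)

lemma R_space_QN_space:
  assumes Y: "semialgebraic n Y"
  shows "R_space (QN_space n Y)"
proof
  show "restricted_topology (points (QN_space n Y)) (opens (QN_space n Y))"
    using restricted_topology_semialgebraic_opens[OF Y] by simp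
  show "sections (QN_space n Y) U = {}" if "U \<notin> opens (QN_space n Y)" for U
    using that qn_cover_open[OF Y] by (auto simp: QN_sections_iff)
  show "sections (QN_space n Y) U \<subseteq> extensional U" for U by (auto simp: QN_sections_iff)
  show "{x \<in> U. f x \<in> T} \<in> opens (QN_space n Y)"
    if f: "f \<in> sections (QN_space n Y) U" and T: "T \<in> real_opens" for U f T
  proof -
    obtain \<V> where \<V>: "qn_cover n Y U f \<V>" using f by (auto simp: QN_sections_iff)
    have *: "open_semialgebraic n (fst v)" "Nash_fun n (fst v) (snd v)" "\<forall>x\<in>fst v \<inter> Y. f x = snd v x" if "v \<in> \<V>" for v
      using \<V> that unfolding qn_cover_def case_prod_unfold by blast+
    have U: "U = (\<Union>v\<in>\<V>. fst v \<inter> Y)" and fin: "finite \<V>" using \<V> by (auto simp: qn_cover_def case_prod_unfold)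
    have "(\<Union>v\<in>\<V>. {x \<in> fst v. snd v x \<in> T} \<inter> Y) \<in> semialgebraic_opens n Y"
      using * T by (intro open_semialgebraic_UN_Int[OF Y fin] open_semialgebraic_Nash_preimage) auto
    moreover have "{x \<in> U. f x \<in> T} = (\<Union>v\<in>\<V>. {x \<in> fst v. snd v x \<in> T} \<inter> Y)"
      unfolding U using *(3) by auto
    ultimately show ?thesis by simp
  qed
  \<comment> \<open>A constant needs a domain in the ambient space, so U is first written as the
    trace of an open semi-algebraic set.\<close>
  show "(\<lambda>x\<in>U. c) \<in> sections (QN_space n Y) U" if U: "U \<in> opens (QN_space n Y)" for U c
  proof -
    obtain V where V: "open_semialgebraic n V" "V \<inter> Y = U" using semialgebraic_open_extension[OF Y] U by auto
    have "qn_cover n Y U (\<lambda>x\<in>U. c) {(V, \<lambda>x. c)}"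
      using V Nash_fun_const[OF V(1)] by (auto simp: qn_cover_def)
    then show ?thesis by (auto simp: QN_sections_iff)
  qed
  show "(\<lambda>x\<in>U. f x + g x) \<in> sections (QN_space n Y) U"
    if fg: "f \<in> sections (QN_space n Y) U" "g \<in> sections (QN_space n Y) U" for U f g
  proof -
    obtain \<V> \<W> where c: "qn_cover n Y U f \<V>" "qn_cover n Y U g \<W>"
      using fg by (auto simp: QN_sections_iff)
    obtain \<X> where "qn_cover n Y U (\<lambda>x. f x + g x) \<X>"
      using qn_cover_binop[where op = "(+)", OF c Nash_fun_add] by iprover
    then have "qn_cover n Y U (\<lambda>x\<in>U. f x + g x) \<X>" by (rule qn_cover_cong) simp
    then show ?thesis unfolding QN_space_simps QN_sections_iff by blast
  qed
  show "(\<lambda>x\<in>U. f x * g x) \<in> sections (QN_space n Y) U"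
    if fg: "f \<in> sections (QN_space n Y) U" "g \<in> sections (QN_space n Y) U" for U f g
  proof -
    obtain \<V> \<W> where c: "qn_cover n Y U f \<V>" "qn_cover n Y U g \<W>"
      using fg by (auto simp: QN_sections_iff)
    obtain \<X> where "qn_cover n Y U (\<lambda>x. f x * g x) \<X>"
      using qn_cover_binop[where op = times, OF c Nash_fun_mult] by iprover
    then have "qn_cover n Y U (\<lambda>x\<in>U. f x * g x) \<X>" by (rule qn_cover_cong) simp
    then show ?thesis unfolding QN_space_simps QN_sections_iff by blast
  qed
  show "restrict f V \<in> sections (QN_space n Y) V"
    if V: "V \<in> opens (QN_space n Y)" "V \<subseteq> U" and f: "f \<in> sections (QN_space n Y) U" for U V f
  proof -
    obtain W where W: "open_semialgebraic n W" "W \<inter> Y = V" using semialgebraic_open_extension[OF Y] V(1) by auto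
    obtain \<V> where "qn_cover n Y U f \<V>" using f by (auto simp: QN_sections_iff)
    from qn_cover_restrict[OF this W(1)] have "qn_cover n Y V f ((\<lambda>(V, g). (V \<inter> W, g)) ` \<V>)"
      using W(2) V(2) by simp
    from qn_cover_cong[OF this, of "restrict f V"] show ?thesis by (auto simp: QN_sections_iff)
  qed
  show "f \<in> sections (QN_space n Y) (\<Union>\<U>)"
    if fin: "finite \<U>" and f: "f \<in> extensional (\<Union>\<U>)"
      and r: "\<And>V. V \<in> \<U> \<Longrightarrow> restrict f V \<in> sections (QN_space n Y) V" for \<U> f
  proof -
    have "\<exists>\<V>. qn_cover n Y V f \<V>" if V: "V \<in> \<U>" for V
    proof -
      obtain \<V> where "qn_cover n Y V (restrict f V) \<V>" using r[OF V] by (auto simp: QN_sections_iff)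
      from qn_cover_cong[OF this, of f] show ?thesis by auto
    qed
    then obtain \<V> where \<V>: "\<And>V. V \<in> \<U> \<Longrightarrow> qn_cover n Y V f (\<V> V)" by metis
    have "qn_cover n Y (\<Union>\<U>) f (\<Union>V\<in>\<U>. \<V> V)"
      unfolding qn_cover_def
    proof (intro conjI)
      show "finite (\<Union>V\<in>\<U>. \<V> V)" using fin \<V> by (auto simp: qn_cover_def)
      show "\<forall>(V, g)\<in>\<Union>V\<in>\<U>. \<V> V. open_semialgebraic n V \<and> Nash_fun n V g \<and> (\<forall>x\<in>V \<inter> Y. f x = g x)"
        using \<V> unfolding qn_cover_def by blast
      have "V = (\<Union>(V, g)\<in>\<V> V. V \<inter> Y)" if "V \<in> \<U>" for V using \<V>[OF that] by (simp add: qn_cover_def)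
      then have "\<Union>\<U> = (\<Union>V\<in>\<U>. \<Union>(V, g)\<in>\<V> V. V \<inter> Y)" by auto
      then show "\<Union>\<U> = (\<Union>(V, g)\<in>\<Union>V\<in>\<U>. \<V> V. V \<inter> Y)" by simp
    qed
    then show ?thesis using f by (auto simp: QN_sections_iff)
  qed
qed

section \<open>Nash manifolds as QN varieties\<close>

lemma local_graph_exists:
  assumes M: "smooth_submanifold n M" and x: "x \<in> M"
  shows "\<exists>J\<subseteq>{..<n}. local_graph n M J x"
proof -
  have MR: "M \<subseteq> Rn n" using M by (simp add: smooth_submanifold_def)
  obtain d W \<phi> \<psi> where sc: "slice_chart n M d W \<phi> \<psi>" "x \<in> W"
    using M x by (auto simp: smooth_submanifold_def)
  from slice_chart_retraction[OF MR sc(1) x sc(2)] obtain I W' r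
    where I: "I \<subseteq> {..<n}" "coord_retraction n M I W' r" "x \<in> W'" by (elim exE conjE)
  then show ?thesis using retraction_imp_local_graph[OF MR I(1,2) x I(3)] by blast
qed

lemma Nash_sections_imp_QN_sections:
  assumes M: "Nash_submanifold n M" and f: "f \<in> Nash_sections n M U"
  shows "f \<in> QN_sections n M U"
proof -
  have M': "smooth_submanifold n M" "semialgebraic n M" using M by (auto simp: Nash_submanifold_def)
  have f': "f \<in> extensional U" "U \<in> semialgebraic_opens n M" "smooth_on_submanifold n M U f" "semialgebraic_fun n U f"
    using f by (auto simp: Nash_sections_def)
  have UM: "U \<subseteq> M"
    using f'(2) unfolding semialgebraic_opens_iff[OF semialgebraic_subset[OF M'(2)]] by blast
  define ok where "ok J v \<longleftrightarrow> open_semialgebraic n (fst v) \<and> Nash_fun n (fst v) (snd v) \<and>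
    fst v \<inter> M = {x \<in> U. local_graph n M J x} \<and> (\<forall>x\<in>fst v \<inter> M. f x = snd v x)"
    for J and v :: "(nat \<Rightarrow> real) set \<times> ((nat \<Rightarrow> real) \<Rightarrow> real)"
  have "\<exists>v. ok J v" if "J \<in> Pow {..<n}" for J
    using smooth_on_submanifold_extend[OF M' _ f'(2-4), of J] that unfolding ok_def by auto
  then obtain v where v: "\<And>J. J \<in> Pow {..<n} \<Longrightarrow> ok J (v J)" by metis
  \<comment> \<open>M is a graph over some J near each of its points, so the finitely many subsets J
    index a cover of U.\<close>
  have "U = (\<Union>J\<in>Pow {..<n}. {x \<in> U. local_graph n M J x})"
    using local_graph_exists[OF M'(1)] UM by blast
  also have "\<dots> = (\<Union>J\<in>Pow {..<n}. fst (v J) \<inter> M)" using v unfolding ok_def by simp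
  finally have "qn_cover n M U f (v ` Pow {..<n})"
  proof -
    assume Ueq: "U = (\<Union>J\<in>Pow {..<n}. fst (v J) \<inter> M)"
    have "open_semialgebraic n (fst w) \<and> Nash_fun n (fst w) (snd w) \<and> (\<forall>x\<in>fst w \<inter> M. f x = snd w x)"
      if "w \<in> v ` Pow {..<n}" for w
      using that v unfolding ok_def by blast
    then show ?thesis unfolding qn_cover_def case_prod_unfold using Ueq by simp
  qed
  then show ?thesis using f'(1) unfolding QN_sections_iff by blast
qed

lemma Nash_fun_smooth_on_submanifold:
  assumes M: "M \<subseteq> Rn n" and sc: "slice_chart n M d W \<phi> \<psi>"
    and U: "openin (subtopology (Euclidean_space n) M) U"
    and cov: "\<And>x. x \<in> U \<Longrightarrow> \<exists>V g. openin (Euclidean_space n) V \<and> x \<in> V \<and> smooth_on n V g \<and> (\<forall>y\<in>V \<inter> M. f y = g y)"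
  shows "smooth_on d (\<phi> ` (U \<inter> W)) (f \<circ> \<psi>)"
proof (rule smooth_on_local)
  note scD = slice_chartD[OF sc]
  have UM: "U \<subseteq> M" using U unfolding openin_subtopology_cube_iff[OF M] by blast
  have op: "openin (Euclidean_space d) (\<phi> ` (U \<inter> W))" by (rule slice_chart_image_open[OF M sc U])
  then show "\<phi> ` (U \<inter> W) \<subseteq> Rn d" by (rule openin_Rn_subset)
  fix u assume "u \<in> \<phi> ` (U \<inter> W)"
  then obtain x where x: "x \<in> U" "x \<in> W" "u = \<phi> x" by blast
  from cov[OF x(1)] obtain V g where V: "openin (Euclidean_space n) V" "x \<in> V" "smooth_on n V g"
    "\<forall>y\<in>V \<inter> M. f y = g y" by (elim exE conjE)
  have WR: "W \<subseteq> Rn n" by (rule openin_Rn_subset[OF scD(2)])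
  have \<psi>R: "\<psi> v \<in> Rn n" if "v \<in> \<phi> ` W" for v using that scD(6) WR by auto
  have c\<psi>: "continuous_on (\<phi> ` W) \<psi>"
    by (rule continuous_on_vec[OF \<psi>R smooth_on_continuous[OF scD(5)]])
  define T where "T = {v \<in> \<phi> ` W. \<psi> v \<in> V} \<inter> Rn d"
  have "openin (Euclidean_space n) {v \<in> \<phi> ` W. \<psi> v \<in> V}"
    using \<psi>R by (intro openin_preimage_vec[OF scD(3) c\<psi> V(1)]) auto
  then have oT: "openin (Euclidean_space d) T" unfolding T_def by (rule openin_Rn_Int[OF scD(1)])
  let ?S = "T \<inter> \<phi> ` (U \<inter> W)"
  have oS: "openin (Euclidean_space d) ?S" by (intro openin_Int oT op)
  have S: "v \<in> \<phi> ` W" "\<psi> v \<in> V" "\<psi> v \<in> U" if "v \<in> ?S" for v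
    using that scD(6) by (auto simp: T_def)
  \<comment> \<open>\<psi> is smooth in n variables; composition with the inclusion of R^d in R^n
    restricts it to the first d.\<close>
  have s\<psi>: "smooth_on d ?S (\<lambda>v. \<psi> v j)" if "j < n" for j
    by (rule smooth_on_compose[where f = "\<lambda>v. \<psi> v j" and G = "\<lambda>v. v", OF oS scD(3) S(1) scD(5)[OF that] smooth_on_coord[OF oS]])
  have "smooth_on d ?S (\<lambda>v. g (\<psi> v))"
    by (rule smooth_on_compose[where G = \<psi>, OF oS V(1) S(2) V(3) s\<psi>])
  then have "smooth_on d ?S (f \<circ> \<psi>)"
  proof (rule smooth_on_cong[OF _ oS])
    fix v assume "v \<in> ?S"
    then have "\<psi> v \<in> V \<inter> M" using S UM by blast
    then show "(f \<circ> \<psi>) v = g (\<psi> v)" using V(4) by simp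
  qed
  moreover have "u \<in> T"
  proof -
    have "u \<in> \<phi> ` W \<inter> Rn d" using x UM scD(7) by blast
    then show ?thesis using x V(2) scD(6)[OF x(2)] by (simp add: T_def)
  qed
  ultimately show "\<exists>W'. openin (Euclidean_space d) W' \<and> u \<in> W' \<and> smooth_on d (W' \<inter> \<phi> ` (U \<inter> W)) (f \<circ> \<psi>)"
    using oT by blast
qed

lemma QN_sections_imp_Nash_sections:
  assumes M: "Nash_submanifold n M" and f: "f \<in> QN_sections n M U"
  shows "f \<in> Nash_sections n M U"
proof -
  have M': "smooth_submanifold n M" "semialgebraic n M" using M by (auto simp: Nash_submanifold_def)
  have MR: "M \<subseteq> Rn n" using M'(1) by (simp add: smooth_submanifold_def)
  obtain \<V> where ext: "f \<in> extensional U" and \<V>: "qn_cover n M U f \<V>"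
    using f unfolding QN_sections_iff by blast
  have U: "U \<in> semialgebraic_opens n M" by (rule qn_cover_open[OF M'(2) \<V>])
  then have Uop: "openin (subtopology (Euclidean_space n) M) U" by (simp add: semialgebraic_opens_def)
  have UM: "U \<subseteq> M" using Uop unfolding openin_subtopology_cube_iff[OF MR] by blast
  have fin: "finite \<V>" and Ueq: "U = (\<Union>v\<in>\<V>. fst v \<inter> M)"
    using \<V> by (auto simp: qn_cover_def case_prod_unfold)
  have v: "open_semialgebraic n (fst v)" "Nash_fun n (fst v) (snd v)" "\<forall>x\<in>fst v \<inter> M. f x = snd v x" if "v \<in> \<V>" for v
    using \<V> that unfolding qn_cover_def case_prod_unfold by blast+
  have "smooth_on_submanifold n M U f"
    unfolding smooth_on_submanifold_def
  proof
    fix p assume p: "p \<in> U"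
    then obtain d W \<phi> \<psi> where sc: "slice_chart n M d W \<phi> \<psi>" "p \<in> W"
      using M'(1) UM unfolding smooth_submanifold_def by blast
    have "smooth_on d (\<phi> ` (U \<inter> W)) (f \<circ> \<psi>)"
    proof (rule Nash_fun_smooth_on_submanifold[OF MR sc(1) Uop])
      fix x assume "x \<in> U"
      then obtain w where w: "w \<in> \<V>" "x \<in> fst w" using Ueq by blast
      then show "\<exists>V g. openin (Euclidean_space n) V \<and> x \<in> V \<and> smooth_on n V g \<and> (\<forall>y\<in>V \<inter> M. f y = g y)"
        using v[OF w(1)] unfolding open_semialgebraic_def Nash_fun_def by blast
    qed
    then show "\<exists>d W \<phi> \<psi>. slice_chart n M d W \<phi> \<psi> \<and> p \<in> W \<and> smooth_on d (\<phi> ` (U \<inter> W)) (f \<circ> \<psi>)"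
      using sc by blast
  qed
  moreover have "semialgebraic_fun n U f"
  proof (rule semialgebraic_funI)
    show "U \<subseteq> Rn n" using UM MR by blast
    have vR: "fst w \<subseteq> Rn n" and vs: "semialgebraic_fun n (fst w) (snd w)" if "w \<in> \<V>" for w
      using v[OF that] semialgebraic_subset unfolding open_semialgebraic_def Nash_fun_def by blast+
    have "definable (\<lambda>z. \<exists>w\<in>\<V>. (trunc n z \<in> fst w \<and> snd w (trunc n z) = z n) \<and> trunc n z \<in> M)"
      by (intro definable_finite_disj[OF fin] definable_conj semialgebraic_fun_definable_eq vs vR
          definable_mem[OF M'(2)] definable_fun_coord)
    moreover have "(\<exists>w\<in>\<V>. (trunc n z \<in> fst w \<and> snd w (trunc n z) = z n) \<and> trunc n z \<in> M)
        \<longleftrightarrow> trunc n z \<in> U \<and> f (trunc n z) = z n" for z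
      unfolding Ueq using v(3) by auto
    ultimately show "definable (\<lambda>z. trunc n z \<in> U \<and> f (trunc n z) = z n)" by simp
  qed
  ultimately show ?thesis using ext U by (simp add: Nash_sections_def)
qed

lemma Nash_space_eq_QN_space:
  assumes "Nash_submanifold n M"
  shows "Nash_space n M = QN_space n M"
proof -
  have "Nash_sections n M = QN_sections n M"
    using Nash_sections_imp_QN_sections[OF assms] QN_sections_imp_Nash_sections[OF assms] by blast
  then show ?thesis by (simp add: Nash_space_def QN_space_def)
qed

lemma affine_Nash_manifold_imp_affine_QN_variety:
  assumes "affine_Nash_manifold A"
  shows "affine_QN_variety A"
proof -
  obtain n M where "R_space A" "closedin (Euclidean_space n) M" "Nash_submanifold n M" "rspace_iso A (Nash_space n M)"
    using assms by (auto simp: affine_Nash_manifold_def)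
  then show ?thesis unfolding affine_QN_variety_def using Nash_space_eq_QN_space by (metis Nash_submanifold_def)
qed

section \<open>Categories of R-spaces\<close>

lemma rspace_morD:
  assumes "\<phi> \<in> rspace_mor A B"
  shows "\<phi> \<in> points A \<rightarrow>\<^sub>E points B" "U \<in> opens B \<Longrightarrow> \<phi> -` U \<inter> points A \<in> opens A"
    "U \<in> opens B \<Longrightarrow> f \<in> sections B U \<Longrightarrow> compose (\<phi> -` U \<inter> points A) f \<phi> \<in> sections A (\<phi> -` U \<inter> points A)"
  using assms unfolding rspace_mor_def by blast+

lemma rspace_mor_id:
  assumes "R_space A"
  shows "(\<lambda>x\<in>points A. x) \<in> rspace_mor A A"
  unfolding rspace_mor_def
proof (intro CollectI conjI ballI)
  interpret R_space A by (rule assms)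
  fix U assume U: "U \<in> opens A"
  then have "U \<subseteq> points A" using topology by (auto simp: restricted_topology_def)
  then have eq: "(\<lambda>x\<in>points A. x) -` U \<inter> points A = U" by auto
  show "(\<lambda>x\<in>points A. x) -` U \<inter> points A \<in> opens A" using U eq by simp
  fix f assume f: "f \<in> sections A U"
  then have "f \<in> extensional U" using sections_extensional[OF U] by blast
  then have "compose U f (\<lambda>x\<in>points A. x) = f"
    using \<open>U \<subseteq> points A\<close> by (intro ext) (auto simp: compose_def extensional_def)
  then show "compose ((\<lambda>x\<in>points A. x) -` U \<inter> points A) f (\<lambda>x\<in>points A. x)
      \<in> sections A ((\<lambda>x\<in>points A. x) -` U \<inter> points A)"
    using f eq by simp
qed auto

lemma rspace_mor_compose:
  assumes f: "f \<in> rspace_mor A B" and g: "g \<in> rspace_mor B C"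
  shows "compose (points A) g f \<in> rspace_mor A C"
  unfolding rspace_mor_def
proof (intro CollectI conjI ballI)
  have fP: "\<And>x. x \<in> points A \<Longrightarrow> f x \<in> points B" using rspace_morD(1)[OF f] by blast
  show "compose (points A) g f \<in> points A \<rightarrow>\<^sub>E points C"
    using rspace_morD(1)[OF f] rspace_morD(1)[OF g] by (auto simp: compose_def)
  fix U assume U: "U \<in> opens C"
  let ?V = "g -` U \<inter> points B"
  have eq: "compose (points A) g f -` U \<inter> points A = f -` ?V \<inter> points A"
    using fP by (auto simp: compose_def)
  have V: "?V \<in> opens B" by (rule rspace_morD(2)[OF g U])
  show "compose (points A) g f -` U \<inter> points A \<in> opens A"
    unfolding eq by (rule rspace_morD(2)[OF f V])
  fix h assume h: "h \<in> sections C U"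
  have "compose (f -` ?V \<inter> points A) (compose ?V h g) f \<in> sections A (f -` ?V \<inter> points A)"
    by (rule rspace_morD(3)[OF f V rspace_morD(3)[OF g U h]])
  moreover have "compose (f -` ?V \<inter> points A) (compose ?V h g) f
      = compose (f -` ?V \<inter> points A) h (compose (points A) g f)"
    by (auto simp: compose_def fun_eq_iff)
  ultimately show "compose (compose (points A) g f -` U \<inter> points A) h (compose (points A) g f)
      \<in> sections A (compose (points A) g f -` U \<inter> points A)"
    unfolding eq by simp
qed

lemma rspace_category_category:
  assumes id: "\<And>A. A \<in> obs \<Longrightarrow> (\<lambda>x\<in>points A. x) \<in> homs A A"
    and comp: "\<And>A B C f g. \<lbrakk>A \<in> obs; B \<in> obs; C \<in> obs; f \<in> homs A B; g \<in> homs B C\<rbrakk> \<Longrightarrow>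
      compose (points A) g f \<in> homs A C"
    and maps: "\<And>A B. \<lbrakk>A \<in> obs; B \<in> obs\<rbrakk> \<Longrightarrow> homs A B \<subseteq> points A \<rightarrow>\<^sub>E points B"
  shows "category (rspace_category obs homs)"
proof
  fix A B D E f g h
  let ?C = "rspace_category obs homs"
  show "A \<in> Obj ?C \<Longrightarrow> Id ?C A \<in> Hom ?C A A" using id by (simp add: rspace_category_def)
  show "\<lbrakk>A \<in> Obj ?C; B \<in> Obj ?C; D \<in> Obj ?C; f \<in> Hom ?C A B; g \<in> Hom ?C B D\<rbrakk>
      \<Longrightarrow> Comp ?C A B D g f \<in> Hom ?C A D"
    using comp by (simp add: rspace_category_def)
  show "\<lbrakk>A \<in> Obj ?C; B \<in> Obj ?C; f \<in> Hom ?C A B\<rbrakk> \<Longrightarrow> Comp ?C A A B f (Id ?C A) = f"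
    using maps[of A B] by (fastforce simp: rspace_category_def compose_def fun_eq_iff PiE_def extensional_def)
  show "\<lbrakk>A \<in> Obj ?C; B \<in> Obj ?C; f \<in> Hom ?C A B\<rbrakk> \<Longrightarrow> Comp ?C A B B (Id ?C B) f = f"
    using maps[of A B] by (fastforce simp: rspace_category_def compose_def fun_eq_iff PiE_def extensional_def)
  show "\<lbrakk>A \<in> Obj ?C; B \<in> Obj ?C; D \<in> Obj ?C; E \<in> Obj ?C; f \<in> Hom ?C A B; g \<in> Hom ?C B D; h \<in> Hom ?C D E\<rbrakk>
      \<Longrightarrow> Comp ?C A D E h (Comp ?C A B D g f) = Comp ?C A B E (Comp ?C B D E h g) f"
    using maps[of A B] by (fastforce simp: rspace_category_def compose_def fun_eq_iff PiE_def)
qed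

lemma category_rspace_mor:
  assumes "\<And>A. A \<in> obs \<Longrightarrow> R_space A"
  shows "category (rspace_category obs rspace_mor)"
  using rspace_mor_id[OF assms] rspace_mor_compose rspace_morD(1)
  by (intro rspace_category_category) blast+

lemma Nash_full_subcategory:
  "full_subcategory (Nash_category :: ('a rspace, 'a \<Rightarrow> 'a) cat_data) QN_category"
proof -
  have N: "category (Nash_category :: ('a rspace, 'a \<Rightarrow> 'a) cat_data)" unfolding Nash_category_def
    by (rule category_rspace_mor) (simp add: affine_Nash_manifold_def)
  have Q: "category (QN_category :: ('a rspace, 'a \<Rightarrow> 'a) cat_data)" unfolding QN_category_def
    by (rule category_rspace_mor) (simp add: affine_QN_variety_def)
  interpret N: category "Nash_category :: ('a rspace, 'a \<Rightarrow> 'a) cat_data" by (rule N)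
  interpret Q: category "QN_category :: ('a rspace, 'a \<Rightarrow> 'a) cat_data" by (rule Q)
  show ?thesis
    by unfold_locales
      (auto simp: Nash_category_def QN_category_def rspace_category_def affine_Nash_manifold_imp_affine_QN_variety)
qed

section \<open>Nash maps as morphisms\<close>

lemma Nash_fun_compose:
  assumes V: "open_semialgebraic n V" and G: "\<And>j. j < m \<Longrightarrow> Nash_fun n V (\<lambda>x. G x j)"
    and GR: "\<And>x. x \<in> V \<Longrightarrow> G x \<in> Rn m"
    and W: "open_semialgebraic m W" and h: "Nash_fun m W h"
  shows "open_semialgebraic n {x \<in> V. G x \<in> W}" "Nash_fun n {x \<in> V. G x \<in> W} (\<lambda>x. h (G x))"
proof -
  let ?T = "{x \<in> V. G x \<in> W}"
  have V': "semialgebraic n V" "openin (Euclidean_space n) V" and VR: "V \<subseteq> Rn n"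
    using V semialgebraic_subset by (auto simp: open_semialgebraic_def)
  have W': "semialgebraic m W" "openin (Euclidean_space m) W" and WR: "W \<subseteq> Rn m"
    using W semialgebraic_subset by (auto simp: open_semialgebraic_def)
  have Gs: "smooth_on n V (\<lambda>x. G x j)" and Ga: "semialgebraic_fun n V (\<lambda>x. G x j)" if "j < m" for j
    using G[OF that] by (auto simp: Nash_fun_def)
  have cG: "continuous_on V G" by (rule continuous_on_vec[OF GR smooth_on_continuous[OF Gs]])
  have oT: "openin (Euclidean_space n) ?T" by (rule openin_preimage_vec[OF V'(2) cG W'(2)]) (use GR in blast)
  have "definable (\<lambda>z. \<exists>y\<in>Rn m. trunc n z \<in> V \<and> y \<in> W \<and> (\<forall>j<m. trunc n z \<in> V \<and> G (trunc n z) j = y j))"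
    by (intro definable_ex_Rn definable_conj definable_mem[OF V'(1)] definable_mem[OF W'(1)] definable_all_less
        semialgebraic_fun_definable_eq[OF Ga VR, simplified] definable_fun_coord definable_fun_trunc)
  then have "semialgebraic n {x \<in> Rn n. \<exists>y\<in>Rn m. x \<in> V \<and> y \<in> W \<and> (\<forall>j<m. x \<in> V \<and> G x j = y j)}"
    by (rule semialgebraic_Collect)
  moreover have "{x \<in> Rn n. \<exists>y\<in>Rn m. x \<in> V \<and> y \<in> W \<and> (\<forall>j<m. x \<in> V \<and> G x j = y j)} = ?T"
  proof (intro equalityI subsetI)
    fix x assume "x \<in> {x \<in> Rn n. \<exists>y\<in>Rn m. x \<in> V \<and> y \<in> W \<and> (\<forall>j<m. x \<in> V \<and> G x j = y j)}"
    then obtain y where y: "y \<in> Rn m" "x \<in> V" "y \<in> W" "\<forall>j<m. G x j = y j" by blast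
    then have "y = G x" using GR by (intro Rn_eqI[of _ m]) auto
    then show "x \<in> ?T" using y by simp
  next
    fix x assume "x \<in> ?T"
    then show "x \<in> {x \<in> Rn n. \<exists>y\<in>Rn m. x \<in> V \<and> y \<in> W \<and> (\<forall>j<m. x \<in> V \<and> G x j = y j)}"
      using VR WR by blast
  qed
  ultimately show T: "open_semialgebraic n ?T" using oT by (simp add: open_semialgebraic_def)
  have hs: "smooth_on m W h" and ha: "semialgebraic_fun m W h" using h by (auto simp: Nash_fun_def)
  have "smooth_on n ?T (\<lambda>x. h (G x))"
    by (rule smooth_on_compose[where G = G, OF oT W'(2) _ hs smooth_on_subset[OF Gs]]) auto
  moreover have "semialgebraic_fun n ?T (\<lambda>x. h (G x))"
  proof (rule semialgebraic_funI)
    show "?T \<subseteq> Rn n" using VR by blast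
    have "definable (\<lambda>z. \<exists>y\<in>Rn m. trunc n z \<in> V \<and> (y \<in> W \<and> h y = z n) \<and> (\<forall>j<m. trunc n z \<in> V \<and> G (trunc n z) j = y j))"
      by (intro definable_ex_Rn definable_conj definable_mem[OF V'(1)] definable_all_less
          semialgebraic_fun_definable_eq[OF ha WR]
          semialgebraic_fun_definable_eq[OF Ga VR, simplified] definable_fun_coord definable_fun_trunc)
    moreover have "(\<exists>y\<in>Rn m. trunc n z \<in> V \<and> (y \<in> W \<and> h y = z n) \<and> (\<forall>j<m. trunc n z \<in> V \<and> G (trunc n z) j = y j))
        \<longleftrightarrow> trunc n z \<in> ?T \<and> h (G (trunc n z)) = z n" for z
    proof
      assume "\<exists>y\<in>Rn m. trunc n z \<in> V \<and> (y \<in> W \<and> h y = z n) \<and> (\<forall>j<m. trunc n z \<in> V \<and> G (trunc n z) j = y j)"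
      then obtain y where y: "y \<in> Rn m" "trunc n z \<in> V" "y \<in> W" "h y = z n" "\<forall>j<m. G (trunc n z) j = y j"
        by blast
      then have "y = G (trunc n z)" using GR by (intro Rn_eqI[of _ m]) auto
      then show "trunc n z \<in> ?T \<and> h (G (trunc n z)) = z n" using y by simp
    next
      assume R: "trunc n z \<in> ?T \<and> h (G (trunc n z)) = z n"
      then have "G (trunc n z) \<in> Rn m" using WR by blast
      then show "\<exists>y\<in>Rn m. trunc n z \<in> V \<and> (y \<in> W \<and> h y = z n) \<and> (\<forall>j<m. trunc n z \<in> V \<and> G (trunc n z) j = y j)"
        using R by (intro bexI[of _ "G (trunc n z)"]) auto
    qed
    ultimately show "definable (\<lambda>z. trunc n z \<in> ?T \<and> h (G (trunc n z)) = z n)" by simp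
  qed
  ultimately show "Nash_fun n ?T (\<lambda>x. h (G x))" by (simp add: Nash_fun_def)
qed

lemma Nash_map_morphism:
  assumes X: "semialgebraic n X" and Y: "semialgebraic m Y" and \<phi>: "\<phi> \<in> X \<rightarrow>\<^sub>E Y"
    and V: "open_semialgebraic n V" "X \<subseteq> V" and G: "\<And>j. j < m \<Longrightarrow> Nash_fun n V (G j)"
    and eq: "\<And>x j. x \<in> X \<Longrightarrow> j < m \<Longrightarrow> \<phi> x j = G j x"
  shows "\<phi> \<in> rspace_mor (QN_space n X) (QN_space m Y)"
proof -
  \<comment> \<open>\<phi> is \<open>undefined\<close> outside X, so a Nash extension to V takes its
    place; coordinates from m on are 0, as for all points of \<open>Rn m\<close>.\<close>
  define \<Gamma> where "\<Gamma> x = (\<lambda>j. if j < m then G j x else 0)" for x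
  have \<Gamma>R: "\<Gamma> x \<in> Rn m" for x by (simp add: \<Gamma>_def Rn_iff)
  have \<phi>\<Gamma>: "\<phi> x = \<Gamma> x" if "x \<in> X" for x
  proof (rule Rn_eqI[OF _ \<Gamma>R])
    show "\<phi> x \<in> Rn m" using \<phi> that semialgebraic_subset[OF Y] by blast
  qed (use eq[OF that] in \<open>simp add: \<Gamma>_def\<close>)
  have \<Gamma>N: "Nash_fun n V (\<lambda>x. \<Gamma> x j)" if "j < m" for j using G[OF that] that by (simp add: \<Gamma>_def)
  have \<phi>Y: "\<phi> x \<in> Y" if "x \<in> X" for x using \<phi> that by blast
  have comp: "open_semialgebraic n {x \<in> V. \<Gamma> x \<in> W}" "Nash_fun n {x \<in> V. \<Gamma> x \<in> W} (\<lambda>x. h (\<Gamma> x))"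
    if "open_semialgebraic m W" "Nash_fun m W h" for W h
    by (rule Nash_fun_compose[where G = \<Gamma>, OF V(1) _ \<Gamma>R that], rule \<Gamma>N, assumption)+
  show ?thesis
    unfolding rspace_mor_def QN_space_simps
  proof (intro CollectI conjI ballI \<phi>)
    fix U assume "U \<in> semialgebraic_opens m Y"
    then obtain W where W: "open_semialgebraic m W" "W \<inter> Y = U" using semialgebraic_open_extension[OF Y] by blast
    have pre: "\<phi> -` U \<inter> X = {x \<in> V. \<Gamma> x \<in> W} \<inter> X"
      using W(2) V(2) \<phi>\<Gamma> \<phi>Y by auto
    show "\<phi> -` U \<inter> X \<in> semialgebraic_opens n X"
      unfolding pre using open_semialgebraic_UN_Int[OF X, of "{()}" "\<lambda>_. {x \<in> V. \<Gamma> x \<in> W}"]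
        comp(1)[OF W(1) Nash_fun_const[OF W(1)]] by simp
    fix f assume "f \<in> QN_sections m Y U"
    then obtain \<V> where \<V>: "qn_cover m Y U f \<V>" unfolding QN_sections_iff by blast
    define \<W> where "\<W> = (\<lambda>v. ({x \<in> V. \<Gamma> x \<in> fst v}, \<lambda>x. snd v (\<Gamma> x))) ` \<V>"
    have fin: "finite \<V>" and Ueq: "U = (\<Union>v\<in>\<V>. fst v \<inter> Y)"
      using \<V> by (auto simp: qn_cover_def case_prod_unfold)
    have v: "open_semialgebraic m (fst v)" "Nash_fun m (fst v) (snd v)" "\<forall>x\<in>fst v \<inter> Y. f x = snd v x" if "v \<in> \<V>" for v
      using \<V> that unfolding qn_cover_def case_prod_unfold by blast+
    let ?c = "compose (\<phi> -` U \<inter> X) f \<phi>"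
    have "qn_cover n X (\<phi> -` U \<inter> X) ?c \<W>"
      unfolding qn_cover_def
    proof (intro conjI)
      show "finite \<W>" using fin by (simp add: \<W>_def)
      have pre': "\<phi> -` U \<inter> X = (\<Union>v\<in>\<V>. {x \<in> V. \<Gamma> x \<in> fst v} \<inter> X)"
        unfolding Ueq using V(2) \<phi>\<Gamma> \<phi>Y by auto
      then show "\<phi> -` U \<inter> X = (\<Union>(T, g)\<in>\<W>. T \<inter> X)" by (simp add: \<W>_def)
      have "open_semialgebraic n {x \<in> V. \<Gamma> x \<in> fst v} \<and> Nash_fun n {x \<in> V. \<Gamma> x \<in> fst v} (\<lambda>x. snd v (\<Gamma> x)) \<and>
          (\<forall>x\<in>{x \<in> V. \<Gamma> x \<in> fst v} \<inter> X. ?c x = snd v (\<Gamma> x))" if w: "v \<in> \<V>" for v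
      proof (intro conjI ballI)
        show "open_semialgebraic n {x \<in> V. \<Gamma> x \<in> fst v}" "Nash_fun n {x \<in> V. \<Gamma> x \<in> fst v} (\<lambda>x. snd v (\<Gamma> x))"
          by (rule comp[OF v(1,2)[OF w]])+
        fix x assume x: "x \<in> {x \<in> V. \<Gamma> x \<in> fst v} \<inter> X"
        then have "x \<in> \<phi> -` U \<inter> X" using w pre' by blast
        then have "?c x = f (\<phi> x)" by (simp add: compose_def)
        also have "\<dots> = snd v (\<Gamma> x)" using v(3)[OF w] x \<phi>\<Gamma>[of x] \<phi>Y[of x] by auto
        finally show "?c x = snd v (\<Gamma> x)" .
      qed
      then show "\<forall>(T, g)\<in>\<W>. open_semialgebraic n T \<and> Nash_fun n T g \<and> (\<forall>x\<in>T \<inter> X. ?c x = g x)"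
        by (simp add: \<W>_def)
    qed
    then show "?c \<in> QN_sections n X (\<phi> -` U \<inter> X)"
      unfolding QN_sections_iff by (auto simp: compose_def)
  qed
qed

section \<open>Hilbert's basis theorem\<close>

text \<open>For polynomial generators, this is the ideal of \<open>P\<close> in the ring of
  polynomial functions.\<close>

inductive_set ideal_span ::
    "nat \<Rightarrow> ((nat \<Rightarrow> real) \<Rightarrow> real) set \<Rightarrow> ((nat \<Rightarrow> real) \<Rightarrow> real) set" for n P where
  span_zero: "(\<lambda>x. 0) \<in> ideal_span n P"
| span_base: "p \<in> P \<Longrightarrow> p \<in> ideal_span n P"
| span_add: "\<lbrakk>f \<in> ideal_span n P; g \<in> ideal_span n P\<rbrakk> \<Longrightarrow> (\<lambda>x. f x + g x) \<in> ideal_span n P"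
| span_mult: "\<lbrakk>polynomial_fun n q; f \<in> ideal_span n P\<rbrakk> \<Longrightarrow> (\<lambda>x. q x * f x) \<in> ideal_span n P"

lemma ideal_span_subset_span:
  assumes "P \<subseteq> ideal_span n Q"
  shows "ideal_span n P \<subseteq> ideal_span n Q"
proof
  fix f assume "f \<in> ideal_span n P"
  then show "f \<in> ideal_span n Q"
    by induction (use assms in \<open>auto intro: ideal_span.intros\<close>)
qed

lemma ideal_span_mono: "P \<subseteq> Q \<Longrightarrow> ideal_span n P \<subseteq> ideal_span n Q"
  by (rule ideal_span_subset_span) (auto intro: span_base)

lemma ideal_span_finite_support:
  "f \<in> ideal_span n P \<Longrightarrow> \<exists>F\<subseteq>P. finite F \<and> f \<in> ideal_span n F"
proof (induction rule: ideal_span.induct)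
  case span_zero
  show ?case by (rule exI[of _ "{}"]) (auto intro: ideal_span.span_zero)
next
  case (span_base p)
  then show ?case by (intro exI[of _ "{p}"]) (auto intro: ideal_span.span_base)
next
  case (span_add f g)
  then obtain F G where "F \<subseteq> P" "finite F" "f \<in> ideal_span n F" "G \<subseteq> P" "finite G" "g \<in> ideal_span n G" by blast
  then have "f \<in> ideal_span n (F \<union> G)" "g \<in> ideal_span n (F \<union> G)"
    using ideal_span_mono[of F "F \<union> G" n] ideal_span_mono[of G "F \<union> G" n] by blast+
  then show ?case using \<open>F \<subseteq> P\<close> \<open>finite F\<close> \<open>G \<subseteq> P\<close> \<open>finite G\<close>
    by (intro exI[of _ "F \<union> G"]) (auto intro: ideal_span.span_add)
next
  case (span_mult q f)
  then obtain F where "F \<subseteq> P" "finite F" "f \<in> ideal_span n F" by blast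
  then show ?case using ideal_span.span_mult[OF span_mult(1)] by (intro exI[of _ F] conjI)
qed

lemma ideal_span_diff:
  assumes "f \<in> ideal_span n P" "g \<in> ideal_span n P"
  shows "(\<lambda>x. f x - g x) \<in> ideal_span n P"
  using span_add[OF assms(1) span_mult[OF polynomial_fun.const[of n "-1"] assms(2)]] by simp

lemma ideal_span_vanish:
  "f \<in> ideal_span n P \<Longrightarrow> (\<And>p. p \<in> P \<Longrightarrow> p x = 0) \<Longrightarrow> f x = 0"
  by (induction rule: ideal_span.induct) auto

lemma ideal_span_polynomial:
  "f \<in> ideal_span n P \<Longrightarrow> (\<And>p. p \<in> P \<Longrightarrow> polynomial_fun n p) \<Longrightarrow> polynomial_fun n f"
  by (induction rule: ideal_span.induct) (auto intro: polynomial_fun.intros)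

section \<open>Leading coefficients in the last variable\<close>

lemma polynomial_fun_Suc: "polynomial_fun n p \<Longrightarrow> polynomial_fun (Suc n) p"
  by (induction rule: polynomial_fun.induct) (auto intro: polynomial_fun.intros)

text \<open>\<open>leading n d a p\<close>: as a polynomial in the coordinate \<open>x n\<close> over the first \<open>n\<close> coordinates,
  \<open>p\<close> has degree at most \<open>d\<close> and \<open>a\<close> is a possible, perhaps zero, coefficient of degree \<open>d\<close>.\<close>

fun leading :: "nat \<Rightarrow> nat \<Rightarrow> ((nat \<Rightarrow> real) \<Rightarrow> real) \<Rightarrow> ((nat \<Rightarrow> real) \<Rightarrow> real) \<Rightarrow> bool" where
  "leading n 0 a p \<longleftrightarrow> p = a"
| "leading n (Suc d) a p \<longleftrightarrow>
    (\<exists>b q. polynomial_fun n b \<and> leading n d b q \<and> p = (\<lambda>x. a x * x n ^ Suc d + q x))"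

lemma leading_zero: "leading n d (\<lambda>x. 0) (\<lambda>x. 0)"
proof (induction d)
  case (Suc d)
  then show ?case using polynomial_fun.const[of n 0]
    by (auto intro!: exI[of _ "\<lambda>x. 0"])
qed simp

lemma leading_add:
  "leading n d a p \<Longrightarrow> leading n d b q \<Longrightarrow> leading n d (\<lambda>x. a x + b x) (\<lambda>x. p x + q x)"
proof (induction d arbitrary: a b p q)
  case (Suc d)
  from Suc.prems(1) obtain a' p' where 1: "polynomial_fun n a'" "leading n d a' p'" "p = (\<lambda>x. a x * x n ^ Suc d + p' x)"
    by auto
  from Suc.prems(2) obtain b' q' where 2: "polynomial_fun n b'" "leading n d b' q'" "q = (\<lambda>x. b x * x n ^ Suc d + q' x)"
    by auto
  have "leading n d (\<lambda>x. a' x + b' x) (\<lambda>x. p' x + q' x)" by (rule Suc.IH[OF 1(2) 2(2)])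
  moreover have "(\<lambda>x. p x + q x) = (\<lambda>x. (a x + b x) * x n ^ Suc d + (p' x + q' x))"
    unfolding 1(3) 2(3) by (auto simp: algebra_simps)
  ultimately show ?case using polynomial_fun.add[OF 1(1) 2(1)]
    unfolding leading.simps by (intro exI conjI)
qed simp

lemma leading_scale:
  "polynomial_fun n s \<Longrightarrow> leading n d a p \<Longrightarrow> leading n d (\<lambda>x. s x * a x) (\<lambda>x. s x * p x)"
proof (induction d arbitrary: a p)
  case (Suc d)
  from Suc.prems(2) obtain a' p' where 1: "polynomial_fun n a'" "leading n d a' p'" "p = (\<lambda>x. a x * x n ^ Suc d + p' x)"
    by auto
  have "leading n d (\<lambda>x. s x * a' x) (\<lambda>x. s x * p' x)" by (rule Suc.IH[OF Suc.prems(1) 1(2)])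
  moreover have "(\<lambda>x. s x * p x) = (\<lambda>x. (s x * a x) * x n ^ Suc d + s x * p' x)"
    unfolding 1(3) by (auto simp: algebra_simps)
  ultimately show ?case using polynomial_fun.mult[OF Suc.prems(1) 1(1)]
    unfolding leading.simps by (intro exI conjI)
qed simp

lemma leading_shift: "leading n d a p \<Longrightarrow> leading n (Suc d) a (\<lambda>x. x n * p x)"
proof (induction d arbitrary: a p)
  case 0
  have "leading n 0 (\<lambda>x. 0) (\<lambda>x. 0)" "polynomial_fun n (\<lambda>x. 0)"
    using leading_zero polynomial_fun.const by blast+
  then show ?case using 0 by (auto intro!: exI[of _ "\<lambda>x. 0"])
next
  case (Suc d)
  from Suc.prems obtain a' p' where 1: "polynomial_fun n a'" "leading n d a' p'" "p = (\<lambda>x. a x * x n ^ Suc d + p' x)"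
    by auto
  have "(\<lambda>x. x n * p x) = (\<lambda>x. a x * x n ^ Suc (Suc d) + x n * p' x)"
    unfolding 1(3) by (auto simp: algebra_simps)
  then show ?case using 1(1) Suc.IH[OF 1(2)]
    unfolding leading.simps(2)[of n "Suc d"] by (intro exI conjI)
qed

lemma leading_shift_power: "leading n d a p \<Longrightarrow> leading n (k + d) a (\<lambda>x. x n ^ k * p x)"
proof (induction k)
  case (Suc k)
  then show ?case using leading_shift[of n "k + d" a "\<lambda>x. x n ^ k * p x"] by (simp add: mult.assoc del: leading.simps)
qed simp

lemma leading_raise: "polynomial_fun n a \<Longrightarrow> leading n d a p \<Longrightarrow> leading n (Suc d) (\<lambda>x. 0) p"
  by (auto intro!: exI[of _ a])

lemma leading_raise_le:
  assumes "polynomial_fun n a" "leading n d a p"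
  shows "\<exists>b. polynomial_fun n b \<and> leading n (k + d) b p"
proof (induction k)
  case 0
  then show ?case using assms by auto
next
  case (Suc k)
  then obtain b where "polynomial_fun n b" "leading n (k + d) b p" by blast
  then have "leading n (Suc (k + d)) (\<lambda>x. 0) p" by (rule leading_raise)
  then show ?case using polynomial_fun.const[of n 0] by (intro exI[of _ "\<lambda>x. 0"]) simp
qed

text \<open>Splitting off the top term of p leaves a sum of two products. Their formal degrees are
  raised to a common value before they are added, which \<open>leading\<close> permits because the
  top coefficient may be zero.\<close>

lemma leading_product:
  assumes "polynomial_fun n b" "leading n e b q"
  shows "polynomial_fun n a \<Longrightarrow> leading n d a p \<Longrightarrow>
    \<exists>c m. polynomial_fun n c \<and> leading n m c (\<lambda>x. p x * q x)"
proof (induction d arbitrary: a p)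
  case 0
  then show ?case using leading_scale[OF 0(1) assms(2)] polynomial_fun.mult[OF 0(1) assms(1)] by auto
next
  case (Suc d)
  from Suc.prems(2) obtain a' p' where 1: "polynomial_fun n a'" "leading n d a' p'" "p = (\<lambda>x. a x * x n ^ Suc d + p' x)"
    by auto
  obtain c m where c: "polynomial_fun n c" "leading n m c (\<lambda>x. p' x * q x)" using Suc.IH[OF 1(1,2)] by blast
  have "leading n (Suc d + e) (\<lambda>x. a x * b x) (\<lambda>x. x n ^ Suc d * (a x * q x))"
    by (rule leading_shift_power[OF leading_scale[OF Suc.prems(1) assms(2)]])
  then obtain c1 where c1: "polynomial_fun n c1" "leading n (m + (Suc d + e)) c1 (\<lambda>x. x n ^ Suc d * (a x * q x))"
    using leading_raise_le[OF polynomial_fun.mult[OF Suc.prems(1) assms(1)]] by blast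
  obtain c2 where c2: "polynomial_fun n c2" "leading n (Suc d + e + m) c2 (\<lambda>x. p' x * q x)"
    using leading_raise_le[OF c] by blast
  have "leading n (m + (Suc d + e)) (\<lambda>x. c1 x + c2 x) (\<lambda>x. x n ^ Suc d * (a x * q x) + p' x * q x)"
    by (rule leading_add[OF c1(2) c2(2)[unfolded add.commute[of "Suc d + e" m]]])
  moreover have "(\<lambda>x. x n ^ Suc d * (a x * q x) + p' x * q x) = (\<lambda>x. p x * q x)"
    unfolding 1(3) by (auto simp: algebra_simps)
  ultimately have "leading n (m + (Suc d + e)) (\<lambda>x. c1 x + c2 x) (\<lambda>x. p x * q x)" by simp
  then show ?case using polynomial_fun.add[OF c1(1) c2(1)] by blast
qed

lemma polynomial_fun_leading:
  "polynomial_fun (Suc n) p \<Longrightarrow> \<exists>a d. polynomial_fun n a \<and> leading n d a p"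
proof (induction rule: polynomial_fun.induct)
  case (const c)
  show ?case using polynomial_fun.const[of n c] by (intro exI[of _ "\<lambda>x. c"] exI[of _ 0]) simp
next
  case (coord i)
  show ?case
  proof (cases "i < n")
    case True
    then show ?thesis using polynomial_fun.coord[OF True]
      by (intro exI[of _ "\<lambda>x. x i"] exI[of _ 0]) simp
  next
    case False
    then have "i = n" using coord by simp
    moreover have "leading n (Suc 0) (\<lambda>x. 1) (\<lambda>x. x n * 1)" by (rule leading_shift) simp
    ultimately show ?thesis using polynomial_fun.const[of n 1]
      by (intro exI[of _ "\<lambda>x. 1"] exI[of _ "Suc 0"]) (simp del: leading.simps)
  qed
next
  case (add p q)
  then obtain a d b e where a: "polynomial_fun n a" "leading n d a p" and b: "polynomial_fun n b" "leading n e b q"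
    by blast
  obtain a' where a': "polynomial_fun n a'" "leading n (e + d) a' p" using leading_raise_le[OF a] by blast
  obtain b' where b': "polynomial_fun n b'" "leading n (d + e) b' q" using leading_raise_le[OF b] by blast
  have "leading n (e + d) (\<lambda>x. a' x + b' x) (\<lambda>x. p x + q x)"
    by (rule leading_add[OF a'(2) b'(2)[unfolded add.commute[of d e]]])
  then show ?case using polynomial_fun.add[OF a'(1) b'(1)] by blast
next
  case (mult p q)
  then show ?case using leading_product by blast
qed

text \<open>The classical argument: the leading coefficients of degree d in the ideal of
  \<open>P\<close> form sets \<open>L d\<close> that grow with d. Finitely many of them generate
  their union, and these lie in one \<open>L D\<close>. Together with generators of each
  \<open>L d\<close> for d up to D, their representatives generate the ideal.\<close>

theorem hilbert_basis:
  "(\<And>p. p \<in> P \<Longrightarrow> polynomial_fun n p) \<Longrightarrow> \<exists>F\<subseteq>P. finite F \<and> P \<subseteq> ideal_span n F"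
proof (induction n arbitrary: P)
  case 0
  have const: "\<exists>c. p = (\<lambda>x. c)" if "polynomial_fun 0 p" for p using that by induction auto
  show ?case
  proof (cases "P \<subseteq> {\<lambda>x. 0}")
    case True
    then show ?thesis by (intro exI[of _ "{}"]) (auto intro: span_zero)
  next
    case False
    then obtain p where p: "p \<in> P" "p \<noteq> (\<lambda>x. 0)" by blast
    then obtain c where c: "p = (\<lambda>x. c)" "c \<noteq> 0" using const 0 by blast
    have "q \<in> ideal_span 0 {p}" if q: "q \<in> P" for q
    proof -
      obtain b where b: "q = (\<lambda>x. b)" using const[OF 0[OF q]] by blast
      have "(\<lambda>x. (b / c) * p x) \<in> ideal_span 0 {p}"
        by (intro span_mult polynomial_fun.const span_base) simp
      then show ?thesis using b c by simp
    qed
    then show ?thesis using p(1) by (intro exI[of _ "{p}"]) auto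
  qed
next
  case (Suc n)
  define I where "I = ideal_span (Suc n) P"
  define L where "L d = {a. polynomial_fun n a \<and> (\<exists>f\<in>I. leading n d a f)}" for d
  have I_add: "f \<in> I \<Longrightarrow> g \<in> I \<Longrightarrow> (\<lambda>x. f x + g x) \<in> I" for f g unfolding I_def by (rule span_add)
  have I_shift: "(\<lambda>x. x n ^ k * f x) \<in> I" if "f \<in> I" for f k
  proof (induction k)
    case (Suc k)
    have "(\<lambda>x. x n * (x n ^ k * f x)) \<in> I"
      unfolding I_def by (rule span_mult[OF polynomial_fun.coord Suc[unfolded I_def]]) simp
    then show ?case by (simp add: mult.assoc)
  qed (use that in simp)
  have L_shift: "L d \<subseteq> L (k + d)" for d k
    unfolding L_def using I_shift leading_shift_power by blast
  have "\<exists>F\<subseteq>(\<Union>d. L d). finite F \<and> (\<Union>d. L d) \<subseteq> ideal_span n F"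
    by (rule Suc.IH) (auto simp: L_def)
  then obtain FL where FL: "FL \<subseteq> (\<Union>d. L d)" "finite FL" "(\<Union>d. L d) \<subseteq> ideal_span n FL" by blast
  then obtain dg where dg: "\<And>a. a \<in> FL \<Longrightarrow> a \<in> L (dg a)" by (metis UN_E subsetD)
  \<comment> \<open>A degree in which all generators in \<open>FL\<close> occur; the 0 covers the
    case of no generators.\<close>
  define D where "D = Max (insert 0 (dg ` FL))"
  have FLD: "FL \<subseteq> L D"
  proof
    fix a assume a: "a \<in> FL"
    then have "dg a \<le> D" unfolding D_def using FL(2) by (intro Max_ge) auto
    then show "a \<in> L D" using L_shift[of "dg a" "D - dg a"] dg[OF a] by auto
  qed
  have "\<exists>F\<subseteq>L d. finite F \<and> L d \<subseteq> ideal_span n F" for d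
    by (rule Suc.IH) (auto simp: L_def)
  then obtain F where F: "\<And>d. F d \<subseteq> L d" "\<And>d. finite (F d)" "\<And>d. L d \<subseteq> ideal_span n (F d)" by metis
  define rep where "rep d a = (SOME f. f \<in> I \<and> leading n d a f)" for d a
  have rep: "rep d a \<in> I \<and> leading n d a (rep d a)" if "a \<in> L d" for d a
  proof -
    have "\<exists>f. f \<in> I \<and> leading n d a f" using that by (auto simp: L_def)
    then show ?thesis unfolding rep_def by (rule someI_ex)
  qed
  define R where "R = rep D ` FL \<union> (\<Union>d\<le>D. rep d ` F d)"
  have finR: "finite R" unfolding R_def using FL(2) F(2) by auto
  have RI: "R \<subseteq> I" unfolding R_def using rep FLD F(1) by blast
  have lift: "\<exists>g\<in>ideal_span (Suc n) R. leading n d a g"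
    if "a \<in> ideal_span n G" "G \<subseteq> L d" "rep d ` G \<subseteq> R" for a d G
    using that(1)
  proof induction
    case span_zero
    then show ?case using leading_zero ideal_span.span_zero by blast
  next
    case (span_base p)
    then have "leading n d p (rep d p)" "rep d p \<in> R" using that(2,3) rep by blast+
    then show ?case using ideal_span.span_base by blast
  next
    case (span_add f g)
    then show ?case using leading_add ideal_span.span_add by blast
  next
    case (span_mult q f)
    then show ?case using leading_scale[OF span_mult(1)] ideal_span.span_mult[OF polynomial_fun_Suc[OF span_mult(1)]] by blast
  qed
  \<comment> \<open>Each leading coefficient already occurs in the ideal of \<open>R\<close>: up to
    degree D by the choice of \<open>F d\<close>, and beyond it after multiplication by a power of
    the last variable.\<close>
  have lead: "\<exists>g\<in>ideal_span (Suc n) R. leading n d a g" if a: "a \<in> L d" for a d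
  proof (cases "d \<le> D")
    case True
    then have "rep d ` F d \<subseteq> R" by (auto simp: R_def)
    then show ?thesis using lift[OF _ F(1)] F(3) a by blast
  next
    case False
    have "rep D ` FL \<subseteq> R" by (auto simp: R_def)
    moreover have "a \<in> ideal_span n FL" using FL(3) a by blast
    ultimately obtain g where g: "g \<in> ideal_span (Suc n) R" "leading n D a g" using lift[OF _ FLD] by blast
    have "(\<lambda>x. x n ^ k * g x) \<in> ideal_span (Suc n) R" for k
    proof (induction k)
      case (Suc k)
      have "(\<lambda>x. x n * (x n ^ k * g x)) \<in> ideal_span (Suc n) R"
        by (intro span_mult polynomial_fun.coord Suc) simp
      then show ?case by (simp add: mult.assoc)
    qed (use g in simp)
    moreover have "leading n ((d - D) + D) a (\<lambda>x. x n ^ (d - D) * g x)" by (rule leading_shift_power[OF g(2)])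
    ultimately show ?thesis using False by (auto simp del: leading.simps)
  qed
  have I_diff: "(\<lambda>x. f x - g x) \<in> I" if "f \<in> I" "g \<in> ideal_span (Suc n) R" for f g
    using that RI ideal_span_subset_span[of R "Suc n" P] unfolding I_def by (intro ideal_span_diff) blast+
  \<comment> \<open>Subtracting an element of the ideal of \<open>R\<close> with the same top term
    lowers the formal degree.\<close>
  have key: "f \<in> ideal_span (Suc n) R" if "f \<in> I" "polynomial_fun n a" "leading n d a f" for f a d
    using that
  proof (induction d arbitrary: f a)
    case (0 f a)
    then have "a \<in> L 0" by (auto simp: L_def)
    then obtain g where "g \<in> ideal_span (Suc n) R" "leading n 0 a g" using lead by blast
    then show ?case using 0 by simp
  next
    case (Suc d f a)
    then have "a \<in> L (Suc d)" by (auto simp: L_def simp del: leading.simps)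
    then obtain g where g: "g \<in> ideal_span (Suc n) R" "leading n (Suc d) a g" using lead by blast
    obtain b p where p: "polynomial_fun n b" "leading n d b p" "f = (\<lambda>x. a x * x n ^ Suc d + p x)"
      using Suc.prems(3) by auto
    obtain c q where q: "polynomial_fun n c" "leading n d c q" "g = (\<lambda>x. a x * x n ^ Suc d + q x)"
      using g(2) by auto
    have eq: "(\<lambda>x. f x - g x) = (\<lambda>x. p x + - 1 * q x)" unfolding p(3) q(3) by (rule ext) simp
    have m1: "polynomial_fun n (\<lambda>x. - 1)" by (rule polynomial_fun.const)
    have "leading n d (\<lambda>x. b x + - 1 * c x) (\<lambda>x. f x - g x)"
      unfolding eq by (rule leading_add[OF p(2) leading_scale[OF m1 q(2)]])
    moreover have "polynomial_fun n (\<lambda>x. b x + - 1 * c x)"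
      by (rule polynomial_fun.add[OF p(1) polynomial_fun.mult[OF m1 q(1)]])
    ultimately have "(\<lambda>x. f x - g x) \<in> ideal_span (Suc n) R"
      using Suc.IH I_diff[OF Suc.prems(1) g(1)] by blast
    from span_add[OF this g(1)] show ?case by simp
  qed
  have IR: "I \<subseteq> ideal_span (Suc n) R"
  proof
    fix f assume f: "f \<in> I"
    then have "polynomial_fun (Suc n) f" unfolding I_def using ideal_span_polynomial Suc.prems by blast
    then show "f \<in> ideal_span (Suc n) R" using polynomial_fun_leading key[OF f] by blast
  qed
  \<comment> \<open>\<open>R\<close> consists of elements of the ideal and not of \<open>P\<close>;
    each of them needs only finitely many members of \<open>P\<close>.\<close>
  have "\<exists>G\<subseteq>P. finite G \<and> r \<in> ideal_span (Suc n) G" if "r \<in> R" for r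
    using ideal_span_finite_support RI that unfolding I_def by blast
  then obtain G where G: "\<And>r. r \<in> R \<Longrightarrow> G r \<subseteq> P" "\<And>r. r \<in> R \<Longrightarrow> finite (G r)"
    "\<And>r. r \<in> R \<Longrightarrow> r \<in> ideal_span (Suc n) (G r)" by metis
  let ?G = "\<Union>r\<in>R. G r"
  have "R \<subseteq> ideal_span (Suc n) ?G" using G(3) ideal_span_mono[of "G _" ?G] by blast
  then have "I \<subseteq> ideal_span (Suc n) ?G" using IR ideal_span_subset_span by blast
  then have "P \<subseteq> ideal_span (Suc n) ?G" unfolding I_def using span_base by blast
  moreover have "?G \<subseteq> P" using G(1) by blast
  moreover have "finite ?G" using G(2) finR by blast
  ultimately show ?case by blast
qed

section \<open>Algebraic subsets are semi-algebraic and closed\<close>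

lemma algebraic_subset_semialgebraic:
  assumes "algebraic_subset n X"
  shows "semialgebraic n X"
proof -
  obtain P where P: "\<And>p. p \<in> P \<Longrightarrow> polynomial_fun n p" "X = {x \<in> Rn n. \<forall>p\<in>P. p x = 0}"
    using assms by (auto simp: algebraic_subset_def)
  obtain F where F: "F \<subseteq> P" "finite F" "P \<subseteq> ideal_span n F"
    using hilbert_basis[of P n] P(1) by blast
  have "(\<forall>p\<in>P. p x = 0) \<longleftrightarrow> (\<forall>p\<in>F. p x = 0)" for x
    using F(1,3) ideal_span_vanish by blast
  then have "X = {x \<in> Rn n. \<forall>p\<in>F. p x = 0}" using P(2) by simp
  moreover have "semialgebraic n {x \<in> Rn n. \<forall>p\<in>F. p x = 0}"
    using F(1) P(1) by (intro semialgebraic_Collect definable_finite_all[OF F(2)] definable_zero polynomial_fun_trunc) blast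
  ultimately show ?thesis by simp
qed

lemma polynomial_fun_smooth:
  "polynomial_fun n p \<Longrightarrow> openin (Euclidean_space n) V \<Longrightarrow> smooth_on n V p"
  by (induction rule: polynomial_fun.induct)
    (auto intro: smooth_on_const smooth_on_coord smooth_on_add smooth_on_mult)

lemma algebraic_subset_closed:
  assumes "algebraic_subset n X"
  shows "closedin (Euclidean_space n) X"
proof -
  obtain P where P: "\<And>p. p \<in> P \<Longrightarrow> polynomial_fun n p" "X = {x \<in> Rn n. \<forall>p\<in>P. p x = 0}"
    using assms by (auto simp: algebraic_subset_def)
  have "openin (Euclidean_space n) {x \<in> Rn n. p x \<in> - {0}}" if "p \<in> P" for p
    using polynomial_fun_smooth[OF P(1)[OF that] openin_Rn]
    by (intro openin_Collect_open openin_Rn smooth_on_continuous) auto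
  then have "openin (Euclidean_space n) (\<Union>p\<in>P. {x \<in> Rn n. p x \<in> - {0}})" by (intro openin_Union) auto
  moreover have "Rn n - X = (\<Union>p\<in>P. {x \<in> Rn n. p x \<in> - {0}})" unfolding P(2) by auto
  ultimately show ?thesis unfolding closedin_def using P(2) by auto
qed

section \<open>Regular maps\<close>

lemma polynomial_fun_prod:
  "(\<And>i. i \<in> I \<Longrightarrow> polynomial_fun n (p i)) \<Longrightarrow> polynomial_fun n (\<lambda>x. \<Prod>i\<in>I. p i x)"
  by (induction I rule: infinite_finite_induct) (auto intro: polynomial_fun.intros)

lemma open_semialgebraic_nonzero:
  assumes "polynomial_fun n q"
  shows "open_semialgebraic n {x \<in> Rn n. q x \<noteq> 0}"
proof -
  have "semialgebraic n {x \<in> Rn n. q x \<noteq> 0}"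
    by (rule semialgebraic_Collect[OF definable_not[OF definable_zero[OF polynomial_fun_trunc[OF assms]]]])
  moreover have "openin (Euclidean_space n) {x \<in> Rn n. q x \<in> - {0}}"
    by (rule openin_Collect_open[OF openin_Rn smooth_on_continuous[OF polynomial_fun_smooth[OF assms openin_Rn]]])
      (simp add: open_Compl)
  ultimately show ?thesis by (simp add: open_semialgebraic_def)
qed

lemma Nash_fun_quotient:
  assumes V: "open_semialgebraic n V" and p: "polynomial_fun n p" and q: "polynomial_fun n q"
    and nz: "\<And>x. x \<in> V \<Longrightarrow> q x \<noteq> 0"
  shows "Nash_fun n V (\<lambda>x. p x / q x)"
proof -
  have V': "semialgebraic n V" "openin (Euclidean_space n) V" using V by (auto simp: open_semialgebraic_def)
  have "smooth_on n V (\<lambda>x. p x / q x)"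
    by (rule smooth_on_divide[OF V'(2) nz polynomial_fun_smooth[OF p V'(2)] polynomial_fun_smooth[OF q V'(2)]])
  moreover have "semialgebraic_fun n V (\<lambda>x. p x / q x)"
  proof (rule semialgebraic_funI[OF semialgebraic_subset[OF V'(1)]])
    have "definable (\<lambda>z. trunc n z \<in> V \<and> p (trunc n z) = z n * q (trunc n z))"
      by (intro definable_conj definable_mem[OF V'(1)] definable_fun_coord
          definable_eq_pt polynomial_fun_trunc p q pt_mult pt_coord)
    moreover have "trunc n z \<in> V \<and> p (trunc n z) = z n * q (trunc n z) \<longleftrightarrow>
        trunc n z \<in> V \<and> p (trunc n z) / q (trunc n z) = z n" for z
      using nz by (auto simp: field_simps)
    ultimately show "definable (\<lambda>z. trunc n z \<in> V \<and> p (trunc n z) / q (trunc n z) = z n)" by simp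
  qed
  ultimately show ?thesis by (simp add: Nash_fun_def)
qed

lemma regular_map_morphism:
  assumes X: "algebraic_subset n X" and Y: "algebraic_subset m Y" and f: "regular_map n X m Y f"
  shows "f \<in> rspace_mor (QN_space n X) (QN_space m Y)"
proof -
  have "\<forall>j. \<exists>p q. j < m \<longrightarrow> polynomial_fun n p \<and> polynomial_fun n q \<and> (\<forall>x\<in>X. q x \<noteq> 0 \<and> f x j = p x / q x)"
    using f unfolding regular_map_def by blast
  then obtain p q where pq: "\<And>j. j < m \<Longrightarrow> polynomial_fun n (p j)" "\<And>j. j < m \<Longrightarrow> polynomial_fun n (q j)"
    "\<And>j x. j < m \<Longrightarrow> x \<in> X \<Longrightarrow> q j x \<noteq> 0 \<and> f x j = p j x / q j x" by metis
  \<comment> \<open>A single domain for all components: the set where the product of the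
    denominators is nonzero.\<close>
  define V where "V = {x \<in> Rn n. (\<Prod>j<m. q j x) \<noteq> 0}"
  have V: "open_semialgebraic n V" unfolding V_def
    by (intro open_semialgebraic_nonzero polynomial_fun_prod pq(2)) simp
  have Xs: "semialgebraic n X" by (rule algebraic_subset_semialgebraic[OF X])
  show ?thesis
  proof (rule Nash_map_morphism[OF Xs algebraic_subset_semialgebraic[OF Y] _ V])
    show "f \<in> X \<rightarrow>\<^sub>E Y" using f by (simp add: regular_map_def)
    show "X \<subseteq> V" using semialgebraic_subset[OF Xs] pq(3) by (auto simp: V_def)
    show "Nash_fun n V (\<lambda>x. p j x / q j x)" if "j < m" for j
      using that by (intro Nash_fun_quotient[OF V pq(1,2)]) (auto simp: V_def)
    show "f x j = p j x / q j x" if "x \<in> X" "j < m" for x j using pq(3) that by blast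
  qed
qed

lemma rspace_iso_refl:
  assumes "R_space A"
  shows "rspace_iso A A"
  unfolding rspace_iso_def
  by (rule bexI[OF bexI[OF _ rspace_mor_id[OF assms]] rspace_mor_id[OF assms]]) auto

lemma affine_QN_variety_algebraic:
  assumes "algebraic_subset n X"
  shows "affine_QN_variety (QN_space n X)"
  unfolding affine_QN_variety_def
  using R_space_QN_space[OF algebraic_subset_semialgebraic[OF assms]] rspace_iso_refl
    algebraic_subset_semialgebraic[OF assms] algebraic_subset_closed[OF assms] by blast

section \<open>The category of regular maps\<close>

lemma regular_map_id: "regular_map n X n X (\<lambda>x\<in>X. x)"
  unfolding regular_map_def
proof (intro conjI allI impI)
  fix j assume "j < n"
  then show "\<exists>p q. polynomial_fun n p \<and> polynomial_fun n q \<and> (\<forall>x\<in>X. q x \<noteq> 0 \<and> (\<lambda>x\<in>X. x) x j = p x / q x)"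
    using polynomial_fun.coord[of j n] polynomial_fun.const[of n 1]
    by (intro exI[of _ "\<lambda>x. x j"] exI[of _ "\<lambda>x. 1"]) simp
qed auto

text \<open>The quotients are given for every index, not only below the dimension of the target of
  f, because p may read more coordinates than that.\<close>

lemma polynomial_fun_of_quotients:
  assumes ab: "\<And>i. polynomial_fun n (a i)" "\<And>i. polynomial_fun n (b i)"
    "\<And>i x. x \<in> X \<Longrightarrow> b i x \<noteq> 0 \<and> f x i = a i x / b i x"
  shows "polynomial_fun m p \<Longrightarrow>
    \<exists>r s. polynomial_fun n r \<and> polynomial_fun n s \<and> (\<forall>x\<in>X. s x \<noteq> 0 \<and> p (f x) = r x / s x)"
proof (induction rule: polynomial_fun.induct)
  case (const c)
  then show ?case using polynomial_fun.const[of n c] polynomial_fun.const[of n 1]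
    by (intro exI[of _ "\<lambda>x. c"] exI[of _ "\<lambda>x. 1"]) simp
next
  case (coord i)
  then show ?case using ab by blast
next
  case (add p q)
  then obtain r s t u where "polynomial_fun n r" "polynomial_fun n s" "polynomial_fun n t" "polynomial_fun n u"
    "\<forall>x\<in>X. s x \<noteq> 0 \<and> p (f x) = r x / s x" "\<forall>x\<in>X. u x \<noteq> 0 \<and> q (f x) = t x / u x" by blast
  then show ?case
    by (intro exI[of _ "\<lambda>x. r x * u x + t x * s x"] exI[of _ "\<lambda>x. s x * u x"])
      (auto intro!: polynomial_fun.add polynomial_fun.mult simp: add_frac_eq)
next
  case (mult p q)
  then obtain r s t u where "polynomial_fun n r" "polynomial_fun n s" "polynomial_fun n t" "polynomial_fun n u"
    "\<forall>x\<in>X. s x \<noteq> 0 \<and> p (f x) = r x / s x" "\<forall>x\<in>X. u x \<noteq> 0 \<and> q (f x) = t x / u x" by blast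
  then show ?case
    by (intro exI[of _ "\<lambda>x. r x * t x"] exI[of _ "\<lambda>x. s x * u x"]) (auto intro!: polynomial_fun.mult)
qed

text \<open>The two ambient dimensions \<open>m\<close> and \<open>m'\<close> of \<open>Y\<close> may differ: all spaces \<open>\<real>\<^sup>m\<close> live in one type.\<close>

lemma regular_map_compose:
  assumes f: "regular_map n X m Y f" and g: "regular_map m' Y k Z g" and Y: "Y \<subseteq> Rn m"
  shows "regular_map n X k Z (compose X g f)"
  unfolding regular_map_def
proof (intro conjI allI impI)
  have fY: "f x \<in> Y" if "x \<in> X" for x using f that by (auto simp: regular_map_def)
  show "compose X g f \<in> X \<rightarrow>\<^sub>E Z"
    using f g by (auto simp: regular_map_def compose_def)
  \<comment> \<open>\<open>g\<close> may be given by polynomials in more than m coordinates. Those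
    from m on vanish on Y and are written as 0 / 1.\<close>
  have "\<exists>a b. polynomial_fun n a \<and> polynomial_fun n b \<and> (\<forall>x\<in>X. b x \<noteq> 0 \<and> f x i = a x / b x)" for i
  proof (cases "i < m")
    case True
    then show ?thesis using f unfolding regular_map_def by blast
  next
    case False
    have "f x i = 0" if "x \<in> X" for x using fY[OF that] Y False by (auto simp: Rn_iff)
    then show ?thesis using polynomial_fun.const[of n 0] polynomial_fun.const[of n 1]
      by (intro exI[of _ "\<lambda>x. 0"] exI[of _ "\<lambda>x. 1"]) simp
  qed
  then obtain a b where ab: "\<And>i. polynomial_fun n (a i)" "\<And>i. polynomial_fun n (b i)"
    "\<And>i x. x \<in> X \<Longrightarrow> b i x \<noteq> 0 \<and> f x i = a i x / b i x" by metis
  fix j assume "j < k"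
  then obtain p q where pq: "polynomial_fun m' p" "polynomial_fun m' q" "\<forall>y\<in>Y. q y \<noteq> 0 \<and> g y j = p y / q y"
    using g unfolding regular_map_def by blast
  from polynomial_fun_of_quotients[where f = f and X = X, OF ab(1,2) ab(3) pq(1)] obtain r s
    where rs: "polynomial_fun n r" "polynomial_fun n s" "\<forall>x\<in>X. s x \<noteq> 0 \<and> p (f x) = r x / s x"
    by blast
  from polynomial_fun_of_quotients[where f = f and X = X, OF ab(1,2) ab(3) pq(2)] obtain t u
    where tu: "polynomial_fun n t" "polynomial_fun n u" "\<forall>x\<in>X. u x \<noteq> 0 \<and> q (f x) = t x / u x"
    by blast
  have "s x * t x \<noteq> 0 \<and> compose X g f x j = (r x * u x) / (s x * t x)" if x: "x \<in> X" for x
  proof -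
    have "q (f x) \<noteq> 0" "g (f x) j = p (f x) / q (f x)" using pq(3) fY[OF x] by auto
    then show ?thesis using rs(3) tu(3) x by (auto simp: compose_def)
  qed
  then show "\<exists>p q. polynomial_fun n p \<and> polynomial_fun n q \<and> (\<forall>x\<in>X. q x \<noteq> 0 \<and> compose X g f x j = p x / q x)"
    using polynomial_fun.mult[OF rs(1) tu(2)] polynomial_fun.mult[OF rs(2) tu(1)] by blast
qed

lemma QN_space_eq_points: "QN_space n X = QN_space m Y \<Longrightarrow> X = Y"
  by (metis QN_space_simps(1))

lemma algebraic_subset_Rn: "algebraic_subset n (Rn n)"
  unfolding algebraic_subset_def by (intro exI[of _ "{}"]) simp

lemma algebraic_subcategory: "subcategory algebraic_category QN_category"
proof -
  let ?obs = "{QN_space n X | n X. algebraic_subset n X}"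
  let ?homs = "\<lambda>A B. {f. \<exists>n X m Y. algebraic_subset n X \<and> A = QN_space n X \<and>
      algebraic_subset m Y \<and> B = QN_space m Y \<and> regular_map n X m Y f}"
  have A: "category algebraic_category"
    unfolding algebraic_category_def
  proof (rule rspace_category_category)
    fix A assume "A \<in> ?obs"
    then obtain n X where "A = QN_space n X" "algebraic_subset n X" by blast
    then show "(\<lambda>x\<in>points A. x) \<in> ?homs A A" using regular_map_id[of n X] by auto
  next
    fix A B C f g assume f: "f \<in> ?homs A B" and g: "g \<in> ?homs B C"
    obtain n X m Y where 1: "algebraic_subset n X" "A = QN_space n X" "algebraic_subset m Y" "B = QN_space m Y"
      "regular_map n X m Y f" using f by blast
    obtain m' Y' k Z where 2: "algebraic_subset m' Y'" "B = QN_space m' Y'" "algebraic_subset k Z" "C = QN_space k Z"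
      "regular_map m' Y' k Z g" using g by blast
    have "Y' = Y" using 1(4) 2(2) QN_space_eq_points by blast
    moreover have "Y \<subseteq> Rn m" using 1(3) by (auto simp: algebraic_subset_def)
    ultimately have "regular_map n X k Z (compose (points A) g f)"
      using regular_map_compose[OF 1(5), of m' k Z g] 1(2) 2(5) by simp
    then show "compose (points A) g f \<in> ?homs A C" using 1 2 by blast
  next
    fix A B
    show "?homs A B \<subseteq> points A \<rightarrow>\<^sub>E points B" by (auto simp: regular_map_def)
  qed
  have Q: "category (QN_category :: ((nat \<Rightarrow> real) rspace, (nat \<Rightarrow> real) \<Rightarrow> (nat \<Rightarrow> real)) cat_data)"
    unfolding QN_category_def by (rule category_rspace_mor) (simp add: affine_QN_variety_def)
  interpret A: category algebraic_category by (rule A)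
  interpret Q: category "QN_category :: ((nat \<Rightarrow> real) rspace, (nat \<Rightarrow> real) \<Rightarrow> (nat \<Rightarrow> real)) cat_data" by (rule Q)
  show ?thesis
  proof unfold_locales
    show "Obj algebraic_category \<subseteq> Obj QN_category"
      using affine_QN_variety_algebraic by (auto simp: algebraic_category_def QN_category_def rspace_category_def)
    show "Hom algebraic_category A B \<subseteq> Hom QN_category A B" for A B
      using regular_map_morphism by (auto simp: algebraic_category_def QN_category_def rspace_category_def)
  qed (simp_all add: algebraic_category_def QN_category_def rspace_category_def)
qed

text \<open>Infinite descent: w = x^2 + 1 divides P, and cancelling it once turns a solution (P, Q)
  into a solution (Q, S) with S of smaller degree. Comparing degrees alone gives nothing, as w has
  even degree.\<close>

lemma square_eq_sum_of_squares_mult: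
  fixes P Q :: "real poly"
  assumes "P * P = [:1, 0, 1:] * (Q * Q)"
  shows "Q = 0"
  using assms
proof (induction "degree Q" arbitrary: P Q rule: less_induct)
  case less
  define w :: "real poly" where "w = [:1, 0, 1:]"
  have w: "degree w = 2" "w \<noteq> 0" by (simp_all add: w_def)
  have prem: "P * P = w * (Q * Q)" using less.prems unfolding w_def .
  show ?case
  proof (rule ccontr)
    assume Q: "Q \<noteq> 0"
    define R where "R = P mod w"
    define a b where "a = coeff R 0" and "b = coeff R 1"
    have degR: "degree R < 2" using degree_mod_less[of w P] w by (auto simp: R_def)
    have R: "R = [:a, b:]"
    proof (rule poly_eqI)
      fix i :: nat
      have "i = 0 \<or> i = 1 \<or> 2 \<le> i" by linarith
      then show "coeff R i = coeff [:a, b:] i"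
        using degR coeff_eq_0[of R i] by (auto simp: a_def b_def coeff_pCons split: nat.splits)
    qed
    have P: "P = P div w * w + R" unfolding R_def by (rule div_mult_mod_eq[symmetric])
    then have "P - R = P div w * w" by (simp add: algebra_simps)
    then have d: "w dvd (P - R) * (P + R)" by simp
    have e: "(P - R) * (P + R) = P * P - R * R" by (simp add: algebra_simps)
    have "w dvd P * P" using prem by simp
    then have "w dvd P * P - (P - R) * (P + R)" using d by (rule dvd_diff)
    then have "w dvd R * R" unfolding e by simp
    \<comment> \<open>Modulo w the square of x is -1, so R * R reduces to the real and imaginary
      parts of (a + b i)^2, which both vanish only for a = b = 0.\<close>
    moreover have "R * R = smult (b * b) w + [:a * a - b * b, 2 * a * b:]"
      unfolding R w_def by (simp add: algebra_simps)
    ultimately have dvd: "w dvd [:a * a - b * b, 2 * a * b:]"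
      by (metis dvd_add_right_iff dvd_refl dvd_smult)
    have "degree [:a * a - b * b, 2 * a * b:] < degree w"
      using degree_pCons_le[of "a * a - b * b" "[:2 * a * b:]"] by (simp add: w)
    then have "[:a * a - b * b, 2 * a * b:] = 0"
      using dvd_imp_degree_le[OF dvd] by linarith
    then have "a * a - b * b = 0" "a * b = 0" by auto
    then have "a = 0" "b = 0" by auto
    then have "P = w * (P div w)" using P R by (simp add: mult.commute)
    then obtain S where S: "P = w * S" by blast
    have "w * (w * (S * S)) = w * (Q * Q)" using prem unfolding S by (simp add: mult_ac)
    then have eq: "Q * Q = w * (S * S)" using w(2) by simp
    have "S \<noteq> 0" using eq Q by auto
    then have "degree (w * (S * S)) = 2 + (degree S + degree S)"
      using w by (simp add: degree_mult_eq)
    moreover have "degree (Q * Q) = degree Q + degree Q" using Q by (simp add: degree_mult_eq)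
    ultimately have "degree S < degree Q" using eq by simp
    then have "S = 0" using less.hyps[OF _ eq[unfolded w_def]] by blast
    then show False using \<open>S \<noteq> 0\<close> by simp
  qed
qed

lemma polynomial_fun_line:
  "polynomial_fun n p \<Longrightarrow> \<exists>P. \<forall>t. p ((\<lambda>i. 0)(0 := t)) = poly P t"
proof (induction rule: polynomial_fun.induct)
  case (const c)
  show ?case by (rule exI[of _ "[:c:]"]) simp
next
  case (coord i)
  show ?case by (cases "i = 0") (auto intro: exI[of _ "[:0, 1:]"] exI[of _ 0])
next
  case (add p q)
  then obtain P Q where "\<forall>t. p ((\<lambda>i. 0)(0 := t)) = poly P t" "\<forall>t. q ((\<lambda>i. 0)(0 := t)) = poly Q t" by blast
  then show ?case by (intro exI[of _ "P + Q"]) (simp del: fun_upd_apply)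
next
  case (mult p q)
  then obtain P Q where "\<forall>t. p ((\<lambda>i. 0)(0 := t)) = poly P t" "\<forall>t. q ((\<lambda>i. 0)(0 := t)) = poly Q t" by blast
  then show ?case by (intro exI[of _ "P * Q"]) (simp del: fun_upd_apply)
qed

text \<open>The graph is the upper branch of y^2 - x^2 = 1. As 1 + x^2 is positive, the square root
  is smooth.\<close>

definition hyperbola_map :: "(nat \<Rightarrow> real) \<Rightarrow> (nat \<Rightarrow> real)"
  where "hyperbola_map = (\<lambda>x\<in>Rn 1. (\<lambda>i. 0)(0 := sqrt (1 + x 0 * x 0)))"

lemma hyperbola_map_morphism: "hyperbola_map \<in> rspace_mor (QN_space 1 (Rn 1)) (QN_space 1 (Rn 1))"
proof (rule Nash_map_morphism[where V = "Rn 1" and G = "\<lambda>j x. sqrt (1 + x 0 * x 0)"])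
  have sa: "semialgebraic 1 (Rn 1)" using open_semialgebraic_Rn by (simp add: open_semialgebraic_def)
  show "semialgebraic 1 (Rn 1)" "semialgebraic 1 (Rn 1)" by (rule sa)+
  show "hyperbola_map \<in> Rn 1 \<rightarrow>\<^sub>E Rn 1" by (auto simp: hyperbola_map_def Rn_iff)
  show "open_semialgebraic 1 (Rn 1)" by (rule open_semialgebraic_Rn)
  show "hyperbola_map x j = sqrt (1 + x 0 * x 0)" if "x \<in> Rn 1" "j < 1" for x j
    using that by (simp add: hyperbola_map_def)
  have "smooth_on 1 (Rn 1) (\<lambda>x. sqrt (1 + x 0 * x 0))"
    by (intro smooth_on_sqrt openin_Rn smooth_on_add smooth_on_mult smooth_on_const smooth_on_coord)
      (simp add: add_pos_nonneg)
  moreover have "semialgebraic_fun 1 (Rn 1) (\<lambda>x. sqrt (1 + x 0 * x 0))"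
  proof (rule semialgebraic_funI)
    have "definable (\<lambda>z :: nat \<Rightarrow> real. 0 \<le> z 1 \<and> z 1 * z 1 = 1 + z 0 * z 0)"
      by (intro definable_conj definable_le definable_eq definable_fun_const definable_fun_coord
          definable_fun_add definable_fun_mult)
    moreover have "0 \<le> z 1 \<and> z 1 * z 1 = 1 + z 0 * z 0 \<longleftrightarrow>
        trunc 1 z \<in> Rn 1 \<and> sqrt (1 + trunc 1 z 0 * trunc 1 z 0) = z 1" for z :: "nat \<Rightarrow> real"
    proof
      assume "0 \<le> z 1 \<and> z 1 * z 1 = 1 + z 0 * z 0"
      then show "trunc 1 z \<in> Rn 1 \<and> sqrt (1 + trunc 1 z 0 * trunc 1 z 0) = z 1"
        by (metis trunc_in_Rn trunc_apply zero_less_one real_sqrt_mult_self real_sqrt_abs2 abs_of_nonneg)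
    next
      assume "trunc 1 z \<in> Rn 1 \<and> sqrt (1 + trunc 1 z 0 * trunc 1 z 0) = z 1"
      then have z: "z 1 = sqrt (1 + z 0 * z 0)" by simp
      have "1 + z 0 * z 0 \<ge> 0" by simp
      then show "0 \<le> z 1 \<and> z 1 * z 1 = 1 + z 0 * z 0" unfolding z by simp
    qed
    ultimately show "definable (\<lambda>z. trunc 1 z \<in> Rn 1 \<and> sqrt (1 + trunc 1 z 0 * trunc 1 z 0) = z 1)" by simp
  qed simp
  ultimately show "Nash_fun 1 (Rn 1) (\<lambda>x. sqrt (1 + x 0 * x 0))" by (simp add: Nash_fun_def)
qed simp

text \<open>The dimensions are arbitrary because a QN space does not record its ambient dimension,
  and a map counts as regular if it is so for some presentation of source and target. For m = 0 the
  condition on components would be vacuous.\<close>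

lemma hyperbola_map_not_regular:
  assumes "0 < m"
  shows "\<not> regular_map n (Rn 1) m Y hyperbola_map"
proof
  assume "regular_map n (Rn 1) m Y hyperbola_map"
  then obtain p q where pq: "polynomial_fun n p" "polynomial_fun n q"
    "\<forall>x\<in>Rn 1. q x \<noteq> 0 \<and> hyperbola_map x 0 = p x / q x"
    using assms unfolding regular_map_def by blast
  obtain P Q where PQ: "\<forall>t. p ((\<lambda>i. 0)(0 := t)) = poly P t" "\<forall>t. q ((\<lambda>i. 0)(0 := t)) = poly Q t"
    using polynomial_fun_line[OF pq(1)] polynomial_fun_line[OF pq(2)] by blast
  have *: "poly Q t \<noteq> 0 \<and> sqrt (1 + t * t) = poly P t / poly Q t" for t
  proof -
    have x: "(\<lambda>i. 0)(0 := t) \<in> Rn 1" by (simp add: Rn_iff)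
    then have "hyperbola_map ((\<lambda>i. 0)(0 := t)) 0 = sqrt (1 + t * t)" by (simp add: hyperbola_map_def)
    then show ?thesis using bspec[OF pq(3) x] PQ by simp
  qed
  have "poly (P * P) t = poly ([:1, 0, 1:] * (Q * Q)) t" for t
  proof -
    have "poly P t = sqrt (1 + t * t) * poly Q t" using *[of t] by (simp add: field_simps)
    then have "poly P t * poly P t = (sqrt (1 + t * t) * sqrt (1 + t * t)) * (poly Q t * poly Q t)"
      by (simp add: mult_ac)
    also have "sqrt (1 + t * t) * sqrt (1 + t * t) = 1 + t * t" by simp
    finally show ?thesis by (simp add: algebra_simps)
  qed
  then have "P * P = [:1, 0, 1:] * (Q * Q)" by (intro iffD1[OF poly_eq_poly_eq_iff] ext)
  then have "Q = 0" by (rule square_eq_sum_of_squares_mult)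
  then show False using * by simp
qed

lemma algebraic_not_full_subcategory: "\<not> full_subcategory algebraic_category QN_category"
proof
  assume "full_subcategory algebraic_category QN_category"
  then interpret full_subcategory algebraic_category QN_category .
  let ?L = "QN_space 1 (Rn 1)"
  have "?L \<in> Obj algebraic_category"
    using algebraic_subset_Rn[of 1] by (auto simp: algebraic_category_def rspace_category_def)
  then have "Hom algebraic_category ?L ?L = Hom QN_category ?L ?L" by (intro full)
  then have "hyperbola_map \<in> Hom algebraic_category ?L ?L"
    using hyperbola_map_morphism by (simp add: QN_category_def rspace_category_def)
  then obtain n X m Y where reg: "regular_map n X m Y hyperbola_map" and Y: "algebraic_subset m Y"
    and eq: "?L = QN_space n X" "?L = QN_space m Y"
    by (auto simp: algebraic_category_def rspace_category_def)
  have XY: "X = Rn 1" "Y = Rn 1" using eq QN_space_eq_points by blast+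
  \<comment> \<open>Rules out a presentation of the target with m = 0, in which regularity would put
    no condition on components.\<close>
  have "Rn 1 \<subseteq> Rn m" using semialgebraic_subset[OF algebraic_subset_semialgebraic[OF Y]] XY(2) by simp
  then have "0 < m" unfolding subset_Euclidean_space by simp
  then show False using hyperbola_map_not_regular reg XY by blast
qed

theorem lemma3p5:
  shows "full_subcategory (Nash_category :: ('a rspace, 'a \<Rightarrow> 'a) cat_data) QN_category
    \<and> subcategory algebraic_category QN_category
    \<and> \<not> full_subcategory algebraic_category QN_category"
  using Nash_full_subcategory algebraic_subcategory algebraic_not_full_subcategory by blast

end
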